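(* Let $A,Q\in\mathbb{C}^{n,n}$ with $Q=Q^*$, $B,C\in\mathbb{C}^{n,m}$, $R\in\mathbb{C}^{m,m}$ with $R=R^*$. Assume that the pair $(A,B)$ is stabilizable, that $\mathcal{S}_{LMI}\neq\emptyset$, and that the even pencil $$s\mathcal{E}-\mathcal{A}=\begin{bmatrix}0&-sI+A&B\\ sI+A^*&Q&C\\ B^*&C^*&R\end{bmatrix}$$ is regular. Let $\gamma>0$ be a real number such that both $$\widetilde A=\begin{bmatrix}0&A-\gamma I\\ A^*-\gamma I&Q\end{bmatrix}\quad\text{and}\quad R-\begin{bmatrix}B^*&C^*\end{bmatrix}\widetilde A^{-1}\begin{bmatrix}B\\ C\end{bmatrix}$$ are nonsingular. Let $E,\widehat F,\widehat G,\widehat H\in\mathbb{C}^{n,n}$ be the blocks determined by $$\begin{bmatrix}0 & A-\gamma I & B\\ A^*-\gamma I & Q & C\\ B^* & C^* & R\end{bmatrix}^{-1}\begin{bmatrix}0 & A+\gamma I & B\\ A^*+\gamma I & Q & C\\ B^* & C^* & R\end{bmatrix}=\begin{bmatrix}E&-\widehat G&0\\ -\widehat H&\widehat F&0\\ \ast&\ast&I_m\end{bmatrix},$$ and consider the reduced $2n\times 2n$ pencil $$s\begin{bmatrix} I_n & - \widehat G\\ 0 & \widehat F \end{bmatrix}-\begin{bmatrix} E & 0\\ -\widehat H & I_n \end{bmatrix}.$$ Let $\mathcal{V}\subset\mathbb{C}^{2n+m}$ be the unique $(n+m)$-dimensional c-semi-stable $\mathcal{E}$-neutral deflating subspace of $s\mathcal{E}-\mathcal{A}$.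 Then there exist matrices $V_1\in\mathbb{C}^{2n,n}$ and $V_2\in\mathbb{C}^{m,n}$ such that $\mathcal{V}$ is the column span of $$\begin{bmatrix}V_1 & 0\\ V_2 & I_m \end{bmatrix},$$ where the columns of $V_1$ span the canonical d-semi-unstable subspace of the reduced pencil. Moreover, if the column span of $V_1$ admits a basis given by the columns of a matrix of the form $$\begin{bmatrix}X_+\\ I_n\end{bmatrix},\qquad X_+\in\mathbb{C}^{n,n},$$ then $X_+$ is the maximal solution of the Lur'e equations $$A^*X+XA+Q=K^*K,\qquad XB+C=K^*L,\qquad R=L^*L.$$
   Context: Notation: $M^*$ is the conjugate transpose; for Hermitian matrices, $P\ge Q$ means $P-Q$ is positive semidefinite. Lur'e equations: the unknowns are $(X,K,L)\in\mathbb{C}^{n,n}\times\mathbb{C}^{p,n}\times\mathbb{C}^{p,m}$ with $X=X^*$ and $p$ as small as possible. A Hermitian $X$ is called a solution if the equations hold for some such $K,L$. $\mathcal{S}_{LMI}$ is the set of Hermitian $Y\in\mathbb{C}^{n,n}$ with $$\begin{bmatrix}A^*Y+YA+Q & YB+C\\ B^*Y+C^* & R\end{bmatrix}\geq0.$$ The maximal solution of the Lur'e equations is the solution $X_+$ such that $Y\le X_+$ for all $Y\in\mathcal{S}_{LMI}$ (it is known to exist if $(A,B)$ is stabilizable and $\mathcal{S}_{LMI}\ne\emptyset$). $(A,B)$ is stabilizable if $\operatorname{rank}[\,sI-A,\ B\,]=n$ for all $s$ in the closed right half-plane. A square pencil $sE-A$ is regular if $\det(sE-A)$ is not identically zero.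 Here $$\mathcal{E}=\begin{bmatrix}0&-I_n&0\\ I_n&0&0\\ 0&0&0\end{bmatrix}.$$ A subspace $\mathcal{V}\subset\mathbb{C}^N$ is a (right) deflating subspace of a pencil $sE-A$, $E,A\in\mathbb{C}^{M,N}$, if for a matrix $V\in\mathbb{C}^{N,k}$ of full column rank with image $\mathcal{V}$ there are $l\le k$, $W\in\mathbb{C}^{M,l}$ and $\widetilde E,\widetilde A\in\mathbb{C}^{l,k}$ with $(sE-A)V=W(s\widetilde E-\widetilde A)$. The eigenvalues contained in the deflating subspace are those of $s\widetilde E-\widetilde A$. $\mathcal{V}$ is $\mathcal{E}$-neutral if $x^*\mathcal{E}y=0$ for all $x,y\in\mathcal{V}$. A finite eigenvalue $\lambda$ is c-stable, c-critical, c-unstable if $\operatorname{Re}\lambda$ is $<0$, $=0$, $>0$ respectively; the infinite eigenvalue counts as c-critical. An eigenvalue $\lambda\in\mathbb{C}\cup\{\infty\}$ is d-stable, d-critical, d-unstable if $|\lambda|$ is $<1$, $=1$, $>1$ respectively (so $\infty$ is d-unstable). A deflating subspace is c-semi-stable if it contains only c-stable or c-critical eigenvalues. Under the hypotheses of the claim, it is known that an $(n+m)$-dimensional c-semi-stable $\mathcal{E}$-neutral deflating subspace of $s\mathcal{E}-\mathcal{A}$ exists and is unique. Canonical subspace: a regular $2n\times 2n$ pencil is weakly d-split if there is an $r$ such that the lengths of the Kronecker (Jordan) chains relative to d-stable eigenvalues sum to $n-r$, those relative to d-unstable eigenvalues (including $\infty$) sum to $n-r$, and the lengths $k_j$ of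 the chains relative to d-critical eigenvalues are all even. (Chains are those given by the Kronecker canonical form; the first vector of a chain is the eigenvector.) In this case the canonical d-semi-unstable subspace is the $n$-dimensional deflating subspace spanned by all the Kronecker chains relative to d-unstable eigenvalues together with the first $k_j/2$ vectors of each d-critical chain. Part of the content of the claim is that the reduced pencil is weakly d-split, so that this subspace is defined. *)

theory Defs
  imports
    "Jordan_Normal_Form.Jordan_Normal_Form"
    "Jordan_Normal_Form.Gauss_Jordan_Elimination"
    "Jordan_Normal_Form.Schur_Decomposition"
    "Jordan_Normal_Form.DL_Rank"
begin

section \<open>Matrices\<close>

definition append_cols :: "'a :: zero mat \<Rightarrow> 'a mat \<Rightarrow> 'a mat" (infixr \<open>@\<^sub>c\<close> 65) where
  "A @\<^sub>c B = four_block_mat A B (0\<^sub>m 0 (dim_col A)) (0\<^sub>m 0 (dim_col B))"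

definition block3_mat ::
  "'a :: zero mat \<Rightarrow> 'a mat \<Rightarrow> 'a mat \<Rightarrow> 'a mat \<Rightarrow> 'a mat \<Rightarrow> 'a mat \<Rightarrow> 'a mat \<Rightarrow> 'a mat \<Rightarrow> 'a mat \<Rightarrow> 'a mat"
where
  "block3_mat M11 M12 M13 M21 M22 M23 M31 M32 M33 =
     four_block_mat (four_block_mat M11 M12 M21 M22) (M13 @\<^sub>r M23) (M31 @\<^sub>c M32) M33"

text \<open>Meaningful only for nonsingular matrices.\<close>
abbreviation mat_inv :: "complex mat \<Rightarrow> complex mat" where
  "mat_inv M \<equiv> the (mat_inverse M)"

definition hermitian_mat :: "complex mat \<Rightarrow> bool" where
  "hermitian_mat M \<longleftrightarrow> square_mat M \<and> mat_adjoint M = M"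

text \<open>The order on \<^typ>\<open>complex\<close> is the partial one: \<open>0 \<le> z\<close> says that \<open>z\<close> is real and nonnegative.\<close>
definition psd_mat :: "complex mat \<Rightarrow> bool" where
  "psd_mat M \<longleftrightarrow> hermitian_mat M \<and>
     (\<forall>v \<in> carrier_vec (dim_row M). 0 \<le> conjugate v \<bullet> (M *\<^sub>v v))"

text \<open>The columns of the \<open>N \<times> k\<close> matrix \<open>V\<close> form a basis of \<open>S\<close>;
  in particular \<open>S\<close> is a subspace of dimension \<open>k\<close>.\<close>
definition basis_mat :: "nat \<Rightarrow> nat \<Rightarrow> complex vec set \<Rightarrow> complex mat \<Rightarrow> bool" where
  "basis_mat N k S V \<longleftrightarrow>
     V \<in> carrier_mat N k \<and> vec_space.rank N V = k \<and> vec_space.col_space N V = S"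

section \<open>Matrix pencils\<close>

text \<open>The pencil \<open>sE - A\<close> is represented by the two matrices \<open>E\<close> and \<open>A\<close>.\<close>

datatype pencil_ev = Finite complex | Infinity

fun c_stable :: "pencil_ev \<Rightarrow> bool" where
  "c_stable (Finite z) \<longleftrightarrow> Re z < 0"
| "c_stable Infinity \<longleftrightarrow> False"

fun c_critical :: "pencil_ev \<Rightarrow> bool" where
  "c_critical (Finite z) \<longleftrightarrow> Re z = 0"
| "c_critical Infinity \<longleftrightarrow> True"

fun d_stable :: "pencil_ev \<Rightarrow> bool" where
  "d_stable (Finite z) \<longleftrightarrow> cmod z < 1"
| "d_stable Infinity \<longleftrightarrow> False"

fun d_critical :: "pencil_ev \<Rightarrow> bool" where
  "d_critical (Finite z) \<longleftrightarrow> cmod z = 1"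
| "d_critical Infinity \<longleftrightarrow> False"

fun d_unstable :: "pencil_ev \<Rightarrow> bool" where
  "d_unstable (Finite z) \<longleftrightarrow> cmod z > 1"
| "d_unstable Infinity \<longleftrightarrow> True"

definition regular_pencil :: "nat \<Rightarrow> complex mat \<Rightarrow> complex mat \<Rightarrow> bool" where
  "regular_pencil N E A \<longleftrightarrow>
     E \<in> carrier_mat N N \<and> A \<in> carrier_mat N N \<and> (\<exists>s. det (s \<cdot>\<^sub>m E - A) \<noteq> 0)"

text \<open>Eigenvalues of a possibly rectangular pencil with \<open>l\<close> rows: the points where the rank
  drops below its generic (that is, maximal) value. For a regular pencil these are the zeros of
  \<open>det (sE - A)\<close>, together with infinity if \<open>E\<close> is singular.\<close>
fun pencil_eigenvalue :: "nat \<Rightarrow> complex mat \<Rightarrow> complex mat \<Rightarrow> pencil_ev \<Rightarrow> bool" where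
  "pencil_eigenvalue l E A (Finite z) \<longleftrightarrow>
     (\<exists>s. vec_space.rank l (z \<cdot>\<^sub>m E - A) < vec_space.rank l (s \<cdot>\<^sub>m E - A))"
| "pencil_eigenvalue l E A Infinity \<longleftrightarrow>
     (\<exists>s. vec_space.rank l E < vec_space.rank l (s \<cdot>\<^sub>m E - A))"

text \<open>\<open>sE - A\<close> has size \<open>M \<times> N\<close>, \<open>S\<close> has dimension \<open>k\<close>, and \<open>sE' - A'\<close> has size \<open>l \<times> k\<close>.\<close>
definition deflating_witness ::
  "nat \<Rightarrow> nat \<Rightarrow> complex mat \<Rightarrow> complex mat \<Rightarrow> nat \<Rightarrow> complex vec set \<Rightarrow> nat \<Rightarrow> complex mat \<Rightarrow> complex mat \<Rightarrow> bool"
where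
  "deflating_witness M N E A k S l E' A' \<longleftrightarrow>
     l \<le> k \<and> E' \<in> carrier_mat l k \<and> A' \<in> carrier_mat l k \<and>
     (\<exists>V W. basis_mat N k S V \<and> W \<in> carrier_mat M l \<and>
        (\<forall>s. (s \<cdot>\<^sub>m E - A) * V = W * (s \<cdot>\<^sub>m E' - A')))"

definition deflating_subspace ::
  "nat \<Rightarrow> nat \<Rightarrow> complex mat \<Rightarrow> complex mat \<Rightarrow> nat \<Rightarrow> complex vec set \<Rightarrow> bool"
where
  "deflating_subspace M N E A k S \<longleftrightarrow> (\<exists>l E' A'. deflating_witness M N E A k S l E' A')"

definition contained_eigenvalue ::
  "nat \<Rightarrow> nat \<Rightarrow> complex mat \<Rightarrow> complex mat \<Rightarrow> nat \<Rightarrow> complex vec set \<Rightarrow> pencil_ev \<Rightarrow> bool"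
where
  "contained_eigenvalue M N E A k S ev \<longleftrightarrow>
     (\<exists>l E' A'. deflating_witness M N E A k S l E' A' \<and> pencil_eigenvalue l E' A' ev)"

definition c_semi_stable_deflating ::
  "nat \<Rightarrow> nat \<Rightarrow> complex mat \<Rightarrow> complex mat \<Rightarrow> nat \<Rightarrow> complex vec set \<Rightarrow> bool"
where
  "c_semi_stable_deflating M N E A k S \<longleftrightarrow> deflating_subspace M N E A k S \<and>
     (\<forall>ev. contained_eigenvalue M N E A k S ev \<longrightarrow> c_stable ev \<or> c_critical ev)"

definition neutral :: "complex mat \<Rightarrow> complex vec set \<Rightarrow> bool" where
  "neutral E S \<longleftrightarrow> (\<forall>x \<in> S. \<forall>y \<in> S. conjugate x \<bullet> (E *\<^sub>v y) = 0)"

subsection \<open>Kronecker canonical form of a regular pencil\<close>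

text \<open>For a regular pencil all Kronecker blocks are square: \<open>sI - J\<^sub>k(z)\<close> for a finite
  eigenvalue \<open>z\<close> and \<open>sJ\<^sub>k(0) - I\<close> for the infinite one. A block is given by its size and its
  eigenvalue. The ones of \<^const>\<open>jordan_block\<close> are above the diagonal.\<close>

fun kronecker_E :: "nat \<times> pencil_ev \<Rightarrow> complex mat" where
  "kronecker_E (k, Finite z) = 1\<^sub>m k"
| "kronecker_E (k, Infinity) = jordan_block k 0"

fun kronecker_A :: "nat \<times> pencil_ev \<Rightarrow> complex mat" where
  "kronecker_A (k, Finite z) = jordan_block k z"
| "kronecker_A (k, Infinity) = 1\<^sub>m k"

definition kronecker_form ::
  "nat \<Rightarrow> complex mat \<Rightarrow> complex mat \<Rightarrow> complex mat \<Rightarrow> complex mat \<Rightarrow> (nat \<times> pencil_ev) list \<Rightarrow> bool"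
where
  "kronecker_form N E A P T bs \<longleftrightarrow>
     P \<in> carrier_mat N N \<and> T \<in> carrier_mat N N \<and> invertible_mat P \<and> invertible_mat T \<and>
     0 \<notin> fst ` set bs \<and>
     P * E * T = diag_block_mat (map kronecker_E bs) \<and>
     P * A * T = diag_block_mat (map kronecker_A bs)"

text \<open>The \<open>j\<close>-th vector of the \<open>i\<close>-th chain, both counted from 0; the vector with \<open>j = 0\<close> is
  the eigenvector, since the first column of each Jordan block is a multiple of a unit vector.\<close>
definition chain_vec :: "complex mat \<Rightarrow> (nat \<times> pencil_ev) list \<Rightarrow> nat \<Rightarrow> nat \<Rightarrow> complex vec" where
  "chain_vec T bs i j = col T (sum_list (map fst (take i bs)) + j)"

definition split_blocks :: "nat \<Rightarrow> (nat \<times> pencil_ev) list \<Rightarrow> bool" where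
  "split_blocks n bs \<longleftrightarrow> (\<exists>r \<le> n.
     sum_list (map fst (filter (\<lambda>b. d_stable (snd b)) bs)) = n - r \<and>
     sum_list (map fst (filter (\<lambda>b. d_unstable (snd b)) bs)) = n - r \<and>
     (\<forall>b \<in> set bs. d_critical (snd b) \<longrightarrow> even (fst b)))"

definition weakly_d_split :: "nat \<Rightarrow> complex mat \<Rightarrow> complex mat \<Rightarrow> bool" where
  "weakly_d_split n E A \<longleftrightarrow> regular_pencil (2 * n) E A \<and>
     (\<exists>P T bs. kronecker_form (2 * n) E A P T bs \<and> split_blocks n bs)"

text \<open>\<open>S\<close> is the canonical d-semi-unstable subspace of the weakly d-split \<open>2n \<times> 2n\<close> pencil
  \<open>sE - A\<close>. It does not depend on the choice of the Kronecker form.\<close>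
definition canonical_d_semi_unstable :: "nat \<Rightarrow> complex mat \<Rightarrow> complex mat \<Rightarrow> complex vec set \<Rightarrow> bool" where
  "canonical_d_semi_unstable n E A S \<longleftrightarrow> regular_pencil (2 * n) E A \<and>
     (\<exists>P T bs. kronecker_form (2 * n) E A P T bs \<and> split_blocks n bs \<and>
        S = LinearCombinations.module.span class_ring (module_vec TYPE(complex) (2 * n))
          ({chain_vec T bs i j | i j. i < length bs \<and> d_unstable (snd (bs ! i)) \<and> j < fst (bs ! i)} \<union>
           {chain_vec T bs i j | i j. i < length bs \<and> d_critical (snd (bs ! i)) \<and> j < fst (bs ! i) div 2}))"

section \<open>Lur'e equations\<close>

definition stabilizable :: "nat \<Rightarrow> complex mat \<Rightarrow> complex mat \<Rightarrow> bool" where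
  "stabilizable n A B \<longleftrightarrow>
     (\<forall>s. Re s \<ge> 0 \<longrightarrow> vec_space.rank n ((s \<cdot>\<^sub>m 1\<^sub>m n - A) @\<^sub>c B) = n)"

definition S_LMI ::
  "nat \<Rightarrow> complex mat \<Rightarrow> complex mat \<Rightarrow> complex mat \<Rightarrow> complex mat \<Rightarrow> complex mat \<Rightarrow> complex mat set"
where
  "S_LMI n A B C Q R = {Y \<in> carrier_mat n n. hermitian_mat Y \<and>
     psd_mat (four_block_mat (mat_adjoint A * Y + Y * A + Q) (Y * B + C)
                             (mat_adjoint B * Y + mat_adjoint C) R)}"

definition lure_equations ::
  "nat \<Rightarrow> nat \<Rightarrow> complex mat \<Rightarrow> complex mat \<Rightarrow> complex mat \<Rightarrow> complex mat \<Rightarrow> complex mat \<Rightarrow>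
   nat \<Rightarrow> complex mat \<Rightarrow> complex mat \<Rightarrow> complex mat \<Rightarrow> bool"
where
  "lure_equations n m A B C Q R p X K L \<longleftrightarrow>
     X \<in> carrier_mat n n \<and> K \<in> carrier_mat p n \<and> L \<in> carrier_mat p m \<and> hermitian_mat X \<and>
     mat_adjoint A * X + X * A + Q = mat_adjoint K * K \<and>
     X * B + C = mat_adjoint K * L \<and>
     R = mat_adjoint L * L"

text \<open>The number \<open>p\<close> of rows is minimal among all triples \<open>(X, K, L)\<close> satisfying the equations,
  not only among those with the given \<open>X\<close>.\<close>
definition lure_solution ::
  "nat \<Rightarrow> nat \<Rightarrow> complex mat \<Rightarrow> complex mat \<Rightarrow> complex mat \<Rightarrow> complex mat \<Rightarrow> complex mat \<Rightarrow> complex mat \<Rightarrow> bool"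
where
  "lure_solution n m A B C Q R X \<longleftrightarrow>
     (\<exists>p K L. lure_equations n m A B C Q R p X K L \<and>
        (\<forall>p' X' K' L'. lure_equations n m A B C Q R p' X' K' L' \<longrightarrow> p \<le> p'))"

definition maximal_lure_solution ::
  "nat \<Rightarrow> nat \<Rightarrow> complex mat \<Rightarrow> complex mat \<Rightarrow> complex mat \<Rightarrow> complex mat \<Rightarrow> complex mat \<Rightarrow> complex mat \<Rightarrow> bool"
where
  "maximal_lure_solution n m A B C Q R X \<longleftrightarrow>
     lure_solution n m A B C Q R X \<and> (\<forall>Y \<in> S_LMI n A B C Q R. psd_mat (X - Y))"

definition even_E :: "nat \<Rightarrow> nat \<Rightarrow> complex mat" where
  "even_E n m = block3_mat
     (0\<^sub>m n n) (- 1\<^sub>m n)  (0\<^sub>m n m)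
     (1\<^sub>m n)   (0\<^sub>m n n) (0\<^sub>m n m)
     (0\<^sub>m m n) (0\<^sub>m m n) (0\<^sub>m m m)"

definition even_A ::
  "nat \<Rightarrow> nat \<Rightarrow> complex mat \<Rightarrow> complex mat \<Rightarrow> complex mat \<Rightarrow> complex mat \<Rightarrow> complex mat \<Rightarrow> complex mat"
where
  "even_A n m A B C Q R = - block3_mat
     (0\<^sub>m n n)       A               B
     (mat_adjoint A) Q               C
     (mat_adjoint B) (mat_adjoint C) R"

lemma dim_mat_adjoint [simp]:
  "dim_row (mat_adjoint M) = dim_col M" "dim_col (mat_adjoint M) = dim_row M"
  by (auto simp: mat_adjoint_def)

lemma even_pencil_eq:
  assumes "A \<in> carrier_mat n n" "B \<in> carrier_mat n m" "C \<in> carrier_mat n m"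
    "Q \<in> carrier_mat n n" "R \<in> carrier_mat m m"
  shows "s \<cdot>\<^sub>m even_E n m - even_A n m A B C Q R = block3_mat
     (0\<^sub>m n n)                          (- (s \<cdot>\<^sub>m 1\<^sub>m n) + A) B
     (s \<cdot>\<^sub>m 1\<^sub>m n + mat_adjoint A) Q                         C
     (mat_adjoint B)                     (mat_adjoint C)           R"
  using assms
  by (intro eq_matI)
    (auto simp: even_E_def even_A_def block3_mat_def append_rows_def append_cols_def Let_def)

end

theory Submission
  imports Defs "Jordan_Normal_Form.Jordan_Normal_Form_Existence"
begin

text \<open>
  With \<open>z = (\<mu>, x)\<close> and \<open>z' = (\<mu>', x')\<close>, a solution of \<open>A_red z = E_red z'\<close> satisfies the energy identity
  \<open>2 \<gamma> (x'\<^sup>* \<mu>' - x\<^sup>* \<mu>) = \<pi>(x - x', -u)\<close>, where \<open>\<pi>\<close> is the quadratic form of the matrix with blocks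
  \<open>Q, C, C\<^sup>*, R\<close>. Its skew part says that the reduced pencil is isometric for the form
  \<open>x\<^sup>* \<nu> - \<mu>\<^sup>* y\<close>, hence chains whose eigenvalues are not mirror images in the unit circle are orthogonal.
  Shifting by some \<open>Y\<close> in \<open>S_LMI\<close> makes the form \<open>\<pi>\<close> positive semidefinite; together with stabilizability
  this puts the first halves, rounded up, of the critical chains into the neutral subspace
  \<open>\<mu> = Y x\<close>. Joined with the unstable chains, and likewise with the stable ones, they span
  a neutral subspace, which has dimension at most \<open>n\<close>. Counting then forces all critical chains to have
  even length. The Cayley transform of \<open>\<V>\<close> contains no stable chains, contains the last \<open>m\<close>
  coordinates, and its top part is a maximal neutral subspace, so that it is the canonical one.

  If this subspace is \<open>\<mu> = X x\<close>, then on the kernel of \<open>[A - \<lambda> I, B]\<close> with \<open>\<lambda>\<close> imaginary the matrix of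
  the linear matrix inequality does not depend on \<open>X\<close>, and for all but finitely many \<open>\<lambda>\<close> every vector
  differs from that kernel by an element of the kernel of the matrix at \<open>X\<close>. This makes the latter
  positive semidefinite, and of minimal rank. Finally the form \<open>x\<^sup>* (X - Y) x\<close> does not decrease
  along the pencil and tends to \<open>0\<close> when unstable chains are followed backwards, so \<open>Y \<le> X\<close>.
\<close>

section \<open>Linear systems and invertible matrices\<close>

text \<open>Since \<open>F\<close> may be singular, the reduced pencil is in general not equivalent
  to a matrix, and \<open>Infinity\<close> can be an eigenvalue. All dynamics are therefore stated
  for the relation \<open>A z = E z'\<close>: finite and infinite chains alike become sequences of
  related pairs, and isometry can be expressed without an inverse. Isometry alone gives neutrality
  only for the first \<open>k div 2\<close> vectors of a critical chain of length \<open>k\<close>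
  and leaves odd chains possible. The middle vector of an odd chain is gained from semidefiniteness
  and stabilizability, and only then does the count force even lengths. The deflating subspace
  brings chains of its own, which need not be among the chains of a chosen Kronecker form of the
  reduced pencil. The two subspaces are therefore compared through orthogonality: each is neutral of
  the largest possible dimension and orthogonal to the other, hence they agree. The points
  \<open>Complex 0 \<omega>\<close> serve twice: regularity provides one at which the even pencil is
  nonsingular, and the vanishing real part removes the unknown from the quadratic form of the matrix
  inequality.\<close>

lemma homogeneous_system_solution:
  fixes M :: "'k \<Rightarrow> 'i \<Rightarrow> 'a :: field"
  assumes "finite K" "finite I" "card K < card I"
  shows "\<exists>c. (\<exists>i\<in>I. c i \<noteq> 0) \<and> (\<forall>k\<in>K. (\<Sum>i\<in>I. M k i * c i) = 0)"
  using assms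
proof (induction K arbitrary: I M rule: finite_induct)
  case empty
  then obtain i where "i \<in> I" by (metis card_gt_0_iff all_not_in_conv card.empty)
  then show ?case by (intro exI[of _ "\<lambda>_. 1"]) auto
next
  case (insert k K)
  show ?case
  proof (cases "\<forall>i\<in>I. M k i = 0")
    case True
    from insert have "card K < card I" by auto
    from insert.IH[OF insert.prems(1) this, of M] True show ?thesis by auto
  next
    case False
    then obtain p where p: "p \<in> I" "M k p \<noteq> 0" by auto
    \<comment> \<open>Row \<open>l\<close> after elimination of the unknown \<open>p\<close>, with
      pivot \<open>M k p\<close> from row \<open>k\<close>.\<close>
    define M' where "M' l i = M l i - M l p * M k i / M k p" for l i
    have "finite (I - {p})" "card K < card (I - {p})"
      using insert p by auto
    from insert.IH[OF this, of M'] obtain c where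
      c: "\<exists>i\<in>I - {p}. c i \<noteq> 0" "\<forall>l\<in>K. (\<Sum>i\<in>I - {p}. M' l i * c i) = 0" by auto
    \<comment> \<open>Back substitution: the value at \<open>p\<close> is the one that row
      \<open>k\<close> demands.\<close>
    define d where "d = c(p := - (\<Sum>i\<in>I - {p}. M k i * c i) / M k p)"
    have s: "(\<Sum>i\<in>I. M l i * d i) = M l p * d p + (\<Sum>i\<in>I - {p}. M l i * c i)" for l
      using p(1) insert.prems(1) by (subst sum.remove[of I p]) (auto simp: d_def intro!: sum.cong)
    have "(\<Sum>i\<in>I. M k i * d i) = 0"
      using p(2) by (simp add: s) (simp add: d_def)
    moreover have "(\<Sum>i\<in>I. M l i * d i) = 0" if "l \<in> K" for l
    proof -
      have "0 = (\<Sum>i\<in>I - {p}. M' l i * c i)" using c that by simp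
      also have "\<dots> = (\<Sum>i\<in>I - {p}. M l i * c i - M l p / M k p * (M k i * c i))"
        by (intro sum.cong) (auto simp: M'_def algebra_simps)
      also have "\<dots> = (\<Sum>i\<in>I - {p}. M l i * c i) - M l p / M k p * (\<Sum>i\<in>I - {p}. M k i * c i)"
        by (simp add: sum_subtractf sum_distrib_left)
      also have "\<dots> = (\<Sum>i\<in>I. M l i * d i)"
        by (simp add: s) (simp add: d_def)
      finally show ?thesis by simp
    qed
    moreover have "\<exists>i\<in>I. d i \<noteq> 0" using c(1) by (auto simp: d_def)
    ultimately show ?thesis by (intro exI[of _ d]) auto
  qed
qed

lemma mult_mat_vec_index:
  assumes "M \<in> carrier_mat r c" "v \<in> carrier_vec c" "k < r"
  shows "(M *\<^sub>v v) $ k = (\<Sum>i<c. M $$ (k, i) * v $ i)"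
  using assms by (auto simp: scalar_prod_def atLeast0LessThan)

lemma mult_mat_zero_vec [simp]:
  fixes M :: "'a :: semiring_0 mat"
  shows "M \<in> carrier_mat r c \<Longrightarrow> M *\<^sub>v 0\<^sub>v c = 0\<^sub>v r"
  by (intro eq_vecI) auto

lemma zero_mat_mult_vec [simp]:
  fixes v :: "'a :: semiring_0 vec"
  shows "v \<in> carrier_vec c \<Longrightarrow> 0\<^sub>m r c *\<^sub>v v = 0\<^sub>v r"
  by (intro eq_vecI) auto

lemma smult_zero_vec_right [simp]: "a \<cdot>\<^sub>v 0\<^sub>v n = (0\<^sub>v n :: 'a :: mult_zero vec)"
  by (intro eq_vecI) auto

lemma wide_mat_kernel:
  fixes M :: "'a :: field mat"
  assumes "M \<in> carrier_mat r c" "r < c"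
  shows "\<exists>v\<in>carrier_vec c. v \<noteq> 0\<^sub>v c \<and> M *\<^sub>v v = 0\<^sub>v r"
proof -
  from homogeneous_system_solution[of "{..<r}" "{..<c}" "\<lambda>k i. M $$ (k, i)"] assms(2)
  obtain f where f: "\<exists>i<c. f i \<noteq> 0" "\<forall>k<r. (\<Sum>i<c. M $$ (k, i) * f i) = 0" by auto
  then obtain i where i: "i < c" "f i \<noteq> 0" by auto
  have "vec c f $ i \<noteq> 0\<^sub>v c $ i" using i by simp
  then have "vec c f \<noteq> 0\<^sub>v c" by metis
  moreover have "M *\<^sub>v vec c f = 0\<^sub>v r"
    using assms f(2) by (intro eq_vecI) (auto simp: mult_mat_vec_index simp del: index_mult_mat_vec)
  ultimately show ?thesis by auto
qed

text \<open>Preimages of the unit vectors form a right inverse; this is injective, so it cannot have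
  more columns than rows.\<close>

lemma surjective_mat_dim:
  fixes M :: "'a :: field mat"
  assumes M: "M \<in> carrier_mat r c" and surj: "\<And>b. b \<in> carrier_vec r \<Longrightarrow> \<exists>v\<in>carrier_vec c. M *\<^sub>v v = b"
  shows "r \<le> c"
proof (rule ccontr)
  assume "\<not> r \<le> c"
  define g where "g i = (SOME v. v \<in> carrier_vec c \<and> M *\<^sub>v v = unit_vec r i)" for i
  have g: "g i \<in> carrier_vec c \<and> M *\<^sub>v g i = unit_vec r i" for i
    unfolding g_def by (rule someI_ex) (use surj[OF unit_vec_carrier] in blast)
  define G where "G = mat_of_cols c (map g [0..<r])"
  have G: "G \<in> carrier_mat c r" by (auto simp: G_def)
  have "M * G = 1\<^sub>m r"
  proof (rule mat_col_eqI)
    fix i assume "i < dim_col (1\<^sub>m r :: 'a mat)"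
    then have i: "i < r" by simp
    have "col G i = g i" using i g by (simp add: G_def)
    then show "col (M * G) i = col (1\<^sub>m r) i"
      unfolding col_mult2[OF M G i] col_one[OF i] using g by simp
  qed (use M G in auto)
  moreover from wide_mat_kernel[OF G] \<open>\<not> r \<le> c\<close> obtain v where
    v: "v \<in> carrier_vec r" "v \<noteq> 0\<^sub>v r" "G *\<^sub>v v = 0\<^sub>v c" by auto
  have "(M * G) *\<^sub>v v = M *\<^sub>v (G *\<^sub>v v)" using M G v by simp
  then have "(M * G) *\<^sub>v v = 0\<^sub>v r" using v(3) M by (auto intro!: eq_vecI)
  ultimately show False using v by simp
qed

lemma injective_mat_dim:
  fixes M :: "'a :: field mat"
  assumes "M \<in> carrier_mat r c" "\<And>v. v \<in> carrier_vec c \<Longrightarrow> M *\<^sub>v v = 0\<^sub>v r \<Longrightarrow> v = 0\<^sub>v c"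
  shows "c \<le> r"
  using wide_mat_kernel[of M r c] assms by force

lemma invertible_matE:
  assumes "invertible_mat M" "M \<in> carrier_mat n n"
  obtains N where "N \<in> carrier_mat n n" "M * N = 1\<^sub>m n" "N * M = 1\<^sub>m n"
proof -
  from assms obtain N where N: "M * N = 1\<^sub>m n" "N * M = 1\<^sub>m (dim_row N)"
    unfolding invertible_mat_def inverts_mat_def by blast
  have "dim_col (M * N) = n" "dim_col (N * M) = dim_row N" by (simp_all only: N index_one_mat)
  then have NN: "N \<in> carrier_mat n n" using assms(2) by (intro carrier_matI) simp_all
  then have "dim_row N = n" by simp
  with NN N show ?thesis using that[of N] by simp
qed

lemma invertible_matI:
  assumes "M \<in> carrier_mat n n" "N \<in> carrier_mat n n" "M * N = 1\<^sub>m n" "N * M = 1\<^sub>m n"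
  shows "invertible_mat M"
  using assms by (auto simp: invertible_mat_def inverts_mat_def)

lemma invertible_mat_iff_det:
  fixes M :: "'a :: field mat"
  assumes M: "M \<in> carrier_mat n n"
  shows "invertible_mat M \<longleftrightarrow> det M \<noteq> 0"
proof
  assume "invertible_mat M"
  then obtain N where N: "N \<in> carrier_mat n n" "M * N = 1\<^sub>m n" using M by (rule invertible_matE)
  then have "det M * det N = 1" using det_mult[OF M N(1)] by simp
  then show "det M \<noteq> 0" by auto
next
  assume "det M \<noteq> 0"
  from det_non_zero_imp_unit[OF M this] obtain N where "N \<in> carrier_mat n n" "M * N = 1\<^sub>m n" "N * M = 1\<^sub>m n"
    unfolding Units_def ring_mat_def by auto
  with M show "invertible_mat M" by (rule invertible_matI)
qed

lemma invertible_mat_iff_injective: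
  fixes M :: "'a :: field mat"
  assumes "M \<in> carrier_mat n n"
  shows "invertible_mat M \<longleftrightarrow> (\<forall>v\<in>carrier_vec n. M *\<^sub>v v = 0\<^sub>v n \<longrightarrow> v = 0\<^sub>v n)"
  using assms det_0_iff_vec_prod_zero_field[OF assms] by (auto simp: invertible_mat_iff_det)

lemma invertible_mat_injective:
  fixes M :: "'a :: field mat"
  assumes "invertible_mat M" "M \<in> carrier_mat n n" "v \<in> carrier_vec n" "w \<in> carrier_vec n"
    "M *\<^sub>v v = M *\<^sub>v w"
  shows "v = w"
proof -
  from assms obtain N where N: "N \<in> carrier_mat n n" "N * M = 1\<^sub>m n" by (auto elim: invertible_matE)
  have "v = (N * M) *\<^sub>v v" "w = (N * M) *\<^sub>v w" using assms N by auto
  then show ?thesis using assms N by (metis assoc_mult_mat_vec)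
qed

lemma invertible_mat_surjective:
  fixes M :: "'a :: field mat"
  assumes "invertible_mat M" "M \<in> carrier_mat n n" "b \<in> carrier_vec n"
  obtains v where "v \<in> carrier_vec n" "M *\<^sub>v v = b"
proof -
  from assms obtain N where N: "N \<in> carrier_mat n n" "M * N = 1\<^sub>m n" by (auto elim: invertible_matE)
  have "M *\<^sub>v (N *\<^sub>v b) = (M * N) *\<^sub>v b" using assms N(1) by simp
  also have "\<dots> = b" using assms N by (simp only: N one_mult_mat_vec)
  finally show thesis using that[of "N *\<^sub>v b"] N(1) assms by simp
qed

lemma mat_inv_props:
  assumes "invertible_mat M" "M \<in> carrier_mat n n"
  shows "mat_inv M \<in> carrier_mat n n" "M * mat_inv M = 1\<^sub>m n" "mat_inv M * M = 1\<^sub>m n"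
proof -
  obtain N where N: "N \<in> carrier_mat n n" "M * N = 1\<^sub>m n" "N * M = 1\<^sub>m n"
    using assms by (rule invertible_matE)
  have "mat_inverse M \<noteq> None"
  proof
    assume "mat_inverse M = None"
    from mat_inverse(1)[OF assms(2) this] N assms(2)
    show False unfolding Units_def by (auto simp: ring_mat_def)
  qed
  then obtain B where "mat_inverse M = Some B" by auto
  from mat_inverse(2)[OF assms(2) this] this
  show "mat_inv M \<in> carrier_mat n n" "M * mat_inv M = 1\<^sub>m n" "mat_inv M * M = 1\<^sub>m n" by auto
qed

section \<open>Neutral subspaces\<close>

definition cip :: "complex vec \<Rightarrow> complex vec \<Rightarrow> complex" where
  "cip v w = conjugate v \<bullet> w"

lemma cip_sum:
  assumes "v \<in> carrier_vec n" "w \<in> carrier_vec n"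
  shows "cip v w = (\<Sum>k<n. cnj (v $ k) * w $ k)"
  using assms by (auto simp: cip_def scalar_prod_def atLeast0LessThan intro!: sum.cong)

lemma cip_add_left [simp]:
  assumes "u \<in> carrier_vec n" "v \<in> carrier_vec n" "w \<in> carrier_vec n"
  shows "cip (u + v) w = cip u w + cip v w"
proof -
  have "cip (u + v) w = (\<Sum>k<n. cnj ((u + v) $ k) * w $ k)"
    by (rule cip_sum) (use assms in simp_all)
  also have "\<dots> = cip u w + cip v w"
    unfolding cip_sum[OF assms(1,3)] cip_sum[OF assms(2,3)] sum.distrib[symmetric]
    by (rule sum.cong) (use assms[THEN carrier_vecD] in \<open>simp_all add: algebra_simps\<close>)
  finally show ?thesis .
qed

lemma cip_add_right [simp]:
  assumes "u \<in> carrier_vec n" "v \<in> carrier_vec n" "w \<in> carrier_vec n"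
  shows "cip w (u + v) = cip w u + cip w v"
proof -
  have "cip w (u + v) = (\<Sum>k<n. cnj (w $ k) * (u + v) $ k)"
    by (rule cip_sum) (use assms in simp_all)
  also have "\<dots> = cip w u + cip w v"
    unfolding cip_sum[OF assms(3,1)] cip_sum[OF assms(3,2)] sum.distrib[symmetric]
    by (rule sum.cong) (use assms[THEN carrier_vecD] in \<open>simp_all add: algebra_simps\<close>)
  finally show ?thesis .
qed

lemma cip_minus_left [simp]:
  assumes "u \<in> carrier_vec n" "v \<in> carrier_vec n" "w \<in> carrier_vec n"
  shows "cip (u - v) w = cip u w - cip v w"
proof -
  have "cip (u - v) w = (\<Sum>k<n. cnj ((u - v) $ k) * w $ k)"
    by (rule cip_sum) (use assms in simp_all)
  also have "\<dots> = cip u w - cip v w"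
    unfolding cip_sum[OF assms(1,3)] cip_sum[OF assms(2,3)] sum_subtractf[symmetric]
    by (rule sum.cong) (use assms[THEN carrier_vecD] in \<open>simp_all add: algebra_simps\<close>)
  finally show ?thesis .
qed

lemma cip_minus_right [simp]:
  assumes "u \<in> carrier_vec n" "v \<in> carrier_vec n" "w \<in> carrier_vec n"
  shows "cip w (u - v) = cip w u - cip w v"
proof -
  have "cip w (u - v) = (\<Sum>k<n. cnj (w $ k) * (u - v) $ k)"
    by (rule cip_sum) (use assms in simp_all)
  also have "\<dots> = cip w u - cip w v"
    unfolding cip_sum[OF assms(3,1)] cip_sum[OF assms(3,2)] sum_subtractf[symmetric]
    by (rule sum.cong) (use assms[THEN carrier_vecD] in \<open>simp_all add: algebra_simps\<close>)
  finally show ?thesis .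
qed

lemma cip_smult_left [simp]:
  "\<lbrakk>v \<in> carrier_vec n; w \<in> carrier_vec n\<rbrakk> \<Longrightarrow> cip (a \<cdot>\<^sub>v v) w = cnj a * cip v w"
  by (simp add: cip_sum[where n = n] sum_distrib_left algebra_simps)

lemma cip_smult_right [simp]:
  "\<lbrakk>v \<in> carrier_vec n; w \<in> carrier_vec n\<rbrakk> \<Longrightarrow> cip v (a \<cdot>\<^sub>v w) = a * cip v w"
  by (simp add: cip_sum[where n = n] sum_distrib_left algebra_simps)

lemma cip_uminus_left [simp]:
  "\<lbrakk>v \<in> carrier_vec n; w \<in> carrier_vec n\<rbrakk> \<Longrightarrow> cip (- v) w = - cip v w"
  by (simp add: cip_sum[where n = n] sum_negf)

lemma cip_uminus_right [simp]:
  "\<lbrakk>v \<in> carrier_vec n; w \<in> carrier_vec n\<rbrakk> \<Longrightarrow> cip v (- w) = - cip v w"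
  by (simp add: cip_sum[where n = n] sum_negf)

lemma cip_zero_left [simp]: "w \<in> carrier_vec n \<Longrightarrow> cip (0\<^sub>v n) w = 0"
  by (simp add: cip_sum[where n = n])

lemma cip_zero_right [simp]: "w \<in> carrier_vec n \<Longrightarrow> cip w (0\<^sub>v n) = 0"
  by (simp add: cip_sum[where n = n])

lemma cip_cnj: "\<lbrakk>v \<in> carrier_vec n; w \<in> carrier_vec n\<rbrakk> \<Longrightarrow> cnj (cip v w) = cip w v"
  by (simp add: cip_sum mult.commute)

lemma cip_self:
  assumes "v \<in> carrier_vec n"
  shows "cip v v = complex_of_real (\<Sum>k<n. (cmod (v $ k))\<^sup>2)"
proof -
  have "cnj z * z = complex_of_real ((cmod z)\<^sup>2)" for z
    by (metis complex_norm_square mult.commute)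
  then show ?thesis by (simp only: cip_sum[OF assms assms] of_real_sum)
qed

lemma cip_self_nonneg: "0 \<le> Re (cip v v)"
  by (subst cip_self[of v "dim_vec v"]) (auto intro: sum_nonneg)

lemma cip_self_eq_0: "v \<in> carrier_vec n \<Longrightarrow> cip v v = 0 \<longleftrightarrow> v = 0\<^sub>v n"
proof
  assume v: "v \<in> carrier_vec n" and "cip v v = 0"
  then have "(\<Sum>k<n. (cmod (v $ k))\<^sup>2) = 0" by (simp only: cip_self of_real_eq_0_iff)
  then have "\<forall>k\<in>{..<n}. (cmod (v $ k))\<^sup>2 = 0" by (subst (asm) sum_nonneg_eq_0_iff) simp_all
  then show "v = 0\<^sub>v n" using carrier_vecD[OF v] by (intro eq_vecI) simp_all
qed (auto simp: cip_sum)

lemma cip_append [simp]: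
  assumes "u \<in> carrier_vec n" "u' \<in> carrier_vec n" "v \<in> carrier_vec m" "v' \<in> carrier_vec m"
  shows "cip (u @\<^sub>v v) (u' @\<^sub>v v') = cip u u' + cip v v'"
proof -
  have "conjugate (u @\<^sub>v v) = conjugate u @\<^sub>v conjugate v"
    by (rule eq_vecI) auto
  then show ?thesis using assms by (simp add: cip_def scalar_prod_append[of _ n _ m])
qed

section \<open>Adjoint matrices\<close>

lemma mat_adjoint_index [simp]:
  "i < dim_col M \<Longrightarrow> j < dim_row M \<Longrightarrow> mat_adjoint M $$ (i, j) = cnj (M $$ (j, i))"
  for M :: "complex mat"
  by (auto simp: mat_adjoint_def mat_of_rows_def)

lemma mat_adjoint_carrier [simp]:
  "M \<in> carrier_mat r c \<Longrightarrow> mat_adjoint M \<in> carrier_mat c r"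
  by (intro carrier_matI) auto

lemma mat_adjoint_adjoint [simp]: "mat_adjoint (mat_adjoint M) = (M :: complex mat)"
  by (intro eq_matI) auto

lemma mat_adjoint_add:
  fixes M N :: "complex mat"
  assumes "M \<in> carrier_mat r c" "N \<in> carrier_mat r c"
  shows "mat_adjoint (M + N) = mat_adjoint M + mat_adjoint N"
  using assms by (intro eq_matI) auto

lemma mat_adjoint_mult:
  fixes M N :: "complex mat"
  assumes "M \<in> carrier_mat r c" "N \<in> carrier_mat c d"
  shows "mat_adjoint (M * N) = mat_adjoint N * mat_adjoint M"
proof (rule eq_matI)
  fix i j assume "i < dim_row (mat_adjoint N * mat_adjoint M)" "j < dim_col (mat_adjoint N * mat_adjoint M)"
  with assms show "mat_adjoint (M * N) $$ (i, j) = (mat_adjoint N * mat_adjoint M) $$ (i, j)"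
    by (auto simp: scalar_prod_def mult.commute intro!: sum.cong)
qed (use assms in auto)

lemma cip_mult_left:
  assumes M: "M \<in> carrier_mat r c" and v: "v \<in> carrier_vec c" and w: "w \<in> carrier_vec r"
  shows "cip (M *\<^sub>v v) w = cip v (mat_adjoint M *\<^sub>v w)"
proof -
  have "cip (M *\<^sub>v v) w = (\<Sum>k<r. cnj (\<Sum>i<c. M $$ (k, i) * v $ i) * w $ k)"
    using assms by (simp add: cip_sum[where n = r] mult_mat_vec_index[OF M v] del: index_mult_mat_vec)
  also have "\<dots> = (\<Sum>k<r. \<Sum>i<c. cnj (v $ i) * (cnj (M $$ (k, i)) * w $ k))"
    unfolding cnj_sum sum_distrib_right by (intro sum.cong) (auto simp: algebra_simps)
  also have "\<dots> = (\<Sum>i<c. \<Sum>k<r. cnj (v $ i) * (cnj (M $$ (k, i)) * w $ k))"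
    by (rule sum.swap)
  also have "\<dots> = (\<Sum>i<c. cnj (v $ i) * (\<Sum>k<r. mat_adjoint M $$ (i, k) * w $ k))"
    using M by (simp add: sum_distrib_left)
  also have "\<dots> = cip v (mat_adjoint M *\<^sub>v w)"
    using v w M mult_mat_vec_carrier[OF mat_adjoint_carrier[OF M] w] by (subst cip_sum[of _ c])
      (auto simp: mult_mat_vec_index[OF mat_adjoint_carrier[OF M] w] simp del: index_mult_mat_vec)
  finally show ?thesis .
qed

lemma hermitian_cip:
  assumes "hermitian_mat M" "M \<in> carrier_mat n n" "v \<in> carrier_vec n" "w \<in> carrier_vec n"
  shows "cip (M *\<^sub>v v) w = cip v (M *\<^sub>v w)"
  using cip_mult_left[OF assms(2-4)] assms(1) by (simp add: hermitian_mat_def)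

text \<open>The skew-Hermitian form of \<^const>\<open>even_E\<close>; it does not see the coordinates from \<open>2 * n\<close> on.\<close>
definition skew_form :: "nat \<Rightarrow> (nat \<Rightarrow> complex) \<Rightarrow> (nat \<Rightarrow> complex) \<Rightarrow> complex" where
  "skew_form n v w = (\<Sum>k<n. cnj (v (n + k)) * w k - cnj (v k) * w (n + k))"

abbreviation hform :: "nat \<Rightarrow> complex vec \<Rightarrow> complex vec \<Rightarrow> complex" where
  "hform n v w \<equiv> skew_form n (($) v) (($) w)"

lemma skew_form_sum_left:
  "skew_form n (\<lambda>k. \<Sum>i\<in>I. c i * f i k) w = (\<Sum>i\<in>I. cnj (c i) * skew_form n (f i) w)"
proof -
  have "skew_form n (\<lambda>k. \<Sum>i\<in>I. c i * f i k) w =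
    (\<Sum>k<n. \<Sum>i\<in>I. cnj (c i) * (cnj (f i (n + k)) * w k - cnj (f i k) * w (n + k)))"
    by (simp add: skew_form_def sum_distrib_right sum_distrib_left sum_subtractf[symmetric] algebra_simps)
  then show ?thesis by (subst (asm) sum.swap) (simp add: skew_form_def sum_distrib_left)
qed

lemma skew_form_sum_right:
  "skew_form n w (\<lambda>k. \<Sum>i\<in>I. c i * f i k) = (\<Sum>i\<in>I. c i * skew_form n w (f i))"
proof -
  have "skew_form n w (\<lambda>k. \<Sum>i\<in>I. c i * f i k) =
    (\<Sum>k<n. \<Sum>i\<in>I. c i * (cnj (w (n + k)) * f i k - cnj (w k) * f i (n + k)))"
    by (simp add: skew_form_def sum_distrib_left sum_distrib_right sum_subtractf[symmetric] algebra_simps)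
  then show ?thesis by (subst (asm) sum.swap) (simp add: skew_form_def sum_distrib_left)
qed

lemma skew_form_commute: "skew_form n w v = - cnj (skew_form n v w)"
  by (simp add: skew_form_def sum_negf[symmetric] algebra_simps)

lemma skew_form_append:
  assumes "\<mu> \<in> carrier_vec n" "x \<in> carrier_vec n" "\<mu>' \<in> carrier_vec n" "x' \<in> carrier_vec n"
  shows "hform n (\<mu> @\<^sub>v x) (\<mu>' @\<^sub>v x') = cip x \<mu>' - cip \<mu> x'"
  using assms by (simp add: skew_form_def cip_sum sum_subtractf)

lemma hform_append_right:
  assumes "v \<in> carrier_vec (2 * n)" "w \<in> carrier_vec (2 * n)"
  shows "hform n (v @\<^sub>v a) (w @\<^sub>v b) = hform n v w"
  using assms by (auto simp: skew_form_def intro!: sum.cong)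

lemma hform_add_left [simp]:
  assumes "u \<in> carrier_vec (2 * n)" "v \<in> carrier_vec (2 * n)" "w \<in> carrier_vec (2 * n)"
  shows "hform n (u + v) w = hform n u w + hform n v w"
  unfolding skew_form_def sum.distrib[symmetric] by (rule sum.cong) (use assms[THEN carrier_vecD] in \<open>simp_all add: algebra_simps\<close>)

lemma hform_add_right [simp]:
  assumes "u \<in> carrier_vec (2 * n)" "v \<in> carrier_vec (2 * n)" "w \<in> carrier_vec (2 * n)"
  shows "hform n w (u + v) = hform n w u + hform n w v"
  unfolding skew_form_def sum.distrib[symmetric] by (rule sum.cong) (use assms[THEN carrier_vecD] in \<open>simp_all add: algebra_simps\<close>)

lemma hform_smult_left [simp]:
  assumes "v \<in> carrier_vec (2 * n)" "w \<in> carrier_vec (2 * n)"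
  shows "hform n (a \<cdot>\<^sub>v v) w = cnj a * hform n v w"
  unfolding skew_form_def sum_distrib_left by (rule sum.cong) (use assms[THEN carrier_vecD] in \<open>simp_all add: algebra_simps\<close>)

lemma hform_smult_right [simp]:
  assumes "v \<in> carrier_vec (2 * n)" "w \<in> carrier_vec (2 * n)"
  shows "hform n w (a \<cdot>\<^sub>v v) = a * hform n w v"
  unfolding skew_form_def sum_distrib_left by (rule sum.cong) (use assms[THEN carrier_vecD] in \<open>simp_all add: algebra_simps\<close>)

lemma hform_zero [simp]: "hform n (0\<^sub>v (2 * n)) w = 0" "hform n w (0\<^sub>v (2 * n)) = 0"
  by (simp_all add: skew_form_def)

lemma hform_combination:
  assumes "v \<in> carrier_vec (2 * n)" "v' \<in> carrier_vec (2 * n)" "w \<in> carrier_vec (2 * n)" "w' \<in> carrier_vec (2 * n)"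
  shows "hform n (a \<cdot>\<^sub>v v + v') (b \<cdot>\<^sub>v w + w') =
    cnj a * b * hform n v w + cnj a * hform n v w' + b * hform n v' w + hform n v' w'"
  using assms by (simp add: algebra_simps)

text \<open>If \<open>J\<close> is the matrix of the form, a neutral subspace \<open>U\<close> meets \<open>J U\<close> trivially.\<close>
lemma neutral_family_card:
  fixes f :: "'i \<Rightarrow> nat \<Rightarrow> complex"
  assumes I: "finite I"
    and neutral: "\<And>i j. i \<in> I \<Longrightarrow> j \<in> I \<Longrightarrow> skew_form n (f i) (f j) = 0"
    and indep: "\<And>c. (\<And>k. k < 2 * n + m \<Longrightarrow> (\<Sum>i\<in>I. c i * f i k) = 0) \<Longrightarrow> \<forall>i\<in>I. c i = 0"
  shows "card I \<le> n + m"
proof (rule ccontr)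
  assume "\<not> card I \<le> n + m"
  define U :: "(bool \<times> 'i) set" where "U = UNIV \<times> I"
  \<comment> \<open>The unknowns are the coefficients of two members \<open>v\<close> (index
    \<open>True\<close>) and \<open>w\<close> (index \<open>False\<close>) of the span. Tags 0 and 1
    express \<open>v = J w\<close> on the first \<open>2 * n\<close> coordinates; tags 4 and 5 make
    the last \<open>m\<close> coordinates of \<open>v\<close> and of \<open>w\<close> vanish. These
    are at most \<open>2 * n + 2 * m\<close> equations for \<open>2 * card I\<close>
    unknowns.\<close>
  define M :: "nat \<times> nat \<Rightarrow> bool \<times> 'i \<Rightarrow> complex" where
    "M = (\<lambda>(t, k) (b, i).
      if t = 0 then (if b then f i k else - f i (n + k))
      else if t = 1 then (if b then f i (n + k) else f i k)
      else if t = 4 then (if b then f i (2 * n + k) else 0)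
      else if t = 5 then (if b then 0 else f i (2 * n + k)) else 0)"
  define K :: "(nat \<times> nat) set" where "K = {..<2} \<times> {..<n} \<union> {4..<6} \<times> {..<m}"
  have "card K \<le> 2 * n + 2 * m"
    unfolding K_def by (rule order.trans[OF card_Un_le]) (simp add: card_cartesian_product)
  moreover have "card U = 2 * card I" "finite U" "finite K"
    using I by (auto simp: U_def K_def card_cartesian_product)
  ultimately obtain c where c: "\<exists>p\<in>U. c p \<noteq> 0" "\<forall>k\<in>K. (\<Sum>p\<in>U. M k p * c p) = 0"
    using homogeneous_system_solution[of K U M] \<open>\<not> card I \<le> n + m\<close> by auto
  define v where "v k = (\<Sum>i\<in>I. c (True, i) * f i k)" for k
  define w where "w k = (\<Sum>i\<in>I. c (False, i) * f i k)" for k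
  have split: "(\<Sum>p\<in>U. g p) = (\<Sum>i\<in>I. g (True, i)) + (\<Sum>i\<in>I. g (False, i))"
    for g :: "bool \<times> 'i \<Rightarrow> complex"
    unfolding U_def UNIV_bool using I
    by (subst sum.cartesian_product') (simp add: add.commute)
  have e1: "v k = w (n + k)" if "k < n" for k
    using c(2)[rule_format, of "(0, k)"] that
    by (simp add: K_def split M_def v_def w_def sum_negf mult.commute)
  have e2: "v (n + k) = - w k" if "k < n" for k
    using c(2)[rule_format, of "(1, k)"] that
    by (simp add: K_def split M_def v_def w_def mult.commute add_eq_0_iff)
  have e3: "v (2 * n + k) = 0" "w (2 * n + k) = 0" if "k < m" for k
    using c(2)[rule_format, of "(4, k)"] c(2)[rule_format, of "(5, k)"] that
    by (simp_all add: K_def split M_def v_def w_def mult.commute)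
  \<comment> \<open>Neutrality makes the form zero, while \<open>v = J w\<close> makes it minus the
    squared norm of the first \<open>2 * n\<close> coordinates of \<open>w\<close>.\<close>
  have "skew_form n v w = 0"
    unfolding v_def w_def by (simp add: skew_form_sum_left skew_form_sum_right neutral)
  moreover have "skew_form n v w = - of_real (\<Sum>k<n. (cmod (w k))\<^sup>2 + (cmod (w (n + k)))\<^sup>2)"
    unfolding skew_form_def of_real_sum sum_negf[symmetric]
    by (intro sum.cong) (simp_all add: e1 e2 complex_norm_square mult.commute del: of_real_power)
  ultimately have "(\<Sum>k<n. (cmod (w k))\<^sup>2 + (cmod (w (n + k)))\<^sup>2) = 0"
    by (simp only: neg_equal_0_iff_equal of_real_eq_0_iff)
  then have sq: "\<forall>k\<in>{..<n}. (cmod (w k))\<^sup>2 + (cmod (w (n + k)))\<^sup>2 = 0"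
    by (subst (asm) sum_nonneg_eq_0_iff) simp_all
  have w0: "w k = 0" "w (n + k) = 0" if "k < n" for k
    using sq[rule_format, of k] that by (simp_all only: sum_power2_eq_zero_iff norm_eq_zero lessThan_iff)
  have cases: "k < n \<or> (\<exists>l<n. k = n + l) \<or> (\<exists>l<m. k = 2 * n + l)" if "k < 2 * n + m" for k
    using that by presburger
  have "w k = 0" "v k = 0" if "k < 2 * n + m" for k
    using cases[OF that] w0 e1 e2 e3 by auto
  then have "\<forall>i\<in>I. c (True, i) = 0" "\<forall>i\<in>I. c (False, i) = 0"
    unfolding v_def w_def by (intro indep; blast)+
  moreover from c(1) obtain b i where "i \<in> I" "c (b, i) \<noteq> 0" unfolding U_def by blast
  ultimately show False by (cases b) auto
qed

text \<open>Adjoining \<open>v\<close>, under the index \<open>None\<close>, to a neutral family of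
  \<open>n + m\<close> members exceeds the bound of \<open>neutral_family_card\<close>, so the
  enlarged family is dependent; independence of \<open>f\<close> gives \<open>v\<close> a nonzero
  coefficient. It serves with \<open>m = 0\<close> for chains of the reduced pencil and with
  \<open>m\<close> extra coordinates for the deflating subspace.\<close>

lemma neutral_family_maximal:
  fixes f :: "'i \<Rightarrow> nat \<Rightarrow> complex"
  assumes I: "finite I" "card I = n + m"
    and neutral: "\<And>i j. i \<in> I \<Longrightarrow> j \<in> I \<Longrightarrow> skew_form n (f i) (f j) = 0"
    and indep: "\<And>c. (\<And>k. k < 2 * n + m \<Longrightarrow> (\<Sum>i\<in>I. c i * f i k) = 0) \<Longrightarrow> \<forall>i\<in>I. c i = 0"
    and v: "\<And>i. i \<in> I \<Longrightarrow> skew_form n (f i) v = 0" "skew_form n v v = 0"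
  shows "\<exists>c. \<forall>k<2 * n + m. v k = (\<Sum>i\<in>I. c i * f i k)"
proof -
  define J where "J = insert None (Some ` I)"
  define g where "g = (\<lambda>p. case p of None \<Rightarrow> v | Some i \<Rightarrow> f i)"
  have J: "finite J" "card J = n + m + 1" using I by (auto simp: J_def card_image)
  have sumJ: "(\<Sum>p\<in>J. h p) = h None + (\<Sum>i\<in>I. h (Some i))" for h :: "'i option \<Rightarrow> complex"
    unfolding J_def using I by (subst sum.insert) (auto simp: sum.reindex)
  have v': "skew_form n v (f i) = 0" if "i \<in> I" for i
    using v(1)[OF that] skew_form_commute[of n v "f i"] by simp
  have "\<exists>c. (\<forall>k<2 * n + m. (\<Sum>p\<in>J. c p * g p k) = 0) \<and> (\<exists>p\<in>J. c p \<noteq> 0)"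
  proof (rule ccontr)
    assume "\<not> ?thesis"
    then have "card J \<le> n + m"
      by (intro neutral_family_card[of J n g m])
        (use J neutral v v' in \<open>auto simp: J_def g_def\<close>)
    with J show False by simp
  qed
  then obtain c where c: "\<And>k. k < 2 * n + m \<Longrightarrow> c None * v k + (\<Sum>i\<in>I. c (Some i) * f i k) = 0"
    "\<exists>p\<in>J. c p \<noteq> 0" by (auto simp: sumJ g_def)
  have "c None \<noteq> 0"
  proof
    assume 0: "c None = 0"
    then have "\<forall>i\<in>I. c (Some i) = 0" using c(1) by (intro indep) auto
    with 0 c(2) show False by (auto simp: J_def)
  qed
  then have "v k = (\<Sum>i\<in>I. - c (Some i) / c None * f i k)" if "k < 2 * n + m" for k
    using c(1)[OF that]
    by (simp add: sum_negf sum_divide_distrib[symmetric] field_simps add_eq_0_iff)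
  then show ?thesis by (intro exI[of _ "\<lambda>i. - c (Some i) / c None"]) blast
qed

text \<open>Linear independence is a property of the set of columns, so repeated columns have to be
  excluded first: a maximal independent subset of the columns has \<open>nc\<close> elements, hence
  no two of the \<open>nc\<close> columns coincide.\<close>

lemma (in vec_space) full_rank_imp_injective:
  assumes A: "A \<in> carrier_mat n nc" and "rank A = nc" and v: "v \<in> carrier_vec nc" "A *\<^sub>v v = 0\<^sub>v n"
  shows "v = 0\<^sub>v nc"
proof (rule ccontr)
  assume "v \<noteq> 0\<^sub>v nc"
  obtain S where S: "maximal S (\<lambda>T. T \<subseteq> set (cols A) \<and> lin_indpt T)"
    using maximal_exists[of "(\<lambda>T. T \<subseteq> set (cols A) \<and> lin_indpt T)" "card (set (cols A))" "{}"]
    by (meson List.finite_set card_mono empty_iff empty_subsetI finite_lin_indpt2 rev_finite_subset)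
  then have "card S \<le> card (set (cols A))" by (simp add: card_mono maximal_def)
  moreover have "rank A = card S" using A S by (rule rank_card_indpt)
  ultimately have "nc \<le> card (set (cols A))" using assms by simp
  moreover have "length (cols A) = nc" using A by simp
  ultimately have d: "distinct (cols A)"
    by (metis card_distinct card_length dual_order.antisym)
  from full_rank_lin_indpt[OF A \<open>rank A = nc\<close> d] lin_depI[OF A v(1) \<open>v \<noteq> 0\<^sub>v nc\<close> v(2) d]
  show False by blast
qed

text \<open>A maximal independent set of columns has \<open>n\<close> elements, so it is a basis of
  the whole space.\<close>

lemma (in vec_space) full_row_rank_imp_surjective:
  assumes A: "A \<in> carrier_mat n nc" and "rank A = n" and b: "b \<in> carrier_vec n"
  shows "\<exists>v\<in>carrier_vec nc. A *\<^sub>v v = b"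
proof -
  obtain S where S: "maximal S (\<lambda>T. T \<subseteq> set (cols A) \<and> lin_indpt T)"
    using maximal_exists[of "(\<lambda>T. T \<subseteq> set (cols A) \<and> lin_indpt T)" "card (set (cols A))" "{}"]
    by (meson List.finite_set card_mono empty_iff empty_subsetI finite_lin_indpt2 rev_finite_subset)
  then have S': "S \<subseteq> set (cols A)" "lin_indpt S" by (auto simp: maximal_def)
  have "card S = n" using rank_card_indpt[OF A S] assms by simp
  moreover have "finite S" using S'(1) by (rule finite_subset) simp
  moreover have "S \<subseteq> carrier_vec n" using S'(1) A cols_dim by blast
  ultimately have "basis S" using S'(2) by (intro dim_li_is_basis) (auto simp: dim_is_n)
  then have "b \<in> span S" using b by (auto simp: basis_def)
  also have "\<dots> \<subseteq> col_space A" unfolding col_space_def by (rule span_is_monotone[OF S'(1)])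
  finally show ?thesis using A by (auto simp: col_space_eq[OF A])
qed

lemma invertible_imp_rank:
  fixes A :: "'a :: field mat"
  assumes "A \<in> carrier_mat n n" "invertible_mat A"
  shows "vec_space.rank n A = n"
  using assms by (simp add: invertible_mat_iff_det vec_space.det_rank_iff)

section \<open>Vector and block matrix arithmetic\<close>

lemma vec_minus_eq_0_iff:
  fixes v :: "'a :: ab_group_add vec"
  assumes "v \<in> carrier_vec n" "w \<in> carrier_vec n"
  shows "v - w = 0\<^sub>v n \<longleftrightarrow> v = w"
proof
  assume "v - w = 0\<^sub>v n"
  then have "v $ i = w $ i" if "i < n" for i
    using that assms by (metis carrier_vecD index_minus_vec(1) index_zero_vec(1) right_minus_eq)
  then show "v = w" using assms by (intro eq_vecI) auto
qed (use assms in auto)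

lemma add_diff_cancel_vec:
  fixes v :: "'a :: ab_group_add vec"
  assumes "v \<in> carrier_vec n" "w \<in> carrier_vec n"
  shows "v + w - w = v"
  using assms by (intro eq_vecI) auto

lemma mult_mat_vec_uminus:
  fixes M :: "'a :: ring mat"
  assumes "M \<in> carrier_mat r c" "v \<in> carrier_vec c"
  shows "M *\<^sub>v (- v) = - (M *\<^sub>v v)"
  using assms by (intro eq_vecI) auto

lemma minus_vec_cancel_right:
  fixes u v w :: "'a :: ab_group_add vec"
  assumes "u \<in> carrier_vec n" "v \<in> carrier_vec n" "w \<in> carrier_vec n" and eq: "u - w = v - w"
  shows "u = v"
proof (rule eq_vecI)
  fix i assume "i < dim_vec v"
  then have "i < dim_vec w" using assms by simp
  with arg_cong[OF eq, of "\<lambda>x. x $ i"] show "u $ i = v $ i" by simp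
qed (use assms in auto)

lemma add_vec_cancel_left:
  fixes u v w :: "'a :: ab_group_add vec"
  assumes "u \<in> carrier_vec n" "v \<in> carrier_vec n" "w \<in> carrier_vec n" and eq: "u + v = u + w"
  shows "v = w"
proof (rule eq_vecI)
  fix i assume "i < dim_vec w"
  then have "i < n" using assms by simp
  then have "u $ i + v $ i = u $ i + w $ i"
    using arg_cong[OF eq, of "\<lambda>x. x $ i"] by (simp add: carrier_vecD[OF assms(2)] carrier_vecD[OF assms(3)])
  then show "v $ i = w $ i" by simp
qed (use assms in simp)

lemma vec_minus_eq_iff:
  fixes u v w :: "'a :: ab_group_add vec"
  assumes "u \<in> carrier_vec n" "v \<in> carrier_vec n" "w \<in> carrier_vec n"
  shows "u - v = w \<longleftrightarrow> u = v + w"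
proof
  assume eq: "u - v = w"
  show "u = v + w" unfolding eq[symmetric] using assms by (intro eq_vecI) auto
next
  assume eq: "u = v + w"
  show "u - v = w" unfolding eq using assms by (intro eq_vecI) auto
qed

lemma vec_add_eq_self_iff:
  fixes v :: "'a :: ab_group_add vec"
  assumes "v \<in> carrier_vec n" "w \<in> carrier_vec n"
  shows "v + w = w \<longleftrightarrow> v = 0\<^sub>v n"
proof
  assume eq: "v + w = w"
  have "v $ i = 0" if "i < n" for i
    using arg_cong[OF eq, of "\<lambda>u. u $ i"] that carrier_vecD[OF assms(2)] by simp
  then show "v = 0\<^sub>v n" using assms by (intro eq_vecI) auto
qed (use assms in auto)

lemma smult_vec_eq_0_iff:
  fixes v :: "'a :: field vec"
  assumes "v \<in> carrier_vec n"
  shows "a \<cdot>\<^sub>v v = 0\<^sub>v n \<longleftrightarrow> a = 0 \<or> v = 0\<^sub>v n"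
proof
  assume eq: "a \<cdot>\<^sub>v v = 0\<^sub>v n"
  have "a = 0 \<or> v $ i = 0" if "i < n" for i
    using arg_cong[OF eq, of "\<lambda>u. u $ i"] that carrier_vecD[OF assms] by simp
  then show "a = 0 \<or> v = 0\<^sub>v n" using assms by (cases "a = 0") (auto intro!: eq_vecI)
qed (use assms in auto)

lemma smult_mat_mult_vec:
  fixes M :: "'a :: comm_ring_1 mat"
  assumes "M \<in> carrier_mat r c" "v \<in> carrier_vec c"
  shows "(a \<cdot>\<^sub>m M) *\<^sub>v v = a \<cdot>\<^sub>v (M *\<^sub>v v)"
  using assms by (intro eq_vecI) (auto simp: scalar_prod_def sum_distrib_left algebra_simps)

lemma append_vec_zero [simp]: "0\<^sub>v a @\<^sub>v 0\<^sub>v b = 0\<^sub>v (a + b)"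
  by (intro eq_vecI) auto

lemma append_vec_eq_zero_iff:
  assumes "v \<in> carrier_vec a" "w \<in> carrier_vec b"
  shows "v @\<^sub>v w = 0\<^sub>v (a + b) \<longleftrightarrow> v = 0\<^sub>v a \<and> w = 0\<^sub>v b"
  using append_vec_eq[OF assms(1) zero_carrier_vec, of w "0\<^sub>v b"] by simp

lemma append_vec_uminus: "- (v @\<^sub>v w) = (- v) @\<^sub>v (- w)" for v w :: "'a :: ring_1 vec"
  by (intro eq_vecI) auto

lemma append_vec_smult: "a \<cdot>\<^sub>v (v @\<^sub>v w) = (a \<cdot>\<^sub>v v) @\<^sub>v (a \<cdot>\<^sub>v w)"
  by (intro eq_vecI) auto

lemma append_cols_carrier [simp]:
  "A \<in> carrier_mat r c \<Longrightarrow> B \<in> carrier_mat r c' \<Longrightarrow> A @\<^sub>c B \<in> carrier_mat r (c + c')"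
  unfolding append_cols_def by (metis four_block_carrier_mat zero_carrier_mat add_0_right carrier_matD(2))

lemma append_cols_mult_vec:
  fixes A :: "'a :: comm_ring_1 mat"
  assumes "A \<in> carrier_mat r c" "B \<in> carrier_mat r c'" "v \<in> carrier_vec c" "w \<in> carrier_vec c'"
  shows "(A @\<^sub>c B) *\<^sub>v (v @\<^sub>v w) = A *\<^sub>v v + B *\<^sub>v w"
proof -
  have d: "dim_col A = c" "dim_col B = c'" using assms by auto
  show ?thesis unfolding append_cols_def d
    by (subst four_block_mat_mult_vec[OF assms(1,2) _ _ assms(3,4)]) (use assms in auto)
qed

lemma block3_mat_carrier:
  assumes "M11 \<in> carrier_mat a a'" "M12 \<in> carrier_mat a b'" "M13 \<in> carrier_mat a c'"
    "M21 \<in> carrier_mat b a'" "M22 \<in> carrier_mat b b'" "M23 \<in> carrier_mat b c'"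
    "M31 \<in> carrier_mat c a'" "M32 \<in> carrier_mat c b'" "M33 \<in> carrier_mat c c'"
  shows "block3_mat M11 M12 M13 M21 M22 M23 M31 M32 M33 \<in> carrier_mat (a + b + c) (a' + b' + c')"
  unfolding block3_mat_def using assms by (meson four_block_carrier_mat)

lemma block3_mat_mult_vec:
  fixes M11 :: "'a :: comm_ring_1 mat"
  assumes "M11 \<in> carrier_mat a a'" "M12 \<in> carrier_mat a b'" "M13 \<in> carrier_mat a c'"
    "M21 \<in> carrier_mat b a'" "M22 \<in> carrier_mat b b'" "M23 \<in> carrier_mat b c'"
    "M31 \<in> carrier_mat c a'" "M32 \<in> carrier_mat c b'" "M33 \<in> carrier_mat c c'"
    and v: "p \<in> carrier_vec a'" "q \<in> carrier_vec b'" "r \<in> carrier_vec c'"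
  shows "block3_mat M11 M12 M13 M21 M22 M23 M31 M32 M33 *\<^sub>v ((p @\<^sub>v q) @\<^sub>v r) =
    ((M11 *\<^sub>v p + M12 *\<^sub>v q + M13 *\<^sub>v r) @\<^sub>v (M21 *\<^sub>v p + M22 *\<^sub>v q + M23 *\<^sub>v r)) @\<^sub>v
    (M31 *\<^sub>v p + M32 *\<^sub>v q + M33 *\<^sub>v r)"
proof -
  have "block3_mat M11 M12 M13 M21 M22 M23 M31 M32 M33 *\<^sub>v ((p @\<^sub>v q) @\<^sub>v r) =
    (four_block_mat M11 M12 M21 M22 *\<^sub>v (p @\<^sub>v q) + (M13 @\<^sub>r M23) *\<^sub>v r) @\<^sub>v
    ((M31 @\<^sub>c M32) *\<^sub>v (p @\<^sub>v q) + M33 *\<^sub>v r)"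
    unfolding block3_mat_def
    by (rule four_block_mat_mult_vec[of _ "a + b" "a' + b'" _ c' _ c])
      (use assms in \<open>auto intro: four_block_carrier_mat\<close>)
  then show ?thesis using assms
    by (simp add: four_block_mat_mult_vec[OF assms(1,2,4,5)] mat_mult_append[OF assms(3,6)]
        append_cols_mult_vec[OF assms(7,8)]
        append_vec_add[of "M11 *\<^sub>v p + M12 *\<^sub>v q" a "M13 *\<^sub>v r" _ b])
qed

lemma split2_vec:
  assumes "v \<in> carrier_vec (a + b)"
  obtains p q where "p \<in> carrier_vec a" "q \<in> carrier_vec b" "v = p @\<^sub>v q"
  using vec_first_last_append[OF assms] that[of "vec_first v a" "vec_last v b"] by simp

lemma split_2n_vec:
  assumes "v \<in> carrier_vec (2 * n)"
  obtains p q where "p \<in> carrier_vec n" "q \<in> carrier_vec n" "v = p @\<^sub>v q"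
  using assms unfolding mult_2 by (rule split2_vec)

lemma split3_vec:
  assumes "v \<in> carrier_vec (2 * n + m)"
  obtains p q r where "p \<in> carrier_vec n" "q \<in> carrier_vec n" "r \<in> carrier_vec m" "v = (p @\<^sub>v q) @\<^sub>v r"
proof -
  from assms obtain z r where "z \<in> carrier_vec (2 * n)" "r \<in> carrier_vec m" "v = z @\<^sub>v r"
    by (rule split2_vec)
  moreover from this(1) obtain p q where "p \<in> carrier_vec n" "q \<in> carrier_vec n" "z = p @\<^sub>v q"
    by (rule split_2n_vec)
  ultimately show thesis using that by blast
qed

lemma append_vec_carrier_2n:
  "p \<in> carrier_vec n \<Longrightarrow> q \<in> carrier_vec n \<Longrightarrow> p @\<^sub>v q \<in> carrier_vec (2 * n)"
  by (simp add: mult_2)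

text \<open>The form is nonnegative at \<open>v - t * M v\<close> for every real \<open>t\<close>,
  yet its linear term in \<open>t\<close> is \<open>-2 * t\<close> times the squared norm of
  \<open>M v\<close>.\<close>

lemma psd_mat_kernel:
  assumes M: "psd_mat M" "M \<in> carrier_mat k k" and v: "v \<in> carrier_vec k" and 0: "Re (cip v (M *\<^sub>v v)) = 0"
  shows "M *\<^sub>v v = 0\<^sub>v k"
proof -
  define w where "w = M *\<^sub>v v"
  have w: "w \<in> carrier_vec k" "M *\<^sub>v w \<in> carrier_vec k" using M v by (auto simp: w_def)
  have nn: "0 \<le> Re (cip u (M *\<^sub>v u))" if "u \<in> carrier_vec k" for u
    using M that by (auto simp: psd_mat_def cip_def less_eq_complex_def)
  have h: "hermitian_mat M" using M by (simp add: psd_mat_def)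
  define a where "a = Re (cip w w)"
  define b where "b = Re (cip w (M *\<^sub>v w))"
  have "a \<ge> 0" "b \<ge> 0" using nn w by (auto simp: a_def b_def cip_self_nonneg)
  have eq: "0 \<le> t\<^sup>2 * b - 2 * t * a" for t :: real
  proof -
    define u where "u = v - complex_of_real t \<cdot>\<^sub>v w"
    have "M *\<^sub>v u = w - complex_of_real t \<cdot>\<^sub>v (M *\<^sub>v w)"
      using M v w by (simp add: u_def w_def mult_minus_distrib_mat_vec[of _ k k] mult_mat_vec[of _ k k])
    moreover have "cip v (M *\<^sub>v w) = cip w w"
      using hermitian_cip[OF h M(2) v w(1)] by (simp add: w_def)
    moreover have "0 \<le> Re (cip u (M *\<^sub>v u))" using v w by (intro nn) (auto simp: u_def)
    ultimately show ?thesis using v w 0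
      by (simp add: u_def a_def b_def w_def[symmetric] cip_minus_left[where n=k] cip_minus_right[where n=k]
          cip_smult_left[where n=k] cip_smult_right[where n=k] algebra_simps power2_eq_square)
  qed
  have "a = 0"
  proof (rule ccontr)
    assume "a \<noteq> 0"
    with \<open>a \<ge> 0\<close> have "a > 0" by simp
    show False
    proof (cases "b = 0")
      case True
      then show False using eq[of 1] \<open>a > 0\<close> by simp
    next
      case False
      \<comment> \<open>\<open>t = a / b\<close> minimises the quadratic.\<close>
      then have "(a / b)\<^sup>2 * b - 2 * (a / b) * a = - a\<^sup>2 / b"
        by (simp add: field_simps power2_eq_square)
      also have "\<dots> < 0" using \<open>a > 0\<close> False \<open>b \<ge> 0\<close> by (simp add: field_simps)
      finally show False using eq[of "a / b"] by simp
    qed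
  qed
  then have "cip w w = 0" using cip_self[OF w(1)] by (simp add: a_def)
  then show ?thesis using cip_self_eq_0[OF w(1)] by (simp add: w_def)
qed

section \<open>The energy identity\<close>

text \<open>Only shapes, symmetry and the sign of \<gamma> are fixed here, so the locale can be
  interpreted a second time with \<open>Q\<close> and \<open>C\<close> replaced by the blocks of the
  linear matrix inequality at some \<open>Y\<close>.\<close>

locale lure_data =
  fixes n m :: nat and A B C Q R :: "complex mat" and \<gamma> :: real
  assumes A [simp]: "A \<in> carrier_mat n n" and Q [simp]: "Q \<in> carrier_mat n n"
    and B [simp]: "B \<in> carrier_mat n m" and C [simp]: "C \<in> carrier_mat n m"
    and R [simp]: "R \<in> carrier_mat m m"
    and Q_herm: "hermitian_mat Q" and R_herm: "hermitian_mat R" and \<gamma>: "\<gamma> > 0"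
begin

lemma mult_vec_closed [simp]:
  "v \<in> carrier_vec n \<Longrightarrow> A *\<^sub>v v \<in> carrier_vec n"
  "v \<in> carrier_vec n \<Longrightarrow> mat_adjoint A *\<^sub>v v \<in> carrier_vec n"
  "v \<in> carrier_vec n \<Longrightarrow> Q *\<^sub>v v \<in> carrier_vec n"
  "w \<in> carrier_vec m \<Longrightarrow> B *\<^sub>v w \<in> carrier_vec n"
  "v \<in> carrier_vec n \<Longrightarrow> mat_adjoint B *\<^sub>v v \<in> carrier_vec m"
  "w \<in> carrier_vec m \<Longrightarrow> C *\<^sub>v w \<in> carrier_vec n"
  "v \<in> carrier_vec n \<Longrightarrow> mat_adjoint C *\<^sub>v v \<in> carrier_vec m"
  "w \<in> carrier_vec m \<Longrightarrow> R *\<^sub>v w \<in> carrier_vec m"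
  using A B C Q R mat_adjoint_carrier[OF A] mat_adjoint_carrier[OF B] mat_adjoint_carrier[OF C]
  by (blast intro: mult_mat_vec_carrier)+

abbreviation "g \<equiv> complex_of_real \<gamma>"

text \<open>The relation \<open>A_red z = E_red z'\<close> for \<open>z = (\<mu>, x)\<close> and \<open>z' = (\<mu>', x')\<close>, with the block
  row that was eliminated put back.\<close>
definition step :: "complex vec \<Rightarrow> complex vec \<Rightarrow> complex vec \<Rightarrow> complex vec \<Rightarrow> complex vec \<Rightarrow> bool" where
  "step \<mu> x \<mu>' x' u \<longleftrightarrow>
     \<mu> \<in> carrier_vec n \<and> x \<in> carrier_vec n \<and> \<mu>' \<in> carrier_vec n \<and> x' \<in> carrier_vec n \<and> u \<in> carrier_vec m \<and>
     A *\<^sub>v (x - x') = g \<cdot>\<^sub>v (x + x') + B *\<^sub>v u \<and>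
     mat_adjoint A *\<^sub>v (\<mu> - \<mu>') + g \<cdot>\<^sub>v (\<mu> + \<mu>') + Q *\<^sub>v (x - x') = C *\<^sub>v u \<and>
     mat_adjoint B *\<^sub>v (\<mu> - \<mu>') + mat_adjoint C *\<^sub>v (x - x') = R *\<^sub>v u"

text \<open>The sesquilinear form of the Popov matrix with blocks \<open>Q\<close>,
  \<open>C\<close>, the adjoint of \<open>C\<close> and \<open>R\<close>, taken at
  \<open>(\<xi>, -u)\<close> and \<open>(\<zeta>, -w)\<close>. The sign of the inputs is built in
  because \<open>step\<close> has them on the right-hand side.\<close>

definition popov :: "complex vec \<Rightarrow> complex vec \<Rightarrow> complex vec \<Rightarrow> complex vec \<Rightarrow> complex" where
  "popov \<xi> u \<zeta> w = cip \<xi> (Q *\<^sub>v \<zeta>) - cip \<xi> (C *\<^sub>v w) - cip (C *\<^sub>v u) \<zeta> + cip u (R *\<^sub>v w)"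

lemma popov_cnj:
  assumes [simp]: "\<xi> \<in> carrier_vec n" "u \<in> carrier_vec m" "\<zeta> \<in> carrier_vec n" "w \<in> carrier_vec m"
  shows "cnj (popov \<zeta> w \<xi> u) = popov \<xi> u \<zeta> w"
proof -
  have "cip (Q *\<^sub>v \<xi>) \<zeta> = cip \<xi> (Q *\<^sub>v \<zeta>)" "cip (R *\<^sub>v u) w = cip u (R *\<^sub>v w)"
    using hermitian_cip[OF Q_herm Q, of \<xi> \<zeta>] hermitian_cip[OF R_herm R, of u w] by simp_all
  then show ?thesis
    by (simp add: popov_def cip_cnj[of _ n] cip_cnj[of _ m])
qed

text \<open>Pair the second row of the step of \<open>\<nu>\<close> with \<open>x - x'\<close> and
  the third with \<open>u\<close>, and remove \<open>A\<close> by the first row of the step of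
  \<open>\<mu>\<close>. The terms with \<open>B\<close> cancel, and the remaining \<gamma>-terms
  combine because \<open>cip (x - x') (\<nu> + \<nu>') + cip (x + x') (\<nu> - \<nu>') = 2 * (cip x
  \<nu> - cip x' \<nu>')\<close>. The two steps enter unequally, which is why exchanging them gives
  new information in \<open>step_isometry\<close>.\<close>

lemma step_energy:
  assumes z: "step \<mu> x \<mu>' x' u" and w: "step \<nu> y \<nu>' y' v"
  shows "2 * g * (cip x' \<nu>' - cip x \<nu>) = popov (x - x') u (y - y') v"
proof -
  note [simp] = cip_minus_left[where n = n] cip_minus_right[where n = n] cip_add_left[where n = n]
    cip_add_right[where n = n] cip_smult_left[where n = n] cip_smult_right[where n = n]
  have [simp]: "\<mu> \<in> carrier_vec n" "x \<in> carrier_vec n" "\<mu>' \<in> carrier_vec n" "x' \<in> carrier_vec n"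
    "u \<in> carrier_vec m" "\<nu> \<in> carrier_vec n" "y \<in> carrier_vec n" "\<nu>' \<in> carrier_vec n"
    "y' \<in> carrier_vec n" "v \<in> carrier_vec m"
    using z w by (auto simp: step_def)
  define \<xi> where "\<xi> = x - x'"
  define \<eta> where "\<eta> = \<nu> - \<nu>'"
  define \<zeta> where "\<zeta> = y - y'"
  have [simp]: "\<xi> \<in> carrier_vec n" "\<eta> \<in> carrier_vec n" "\<zeta> \<in> carrier_vec n"
    by (auto simp: \<xi>_def \<eta>_def \<zeta>_def)
  have r1: "A *\<^sub>v \<xi> = g \<cdot>\<^sub>v (x + x') + B *\<^sub>v u"
    and r2: "mat_adjoint A *\<^sub>v \<eta> + g \<cdot>\<^sub>v (\<nu> + \<nu>') + Q *\<^sub>v \<zeta> = C *\<^sub>v v"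
    and r3: "mat_adjoint B *\<^sub>v \<eta> + mat_adjoint C *\<^sub>v \<zeta> = R *\<^sub>v v"
    using z w by (auto simp: step_def \<xi>_def \<eta>_def \<zeta>_def)
  have a: "cip \<xi> (mat_adjoint A *\<^sub>v \<eta>) = g * (cip x \<eta> + cip x' \<eta>) + cip (B *\<^sub>v u) \<eta>"
    unfolding cip_mult_left[OF A, symmetric, of \<xi> \<eta>, simplified] r1
    by (simp add: algebra_simps)
  have "cip \<xi> (mat_adjoint A *\<^sub>v \<eta> + g \<cdot>\<^sub>v (\<nu> + \<nu>') + Q *\<^sub>v \<zeta>) = cip \<xi> (C *\<^sub>v v)"
    by (simp only: r2)
  then have e2: "cip \<xi> (mat_adjoint A *\<^sub>v \<eta>) + g * (cip \<xi> \<nu> + cip \<xi> \<nu>') + cip \<xi> (Q *\<^sub>v \<zeta>) = cip \<xi> (C *\<^sub>v v)"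
    by (simp add: algebra_simps)
  have "cip u (mat_adjoint B *\<^sub>v \<eta> + mat_adjoint C *\<^sub>v \<zeta>) = cip u (R *\<^sub>v v)"
    by (simp only: r3)
  then have e3: "cip (B *\<^sub>v u) \<eta> + cip (C *\<^sub>v u) \<zeta> = cip u (R *\<^sub>v v)"
    by (simp add: cip_mult_left[OF B] cip_mult_left[OF C] cip_add_right[where n = m])
  have "popov \<xi> u \<zeta> v = - g * (cip \<xi> \<nu> + cip \<xi> \<nu>' + cip x \<eta> + cip x' \<eta>)"
  proof -
    have "cip \<xi> (Q *\<^sub>v \<zeta>) = cip \<xi> (C *\<^sub>v v) - (g * (cip x \<eta> + cip x' \<eta>) + cip (B *\<^sub>v u) \<eta>)
      - g * (cip \<xi> \<nu> + cip \<xi> \<nu>')"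
      unfolding e2[symmetric] a by simp
    then show ?thesis unfolding popov_def e3[symmetric] by (simp add: algebra_simps)
  qed
  also have "\<dots> = 2 * g * (cip x' \<nu>' - cip x \<nu>)"
    by (simp add: \<xi>_def \<eta>_def algebra_simps)
  finally show ?thesis by (simp add: \<xi>_def \<zeta>_def)
qed

lemma step_isometry:
  assumes z: "step \<mu> x \<mu>' x' u" and w: "step \<nu> y \<nu>' y' v"
  shows "cip x' \<nu>' - cip \<mu>' y' = cip x \<nu> - cip \<mu> y"
proof -
  have [simp]: "\<mu> \<in> carrier_vec n" "x \<in> carrier_vec n" "\<mu>' \<in> carrier_vec n" "x' \<in> carrier_vec n"
    "u \<in> carrier_vec m" "\<nu> \<in> carrier_vec n" "y \<in> carrier_vec n" "\<nu>' \<in> carrier_vec n"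
    "y' \<in> carrier_vec n" "v \<in> carrier_vec m"
    using z w by (auto simp: step_def)
  have "2 * g * (cip x' \<nu>' - cip x \<nu>) = cnj (2 * g * (cip y' \<mu>' - cip y \<mu>))"
    using step_energy[OF z w] step_energy[OF w z] popov_cnj[of "x - x'" u "y - y'" v] by simp
  also have "\<dots> = 2 * g * (cip \<mu>' y' - cip \<mu> y)" by (simp add: cip_cnj[of _ n])
  finally have "cip x' \<nu>' - cip x \<nu> = cip \<mu>' y' - cip \<mu> y" using \<gamma> by simp
  then show ?thesis by (simp add: algebra_simps)
qed

lemma hermitian_lyapunov:
  assumes "Y \<in> carrier_mat n n" "hermitian_mat Y"
  shows "hermitian_mat (mat_adjoint A * Y + Y * A + Q)"
proof -
  have [simp]: "mat_adjoint A * Y \<in> carrier_mat n n" "Y * A \<in> carrier_mat n n"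
    by (rule mult_carrier_mat[OF mat_adjoint_carrier[OF A] assms(1)], rule mult_carrier_mat[OF assms(1) A])
  have "mat_adjoint (mat_adjoint A * Y + Y * A + Q) = Y * A + mat_adjoint A * Y + Q"
    using assms(2) Q_herm
    by (simp add: mat_adjoint_add[of _ n n] mat_adjoint_mult[OF assms(1) A]
        mat_adjoint_mult[OF mat_adjoint_carrier[OF A] assms(1)] hermitian_mat_def)
  also have "Y * A + mat_adjoint A * Y = mat_adjoint A * Y + Y * A"
    by (rule comm_add_mat[of _ n n]) auto
  finally show ?thesis by (simp add: hermitian_mat_def carrier_matD[OF Q])
qed

lemma lure_data_shift:
  assumes Y: "Y \<in> carrier_mat n n" "hermitian_mat Y"
  shows "lure_data n m A B (Y * B + C) (mat_adjoint A * Y + Y * A + Q) R \<gamma>"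
proof
  show "hermitian_mat (mat_adjoint A * Y + Y * A + Q)"
    using Y by (rule hermitian_lyapunov)
qed (use Y R_herm \<gamma> in \<open>auto intro!: add_carrier_mat mult_carrier_mat[of _ n n]\<close>)

lemma adjoint_shift:
  assumes Y: "Y \<in> carrier_mat n n" "hermitian_mat Y"
  shows "mat_adjoint (Y * B + C) = mat_adjoint B * Y + mat_adjoint C"
  using Y(2) by (simp add: mat_adjoint_add[OF mult_carrier_mat[OF Y(1) B] C] mat_adjoint_mult[OF Y(1) B] hermitian_mat_def)

text \<open>Subtracting \<open>Y x\<close> from \<open>\<mu>\<close> is the congruence that replaces \<open>Q\<close> and \<open>C\<close> by the blocks of the
  linear matrix inequality.\<close>
lemma step_shift:
  assumes Y: "Y \<in> carrier_mat n n" "hermitian_mat Y" and z: "step \<mu> x \<mu>' x' u"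
  shows "lure_data.step n m A B (Y * B + C) (mat_adjoint A * Y + Y * A + Q) R \<gamma>
    (\<mu> - Y *\<^sub>v x) x (\<mu>' - Y *\<^sub>v x') x' u"
proof -
  have [simp]: "\<mu> \<in> carrier_vec n" "x \<in> carrier_vec n" "\<mu>' \<in> carrier_vec n" "x' \<in> carrier_vec n"
    "u \<in> carrier_vec m" using z by (auto simp: step_def)
  note [simp] = Y(1)
  define \<xi> where "\<xi> = x - x'"
  define \<sigma> where "\<sigma> = x + x'"
  define \<eta> where "\<eta> = \<mu> - \<mu>'"
  define \<tau> where "\<tau> = \<mu> + \<mu>'"
  have [simp]: "\<xi> \<in> carrier_vec n" "\<eta> \<in> carrier_vec n" "\<sigma> \<in> carrier_vec n" "\<tau> \<in> carrier_vec n"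
    by (auto simp: \<xi>_def \<eta>_def \<sigma>_def \<tau>_def)
  have [simp]: "dim_vec \<mu> = n" "dim_vec x = n" "dim_vec \<mu>' = n" "dim_vec x' = n"
    "dim_vec \<xi> = n" "dim_vec \<eta> = n" "dim_vec \<sigma> = n" "dim_vec \<tau> = n"
    by (simp_all add: carrier_vecD)
  have [simp]: "dim_row Y = n" "dim_row A = n" "dim_col A = n" "dim_row Q = n" "dim_row B = n" "dim_row C = n"
     "dim_row R = m" "dim_col B = m" "dim_col C = m"
    by (simp_all add: carrier_matD[OF Y(1)] carrier_matD[OF A] carrier_matD[OF B] carrier_matD[OF C]
      carrier_matD[OF Q] carrier_matD[OF R])
  have [simp]: "Y *\<^sub>v w \<in> carrier_vec n" if "w \<in> carrier_vec n" for w
    using Y(1) that by (rule mult_mat_vec_carrier)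
  have r1: "A *\<^sub>v \<xi> = g \<cdot>\<^sub>v \<sigma> + B *\<^sub>v u"
    and r2: "mat_adjoint A *\<^sub>v \<eta> + g \<cdot>\<^sub>v \<tau> + Q *\<^sub>v \<xi> = C *\<^sub>v u"
    and r3: "mat_adjoint B *\<^sub>v \<eta> + mat_adjoint C *\<^sub>v \<xi> = R *\<^sub>v u"
    using z by (auto simp: step_def \<xi>_def \<eta>_def \<sigma>_def \<tau>_def)
  have d: "(\<mu> - Y *\<^sub>v x) - (\<mu>' - Y *\<^sub>v x') = \<eta> - Y *\<^sub>v \<xi>"
    unfolding \<xi>_def \<eta>_def by (subst mult_minus_distrib_mat_vec[of Y n n]) (auto intro!: eq_vecI)
  have s: "(\<mu> - Y *\<^sub>v x) + (\<mu>' - Y *\<^sub>v x') = \<tau> - Y *\<^sub>v \<sigma>"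
    unfolding \<tau>_def \<sigma>_def by (subst mult_add_distrib_mat_vec[of Y n n]) (auto intro!: eq_vecI)
  \<comment> \<open>\<open>Y\<close> times the first row is what the second row gains from the term
    \<open>Y * A\<close>; it cancels \<open>g\<close> times \<open>Y \<sigma>\<close> and leaves
    \<open>Y * B\<close> on the right-hand side.\<close>
  have Yr1: "Y *\<^sub>v (A *\<^sub>v \<xi>) = g \<cdot>\<^sub>v (Y *\<^sub>v \<sigma>) + Y *\<^sub>v (B *\<^sub>v u)"
    unfolding r1 by (simp add: mult_add_distrib_mat_vec[of Y n n] mult_mat_vec[of Y n n])
  have m1: "(mat_adjoint A * Y + Y * A + Q) *\<^sub>v \<xi> = mat_adjoint A *\<^sub>v (Y *\<^sub>v \<xi>) + Y *\<^sub>v (A *\<^sub>v \<xi>) + Q *\<^sub>v \<xi>"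
    by (simp add: add_mult_distrib_mat_vec[of _ n n] mult_carrier_mat[OF mat_adjoint_carrier[OF A] Y(1)]
        mult_carrier_mat[OF Y(1) A] assoc_mult_mat_vec[OF mat_adjoint_carrier[OF A] Y(1)]
        assoc_mult_mat_vec[OF Y(1) A])
  have m2: "(Y * B + C) *\<^sub>v u = Y *\<^sub>v (B *\<^sub>v u) + C *\<^sub>v u"
    by (simp add: add_mult_distrib_mat_vec[of _ n m] mult_carrier_mat[OF Y(1) B] assoc_mult_mat_vec[OF Y(1) B])
  note adj = adjoint_shift[OF Y]
  have m3: "mat_adjoint (Y * B + C) *\<^sub>v \<xi> = mat_adjoint B *\<^sub>v (Y *\<^sub>v \<xi>) + mat_adjoint C *\<^sub>v \<xi>"
    unfolding adj by (simp add: add_mult_distrib_mat_vec[of _ m n] mult_carrier_mat[of _ m n _ n]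
        assoc_mult_mat_vec[OF mat_adjoint_carrier[OF B] Y(1)])
  have t1: "mat_adjoint A *\<^sub>v (\<eta> - Y *\<^sub>v \<xi>) + g \<cdot>\<^sub>v (\<tau> - Y *\<^sub>v \<sigma>) + (mat_adjoint A * Y + Y * A + Q) *\<^sub>v \<xi>
    = (Y * B + C) *\<^sub>v u"
    unfolding m1 m2 r2[symmetric] Yr1
    by (subst mult_minus_distrib_mat_vec[of _ n n]; simp?) (intro eq_vecI; simp add: algebra_simps)
  have t2: "mat_adjoint B *\<^sub>v (\<eta> - Y *\<^sub>v \<xi>) + mat_adjoint (Y * B + C) *\<^sub>v \<xi> = R *\<^sub>v u"
    unfolding m3 r3[symmetric]
    by (subst mult_minus_distrib_mat_vec[of _ m n]; simp?) (intro eq_vecI; simp)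
  interpret Y: lure_data n m A B "Y * B + C" "mat_adjoint A * Y + Y * A + Q" R \<gamma>
    using Y by (rule lure_data_shift)
  show ?thesis unfolding Y.step_def d s
    using r1 t1 t2 by (simp add: \<xi>_def \<sigma>_def)
qed

end

section \<open>Dissipation and stabilizability for a semidefinite Popov matrix\<close>

locale lure_psd = lure_data +
  assumes psd: "psd_mat (four_block_mat Q C (mat_adjoint C) R)" and stab: "stabilizable n A B"
begin

lemma popov_block:
  assumes [simp]: "\<xi> \<in> carrier_vec n" "u \<in> carrier_vec m"
  defines "M \<equiv> four_block_mat Q C (mat_adjoint C) R"
  shows "M *\<^sub>v (\<xi> @\<^sub>v - u) = (Q *\<^sub>v \<xi> - C *\<^sub>v u) @\<^sub>v (mat_adjoint C *\<^sub>v \<xi> - R *\<^sub>v u)"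
    and "popov \<xi> u \<xi> u = cip (\<xi> @\<^sub>v - u) (M *\<^sub>v (\<xi> @\<^sub>v - u))"
proof -
  have neg: "- u = (-1) \<cdot>\<^sub>v u" by (intro eq_vecI) auto
  have "M *\<^sub>v (\<xi> @\<^sub>v - u) = (Q *\<^sub>v \<xi> + C *\<^sub>v (- u)) @\<^sub>v (mat_adjoint C *\<^sub>v \<xi> + R *\<^sub>v (- u))"
    unfolding M_def by (rule four_block_mat_mult_vec[of _ n n _ m _ m]) auto
  moreover have "C *\<^sub>v (- u) = - (C *\<^sub>v u)" "R *\<^sub>v (- u) = - (R *\<^sub>v u)"
    by (simp_all add: neg mult_mat_vec[OF C] mult_mat_vec[OF R], (intro eq_vecI; simp)+)
  ultimately show eq: "M *\<^sub>v (\<xi> @\<^sub>v - u) = (Q *\<^sub>v \<xi> - C *\<^sub>v u) @\<^sub>v (mat_adjoint C *\<^sub>v \<xi> - R *\<^sub>v u)"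
    by (simp add: minus_add_uminus_vec[of _ n] minus_add_uminus_vec[of _ m])
  show "popov \<xi> u \<xi> u = cip (\<xi> @\<^sub>v - u) (M *\<^sub>v (\<xi> @\<^sub>v - u))"
    unfolding eq popov_def
    by (simp add: cip_append[where n = n and m = m] cip_minus_right[where n = n] cip_minus_right[where n = m]
        cip_uminus_left[where n = m] cip_mult_left[OF C])
qed

lemma popov_nonneg:
  assumes "\<xi> \<in> carrier_vec n" "u \<in> carrier_vec m"
  shows "0 \<le> Re (popov \<xi> u \<xi> u)"
proof -
  let ?M = "four_block_mat Q C (mat_adjoint C) R"
  have "?M \<in> carrier_mat (n + m) (n + m)" by auto
  moreover have "\<xi> @\<^sub>v - u \<in> carrier_vec (n + m)" using assms by simp
  ultimately have "0 \<le> conjugate (\<xi> @\<^sub>v - u) \<bullet> (?M *\<^sub>v (\<xi> @\<^sub>v - u))"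
    using psd unfolding psd_mat_def by (metis carrier_matD(1))
  then show ?thesis unfolding popov_block(2)[OF assms] by (simp add: cip_def less_eq_complex_def)
qed

text \<open>The right-hand side of the energy identity is nonnegative. In the application the data
  are shifted and \<open>\<mu>\<close> stands for \<open>X x - Y x\<close>, so the monotone quantity
  is the gap between two candidate solutions at \<open>x\<close>.\<close>

lemma step_mono:
  assumes "step \<mu> x \<mu>' x' u"
  shows "Re (cip x \<mu>) \<le> Re (cip x' \<mu>')"
proof -
  have "0 \<le> Re (popov (x - x') u (x - x') u)"
    using assms by (intro popov_nonneg) (auto simp: step_def)
  also have "\<dots> = 2 * \<gamma> * (Re (cip x' \<mu>') - Re (cip x \<mu>))"
    by (simp flip: step_energy[OF assms assms])
  finally show ?thesis using \<gamma> by (simp add: zero_le_mult_iff)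
qed

text \<open>Without gain of energy, \<open>(x - x', -u)\<close> lies in the kernel of the
  semidefinite matrix. This cancels every term with \<open>x - x'\<close> and \<open>u\<close> from
  the last two rows of the step, and homogeneous equations for \<open>\<mu>\<close> and
  \<open>\<mu>'\<close> remain.\<close>

lemma step_equality:
  assumes st: "step \<mu> x \<mu>' x' u" and eq: "cip x' \<mu>' = cip x \<mu>"
  shows "mat_adjoint A *\<^sub>v (\<mu> - \<mu>') + g \<cdot>\<^sub>v (\<mu> + \<mu>') = 0\<^sub>v n" "mat_adjoint B *\<^sub>v (\<mu> - \<mu>') = 0\<^sub>v m"
proof -
  have [simp]: "\<mu> \<in> carrier_vec n" "x \<in> carrier_vec n" "\<mu>' \<in> carrier_vec n" "x' \<in> carrier_vec n"
    "u \<in> carrier_vec m" using st by (auto simp: step_def)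
  define p where "p = (x - x') @\<^sub>v - u"
  let ?M = "four_block_mat Q C (mat_adjoint C) R"
  have M: "?M \<in> carrier_mat (n + m) (n + m)" by auto
  have "cip p (?M *\<^sub>v p) = 0"
    using step_energy[OF st st] eq popov_block(2)[of "x - x'" u] by (simp add: p_def)
  then have "?M *\<^sub>v p = 0\<^sub>v (n + m)"
    by (intro psd_mat_kernel[OF psd M]) (auto simp: p_def)
  then have "(Q *\<^sub>v (x - x') - C *\<^sub>v u) @\<^sub>v (mat_adjoint C *\<^sub>v (x - x') - R *\<^sub>v u) = 0\<^sub>v (n + m)"
    unfolding p_def by (subst (asm) popov_block(1)) auto
  then have "Q *\<^sub>v (x - x') - C *\<^sub>v u = 0\<^sub>v n" "mat_adjoint C *\<^sub>v (x - x') - R *\<^sub>v u = 0\<^sub>v m"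
    using append_vec_eq_zero_iff[of "Q *\<^sub>v (x - x') - C *\<^sub>v u" n "mat_adjoint C *\<^sub>v (x - x') - R *\<^sub>v u" m]
    by simp_all
  then have Qx: "Q *\<^sub>v (x - x') = C *\<^sub>v u" and Cx: "mat_adjoint C *\<^sub>v (x - x') = R *\<^sub>v u"
    by (auto dest!: vec_minus_eq_0_iff[THEN iffD1, rotated 2])
  have "mat_adjoint A *\<^sub>v (\<mu> - \<mu>') + g \<cdot>\<^sub>v (\<mu> + \<mu>') + C *\<^sub>v u = C *\<^sub>v u"
    "mat_adjoint B *\<^sub>v (\<mu> - \<mu>') + R *\<^sub>v u = R *\<^sub>v u"
    using st unfolding step_def Qx Cx by blast+
  then show "mat_adjoint A *\<^sub>v (\<mu> - \<mu>') + g \<cdot>\<^sub>v (\<mu> + \<mu>') = 0\<^sub>v n" "mat_adjoint B *\<^sub>v (\<mu> - \<mu>') = 0\<^sub>v m"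
    by (auto dest!: vec_add_eq_self_iff[THEN iffD1, rotated 2])
qed

text \<open>The Hautus argument: full row rank at \<open>cnj \<kappa>\<close> writes
  \<open>\<mu>\<close> as a combination of the columns of \<open>[cnj \<kappa> I - A, B]\<close>,
  all of which are orthogonal to \<open>\<mu>\<close>.\<close>

lemma stabilizable_left_kernel:
  assumes \<mu>: "\<mu> \<in> carrier_vec n" and "mat_adjoint A *\<^sub>v \<mu> = \<kappa> \<cdot>\<^sub>v \<mu>" "mat_adjoint B *\<^sub>v \<mu> = 0\<^sub>v m"
    and \<kappa>: "Re \<kappa> \<ge> 0"
  shows "\<mu> = 0\<^sub>v n"
proof -
  let ?S = "cnj \<kappa> \<cdot>\<^sub>m 1\<^sub>m n - A"
  have S: "?S \<in> carrier_mat n n" by (rule minus_carrier_mat) simp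
  have "vec_space.rank n (?S @\<^sub>c B) = n" using stab \<kappa> by (simp add: stabilizable_def)
  from vec_space.full_row_rank_imp_surjective[OF append_cols_carrier[OF S B] this \<mu>]
  obtain v where v: "v \<in> carrier_vec (n + m)" "(?S @\<^sub>c B) *\<^sub>v v = \<mu>" by auto
  from v(1) obtain p q where pq [simp]: "p \<in> carrier_vec n" "q \<in> carrier_vec m" and "v = p @\<^sub>v q"
    by (rule split2_vec)
  with v(2) have "\<mu> = ?S *\<^sub>v p + B *\<^sub>v q" using append_cols_mult_vec[OF S B pq] by simp
  also have "?S *\<^sub>v p = cnj \<kappa> \<cdot>\<^sub>v p - A *\<^sub>v p"
    by (subst minus_mult_distrib_mat_vec[of _ n n]) (auto simp: smult_mat_mult_vec[of _ n n])
  finally have mu: "\<mu> = cnj \<kappa> \<cdot>\<^sub>v p - A *\<^sub>v p + B *\<^sub>v q" .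
  have "cip \<mu> \<mu> = cip (cnj \<kappa> \<cdot>\<^sub>v p - A *\<^sub>v p + B *\<^sub>v q) \<mu>" using mu by simp
  also have "\<dots> = \<kappa> * cip p \<mu> - cip p (mat_adjoint A *\<^sub>v \<mu>) + cip q (mat_adjoint B *\<^sub>v \<mu>)"
    using \<mu> by (simp add: cip_mult_left[OF A] cip_mult_left[OF B] cip_add_left[where n = n]
        cip_minus_left[where n = n] cip_smult_left[where n = n])
  also have "\<dots> = 0" unfolding assms using \<mu> by (simp add: cip_smult_right[where n = n])
  finally show ?thesis using cip_self_eq_0[OF \<mu>] by simp
qed

text \<open>The only place where stabilizability enters; \<open>s\<close> corresponds to a point of the closed right half-plane.\<close>
lemma step_unimodular:
  assumes st: "step \<mu> x (s \<cdot>\<^sub>v \<mu>) (s \<cdot>\<^sub>v x + x\<^sub>0) u" and s: "cmod s = 1"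
    and x0: "x\<^sub>0 \<in> carrier_vec n" "cip x\<^sub>0 \<mu> = 0"
  shows "\<mu> = 0\<^sub>v n"
proof -
  have [simp]: "\<mu> \<in> carrier_vec n" "x \<in> carrier_vec n" using st by (auto simp: step_def)
  have ss: "cnj s * s = 1" using s by (metis complex_norm_square mult.commute of_real_1 one_power2)
  \<comment> \<open>Unimodularity of \<open>s\<close> and orthogonality of \<open>x\<^sub>0\<close>
    to \<open>\<mu>\<close> keep the energy constant, so \<open>step_equality\<close>
    applies.\<close>
  have "cip (s \<cdot>\<^sub>v x + x\<^sub>0) (s \<cdot>\<^sub>v \<mu>) = cip x \<mu>"
    using x0 ss by (simp add: cip_add_left[where n = n] cip_smult_left[where n = n] cip_smult_right[where n = n])
      (simp add: mult.assoc[symmetric] mult.commute)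
  note eq = step_equality[OF st this]
  have d: "\<mu> - s \<cdot>\<^sub>v \<mu> = (1 - s) \<cdot>\<^sub>v \<mu>" "\<mu> + s \<cdot>\<^sub>v \<mu> = (1 + s) \<cdot>\<^sub>v \<mu>"
    by (intro eq_vecI; simp add: algebra_simps)+
  have eq1: "(1 - s) \<cdot>\<^sub>v (mat_adjoint A *\<^sub>v \<mu>) + (g * (1 + s)) \<cdot>\<^sub>v \<mu> = 0\<^sub>v n"
    and eq2: "(1 - s) \<cdot>\<^sub>v (mat_adjoint B *\<^sub>v \<mu>) = 0\<^sub>v m"
    using eq unfolding d
    by (simp_all add: mult_mat_vec[of _ n n] mult_mat_vec[of _ m n] smult_smult_assoc)
  show ?thesis
  proof (cases "s = 1")
    \<comment> \<open>\<open>s = 1\<close> corresponds to the point at infinity; the first equation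
      then reads \<open>2 * g * \<mu> = 0\<close>.\<close>
    case True
    have "0 \<cdot>\<^sub>v (mat_adjoint A *\<^sub>v \<mu>) = 0\<^sub>v n"
      using smult_vec_eq_0_iff[of "mat_adjoint A *\<^sub>v \<mu>" n 0] by simp
    with True have "(2 * g) \<cdot>\<^sub>v \<mu> = 0\<^sub>v n"
      using eq1 by (simp add: mult.commute)
    then show ?thesis using \<gamma> by (simp add: smult_vec_eq_0_iff[of _ n] smult_vec_eq_0_iff[of _ m])
  next
    case False
    \<comment> \<open>The inverse Cayley transform of \<open>s\<close>, up to sign. It is imaginary
      because \<open>(1 + s) * (1 - cnj s) = s - cnj s\<close> for unimodular
      \<open>s\<close>.\<close>
    define \<kappa> where "\<kappa> = - g * (1 + s) / (1 - s)"
    have "mat_adjoint A *\<^sub>v \<mu> = \<kappa> \<cdot>\<^sub>v \<mu>"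
    proof (rule eq_vecI)
      fix i assume "i < dim_vec (\<kappa> \<cdot>\<^sub>v \<mu>)"
      then have "i < n" by (simp add: carrier_vecD[of \<mu> n])
      with arg_cong[OF eq1, of "\<lambda>v. v $ i"] have "(1 - s) * (mat_adjoint A *\<^sub>v \<mu>) $ i + g * (1 + s) * \<mu> $ i = 0"
        by (simp add: carrier_vecD[of \<mu> n] carrier_matD[OF A] del: index_mult_mat_vec)
      then have "(1 - s) * (mat_adjoint A *\<^sub>v \<mu>) $ i = (1 - s) * (\<kappa> * \<mu> $ i)"
        using False by (simp add: \<kappa>_def add_eq_0_iff del: index_mult_mat_vec)
      then have "(mat_adjoint A *\<^sub>v \<mu>) $ i = \<kappa> * \<mu> $ i" using False by simp
      with \<open>i < n\<close> show "(mat_adjoint A *\<^sub>v \<mu>) $ i = (\<kappa> \<cdot>\<^sub>v \<mu>) $ i"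
        by (simp add: carrier_vecD[of \<mu> n])
    qed (simp_all add: carrier_vecD[of \<mu> n] carrier_matD[OF A])
    moreover have "mat_adjoint B *\<^sub>v \<mu> = 0\<^sub>v m"
      using eq2 False by (simp add: smult_vec_eq_0_iff[of _ n] smult_vec_eq_0_iff[of _ m])
    moreover have "Re \<kappa> = 0"
    proof -
      have "\<kappa> = - g * ((1 + s) * (1 - cnj s)) / ((1 - s) * (1 - cnj s))"
        using False by (simp add: \<kappa>_def)
      also have "(1 + s) * (1 - cnj s) = s - cnj s" using ss by (simp add: algebra_simps)
      also have "(1 - s) * (1 - cnj s) = complex_of_real ((cmod (1 - s))\<^sup>2)"
        by (simp only: complex_norm_square complex_cnj_diff complex_cnj_one)
      finally show ?thesis by (simp add: Re_divide_of_real)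
    qed
    ultimately show ?thesis by (intro stabilizable_left_kernel[of _ \<kappa>]) auto
  qed
qed

end

section \<open>Chains of isometric pencils\<close>

fun chain_pred :: "nat \<Rightarrow> (nat \<Rightarrow> complex vec) \<Rightarrow> nat \<Rightarrow> complex vec" where
  "chain_pred N v 0 = 0\<^sub>v N"
| "chain_pred N v (Suc i) = v i"

text \<open>Both cases relate pairs by \<open>A z = E z'\<close>: from \<open>v i\<close> to
  \<open>z v i\<close> plus its predecessor or, at \<open>Infinity\<close>, from the predecessor to
  \<open>v i\<close>. Chain vectors may vanish or be dependent, so linear images of chains are
  chains again.\<close>

definition pencil_chain ::
  "nat \<Rightarrow> complex mat \<Rightarrow> complex mat \<Rightarrow> pencil_ev \<Rightarrow> nat \<Rightarrow> (nat \<Rightarrow> complex vec) \<Rightarrow> bool" where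
  "pencil_chain N E A ev k v \<longleftrightarrow> (\<forall>i<k. v i \<in> carrier_vec N \<and>
     (case ev of
        Finite z \<Rightarrow> A *\<^sub>v v i = E *\<^sub>v (z \<cdot>\<^sub>v v i + chain_pred N v i)
      | Infinity \<Rightarrow> E *\<^sub>v v i = A *\<^sub>v chain_pred N v i))"

lemma pencil_chain_carrier: "pencil_chain N E A ev k v \<Longrightarrow> i < k \<Longrightarrow> v i \<in> carrier_vec N"
  by (simp add: pencil_chain_def)

lemma pencil_chain_pred_carrier: "pencil_chain N E A ev k v \<Longrightarrow> i < k \<Longrightarrow> chain_pred N v i \<in> carrier_vec N"
  by (cases i) (auto simp: pencil_chain_def)

text \<open>Fails exactly for mirror images in the unit circle, where \<open>0\<close> and
  \<open>Infinity\<close> mirror each other.\<close>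

fun nonresonant :: "pencil_ev \<Rightarrow> pencil_ev \<Rightarrow> bool" where
  "nonresonant (Finite z) (Finite y) \<longleftrightarrow> cnj z * y \<noteq> 1"
| "nonresonant (Finite z) Infinity \<longleftrightarrow> z \<noteq> 0"
| "nonresonant Infinity (Finite y) \<longleftrightarrow> y \<noteq> 0"
| "nonresonant Infinity Infinity \<longleftrightarrow> True"

lemma pencil_ev_trichotomy:
  "d_stable ev \<or> d_critical ev \<or> d_unstable ev"
  "\<not> (d_stable ev \<and> d_critical ev)" "\<not> (d_stable ev \<and> d_unstable ev)" "\<not> (d_critical ev \<and> d_unstable ev)"
  by (cases ev; auto)+

lemma nonresonant_outer:
  assumes "d_unstable a" "d_unstable b \<or> d_critical b"
  shows "nonresonant a b" "nonresonant b a"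
proof -
  have *: "cnj z * y \<noteq> 1" "cnj y * z \<noteq> 1" if "cmod z > 1" "cmod y \<ge> 1" for z y
  proof -
    have "cmod (cnj z * y) > 1" "cmod (cnj y * z) > 1"
      using that by (simp_all add: norm_mult) (metis less_le_trans mult_le_cancel_left1 mult_le_cancel_right1 not_less order.strict_implies_order zero_less_one less_trans)+
    then show "cnj z * y \<noteq> 1" "cnj y * z \<noteq> 1" by (metis norm_one less_irrefl)+
  qed
  show "nonresonant a b" "nonresonant b a"
    using assms by (cases a; cases b; auto simp: * dest: *)+
qed

lemma nonresonant_inner:
  assumes "d_stable a" "d_stable b \<or> d_critical b"
  shows "nonresonant a b" "nonresonant b a"
proof -
  have *: "cnj z * y \<noteq> 1" "cnj y * z \<noteq> 1" if "cmod z < 1" "cmod y \<le> 1" for z y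
  proof -
    have "cmod z * cmod y < 1"
      using that mult_left_mono[of "cmod y" 1 "cmod z"] by auto
    then have "cmod (cnj z * y) < 1" "cmod (cnj y * z) < 1"
      by (simp_all add: norm_mult mult.commute)
    then show "cnj z * y \<noteq> 1" "cnj y * z \<noteq> 1" by (metis norm_one less_irrefl)+
  qed
  show "nonresonant a b" "nonresonant b a"
    using assms by (cases a; cases b; auto simp: * dest: *)+
qed

text \<open>Once the perturbation is below \<open>d\<close>, the bound \<open>e / 2\<close> is
  invariant under the recursion, and the part due to the starting value decays
  geometrically.\<close>

lemma contracting_recursion_tendsto_0:
  fixes a b :: "nat \<Rightarrow> complex"
  assumes rec: "\<And>t. a (Suc t) = r * (a t - b (Suc t))" and b: "b \<longlonglongrightarrow> 0" and r: "cmod r < 1"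
  shows "a \<longlonglongrightarrow> 0"
proof (rule LIMSEQ_I)
  fix e :: real assume e: "e > 0"
  \<comment> \<open>Chosen so that \<open>cmod r * (e / 2 + d) \<le> e / 2\<close>.\<close>
  define d where "d = e * (1 - cmod r) / 2"
  have "d > 0" using e r by (simp add: d_def)
  then obtain T where T: "\<And>t. t \<ge> T \<Longrightarrow> cmod (b t) < d" using LIMSEQ_D[OF b] by auto
  have bd: "cmod (a (T + t)) \<le> cmod r ^ t * cmod (a T) + e / 2" for t
  proof (induction t)
    case (Suc t)
    have "cmod (a (T + Suc t)) = cmod r * cmod (a (T + t) - b (Suc (T + t)))"
      by (simp add: rec norm_mult)
    also have "\<dots> \<le> cmod r * (cmod (a (T + t)) + d)"
      using norm_triangle_ineq4[of "a (T + t)" "b (Suc (T + t))"] T[of "Suc (T + t)"]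
      by (intro mult_left_mono) auto
    also have "\<dots> \<le> cmod r * (cmod r ^ t * cmod (a T) + e / 2 + d)"
      using Suc by (intro mult_left_mono) auto
    also have "\<dots> = cmod r ^ Suc t * cmod (a T) + cmod r * (e / 2 + d)" by (simp add: algebra_simps)
    also have "cmod r * (e / 2 + d) = e / 2 - (1 - cmod r)\<^sup>2 * e / 2"
      unfolding d_def by (simp add: field_simps power2_eq_square)
    also have "\<dots> \<le> e / 2" using e by simp
    finally show ?case by simp
  qed (use e in simp)
  have "(\<lambda>t. cmod r ^ t * cmod (a T)) \<longlonglongrightarrow> 0"
    using r by (intro tendsto_mult_left_zero LIMSEQ_power_zero) auto
  then obtain S where S: "\<And>t. t \<ge> S \<Longrightarrow> cmod r ^ t * cmod (a T) < e / 2"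
    using e LIMSEQ_D[of _ 0 "e / 2"] by force
  have "cmod (a t) < e" if "t \<ge> T + S" for t
  proof -
    from that have "t = T + (t - T)" "t - T \<ge> S" by auto
    then show ?thesis using bd[of "t - T"] S[of "t - T"] by simp
  qed
  then show "\<exists>no. \<forall>t\<ge>no. norm (a t - 0) < e" by auto
qed

locale isometric_pencil =
  fixes n :: nat and E A :: "complex mat"
  assumes E: "E \<in> carrier_mat (2 * n) (2 * n)" and A: "A \<in> carrier_mat (2 * n) (2 * n)"
    and isometry: "\<And>z z' w w'. \<lbrakk>z \<in> carrier_vec (2 * n); z' \<in> carrier_vec (2 * n);
      w \<in> carrier_vec (2 * n); w' \<in> carrier_vec (2 * n);
      A *\<^sub>v z = E *\<^sub>v z'; A *\<^sub>v w = E *\<^sub>v w'\<rbrakk> \<Longrightarrow> hform n z' w' = hform n z w"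
begin

abbreviation "chain \<equiv> pencil_chain (2 * n) E A"

text \<open>The index runs against the relation: each \<open>p (Suc t)\<close> is a predecessor of
  \<open>p t\<close>. Unstable directions decay this way; membership in \<open>L\<close> will keep
  the orbit on the graph \<open>\<mu> = X x\<close>.\<close>

definition backward_orbit :: "complex vec set \<Rightarrow> (nat \<Rightarrow> complex vec) \<Rightarrow> bool" where
  "backward_orbit L p \<longleftrightarrow> (\<forall>t. p t \<in> L \<and> A *\<^sub>v p (Suc t) = E *\<^sub>v p t) \<and>
     (\<forall>c<2 * n. (\<lambda>t. p t $ c) \<longlonglongrightarrow> 0)"

text \<open>Isometry applied at \<open>(i, j)\<close> involves, besides that pair itself, only pairs
  with smaller \<open>i + j\<close>. What remains is \<open>cnj z * y - 1\<close> times the form, or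
  its analogue at \<open>Infinity\<close>.\<close>

lemma chain_orthogonal:
  assumes v: "chain a k v" and w: "chain b l w" and ab: "nonresonant a b"
  shows "i < k \<Longrightarrow> j < l \<Longrightarrow> hform n (v i) (w j) = 0"
proof (induction "i + j" arbitrary: i j rule: less_induct)
  case less
  define p where "p = chain_pred (2 * n) v i"
  define q where "q = chain_pred (2 * n) w j"
  have c [simp]: "v i \<in> carrier_vec (2 * n)" "w j \<in> carrier_vec (2 * n)"
    "p \<in> carrier_vec (2 * n)" "q \<in> carrier_vec (2 * n)"
    using v w less.prems by (auto simp: p_def q_def intro: pencil_chain_carrier pencil_chain_pred_carrier)
  have [simp]: "hform n p (w j) = 0"
    unfolding p_def using less.hyps[of "i - 1" j] less.prems by (cases i) auto
  have [simp]: "hform n (v i) q = 0"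
    unfolding q_def using less.hyps[of i "j - 1"] less.prems by (cases j) auto
  have [simp]: "hform n p q = 0"
    unfolding p_def q_def using less.hyps[of "i - 1" "j - 1"] less.prems c(1,2) pencil_chain_carrier[OF v] pencil_chain_carrier[OF w]
    by (cases i; cases j) auto
  have sv: "A *\<^sub>v v i = E *\<^sub>v (z \<cdot>\<^sub>v v i + p)" if "a = Finite z" for z
    using v less.prems that by (simp add: pencil_chain_def p_def)
  have sw: "A *\<^sub>v w j = E *\<^sub>v (z \<cdot>\<^sub>v w j + q)" if "b = Finite z" for z
    using w less.prems that by (simp add: pencil_chain_def q_def)
  have iv: "A *\<^sub>v p = E *\<^sub>v v i" if "a = Infinity"
    using v less.prems that by (simp add: pencil_chain_def p_def)
  have iw: "A *\<^sub>v q = E *\<^sub>v w j" if "b = Infinity"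
    using w less.prems that by (simp add: pencil_chain_def q_def)
  show ?case
  proof (cases a; cases b)
    fix z y assume ab': "a = Finite z" "b = Finite y"
    have "hform n (z \<cdot>\<^sub>v v i + p) (y \<cdot>\<^sub>v w j + q) = hform n (v i) (w j)"
      by (rule isometry[OF _ _ _ _ sv[OF ab'(1)] sw[OF ab'(2)]]) auto
    then have "(cnj z * y - 1) * hform n (v i) (w j) = 0"
      by (subst (asm) hform_combination) (simp_all add: left_diff_distrib)
    then show ?thesis using ab ab' by simp
  next
    fix z assume ab': "a = Finite z" "b = Infinity"
    have "hform n (z \<cdot>\<^sub>v v i + p) (w j) = hform n (v i) q"
      by (rule isometry[OF _ _ _ _ sv[OF ab'(1)] iw[OF ab'(2)]]) auto
    then show ?thesis using ab ab' by simp
  next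
    fix y assume ab': "a = Infinity" "b = Finite y"
    have "hform n (v i) (y \<cdot>\<^sub>v w j + q) = hform n p (w j)"
      by (rule isometry[OF _ _ _ _ iv[OF ab'(1)] sw[OF ab'(2)]]) auto
    then show ?thesis using ab ab' by simp
  next
    assume ab': "a = Infinity" "b = Infinity"
    have "hform n (v i) (w j) = hform n p q"
      by (rule isometry[OF _ _ _ _ iv[OF ab'(1)] iw[OF ab'(2)]]) auto
    then show ?thesis by simp
  qed
qed

text \<open>For unimodular \<open>s\<close> the terms at the two top vectors cancel in the isometry
  at \<open>(i + 1, j)\<close>, and the value at \<open>(i, j)\<close> is expressed by values at
  smaller \<open>j\<close>. This uses the vector after \<open>v i\<close>, whence
  \<open>i + j + 2 \<le> k\<close>.\<close>

lemma critical_chain_neutral: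
  assumes v: "chain (Finite s) k v" and s: "cmod s = 1"
  shows "i + j + 2 \<le> k \<Longrightarrow> hform n (v i) (v j) = 0"
proof (induction j arbitrary: i)
  case (0 i)
  have c [simp]: "v i \<in> carrier_vec (2 * n)" "v (Suc i) \<in> carrier_vec (2 * n)" "v 0 \<in> carrier_vec (2 * n)"
    using 0 by (auto intro: pencil_chain_carrier[OF v])
  have ss: "cnj s * s = 1" using s by (metis complex_norm_square mult.commute of_real_1 one_power2)
  have "A *\<^sub>v v (Suc i) = E *\<^sub>v (s \<cdot>\<^sub>v v (Suc i) + v i)" "A *\<^sub>v v 0 = E *\<^sub>v (s \<cdot>\<^sub>v v 0 + 0\<^sub>v (2 * n))"
    using v[unfolded pencil_chain_def, rule_format, of "Suc i"] v[unfolded pencil_chain_def, rule_format, of 0] 0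
    by auto
  then have "hform n (s \<cdot>\<^sub>v v (Suc i) + v i) (s \<cdot>\<^sub>v v 0 + 0\<^sub>v (2 * n)) = hform n (v (Suc i)) (v 0)"
    by (intro isometry) auto
  then have "s * hform n (v i) (v 0) = 0" by (subst (asm) hform_combination) (simp_all add: ss)
  then show ?case using s by auto
next
  case (Suc j i)
  have c [simp]: "v i \<in> carrier_vec (2 * n)" "v (Suc i) \<in> carrier_vec (2 * n)" "v j \<in> carrier_vec (2 * n)"
     "v (Suc j) \<in> carrier_vec (2 * n)"
    using Suc.prems by (auto intro: pencil_chain_carrier[OF v])
  have ss: "cnj s * s = 1" using s by (metis complex_norm_square mult.commute of_real_1 one_power2)
  have "A *\<^sub>v v (Suc i) = E *\<^sub>v (s \<cdot>\<^sub>v v (Suc i) + v i)" "A *\<^sub>v v (Suc j) = E *\<^sub>v (s \<cdot>\<^sub>v v (Suc j) + v j)"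
    using v[unfolded pencil_chain_def, rule_format, of "Suc i"] v[unfolded pencil_chain_def, rule_format, of "Suc j"] Suc.prems
    by auto
  then have "hform n (s \<cdot>\<^sub>v v (Suc i) + v i) (s \<cdot>\<^sub>v v (Suc j) + v j) = hform n (v (Suc i)) (v (Suc j))"
    by (intro isometry) auto
  moreover have "hform n (v (Suc i)) (v j) = 0" "hform n (v i) (v j) = 0"
    using Suc.prems by (auto intro!: Suc.IH)
  ultimately have "s * hform n (v i) (v (Suc j)) = 0" by (subst (asm) hform_combination) (simp_all add: ss)
  then show ?case using s by auto
qed

text \<open>Induction along the chain: an orbit of \<open>v i\<close> is built from an orbit
  \<open>b\<close> of its predecessor, starting from the zero orbit.\<close>

lemma unstable_chain_decay:
  assumes L0: "0\<^sub>v (2 * n) \<in> L" and Lminus: "\<And>z w. z \<in> L \<Longrightarrow> w \<in> L \<Longrightarrow> z - w \<in> L"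
    and Lsmult: "\<And>c z. z \<in> L \<Longrightarrow> c \<cdot>\<^sub>v z \<in> L" and Lc: "L \<subseteq> carrier_vec (2 * n)"
    and v: "chain a k v" and a: "d_unstable a" and vL: "\<And>i. i < k \<Longrightarrow> v i \<in> L"
  shows "i < k \<Longrightarrow> \<exists>p. p 0 = v i \<and> backward_orbit L p"
proof (induction i)
  let ?P = "\<lambda>i. \<exists>p. p 0 = v i \<and> backward_orbit L p"
  have ext: "?P i" if i: "i < k" and b0: "b 0 = chain_pred (2 * n) v i" and b: "backward_orbit L b" for i b
  proof (cases a)
    case Infinity
    \<comment> \<open>Here \<open>A\<close> applied to the predecessor equals \<open>E\<close>
      applied to \<open>v i\<close>, so it is enough to put \<open>v i\<close> in front of
      \<open>b\<close>.\<close>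
    define p where "p t = (case t of 0 \<Rightarrow> v i | Suc t \<Rightarrow> b t)" for t
    have "A *\<^sub>v p (Suc t) = E *\<^sub>v p t" for t
      using b b0 v i Infinity by (cases t) (auto simp: p_def backward_orbit_def pencil_chain_def)
    moreover have "p t \<in> L" for t using b vL[OF i] by (cases t) (auto simp: p_def backward_orbit_def)
    moreover have "(\<lambda>t. p t $ c) \<longlonglongrightarrow> 0" if "c < 2 * n" for c
      by (rule LIMSEQ_imp_Suc) (use b that in \<open>simp add: p_def backward_orbit_def\<close>)
    ultimately show ?thesis by (intro exI[of _ p]) (simp add: backward_orbit_def p_def)
  next
    case (Finite z)
    with a have z: "cmod z > 1" by simp
    then have z0: "z \<noteq> 0" by auto
    \<comment> \<open>Solves \<open>z * p (Suc t) + b (Suc t) = p t\<close>, the chain relation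
      carried backwards; it contracts because \<open>cmod z > 1\<close>.\<close>
    define p where "p = rec_nat (v i) (\<lambda>t w. (1 / z) \<cdot>\<^sub>v (w - b (Suc t)))"
    have p: "p 0 = v i" "p (Suc t) = (1 / z) \<cdot>\<^sub>v (p t - b (Suc t))" for t by (simp_all add: p_def)
    have bL: "b t \<in> L" for t using b by (simp add: backward_orbit_def)
    have pL: "p t \<in> L" for t by (induction t) (auto simp: p vL[OF i] bL intro!: Lminus Lsmult)
    have c [simp]: "b t \<in> carrier_vec (2 * n)" "p t \<in> carrier_vec (2 * n)" for t using bL pL Lc by auto
    have Ap: "A *\<^sub>v p (Suc t) = (1 / z) \<cdot>\<^sub>v (A *\<^sub>v p t - A *\<^sub>v b (Suc t))" for t
      unfolding p(2) by (simp add: mult_mat_vec[OF A] mult_minus_distrib_mat_vec[OF A])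
    have Ab: "A *\<^sub>v b (Suc t) = E *\<^sub>v b t" for t using b by (simp add: backward_orbit_def)
    have "A *\<^sub>v p (Suc t) = E *\<^sub>v p t" for t
    proof (induction t)
      case 0
      have "A *\<^sub>v p 0 = E *\<^sub>v (z \<cdot>\<^sub>v p 0 + b 0)"
        using v i Finite by (simp add: pencil_chain_def p(1) b0)
      then have "A *\<^sub>v p 0 - A *\<^sub>v b (Suc 0) = E *\<^sub>v (z \<cdot>\<^sub>v p 0 + b 0) - E *\<^sub>v b 0"
        by (simp add: Ab)
      also have "\<dots> = E *\<^sub>v (z \<cdot>\<^sub>v p 0 + b 0 - b 0)"
        by (rule mult_minus_distrib_mat_vec[OF E, symmetric]) auto
      also have "z \<cdot>\<^sub>v p 0 + b 0 - b 0 = z \<cdot>\<^sub>v p 0"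
        by (simp add: add_diff_cancel_vec[of _ "2 * n"])
      finally show ?case unfolding Ap using z0 by (simp add: mult_mat_vec[OF E] smult_smult_assoc)
    next
      case (Suc t)
      have "A *\<^sub>v p (Suc (Suc t)) = (1 / z) \<cdot>\<^sub>v (E *\<^sub>v p t - E *\<^sub>v b (Suc t))"
        by (simp only: Ap[of "Suc t"] Suc.IH Ab)
      also have "\<dots> = E *\<^sub>v p (Suc t)"
        unfolding p(2) by (simp add: mult_mat_vec[OF E] mult_minus_distrib_mat_vec[OF E])
      finally show ?case .
    qed
    moreover have "(\<lambda>t. p t $ c) \<longlonglongrightarrow> 0" if "c < 2 * n" for c
    proof (rule contracting_recursion_tendsto_0)
      show "p (Suc t) $ c = 1 / z * (p t $ c - b (Suc t) $ c)" for t
        using that by (simp add: p(2) carrier_vecD[OF c(1)])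
      show "(\<lambda>t. b t $ c) \<longlonglongrightarrow> 0" using b that by (simp add: backward_orbit_def)
      show "cmod (1 / z) < 1" using z z0 by (auto simp: norm_divide divide_less_eq)
    qed
    ultimately show ?thesis using p(1) pL by (intro exI[of _ p]) (simp add: backward_orbit_def)
  qed
  {
    case 0
    have "backward_orbit L (\<lambda>_. 0\<^sub>v (2 * n))"
      using L0 mult_mat_zero_vec[OF A] mult_mat_zero_vec[OF E] by (simp add: backward_orbit_def)
    with 0 ext[of 0 "\<lambda>_. 0\<^sub>v (2 * n)"] show ?case by simp
  next
    case (Suc i)
    then obtain b where "b 0 = v i" "backward_orbit L b" by auto
    with Suc.prems ext[of "Suc i" b] show ?case by simp
  }
qed

end

text \<open>\<open>null\<close> abstracts the neutral subspace \<open>\<mu> = Y x\<close>;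
  \<open>null_step\<close> is the form in which semidefiniteness and stabilizability enter.\<close>

locale definite_pencil = isometric_pencil +
  fixes null :: "complex vec \<Rightarrow> bool"
  assumes null_zero: "null (0\<^sub>v (2 * n))"
    and null_neutral: "\<And>z w. null z \<Longrightarrow> null w \<Longrightarrow> hform n z w = 0"
    and null_step: "\<And>s z z'. \<lbrakk>z \<in> carrier_vec (2 * n); z' \<in> carrier_vec (2 * n); cmod s = 1;
      A *\<^sub>v z = E *\<^sub>v (s \<cdot>\<^sub>v z + z'); null z'; hform n z' z = 0\<rbrakk> \<Longrightarrow> null z"
begin

text \<open>The bound \<open>l\<close> allows two uses: the first half of an arbitrary critical
  chain, whose neighbours are orthogonal by \<open>critical_chain_neutral\<close>, and whole chains
  inside a neutral subspace.\<close>

lemma critical_chain_null: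
  assumes v: "chain (Finite s) k v" and s: "cmod s = 1"
    and neutral: "\<And>i. Suc i < l \<Longrightarrow> hform n (v i) (v (Suc i)) = 0" and "l \<le> k"
  shows "i < l \<Longrightarrow> null (v i)"
proof (induction i)
  case 0
  have "A *\<^sub>v v 0 = E *\<^sub>v (s \<cdot>\<^sub>v v 0 + 0\<^sub>v (2 * n))"
    using v[unfolded pencil_chain_def, rule_format, of 0] 0 \<open>l \<le> k\<close> by auto
  then show ?case
    using 0 \<open>l \<le> k\<close> null_zero s pencil_chain_carrier[OF v, of 0]
    by - (rule null_step[of _ "0\<^sub>v (2 * n)" s], auto)
next
  case (Suc i)
  have "A *\<^sub>v v (Suc i) = E *\<^sub>v (s \<cdot>\<^sub>v v (Suc i) + v i)"
    using v[unfolded pencil_chain_def, rule_format, of "Suc i"] Suc.prems \<open>l \<le> k\<close> by auto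
  then show ?case
    using Suc \<open>l \<le> k\<close> s pencil_chain_carrier[OF v] neutral[of i]
    by - (rule null_step[of _ "v i" s], auto)
qed

lemma critical_chain_first_half:
  assumes "chain (Finite s) k v" "cmod s = 1" "2 * i < k"
  shows "null (v i)"
proof (rule critical_chain_null[OF assms(1,2)])
  \<comment> \<open>Neighbours below the rounded-up half satisfy \<open>2 * j + 3 \<le> k\<close>,
    exactly what \<open>critical_chain_neutral\<close> requires; for odd \<open>k\<close> this
    admits the middle vector.\<close>
  show "hform n (v j) (v (Suc j)) = 0" if "Suc j < (k + 1) div 2" for j
    using that by (intro critical_chain_neutral[OF assms(1,2)]) linarith
  show "(k + 1) div 2 \<le> k" "i < (k + 1) div 2" using assms(3) by linarith+
qed

end

section \<open>Existence of the Kronecker form\<close>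

lemma mult_mat_unit_vec:
  fixes M :: "'a :: field mat"
  assumes "M \<in> carrier_mat r c" "j < c"
  shows "M *\<^sub>v unit_vec c j = col M j"
  using assms by (intro eq_vecI) auto

text \<open>The step case may assume a nonzero coefficient, which limits the columns that occur to
  the support of \<open>c\<close>.\<close>

lemma mult_mat_vec_induct [consumes 2, case_names zero step]:
  fixes T :: "'a :: field mat"
  assumes T: "T \<in> carrier_mat r k" and c: "c \<in> carrier_vec k"
    and zero: "P (0\<^sub>v r)"
    and step: "\<And>i v. i < k \<Longrightarrow> c $ i \<noteq> 0 \<Longrightarrow> v \<in> carrier_vec r \<Longrightarrow> P v \<Longrightarrow> P (v + c $ i \<cdot>\<^sub>v col T i)"
  shows "P (T *\<^sub>v c)"
proof -
  define d where "d j = vec k (\<lambda>i. if i < j then c $ i else 0)" for j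
  have d: "d j \<in> carrier_vec k" for j by (simp add: d_def)
  have "P (T *\<^sub>v d j)" if "j \<le> k" for j
    using that
  proof (induction j)
    case 0
    have "d 0 = 0\<^sub>v k" by (intro eq_vecI) (auto simp: d_def)
    moreover have "T *\<^sub>v 0\<^sub>v k = 0\<^sub>v r" using T by (intro eq_vecI) auto
    ultimately show ?case using zero by simp
  next
    case (Suc j)
    have "d (Suc j) = d j + c $ j \<cdot>\<^sub>v unit_vec k j"
      using Suc.prems by (intro eq_vecI) (auto simp: d_def less_Suc_eq)
    then have eq: "T *\<^sub>v d (Suc j) = T *\<^sub>v d j + c $ j \<cdot>\<^sub>v col T j"
      using T Suc.prems d
      by (simp add: mult_add_distrib_mat_vec[of _ r k] mult_mat_vec[of _ r k] mult_mat_unit_vec)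
    show ?case
    proof (cases "c $ j = 0")
      case True
      have "T *\<^sub>v d j \<in> carrier_vec r" using mult_mat_vec_carrier[OF T d] .
      moreover have "0 \<cdot>\<^sub>v col T j = 0\<^sub>v r" using T by (intro eq_vecI) auto
      ultimately show ?thesis using Suc eq True by simp
    next
      case False
      then show ?thesis unfolding eq using Suc mult_mat_vec_carrier[OF T d] by (intro step) auto
    qed
  qed
  moreover have "d k = c" using c by (intro eq_vecI) (auto simp: d_def)
  ultimately show ?thesis by (metis order_refl)
qed

lemma nilpotent_block_mult_unit:
  assumes "j < k"
  shows "jordan_block k (0 :: 'a :: field) *\<^sub>v unit_vec k j = (if j = 0 then 0\<^sub>v k else unit_vec k (j - 1))"
  using assms by (subst mult_mat_unit_vec[of _ k]) (auto simp: jordan_block_def unit_vec_def intro!: eq_vecI)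

lemma nilpotent_block_funpow_unit:
  assumes "j < k"
  shows "(((*\<^sub>v) (jordan_block k (0 :: 'a :: field))) ^^ i) (unit_vec k j) =
    (if i \<le> j then unit_vec k (j - i) else 0\<^sub>v k)"
proof (induction i)
  case (Suc i)
  have z: "jordan_block k (0 :: 'a) *\<^sub>v 0\<^sub>v k = 0\<^sub>v k" by (intro eq_vecI) auto
  show ?case using Suc assms nilpotent_block_mult_unit[of "j - i" k, where 'a = 'a]
    by (auto simp: z)
qed simp

lemma funpow_mult_mat_vec:
  fixes M :: "'a :: field mat"
  assumes M: "M \<in> carrier_mat k k"
  shows "v \<in> carrier_vec k \<Longrightarrow> ((*\<^sub>v) M ^^ i) v \<in> carrier_vec k"
    and "v \<in> carrier_vec k \<Longrightarrow> w \<in> carrier_vec k \<Longrightarrow> ((*\<^sub>v) M ^^ i) (v + w) = ((*\<^sub>v) M ^^ i) v + ((*\<^sub>v) M ^^ i) w"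
    and "v \<in> carrier_vec k \<Longrightarrow> ((*\<^sub>v) M ^^ i) (a \<cdot>\<^sub>v v) = a \<cdot>\<^sub>v ((*\<^sub>v) M ^^ i) v"
proof -
  show c: "v \<in> carrier_vec k \<Longrightarrow> ((*\<^sub>v) M ^^ i) v \<in> carrier_vec k" for v i
    by (induction i) (auto intro: mult_mat_vec_carrier[OF M])
  show "v \<in> carrier_vec k \<Longrightarrow> w \<in> carrier_vec k \<Longrightarrow> ((*\<^sub>v) M ^^ i) (v + w) = ((*\<^sub>v) M ^^ i) v + ((*\<^sub>v) M ^^ i) w"
    by (induction i) (simp_all add: mult_add_distrib_mat_vec[OF M] c)
  show "v \<in> carrier_vec k \<Longrightarrow> ((*\<^sub>v) M ^^ i) (a \<cdot>\<^sub>v v) = a \<cdot>\<^sub>v ((*\<^sub>v) M ^^ i) v"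
    by (induction i) (simp_all add: mult_mat_vec[OF M] c)
qed

lemma eq_mat_by_vec:
  fixes M :: "'a :: field mat"
  assumes M: "M \<in> carrier_mat r c" "N \<in> carrier_mat r c"
    and eq: "\<And>j. j < c \<Longrightarrow> M *\<^sub>v unit_vec c j = N *\<^sub>v unit_vec c j"
  shows "M = N"
proof (rule mat_col_eqI)
  fix j assume "j < dim_col N"
  then show "col M j = col N j" using M eq[of j] by (simp add: mult_mat_unit_vec)
qed (use M in auto)

text \<open>\<open>N\<close> lowers unit vectors, so \<open>U * N\<close> lowers the columns
  \<open>U ^ (k - 1 - j) e_j\<close>: the additional factor \<open>U\<close> is just what the
  preceding column has. The lemma removes the unit factor that appears when a block is divided by
  the other matrix of its pencil.\<close>

lemma commuting_factor_similar_nilpotent: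
  fixes U :: "'a :: field mat"
  defines "N \<equiv> \<lambda>k. jordan_block k (0 :: 'a)"
  assumes U: "U \<in> carrier_mat k k" "invertible_mat U" and comm: "U * N k = N k * U"
  shows "\<exists>T\<in>carrier_mat k k. invertible_mat T \<and> U * N k * T = T * N k"
proof -
  let ?u = "(*\<^sub>v) U" and ?n = "(*\<^sub>v) (N k)"
  have N: "N k \<in> carrier_mat k k" by (simp add: N_def)
  have cm: "?n (?u v) = ?u (?n v)" if "v \<in> carrier_vec k" for v
    using that by (metis U(1) N comm assoc_mult_mat_vec)
  have cmu: "?n ((?u ^^ i) v) = (?u ^^ i) (?n v)" if "v \<in> carrier_vec k" for v i
    by (induction i) (simp_all add: cm funpow_mult_mat_vec(1)[OF U(1)] that)
  have cmn: "(?n ^^ j) ((?u ^^ i) v) = (?u ^^ i) ((?n ^^ j) v)" if "v \<in> carrier_vec k" for v i j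
    by (induction j) (simp_all add: cmu funpow_mult_mat_vec(1)[OF N] that)
  have zu: "(?u ^^ i) (0\<^sub>v k) = 0\<^sub>v k" for i
    using funpow_mult_mat_vec(3)[OF U(1), of "0\<^sub>v k" i 0] funpow_mult_mat_vec(1)[OF U(1), of "0\<^sub>v k" i]
    by (simp add: smult_vec_eq_0_iff[of _ k, symmetric])
      (metis smult_vec_eq_0_iff zero_carrier_vec)
  define f where "f j = (?u ^^ (k - Suc j)) (unit_vec k j)" for j
  have f: "f j \<in> carrier_vec k" for j unfolding f_def by (intro funpow_mult_mat_vec(1)[OF U(1)]) simp
  define T where "T = mat_of_cols k (map f [0..<k])"
  have T: "T \<in> carrier_mat k k" by (auto simp: T_def)
  have colT: "col T j = f j" if "j < k" for j using that f by (simp add: T_def)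
  have Tu: "T *\<^sub>v unit_vec k j = f j" if "j < k" for j using that T by (simp add: mult_mat_unit_vec colT)
  have "U * N k * T = T * N k"
  proof (rule eq_mat_by_vec)
    fix j assume j: "j < k"
    have "(U * N k * T) *\<^sub>v unit_vec k j = ?u (?n (f j))"
      using U N T by (simp add: assoc_mult_mat_vec[of _ k k _ k] mult_carrier_mat[OF U(1) N] Tu[OF j] f)
    also have "\<dots> = ?u ((?u ^^ (k - Suc j)) (?n (unit_vec k j)))"
      unfolding f_def by (subst cmu) auto
    also have "\<dots> = (?u ^^ (k - j)) (?n (unit_vec k j))"
      using j by (simp add: funpow_Suc_right[symmetric] Suc_diff_Suc flip: funpow.simps(2) comp_apply[of ?u])
    also have "\<dots> = T *\<^sub>v (?n (unit_vec k j))"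
    proof (cases j)
      case 0
      then show ?thesis using j T nilpotent_block_mult_unit[OF j, where 'a = 'a]
        by (simp add: N_def zu)
    next
      case (Suc i)
      then show ?thesis using j nilpotent_block_mult_unit[OF j, where 'a = 'a]
        by (simp add: N_def Tu f_def)
    qed
    also have "\<dots> = (T * N k) *\<^sub>v unit_vec k j" using T N by simp
    finally show "(U * N k * T) *\<^sub>v unit_vec k j = (T * N k) *\<^sub>v unit_vec k j" .
  qed (use U N T in auto)
  moreover have "invertible_mat T"
    unfolding invertible_mat_iff_injective[OF T]
  proof (intro ballI impI, rule ccontr)
    fix c assume c: "c \<in> carrier_vec k" "T *\<^sub>v c = 0\<^sub>v k" "c \<noteq> 0\<^sub>v k"
    \<comment> \<open>Let \<open>m\<close> be the last index in the support of \<open>c\<close>. The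
      \<open>m\<close>-th power of \<open>N\<close> kills the columns before \<open>m\<close> and
      sends column \<open>m\<close> to a power of \<open>U\<close> applied to the first unit vector,
      which is nonzero.\<close>
    define S where "S = {i. i < k \<and> c $ i \<noteq> 0}"
    have "S \<noteq> {}"
    proof
      assume "S = {}"
      then have "c = 0\<^sub>v k" using c(1) by (intro eq_vecI) (auto simp: S_def)
      with c(3) show False by simp
    qed
    moreover have "finite S" by (simp add: S_def)
    ultimately have m: "Max S \<in> S" "\<And>i. i \<in> S \<Longrightarrow> i \<le> Max S" by auto
    define m where "m = Max S"
    have m: "m < k" "c $ m \<noteq> 0" "\<And>i. i < k \<Longrightarrow> c $ i \<noteq> 0 \<Longrightarrow> i \<le> m"
      using m by (auto simp: m_def S_def)
    define w where "w = (?u ^^ (k - Suc m)) (unit_vec k 0)"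
    have wc: "w \<in> carrier_vec k" unfolding w_def by (intro funpow_mult_mat_vec(1)[OF U(1)]) simp
    have w0: "w \<noteq> 0\<^sub>v k"
    proof -
      have "(?u ^^ i) v = 0\<^sub>v k \<Longrightarrow> v = 0\<^sub>v k" if "v \<in> carrier_vec k" for i v
      proof (induction i)
        case (Suc i)
        then show ?case using U funpow_mult_mat_vec(1)[OF U(1) that]
          by (auto simp: invertible_mat_iff_injective[OF U(1)])
      qed simp
      moreover have "unit_vec k 0 \<noteq> (0\<^sub>v k :: 'a vec)"
        using m(1) by (metis index_unit_vec(1) index_zero_vec(1) gr_implies_not0 gr0I zero_neq_one)
      ultimately show ?thesis unfolding w_def by (metis unit_vec_carrier)
    qed
    define d where "d = vec k (\<lambda>i. if i = m then 0 else c $ i)"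
    have d: "d \<in> carrier_vec k" by (simp add: d_def)
    have cd: "c = d + c $ m \<cdot>\<^sub>v unit_vec k m"
      using c(1) m(1) by (intro eq_vecI) (auto simp: d_def)
    have nf: "(?n ^^ m) (f j) = (if j < m then 0\<^sub>v k else w)" if "j \<le> m" for j
      using that m(1) unfolding f_def cmn[OF unit_vec_carrier]
      by (auto simp: w_def zu N_def nilpotent_block_funpow_unit)
    have zn: "(?n ^^ m) (0\<^sub>v k) = 0\<^sub>v k"
      using funpow_mult_mat_vec(3)[OF N, of "0\<^sub>v k" m 0] funpow_mult_mat_vec(1)[OF N, of "0\<^sub>v k" m]
      by (metis smult_vec_eq_0_iff zero_carrier_vec)
    have nd: "(?n ^^ m) (T *\<^sub>v d) = 0\<^sub>v k"
      using T d
    proof (induction rule: mult_mat_vec_induct)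
      case zero
      show ?case by (rule zn)
    next
      case (step i v)
      then have "i < m" using m(3)[of i] by (auto simp: d_def split: if_splits)
      then show ?case using step nf[of i]
        by (simp add: colT f funpow_mult_mat_vec[OF N])
    qed
    have "(?n ^^ m) (T *\<^sub>v c) = (?n ^^ m) (T *\<^sub>v d) + c $ m \<cdot>\<^sub>v (?n ^^ m) (f m)"
      using T d m(1) mult_mat_vec_carrier[OF T d]
      by (subst cd) (simp add: mult_add_distrib_mat_vec[OF T] mult_mat_vec[OF T] Tu funpow_mult_mat_vec[OF N] f)
    then have "0\<^sub>v k = c $ m \<cdot>\<^sub>v w" using nd nf[of m] c(2) zn wc by simp
    then show False using smult_vec_eq_0_iff[OF wc, of "c $ m"] m(2) w0 by simp
  qed
  ultimately show ?thesis using T by blast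
qed

lemma inverse_mat_commute:
  fixes W :: "'a :: field mat"
  assumes "W \<in> carrier_mat k k" "V \<in> carrier_mat k k" "X \<in> carrier_mat k k"
    and "W * V = 1\<^sub>m k" "V * W = 1\<^sub>m k" "W * X = X * W"
  shows "V * X = X * V"
proof -
  have "V * X = V * X * (W * V)" using assms by simp
  also have "\<dots> = V * (X * W) * V" using assms(1-3) by (simp add: assoc_mult_mat[of _ k k _ k _ k])
  also have "\<dots> = (V * W) * X * V" unfolding assms(6)[symmetric]
    using assms(1-3) by (simp add: assoc_mult_mat[of _ k k _ k _ k])
  also have "\<dots> = X * V" using assms by simp
  finally show ?thesis .
qed

lemma upper_triangular_invertible:
  fixes M :: "'a :: field mat"
  assumes "M \<in> carrier_mat k k" "upper_triangular M" "\<And>i. i < k \<Longrightarrow> M $$ (i, i) \<noteq> 0"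
  shows "invertible_mat M"
proof -
  have "det M = prod_list (diag_mat M)" using assms by (intro det_upper_triangular)
  also have "\<dots> \<noteq> 0" using assms by (auto simp: prod_list_zero_iff diag_mat_def)
  finally show ?thesis using assms by (simp add: invertible_mat_iff_det)
qed

text \<open>This is the pencil \<open>(K, a K - I)\<close> restricted to a Jordan block of
  \<open>K\<close>. If \<open>\<kappa> = 0\<close>, then \<open>a J - I\<close> is invertible and
  the eigenvalue is infinite; otherwise dividing by \<open>J\<close> leaves \<open>a I\<close> minus
  the inverse of \<open>J\<close>, with eigenvalue \<open>a - 1 / \<kappa>\<close>.\<close>

lemma kronecker_block_exists:
  fixes k :: nat and a \<kappa> :: complex
  defines "J \<equiv> jordan_block k \<kappa>"
  shows "\<exists>P\<in>carrier_mat k k. \<exists>T\<in>carrier_mat k k. \<exists>ev. invertible_mat P \<and> invertible_mat T \<and>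
    P * J * T = kronecker_E (k, ev) \<and> P * (a \<cdot>\<^sub>m J - 1\<^sub>m k) * T = kronecker_A (k, ev)"
proof -
  let ?N = "jordan_block k (0 :: complex)" and ?I = "1\<^sub>m k :: complex mat"
  note sq = mult_carrier_mat[of _ k k _ k]
  note assoc = assoc_mult_mat[of _ k k _ k _ k]
  have N: "?N \<in> carrier_mat k k" by simp
  have J: "J \<in> carrier_mat k k" by (simp add: J_def)
  have JN: "J = \<kappa> \<cdot>\<^sub>m ?I + ?N" unfolding J_def by (intro eq_matI) (auto simp: jordan_block_def)
  show ?thesis
  proof (cases "\<kappa> = 0")
    case True
    define W where "W = a \<cdot>\<^sub>m ?N - ?I"
    have W: "W \<in> carrier_mat k k" by (simp add: W_def minus_carrier_mat)
    have "invertible_mat W"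
      by (rule upper_triangular_invertible[OF W]) (auto simp: W_def jordan_block_def)
    then obtain V where V: "V \<in> carrier_mat k k" "W * V = ?I" "V * W = ?I"
      using W by (rule invertible_matE)
    have "W * ?N = ?N * W"
      unfolding W_def by (simp add: minus_mult_distrib_mat[of _ k k _ _ k] mult_minus_distrib_mat[of _ k k _ k]
          mult_smult_assoc_mat[of _ k k _ k] mult_smult_distrib[of _ k k _ k])
    then have VN: "V * ?N = ?N * V" by (rule inverse_mat_commute[OF W V(1) N V(2,3)])
    have Vi: "invertible_mat V" using V W by (intro invertible_matI[of V k W])
    obtain T where T: "T \<in> carrier_mat k k" "invertible_mat T" "V * ?N * T = T * ?N"
      using commuting_factor_similar_nilpotent[OF V(1) Vi VN] by auto
    obtain S where S: "S \<in> carrier_mat k k" "T * S = ?I" "S * T = ?I"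
      using T(2,1) by (rule invertible_matE)
    have "S * V * ?N * T = S * (V * ?N * T)" using S V T N by (simp add: assoc sq)
    also have "\<dots> = (S * T) * ?N" unfolding T(3) by (rule assoc[OF S(1) T(1) N, symmetric])
    finally have 1: "S * V * ?N * T = ?N" by (simp only: S(3) left_mult_one_mat[OF N])
    have "S * V * W * T = S * (V * W) * T" using S V T W by (simp add: assoc sq)
    then have 2: "S * V * W * T = ?I" using S V T by simp
    have "invertible_mat (S * V)"
      using S V T W by (intro invertible_matI[of _ k "W * T"])
        (simp_all add: sq assoc, metis assoc left_mult_one_mat sq, metis assoc left_mult_one_mat sq)
    with 1 2 S V T True show ?thesis
      by (intro bexI[of _ "S * V"] bexI[of _ T] exI[of _ Infinity]) (auto simp: J_def W_def)
  next
    case False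
    have "invertible_mat J"
      by (rule upper_triangular_invertible[OF J]) (use False in \<open>auto simp: J_def jordan_block_def\<close>)
    then obtain V where V: "V \<in> carrier_mat k k" "J * V = ?I" "V * J = ?I"
      using J by (rule invertible_matE)
    \<comment> \<open>From \<open>J = \<kappa> I + N\<close> the inverse \<open>V\<close> of
      \<open>J\<close> satisfies \<open>- V = - (1 / \<kappa>) I + U * N\<close>, so
      \<open>U\<close> is the unit factor left in front of \<open>N\<close>.\<close>
    define U where "U = (1 / \<kappa>) \<cdot>\<^sub>m V"
    have U: "U \<in> carrier_mat k k" using V by (simp add: U_def)
    have "J * ?N = ?N * J"
      unfolding JN by (simp add: add_mult_distrib_mat[of _ k k _ _ k] mult_add_distrib_mat[of _ k k _ k]
          mult_smult_assoc_mat[of _ k k _ k] mult_smult_distrib[of _ k k _ k])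
    then have VN: "V * ?N = ?N * V" by (rule inverse_mat_commute[OF J V(1) N V(2,3)])
    have Uc: "U * ?N = ?N * U"
      using VN V by (simp add: U_def mult_smult_assoc_mat[of _ k k _ k] mult_smult_distrib[of _ k k _ k])
    have Ui: "invertible_mat U"
      using V J False by (intro invertible_matI[of U k "\<kappa> \<cdot>\<^sub>m J"])
        (simp_all add: U_def mult_smult_assoc_mat[of _ k k _ k] mult_smult_distrib[of _ k k _ k],
          (intro eq_matI; simp)+)
    obtain T where T: "T \<in> carrier_mat k k" "invertible_mat T" "U * ?N * T = T * ?N"
      using commuting_factor_similar_nilpotent[OF U Ui Uc] by auto
    obtain S where S: "S \<in> carrier_mat k k" "T * S = ?I" "S * T = ?I"
      using T(2,1) by (rule invertible_matE)
    have "S * V * J * T = S * (V * J) * T" using S V T J by (simp add: assoc sq)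
    then have 1: "S * V * J * T = ?I" using S V T by simp
    have "?I = \<kappa> \<cdot>\<^sub>m V + V * ?N"
      using V(3) V(1) unfolding JN by (simp add: mult_add_distrib_mat[of _ k k _ k] mult_smult_distrib[of _ k k _ k])
    then have "(1 / \<kappa>) \<cdot>\<^sub>m ?I = (1 / \<kappa>) \<cdot>\<^sub>m (\<kappa> \<cdot>\<^sub>m V + V * ?N)" by simp
    also have "\<dots> = V + U * ?N"
      using V(1) False by (simp add: U_def mult_smult_assoc_mat[of _ k k _ k])
        (intro eq_matI; simp add: field_simps del: index_mult_mat(1))
    finally have eV: "(1 / \<kappa>) \<cdot>\<^sub>m ?I = V + U * ?N" .
    have "V * (a \<cdot>\<^sub>m J - ?I) = a \<cdot>\<^sub>m ?I - V"
      using V J by (simp add: mult_minus_distrib_mat[of _ k k _ k] mult_smult_distrib[of _ k k _ k])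
    also have "\<dots> = (a - 1 / \<kappa>) \<cdot>\<^sub>m ?I + U * ?N"
    proof (rule eq_matI)
      fix i j assume "i < dim_row ((a - 1 / \<kappa>) \<cdot>\<^sub>m ?I + U * ?N)" "j < dim_col ((a - 1 / \<kappa>) \<cdot>\<^sub>m ?I + U * ?N)"
      then have ij: "i < k" "j < k" by (simp_all add: carrier_matD[OF U])
      have "(1 / \<kappa>) * ?I $$ (i, j) = V $$ (i, j) + (U * ?N) $$ (i, j)"
        using arg_cong[OF eV, of "\<lambda>M. M $$ (i, j)"] ij V(1) by (simp add: carrier_matD[OF U] del: index_mult_mat(1))
      then show "(a \<cdot>\<^sub>m ?I - V) $$ (i, j) = ((a - 1 / \<kappa>) \<cdot>\<^sub>m ?I + U * ?N) $$ (i, j)"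
        using ij V(1) by (simp add: carrier_matD[OF U] algebra_simps del: index_mult_mat(1))
    qed (use V U in auto)
    finally have Vw: "V * (a \<cdot>\<^sub>m J - ?I) = (a - 1 / \<kappa>) \<cdot>\<^sub>m ?I + U * ?N" .
    have aJ: "a \<cdot>\<^sub>m J - ?I \<in> carrier_mat k k" by (simp add: minus_carrier_mat)
    have "S * V * (a \<cdot>\<^sub>m J - ?I) * T = S * (V * (a \<cdot>\<^sub>m J - ?I)) * T"
      using S V aJ T by (simp add: assoc sq)
    also have "\<dots> = (a - 1 / \<kappa>) \<cdot>\<^sub>m (S * T) + S * (U * ?N * T)"
      unfolding Vw using S U T N
      by (simp add: mult_add_distrib_mat[of _ k k _ k] add_mult_distrib_mat[of _ k k _ _ k] sq assoc
          mult_smult_assoc_mat[of _ k k _ k] mult_smult_distrib[of _ k k _ k])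
    also have "S * (U * ?N * T) = S * T * ?N" unfolding T(3) by (rule assoc[OF S(1) T(1) N, symmetric])
    also have "(a - 1 / \<kappa>) \<cdot>\<^sub>m (S * T) + S * T * ?N = jordan_block k (a - 1 / \<kappa>)"
      unfolding S(3) by (intro eq_matI) (auto simp: jordan_block_def)
    finally have 2: "S * V * (a \<cdot>\<^sub>m J - ?I) * T = jordan_block k (a - 1 / \<kappa>)" .
    have "invertible_mat (S * V)"
      using S V T J by (intro invertible_matI[of _ k "J * T"])
        (simp_all add: sq assoc, metis assoc left_mult_one_mat sq, metis assoc left_mult_one_mat sq)
    with 1 2 S V T show ?thesis
      by (intro bexI[of _ "S * V"] bexI[of _ T] exI[of _ "Finite (a - 1 / \<kappa>)"]) auto
  qed
qed

lemma block_diag_mult: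
  fixes M1 :: "'a :: comm_ring_1 mat"
  assumes "M1 \<in> carrier_mat k k" "N1 \<in> carrier_mat k k" "M2 \<in> carrier_mat l l" "N2 \<in> carrier_mat l l"
  shows "four_block_mat M1 (0\<^sub>m k l) (0\<^sub>m l k) M2 * four_block_mat N1 (0\<^sub>m k l) (0\<^sub>m l k) N2 =
    four_block_mat (M1 * N1) (0\<^sub>m k l) (0\<^sub>m l k) (M2 * N2)"
  by (subst mult_four_block_mat[OF assms(1) _ _ assms(3,2) _ _ assms(4)]) (use assms in auto)

lemma kronecker_dims [simp]:
  "dim_row (kronecker_E b) = fst b" "dim_col (kronecker_E b) = fst b"
  "dim_row (kronecker_A b) = fst b" "dim_col (kronecker_A b) = fst b"
  by (cases b; cases "snd b"; simp)+

lemma kronecker_diag_dims [simp]: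
  "dim_row (diag_block_mat (map kronecker_E bs)) = sum_list (map fst bs)"
  "dim_col (diag_block_mat (map kronecker_E bs)) = sum_list (map fst bs)"
  "dim_row (diag_block_mat (map kronecker_A bs)) = sum_list (map fst bs)"
  "dim_col (diag_block_mat (map kronecker_A bs)) = sum_list (map fst bs)"
  by (simp_all add: dim_diag_block_mat o_def)

text \<open>\<open>kronecker_block_exists\<close> applied block by block; each block finds its own
  eigenvalue, while the point \<open>a\<close> is common to all.\<close>

lemma jordan_matrix_kronecker:
  fixes a :: complex
  assumes "0 \<notin> fst ` set n_as"
  defines "N \<equiv> sum_list (map fst n_as)"
  shows "\<exists>P\<in>carrier_mat N N. \<exists>T\<in>carrier_mat N N. \<exists>bs. invertible_mat P \<and> invertible_mat T \<and>
    0 \<notin> fst ` set bs \<and> P * jordan_matrix n_as * T = diag_block_mat (map kronecker_E bs) \<and>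
    P * (a \<cdot>\<^sub>m jordan_matrix n_as - 1\<^sub>m N) * T = diag_block_mat (map kronecker_A bs)"
  using assms(1) unfolding N_def
proof (induction n_as)
  case Nil
  have "1\<^sub>m 0 = (0\<^sub>m 0 0 :: complex mat)" by (intro eq_matI) auto
  moreover have "invertible_mat (1\<^sub>m 0 :: complex mat)" by (rule invertible_matI[of _ 0 "1\<^sub>m 0"]) auto
  moreover have "M = 0\<^sub>m 0 0" if "M \<in> carrier_mat 0 0" for M :: "complex mat"
    using that by (intro eq_matI) auto
  moreover have "1\<^sub>m 0 * jordan_matrix ([] :: (nat \<times> complex) list) * 1\<^sub>m 0 \<in> carrier_mat 0 0"
    "1\<^sub>m 0 * (a \<cdot>\<^sub>m jordan_matrix ([] :: (nat \<times> complex) list) - 1\<^sub>m 0) * 1\<^sub>m 0 \<in> carrier_mat 0 0"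
    by (rule carrier_matI; simp)+
  ultimately show ?case
    by (intro bexI[of _ "1\<^sub>m 0"] exI[of _ "[]"]) auto
next
  case (Cons b n_as)
  obtain k \<kappa> where b: "b = (k, \<kappa>)" by (cases b)
  define l where "l = sum_list (map fst n_as)"
  define J where "J = jordan_block k \<kappa>"
  define M where "M = jordan_matrix n_as"
  have [simp]: "J \<in> carrier_mat k k" "M \<in> carrier_mat l l" by (simp_all add: J_def M_def l_def)
  obtain P2 T2 bs where 2: "P2 \<in> carrier_mat l l" "T2 \<in> carrier_mat l l" "invertible_mat P2" "invertible_mat T2"
    "0 \<notin> fst ` set bs" "P2 * M * T2 = diag_block_mat (map kronecker_E bs)"
    "P2 * (a \<cdot>\<^sub>m M - 1\<^sub>m l) * T2 = diag_block_mat (map kronecker_A bs)"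
    using Cons unfolding M_def l_def by auto
  obtain P1 T1 ev where 1: "P1 \<in> carrier_mat k k" "T1 \<in> carrier_mat k k" "invertible_mat P1" "invertible_mat T1"
    "P1 * J * T1 = kronecker_E (k, ev)" "P1 * (a \<cdot>\<^sub>m J - 1\<^sub>m k) * T1 = kronecker_A (k, ev)"
    using kronecker_block_exists[of k \<kappa> a] unfolding J_def by auto
  define D where "D X Y = four_block_mat X (0\<^sub>m k l) (0\<^sub>m l k) Y" for X Y :: "complex mat"
  have Dc: "D X Y \<in> carrier_mat (k + l) (k + l)" if "X \<in> carrier_mat k k" "Y \<in> carrier_mat l l" for X Y
    using that by (simp add: D_def)
  have Dm: "D X Y * D X' Y' = D (X * X') (Y * Y')"
    if "X \<in> carrier_mat k k" "Y \<in> carrier_mat l l" "X' \<in> carrier_mat k k" "Y' \<in> carrier_mat l l" for X Y X' Y'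
    unfolding D_def using that by (intro block_diag_mult)
  have Di: "invertible_mat (D X Y)" if XY: "X \<in> carrier_mat k k" "Y \<in> carrier_mat l l" and inv: "invertible_mat X" "invertible_mat Y" for X Y
  proof -
    obtain X' where X': "X' \<in> carrier_mat k k" "X * X' = 1\<^sub>m k" "X' * X = 1\<^sub>m k"
      using inv(1) XY(1) by (rule invertible_matE)
    obtain Y' where Y': "Y' \<in> carrier_mat l l" "Y * Y' = 1\<^sub>m l" "Y' * Y = 1\<^sub>m l"
      using inv(2) XY(2) by (rule invertible_matE)
    show ?thesis
      by (rule invertible_matI[OF Dc[OF XY] Dc[OF X'(1) Y'(1)]])
        (simp_all add: Dm XY X' Y', simp_all add: D_def)
  qed
  have jm: "jordan_matrix (b # n_as) = D J M"
    unfolding b jordan_matrix_Cons D_def J_def M_def l_def ..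
  have jm': "a \<cdot>\<^sub>m D J M - 1\<^sub>m (k + l) = D (a \<cdot>\<^sub>m J - 1\<^sub>m k) (a \<cdot>\<^sub>m M - 1\<^sub>m l)"
    unfolding D_def using carrier_matD[of J k k] carrier_matD[of M l l] by (intro eq_matI) auto
  have c: "a \<cdot>\<^sub>m J - 1\<^sub>m k \<in> carrier_mat k k" "a \<cdot>\<^sub>m M - 1\<^sub>m l \<in> carrier_mat l l"
    by (auto intro: minus_carrier_mat)
  have s: "sum_list (map fst bs) = l"
    using arg_cong[OF 2(6), of dim_row] 2(1) by simp
  have "D P1 P2 * D J M * D T1 T2 = D (P1 * J * T1) (P2 * M * T2)"
    using 1(1,2) 2(1,2) by (simp add: Dm mult_carrier_mat[of _ k k _ k] mult_carrier_mat[of _ l l _ l])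
  also have "\<dots> = diag_block_mat (map kronecker_E ((k, ev) # bs))"
    unfolding 1 2 D_def by (simp add: Let_def s)
  finally have E: "D P1 P2 * D J M * D T1 T2 = diag_block_mat (map kronecker_E ((k, ev) # bs))" .
  have "D P1 P2 * D (a \<cdot>\<^sub>m J - 1\<^sub>m k) (a \<cdot>\<^sub>m M - 1\<^sub>m l) * D T1 T2 =
    D (P1 * (a \<cdot>\<^sub>m J - 1\<^sub>m k) * T1) (P2 * (a \<cdot>\<^sub>m M - 1\<^sub>m l) * T2)"
    using 1(1,2) 2(1,2) c by (simp add: Dm mult_carrier_mat[of _ k k _ k] mult_carrier_mat[of _ l l _ l])
  also have "\<dots> = diag_block_mat (map kronecker_A ((k, ev) # bs))"
    unfolding 1 2 D_def by (simp add: Let_def s)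
  finally have A: "D P1 P2 * (a \<cdot>\<^sub>m D J M - 1\<^sub>m (k + l)) * D T1 T2 = diag_block_mat (map kronecker_A ((k, ev) # bs))"
    unfolding jm' .
  have "sum_list (map fst (b # n_as)) = k + l" by (simp add: b l_def)
  with E A Dc[OF 1(1) 2(1)] Dc[OF 1(2) 2(2)] Di[OF 1(1) 2(1) 1(3) 2(3)] Di[OF 1(2) 2(2) 1(4) 2(4)] 2(5) Cons.prems
  show ?case unfolding jm
    by (intro bexI[of _ "D P1 P2"] bexI[of _ "D T1 T2"] exI[of _ "(k, ev) # bs"]) (auto simp: b)
qed

lemma invertible_mat_mult:
  fixes M :: "'a :: field mat"
  assumes "M \<in> carrier_mat k k" "N \<in> carrier_mat k k" "invertible_mat M" "invertible_mat N"
  shows "invertible_mat (M * N)"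
  using assms det_mult[OF assms(1,2)]
  by (simp add: invertible_mat_iff_det mult_carrier_mat[OF assms(1,2)] invertible_mat_iff_det[OF mult_carrier_mat[OF assms(1,2)]])

text \<open>Dividing by \<open>a E - A\<close> at a nonsingular point \<open>a\<close> turns the
  pencil into \<open>(K, a K - I)\<close>, so the Jordan form of the single matrix \<open>K\<close>
  brings both to block form at once.\<close>

theorem kronecker_form_exists:
  assumes "regular_pencil N E A"
  shows "\<exists>P T bs. kronecker_form N E A P T bs"
proof -
  note sq = mult_carrier_mat[of _ N N _ N]
  note assoc = assoc_mult_mat[of _ N N _ N _ N]
  from assms obtain a where E: "E \<in> carrier_mat N N" and A: "A \<in> carrier_mat N N" and a: "det (a \<cdot>\<^sub>m E - A) \<noteq> 0"
    by (auto simp: regular_pencil_def)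
  define G where "G = a \<cdot>\<^sub>m E - A"
  have G: "G \<in> carrier_mat N N" unfolding G_def using A by (rule minus_carrier_mat)
  have "invertible_mat G" using a G by (simp add: invertible_mat_iff_det G_def)
  then obtain Gi where Gi: "Gi \<in> carrier_mat N N" "G * Gi = 1\<^sub>m N" "Gi * G = 1\<^sub>m N"
    using G by (rule invertible_matE)
  define K where "K = Gi * E"
  have K: "K \<in> carrier_mat N N" using Gi E by (simp add: K_def sq)
  have "A = a \<cdot>\<^sub>m E - G" unfolding G_def using A E by (intro eq_matI) auto
  then have GiA: "Gi * A = a \<cdot>\<^sub>m K - 1\<^sub>m N"
    using Gi E G by (simp add: K_def mult_minus_distrib_mat[of _ N N _ N] mult_smult_distrib[of _ N N _ N])
  obtain as where "char_poly K = (\<Prod>a\<leftarrow>as. [:- a, 1:])" using char_poly_factorized[OF K] by auto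
  from jordan_nf_exists[OF K this] obtain n_as where n_as: "0 \<notin> fst ` set n_as" "similar_mat K (jordan_matrix n_as)"
    unfolding jordan_nf_def by blast
  from n_as(2) obtain S Si where "similar_mat_wit K (jordan_matrix n_as) S Si"
    unfolding similar_mat_def by blast
  then have S: "S \<in> carrier_mat N N" "Si \<in> carrier_mat N N" "jordan_matrix n_as \<in> carrier_mat N N"
    "S * Si = 1\<^sub>m N" "Si * S = 1\<^sub>m N" "K = S * jordan_matrix n_as * Si"
    unfolding similar_mat_wit_def Let_def carrier_matD(1)[OF K] by blast+
  have N: "sum_list (map fst n_as) = N" using carrier_matD(1)[OF S(3)] by simp
  define M where "M = jordan_matrix n_as"
  have M: "M \<in> carrier_mat N N" using S(3) by (simp add: M_def)
  have aM: "a \<cdot>\<^sub>m M - 1\<^sub>m N \<in> carrier_mat N N" by (rule minus_carrier_mat) simp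
  obtain P1 T1 bs where 1: "P1 \<in> carrier_mat N N" "T1 \<in> carrier_mat N N" "invertible_mat P1" "invertible_mat T1"
    "0 \<notin> fst ` set bs" "P1 * M * T1 = diag_block_mat (map kronecker_E bs)"
    "P1 * (a \<cdot>\<^sub>m M - 1\<^sub>m N) * T1 = diag_block_mat (map kronecker_A bs)"
    using jordan_matrix_kronecker[OF n_as(1), of a] unfolding N M_def by auto
  have cancel: "Si * (S * X) = X" if "X \<in> carrier_mat N N" for X
    using that S by (metis assoc left_mult_one_mat)
  have SKS: "Si * K * S = M"
    unfolding S(6) using S M by (simp add: assoc sq M_def[symmetric] cancel)
  have SAS: "Si * (a \<cdot>\<^sub>m K - 1\<^sub>m N) * S = a \<cdot>\<^sub>m M - 1\<^sub>m N"
    unfolding SKS[symmetric] using S(1,2,5) K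
    by (simp add: mult_minus_distrib_mat[of _ N N _ N] minus_mult_distrib_mat[of _ N N _ _ N] sq
        mult_smult_distrib[of _ N N _ N] mult_smult_assoc_mat[of _ N N _ N])
  define P where "P = P1 * Si * Gi"
  define T where "T = S * T1"
  have "P * E * T = P1 * (Si * (Gi * E) * S) * T1"
    unfolding P_def T_def using 1(1,2) S(1,2) Gi E by (simp add: assoc sq)
  then have PE: "P * E * T = diag_block_mat (map kronecker_E bs)"
    unfolding K_def[symmetric] SKS 1(6) .
  have "P * A * T = P1 * (Si * (Gi * A) * S) * T1"
    unfolding P_def T_def using 1(1,2) S(1,2) Gi A by (simp add: assoc sq)
  then have PA: "P * A * T = diag_block_mat (map kronecker_A bs)"
    unfolding GiA SAS 1(7) .
  have inv: "invertible_mat Si" "invertible_mat S" "invertible_mat Gi"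
    using S Gi G by (auto intro: invertible_matI)
  have "kronecker_form N E A P T bs"
    unfolding kronecker_form_def
    using PE PA 1 S(1,2) Gi inv
    by (auto simp: P_def T_def intro!: sq invertible_mat_mult[of _ N])
  then show ?thesis by blast
qed

section \<open>Chains of the Kronecker form\<close>

abbreviation block_offset :: "(nat \<times> pencil_ev) list \<Rightarrow> nat \<Rightarrow> nat" where
  "block_offset bs i \<equiv> sum_list (map fst (take i bs))"

lemma block_offset_Suc: "i < length bs \<Longrightarrow> block_offset bs (Suc i) = block_offset bs i + fst (bs ! i)"
  by (simp add: take_Suc_conv_app_nth)

lemma block_offset_mono: "i \<le> j \<Longrightarrow> block_offset bs i \<le> block_offset bs j"
  by (metis le_add1 le_Suc_ex map_append sum_list_append take_add)

lemma block_offset_inj: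
  assumes "i < length bs" "j < fst (bs ! i)" "i' < length bs" "j' < fst (bs ! i')"
    and "block_offset bs i + j = block_offset bs i' + j'"
  shows "i = i' \<and> j = j'"
proof -
  have "False" if "p < p'" "p < length bs" "q < fst (bs ! p)" "block_offset bs p + q = block_offset bs p' + q'" for p p' q q'
    using that block_offset_Suc[of p bs] block_offset_mono[of "Suc p" p' bs] by simp
  then have "i = i'" using assms by (metis linorder_neqE_nat)
  then show ?thesis using assms by simp
qed

lemma block_offset_less:
  assumes "i < length bs" "j < fst (bs ! i)"
  shows "block_offset bs i + j < sum_list (map fst bs)"
  using assms block_offset_Suc[of i bs] block_offset_mono[of "Suc i" "length bs" bs] by simp

lemma block_offset_cases:
  assumes "r < sum_list (map fst bs)"
  obtains i j where "i < length bs" "j < fst (bs ! i)" "r = block_offset bs i + j"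
proof -
  have "\<exists>i j. i < length bs \<and> j < fst (bs ! i) \<and> r = block_offset bs i + j"
    if "l \<le> length bs" "r < block_offset bs l" for l
    using that
  proof (induction l)
    case (Suc l)
    show ?case
    proof (cases "r < block_offset bs l")
      case False
      then show ?thesis using Suc.prems block_offset_Suc[of l bs]
        by (intro exI[of _ l] exI[of _ "r - block_offset bs l"]) auto
    qed (use Suc in simp)
  qed simp
  from this[of "length bs"] assms that show thesis by auto
qed

text \<open>Padding with zeros outside block \<open>i\<close>; the recursion follows that of
  \<open>diag_block_mat\<close>, so each block acts on its own.\<close>

fun block_embed :: "(nat \<times> pencil_ev) list \<Rightarrow> nat \<Rightarrow> complex vec \<Rightarrow> complex vec" where
  "block_embed [] i x = 0\<^sub>v 0"
| "block_embed (b # bs) 0 x = x @\<^sub>v 0\<^sub>v (sum_list (map fst bs))"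
| "block_embed (b # bs) (Suc i) x = 0\<^sub>v (fst b) @\<^sub>v block_embed bs i x"

lemma block_embed_carrier:
  "i < length bs \<Longrightarrow> x \<in> carrier_vec (fst (bs ! i)) \<Longrightarrow> block_embed bs i x \<in> carrier_vec (sum_list (map fst bs))"
  by (induction bs i x rule: block_embed.induct) auto

lemma block_embed_zero:
  "i < length bs \<Longrightarrow> block_embed bs i (0\<^sub>v (fst (bs ! i))) = 0\<^sub>v (sum_list (map fst bs))"
  by (induction bs i "0\<^sub>v (fst (bs ! i)) :: complex vec" rule: block_embed.induct) auto

lemma block_embed_combination:
  "i < length bs \<Longrightarrow> x \<in> carrier_vec (fst (bs ! i)) \<Longrightarrow> y \<in> carrier_vec (fst (bs ! i)) \<Longrightarrow>
    block_embed bs i (a \<cdot>\<^sub>v x + y) = a \<cdot>\<^sub>v block_embed bs i x + block_embed bs i y"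
proof (induction bs arbitrary: i)
  case (Cons b bs)
  show ?case
  proof (cases i)
    case 0
    with Cons.prems show ?thesis
      by (simp add: append_vec_smult append_vec_add[of _ "fst b" _ _ "sum_list (map fst bs)"])
  next
    case (Suc i')
    with Cons show ?thesis
      by (simp add: append_vec_smult append_vec_add[of _ "fst b" _ _ "sum_list (map fst bs)"] block_embed_carrier)
  qed
qed simp

lemma block_embed_unit:
  "i < length bs \<Longrightarrow> j < fst (bs ! i) \<Longrightarrow>
    block_embed bs i (unit_vec (fst (bs ! i)) j) = unit_vec (sum_list (map fst bs)) (block_offset bs i + j)"
proof (induction bs arbitrary: i)
  case (Cons b bs)
  show ?case
  proof (cases i)
    case 0
    with Cons.prems show ?thesis by (intro eq_vecI) (auto simp: unit_vec_def)
  next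
    case (Suc i')
    with Cons show ?thesis by (intro eq_vecI) (auto simp: unit_vec_def)
  qed
qed simp

lemma diag_block_mat_embed:
  fixes K :: "nat \<times> pencil_ev \<Rightarrow> complex mat"
  assumes K: "\<And>b. K b \<in> carrier_mat (fst b) (fst b)"
  shows "i < length bs \<Longrightarrow> x \<in> carrier_vec (fst (bs ! i)) \<Longrightarrow>
    diag_block_mat (map K bs) *\<^sub>v block_embed bs i x = block_embed bs i (K (bs ! i) *\<^sub>v x)"
proof (induction bs arbitrary: i)
  case (Cons b bs)
  let ?l = "sum_list (map fst bs)"
  have D: "diag_block_mat (map K bs) \<in> carrier_mat ?l ?l"
    using K by (intro carrier_matI) (auto simp: dim_diag_block_mat o_def carrier_matD[OF K])
  have eq: "diag_block_mat (map K (b # bs)) =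
      four_block_mat (K b) (0\<^sub>m (fst b) ?l) (0\<^sub>m ?l (fst b)) (diag_block_mat (map K bs))"
    by (simp add: Let_def carrier_matD[OF K] carrier_matD[OF D])
  show ?case
  proof (cases i)
    case 0
    have "diag_block_mat (map K (b # bs)) *\<^sub>v (x @\<^sub>v 0\<^sub>v ?l) = (K b *\<^sub>v x) @\<^sub>v 0\<^sub>v ?l"
      unfolding eq using Cons.prems 0 mult_mat_vec_carrier[OF K, of x b] mult_mat_zero_vec[OF D]
      by (subst four_block_mat_mult_vec[OF K _ _ D]) auto
    with 0 show ?thesis by simp
  next
    case (Suc i')
    define y where "y = block_embed bs i' x"
    have y: "y \<in> carrier_vec ?l" using Cons.prems Suc by (auto simp: y_def intro: block_embed_carrier)
    have "diag_block_mat (map K (b # bs)) *\<^sub>v (0\<^sub>v (fst b) @\<^sub>v y) = 0\<^sub>v (fst b) @\<^sub>v (diag_block_mat (map K bs) *\<^sub>v y)"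
      unfolding eq using y mult_mat_vec_carrier[OF D y] mult_mat_zero_vec[OF K, of b]
      by (subst four_block_mat_mult_vec[OF K _ _ D]) auto
    with Suc Cons show ?thesis by (simp add: y_def del: diag_block_mat.simps)
  qed
qed simp

lemma jordan_block_mult_unit:
  fixes z :: complex
  assumes "j < k"
  shows "jordan_block k z *\<^sub>v unit_vec k j = z \<cdot>\<^sub>v unit_vec k j + (if j = 0 then 0\<^sub>v k else unit_vec k (j - 1))"
  using assms by (subst mult_mat_unit_vec[of _ k]) (auto simp: jordan_block_def unit_vec_def intro!: eq_vecI)

lemma kronecker_carrier: "kronecker_E b \<in> carrier_mat (fst b) (fst b)" "kronecker_A b \<in> carrier_mat (fst b) (fst b)"
  by (intro carrier_matI; simp)+

lemma kronecker_form_size: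
  assumes "kronecker_form N E A P T bs" "E \<in> carrier_mat N N"
  shows "sum_list (map fst bs) = N"
proof -
  have "P \<in> carrier_mat N N" "T \<in> carrier_mat N N" using assms(1) by (simp_all add: kronecker_form_def)
  then have "P * E * T \<in> carrier_mat N N" using assms(2) by (blast intro: mult_carrier_mat)
  then have "diag_block_mat (map kronecker_E bs) \<in> carrier_mat N N"
    using assms(1) by (simp only: kronecker_form_def)
  from carrier_matD(1)[OF this] show ?thesis by simp
qed

text \<open>Columns of \<open>T\<close> are images of unit vectors, on which the canonical blocks
  act by a shift; injectivity of \<open>P\<close> transfers the relation to \<open>E\<close> and
  \<open>A\<close>.\<close>

lemma kronecker_form_chain:
  assumes K: "kronecker_form N E A P T bs" and E: "E \<in> carrier_mat N N" and A: "A \<in> carrier_mat N N"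
    and i: "i < length bs"
  shows "pencil_chain N E A (snd (bs ! i)) (fst (bs ! i)) (chain_vec T bs i)"
proof -
  let ?k = "fst (bs ! i)"
  have P: "P \<in> carrier_mat N N" "invertible_mat P" and T: "T \<in> carrier_mat N N"
    and PE: "P * E * T = diag_block_mat (map kronecker_E bs)"
    and PA: "P * A * T = diag_block_mat (map kronecker_A bs)"
    using K by (auto simp: kronecker_form_def)
  have N: "sum_list (map fst bs) = N" using kronecker_form_size[OF K E] .
  define u where "u j = block_embed bs i (unit_vec ?k j)" for j
  have uc: "u j \<in> carrier_vec N" for j using block_embed_carrier[OF i] by (simp add: u_def N)
  have ch: "chain_vec T bs i j = T *\<^sub>v u j" if "j < ?k" for j
    using that block_offset_less[OF i that] T
    by (simp add: chain_vec_def u_def block_embed_unit[OF i that] N mult_mat_unit_vec)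
  \<comment> \<open>The preceding unit vector of the same block, or zero at its start;
    \<open>T\<close> maps it to \<open>chain_pred\<close>.\<close>
  define pu where "pu j = block_embed bs i (if j = 0 then 0\<^sub>v ?k else unit_vec ?k (j - 1))" for j
  have puc: "pu j \<in> carrier_vec N" for j
    using block_embed_carrier[OF i] by (simp add: pu_def N)
  have pch: "chain_pred N (chain_vec T bs i) j = T *\<^sub>v pu j" if "j < ?k" for j
    using that ch[of "j - 1"] mult_mat_zero_vec[OF T]
    by (cases j) (simp_all add: pu_def u_def block_embed_zero[OF i] N)
  have cancel: "M *\<^sub>v (T *\<^sub>v v) = M' *\<^sub>v (T *\<^sub>v w)"
    if "M \<in> carrier_mat N N" "M' \<in> carrier_mat N N" "v \<in> carrier_vec N" "w \<in> carrier_vec N"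
      "(P * M * T) *\<^sub>v v = (P * M' * T) *\<^sub>v w" for M M' v w
  proof (rule invertible_mat_injective[OF P(2,1)])
    show "P *\<^sub>v (M *\<^sub>v (T *\<^sub>v v)) = P *\<^sub>v (M' *\<^sub>v (T *\<^sub>v w))"
      using that P(1) T by (simp add: assoc_mult_mat_vec[of _ N N _ N] mult_carrier_mat[of _ N N _ N] mult_mat_vec_carrier[of _ N N])
  qed (use that T in \<open>auto intro!: mult_mat_vec_carrier[of _ N N]\<close>)
  show ?thesis unfolding pencil_chain_def
  proof (intro allI impI conjI)
    fix j assume j: "j < ?k"
    show "chain_vec T bs i j \<in> carrier_vec N" using ch[OF j] uc T by (auto intro: mult_mat_vec_carrier)
    show "case snd (bs ! i) of Finite z \<Rightarrow>
        A *\<^sub>v chain_vec T bs i j = E *\<^sub>v (z \<cdot>\<^sub>v chain_vec T bs i j + chain_pred N (chain_vec T bs i) j)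
      | Infinity \<Rightarrow> E *\<^sub>v chain_vec T bs i j = A *\<^sub>v chain_pred N (chain_vec T bs i) j"
    proof (cases "snd (bs ! i)")
      case (Finite z)
      then have b: "kronecker_E (bs ! i) = 1\<^sub>m ?k" "kronecker_A (bs ! i) = jordan_block ?k z"
        by (cases "bs ! i"; simp)+
      have uE: "diag_block_mat (map kronecker_E bs) *\<^sub>v block_embed bs i x = block_embed bs i x"
        if "x \<in> carrier_vec ?k" for x
        using diag_block_mat_embed[of kronecker_E, OF kronecker_carrier(1) i that] that
        by (simp add: b)
      have eq: "diag_block_mat (map kronecker_A bs) *\<^sub>v u j = z \<cdot>\<^sub>v u j + pu j"
        using diag_block_mat_embed[of kronecker_A, OF kronecker_carrier(2) i, of "unit_vec ?k j"]
        by (simp add: b jordan_block_mult_unit[OF j] block_embed_combination[OF i] u_def pu_def)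
      also have "\<dots> = block_embed bs i (z \<cdot>\<^sub>v unit_vec ?k j + (if j = 0 then 0\<^sub>v ?k else unit_vec ?k (j - 1)))"
        by (simp add: block_embed_combination[OF i] u_def pu_def)
      also have "\<dots> = diag_block_mat (map kronecker_E bs) *\<^sub>v \<dots>" by (rule uE[symmetric]) simp
      also have "block_embed bs i (z \<cdot>\<^sub>v unit_vec ?k j + (if j = 0 then 0\<^sub>v ?k else unit_vec ?k (j - 1))) = z \<cdot>\<^sub>v u j + pu j"
        by (simp add: block_embed_combination[OF i] u_def pu_def)
      finally have "A *\<^sub>v (T *\<^sub>v u j) = E *\<^sub>v (T *\<^sub>v (z \<cdot>\<^sub>v u j + pu j))"
        using uc puc by (intro cancel[OF A E]) (auto simp: PA PE)
      also have "T *\<^sub>v (z \<cdot>\<^sub>v u j + pu j) = z \<cdot>\<^sub>v (T *\<^sub>v u j) + T *\<^sub>v pu j"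
        using uc puc T by (simp add: mult_add_distrib_mat_vec[OF T] mult_mat_vec[OF T])
      finally show ?thesis by (simp add: Finite ch[OF j] pch[OF j])
    next
      case Infinity
      then have b: "kronecker_E (bs ! i) = jordan_block ?k 0" "kronecker_A (bs ! i) = 1\<^sub>m ?k"
        by (cases "bs ! i"; simp)+
      have "diag_block_mat (map kronecker_E bs) *\<^sub>v u j = pu j"
        using diag_block_mat_embed[of kronecker_E, OF kronecker_carrier(1) i, of "unit_vec ?k j"]
        by (simp add: b nilpotent_block_mult_unit[OF j] u_def pu_def)
      also have "\<dots> = diag_block_mat (map kronecker_A bs) *\<^sub>v pu j"
        using diag_block_mat_embed[of kronecker_A, OF kronecker_carrier(2) i, of "if j = 0 then 0\<^sub>v ?k else unit_vec ?k (j - 1)"]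
        by (simp add: b pu_def)
      finally have "E *\<^sub>v (T *\<^sub>v u j) = A *\<^sub>v (T *\<^sub>v pu j)"
        using uc puc by (intro cancel[OF E A]) (auto simp: PA PE)
      then show ?thesis by (simp add: Infinity ch[OF j] pch[OF j])
    qed
  qed
qed

text \<open>A relation among chosen columns, extended by zero, is a kernel vector of
  \<open>T\<close>; \<open>idx\<close> lets the chosen columns be indexed by pairs of block and
  position.\<close>

lemma columns_independent:
  fixes T :: "'a :: field mat"
  assumes T: "T \<in> carrier_mat N N" "invertible_mat T" and I: "finite I" "inj_on idx I" "idx ` I \<subseteq> {..<N}"
    and 0: "\<And>k. k < N \<Longrightarrow> (\<Sum>p\<in>I. c p * col T (idx p) $ k) = 0"
  shows "\<forall>p\<in>I. c p = 0"
proof -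
  define d where "d = vec N (\<lambda>r. \<Sum>p\<in>I. if idx p = r then c p else 0)"
  have d: "d \<in> carrier_vec N" by (simp add: d_def)
  have "(T *\<^sub>v d) $ k = 0" if k: "k < N" for k
  proof -
    have "(T *\<^sub>v d) $ k = (\<Sum>r<N. \<Sum>p\<in>I. T $$ (k, r) * (if idx p = r then c p else 0))"
      unfolding mult_mat_vec_index[OF T(1) d k] by (simp add: d_def sum_distrib_left)
    also have "\<dots> = (\<Sum>p\<in>I. \<Sum>r<N. if idx p = r then T $$ (k, r) * c p else 0)"
      by (subst sum.swap) (simp add: if_distrib cong: if_cong)
    also have "\<dots> = (\<Sum>p\<in>I. c p * col T (idx p) $ k)"
      using I T(1) k by (intro sum.cong) (auto simp: sum.delta' mult.commute)
    finally show ?thesis using 0[OF k] by simp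
  qed
  then have "T *\<^sub>v d = 0\<^sub>v N" using T by (intro eq_vecI) auto
  then have "d = 0\<^sub>v N" using T d by (auto simp: invertible_mat_iff_injective[OF T(1)])
  show ?thesis
  proof
    fix p assume p: "p \<in> I"
    then have "idx p < N" using I by auto
    with \<open>d = 0\<^sub>v N\<close> have "d $ idx p = 0" by simp
    moreover have "d $ idx p = (\<Sum>q\<in>I. if q = p then c q else 0)"
      using \<open>idx p < N\<close> p I(2) unfolding d_def by (simp, intro sum.cong) (auto dest: inj_onD)
    ultimately show "c p = 0" using p I(1) by (simp add: sum.delta')
  qed
qed

section \<open>Outer and inner chain vectors\<close>

context definite_pencil
begin

text \<open>Any chain qualifies, not only those of one Kronecker form, so that chains found inside
  the deflating subspace can be measured against those of the canonical subspace.\<close>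

definition outer_vec :: "complex vec \<Rightarrow> bool" where
  "outer_vec v \<longleftrightarrow> (\<exists>a k w i. chain a k w \<and> i < k \<and> v = w i \<and> (d_unstable a \<or> d_critical a \<and> null v))"

definition inner_vec :: "complex vec \<Rightarrow> bool" where
  "inner_vec v \<longleftrightarrow> (\<exists>a k w i. chain a k w \<and> i < k \<and> v = w i \<and> (d_stable a \<or> d_critical a \<and> null v))"

text \<open>Unstable vectors are orthogonal to unstable and critical ones since the eigenvalues are
  nonresonant; two critical vectors may be resonant, and there \<open>null\<close> takes
  over.\<close>

lemma outer_vec_neutral: "outer_vec v \<Longrightarrow> outer_vec w \<Longrightarrow> hform n v w = 0"
  unfolding outer_vec_def using chain_orthogonal nonresonant_outer null_neutral by metis

lemma inner_vec_neutral: "inner_vec v \<Longrightarrow> inner_vec w \<Longrightarrow> hform n v w = 0"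
  unfolding inner_vec_def using chain_orthogonal nonresonant_inner null_neutral by metis

end

section \<open>Counting chains\<close>

lemma sum_list_filter_nth:
  "sum_list (map f (filter Q xs)) = (\<Sum>i<length xs. if Q (xs ! i) then f (xs ! i) else (0 :: nat))"
  by (induction xs) (simp_all add: sum.lessThan_Suc_shift del: sum.lessThan_Suc cong: if_cong)

context definite_pencil
begin

text \<open>Rounding up makes the outer vectors and the inner vectors each neutral, so that together they
  have at most \<open>2n\<close> elements; this forces the critical sizes to be even.\<close>
definition outer_length :: "nat \<times> pencil_ev \<Rightarrow> nat" where
  "outer_length b = (if d_unstable (snd b) then fst b else if d_critical (snd b) then (fst b + 1) div 2 else 0)"

definition inner_length :: "nat \<times> pencil_ev \<Rightarrow> nat" where
  "inner_length b = (if d_stable (snd b) then fst b else if d_critical (snd b) then (fst b + 1) div 2 else 0)"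

definition outer_index :: "(nat \<times> pencil_ev) list \<Rightarrow> (nat \<times> nat) set" where
  "outer_index bs = (SIGMA i:{..<length bs}. {..<outer_length (bs ! i)})"

context
  fixes P T :: "complex mat" and bs :: "(nat \<times> pencil_ev) list"
  assumes K: "kronecker_form (2 * n) E A P T bs"
begin

text \<open>\<open>len\<close> stands for the outer or the inner length, so both families share one
  independence proof.\<close>

lemma chain_vec_independent:
  assumes len: "\<And>b. len b \<le> fst b"
    and 0: "\<And>k. k < 2 * n \<Longrightarrow>
      (\<Sum>p\<in>(SIGMA i:{..<length bs}. {..<len (bs ! i)}). c p * chain_vec T bs (fst p) (snd p) $ k) = 0"
  shows "\<forall>p\<in>(SIGMA i:{..<length bs}. {..<len (bs ! i)}). c p = 0"
proof -
  let ?I = "SIGMA i:{..<length bs}. {..<len (bs ! i)}"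
  have len': "fst p < length bs" "snd p < fst (bs ! fst p)" if "p \<in> ?I" for p
    using that len[of "bs ! fst p"] by auto
  show ?thesis
  proof (rule columns_independent[of T "2 * n" ?I "\<lambda>p. block_offset bs (fst p) + snd p"])
    show "T \<in> carrier_mat (2 * n) (2 * n)" "invertible_mat T" using K by (simp_all add: kronecker_form_def)
    show "finite ?I" by simp
    show "inj_on (\<lambda>p. block_offset bs (fst p) + snd p) ?I"
      using len' by (intro inj_onI) (metis block_offset_inj prod.collapse)
    show "(\<lambda>p. block_offset bs (fst p) + snd p) ` ?I \<subseteq> {..<2 * n}"
      using len' block_offset_less kronecker_form_size[OF K E] by fastforce
    show "(\<Sum>p\<in>?I. c p * col T (block_offset bs (fst p) + snd p) $ k) = 0" if "k < 2 * n" for k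
      using 0[OF that] by (simp add: chain_vec_def)
  qed
qed

lemma outer_chain_vec:
  assumes "i < length bs" "j < outer_length (bs ! i)"
  shows "outer_vec (chain_vec T bs i j)"
proof -
  have ch: "chain (snd (bs ! i)) (fst (bs ! i)) (chain_vec T bs i)"
    by (rule kronecker_form_chain[OF K E A assms(1)])
  show ?thesis
  proof (cases "d_unstable (snd (bs ! i))")
    case True
    then have "j < fst (bs ! i)" using assms(2) by (simp add: outer_length_def)
    with True ch show ?thesis unfolding outer_vec_def by blast
  next
    case False
    with assms(2) have c: "d_critical (snd (bs ! i))" and j: "j < (fst (bs ! i) + 1) div 2"
      by (simp_all add: outer_length_def split: if_splits)
    from c obtain s where s: "snd (bs ! i) = Finite s" "cmod s = 1" by (cases "snd (bs ! i)") auto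
    have "null (chain_vec T bs i j)"
      using critical_chain_first_half[OF ch[unfolded s(1)] s(2)] j by simp
    moreover have "j < fst (bs ! i)" using j by linarith
    ultimately show ?thesis unfolding outer_vec_def using ch c by blast
  qed
qed

lemma inner_chain_vec:
  assumes "i < length bs" "j < inner_length (bs ! i)"
  shows "inner_vec (chain_vec T bs i j)"
proof -
  have ch: "chain (snd (bs ! i)) (fst (bs ! i)) (chain_vec T bs i)"
    by (rule kronecker_form_chain[OF K E A assms(1)])
  show ?thesis
  proof (cases "d_stable (snd (bs ! i))")
    case True
    then have "j < fst (bs ! i)" using assms(2) by (simp add: inner_length_def)
    with True ch show ?thesis unfolding inner_vec_def by blast
  next
    case False
    with assms(2) have c: "d_critical (snd (bs ! i))" and j: "j < (fst (bs ! i) + 1) div 2"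
      by (simp_all add: inner_length_def split: if_splits)
    from c obtain s where s: "snd (bs ! i) = Finite s" "cmod s = 1" by (cases "snd (bs ! i)") auto
    have "null (chain_vec T bs i j)"
      using critical_chain_first_half[OF ch[unfolded s(1)] s(2)] j by simp
    moreover have "j < fst (bs ! i)" using j by linarith
    ultimately show ?thesis unfolding inner_vec_def using ch c by blast
  qed
qed

lemma outer_length_le: "outer_length b \<le> fst b" and inner_length_le: "inner_length b \<le> fst b"
  by (cases "fst b"; simp add: outer_length_def inner_length_def)+

lemma outer_card_le: "(\<Sum>i<length bs. outer_length (bs ! i)) \<le> n"
proof -
  let ?I = "SIGMA i:{..<length bs}. {..<outer_length (bs ! i)}"
  have "card ?I \<le> n + 0"
  proof (rule neutral_family_card[of ?I n "\<lambda>p. ($) (chain_vec T bs (fst p) (snd p))"])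
    show "hform n (chain_vec T bs (fst p) (snd p)) (chain_vec T bs (fst q) (snd q)) = 0"
      if "p \<in> ?I" "q \<in> ?I" for p q
      using that by (intro outer_vec_neutral outer_chain_vec) auto
    show "\<forall>p\<in>?I. c p = 0" if "\<And>k. k < 2 * n + 0 \<Longrightarrow> (\<Sum>p\<in>?I. c p * chain_vec T bs (fst p) (snd p) $ k) = 0" for c
      by (rule chain_vec_independent[OF outer_length_le]) (use that in simp)
  qed simp
  then show ?thesis by simp
qed

lemma inner_card_le: "(\<Sum>i<length bs. inner_length (bs ! i)) \<le> n"
proof -
  let ?I = "SIGMA i:{..<length bs}. {..<inner_length (bs ! i)}"
  have "card ?I \<le> n + 0"
  proof (rule neutral_family_card[of ?I n "\<lambda>p. ($) (chain_vec T bs (fst p) (snd p))"])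
    show "hform n (chain_vec T bs (fst p) (snd p)) (chain_vec T bs (fst q) (snd q)) = 0"
      if "p \<in> ?I" "q \<in> ?I" for p q
      using that by (intro inner_vec_neutral inner_chain_vec) auto
    show "\<forall>p\<in>?I. c p = 0" if "\<And>k. k < 2 * n + 0 \<Longrightarrow> (\<Sum>p\<in>?I. c p * chain_vec T bs (fst p) (snd p) $ k) = 0" for c
      by (rule chain_vec_independent[OF inner_length_le]) (use that in simp)
  qed simp
  then show ?thesis by simp
qed

text \<open>The block sizes sum to \<open>2 * n\<close>. Outer and inner length together cover each
  block and sum to at most \<open>n\<close> each, so equality holds in every block; for a critical
  block of size \<open>k\<close> this reads \<open>k = 2 * ((k + 1) div 2)\<close>.\<close>

lemma block_lengths:
  shows "(\<Sum>i<length bs. outer_length (bs ! i)) = n" "(\<Sum>i<length bs. inner_length (bs ! i)) = n"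
    and "i < length bs \<Longrightarrow> fst (bs ! i) = outer_length (bs ! i) + inner_length (bs ! i)"
proof -
  let ?s = "\<lambda>f. \<Sum>i<length bs. f (bs ! i) :: nat"
  have le: "fst b \<le> outer_length b + inner_length b" for b :: "nat \<times> pencil_ev"
    using pencil_ev_trichotomy(1)[of "snd b"] by (auto simp: outer_length_def inner_length_def)
  have tot: "?s fst = 2 * n"
    using kronecker_form_size[OF K E] by (simp add: sum_list_sum_nth atLeast0LessThan)
  moreover have "?s fst \<le> ?s (\<lambda>b. outer_length b + inner_length b)" by (intro sum_mono le)
  moreover have "?s (\<lambda>b. outer_length b + inner_length b) = ?s outer_length + ?s inner_length" by (simp add: sum.distrib)
  ultimately show "?s outer_length = n" "?s inner_length = n" using outer_card_le inner_card_le by linarith+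
  then have "?s fst = ?s (\<lambda>b. outer_length b + inner_length b)" using tot by (simp add: sum.distrib)
  then show "i < length bs \<Longrightarrow> fst (bs ! i) = outer_length (bs ! i) + inner_length (bs ! i)"
    using sum_mono_inv[of "\<lambda>i. fst (bs ! i)" "{..<length bs}" "\<lambda>i. outer_length (bs ! i) + inner_length (bs ! i)" i] le
    by simp
qed

lemma critical_even:
  assumes "i < length bs" "d_critical (snd (bs ! i))"
  shows "even (fst (bs ! i))"
proof -
  have "fst (bs ! i) = 2 * ((fst (bs ! i) + 1) div 2)"
    using block_lengths(3)[OF assms(1)] assms(2) pencil_ev_trichotomy[of "snd (bs ! i)"]
    by (auto simp: outer_length_def inner_length_def)
  then show ?thesis by (metis dvd_triv_left)
qed

lemma outer_length_half:
  assumes "i < length bs" "d_critical (snd (bs ! i))"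
  shows "outer_length (bs ! i) = fst (bs ! i) div 2"
  using critical_even[OF assms] assms(2) pencil_ev_trichotomy[of "snd (bs ! i)"] by (auto simp: outer_length_def)

lemma split_blocks_kronecker: "split_blocks n bs"
proof -
  \<comment> \<open>Half of the total critical length: what the unstable blocks, and likewise the
    stable ones, leave of \<open>n\<close>.\<close>
  define r where "r = (\<Sum>i<length bs. if d_critical (snd (bs ! i)) then fst (bs ! i) div 2 else 0)"
  have "n = (\<Sum>i<length bs. (if d_unstable (snd (bs ! i)) then fst (bs ! i) else 0)
      + (if d_critical (snd (bs ! i)) then fst (bs ! i) div 2 else 0))"
    unfolding block_lengths(1)[symmetric]
    using critical_even pencil_ev_trichotomy by (intro sum.cong) (auto simp: outer_length_def)
  then have u: "n = sum_list (map fst (filter (\<lambda>b. d_unstable (snd b)) bs)) + r"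
    by (simp add: sum.distrib sum_list_filter_nth r_def)
  have "n = (\<Sum>i<length bs. (if d_stable (snd (bs ! i)) then fst (bs ! i) else 0)
      + (if d_critical (snd (bs ! i)) then fst (bs ! i) div 2 else 0))"
    unfolding block_lengths(2)[symmetric]
    using critical_even pencil_ev_trichotomy by (intro sum.cong) (auto simp: inner_length_def)
  then have s: "n = sum_list (map fst (filter (\<lambda>b. d_stable (snd b)) bs)) + r"
    by (simp add: sum.distrib sum_list_filter_nth r_def)
  have "\<forall>b\<in>set bs. d_critical (snd b) \<longrightarrow> even (fst b)"
    using critical_even by (metis in_set_conv_nth)
  with u s show ?thesis unfolding split_blocks_def by (intro exI[of _ r]) auto
qed

lemma card_outer_index: "card (outer_index bs) = n"
  using block_lengths(1) by (simp add: outer_index_def)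

lemma outer_index_chain_vecs:
  "(\<lambda>p. chain_vec T bs (fst p) (snd p)) ` outer_index bs =
    {chain_vec T bs i j | i j. i < length bs \<and> d_unstable (snd (bs ! i)) \<and> j < fst (bs ! i)} \<union>
    {chain_vec T bs i j | i j. i < length bs \<and> d_critical (snd (bs ! i)) \<and> j < fst (bs ! i) div 2}"
  (is "_ ` _ = ?U \<union> ?C")
proof -
  have iff: "j < outer_length (bs ! i) \<longleftrightarrow> d_unstable (snd (bs ! i)) \<and> j < fst (bs ! i) \<or>
      d_critical (snd (bs ! i)) \<and> j < fst (bs ! i) div 2" if "i < length bs" for i j
    using outer_length_half[OF that] pencil_ev_trichotomy(4)[of "snd (bs ! i)"] by (auto simp: outer_length_def)
  have "(\<lambda>p. chain_vec T bs (fst p) (snd p)) ` outer_index bs =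
      {chain_vec T bs i j | i j. i < length bs \<and> j < outer_length (bs ! i)}"
    by (force simp: outer_index_def)
  also have "\<dots> = ?U \<union> ?C" using iff by blast
  finally show ?thesis .
qed

text \<open>The outer vectors of the Kronecker form are a neutral family of the maximal size
  \<open>n\<close>, so \<open>neutral_family_maximal\<close> captures every isotropic vector
  orthogonal to them.\<close>

lemma canonical_basis:
  obtains V where "V \<in> carrier_mat (2 * n) n" "set (cols V) = (\<lambda>p. chain_vec T bs (fst p) (snd p)) ` outer_index bs"
    "\<And>v. v \<in> carrier_vec (2 * n) \<Longrightarrow> hform n v v = 0 \<Longrightarrow> (\<And>w. outer_vec w \<Longrightarrow> hform n w v = 0) \<Longrightarrow>
      \<exists>c\<in>carrier_vec n. V *\<^sub>v c = v"
proof -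
  let ?f = "\<lambda>p. chain_vec T bs (fst p) (snd p)" and ?I = "outer_index bs"
  have fin: "finite ?I" by (simp add: outer_index_def)
  obtain L where L: "set L = ?I" "distinct L" using finite_distinct_list[OF fin] by auto
  have len: "length L = n" using L card_outer_index distinct_card by fastforce
  have fc: "?f p \<in> carrier_vec (2 * n)" if "p \<in> ?I" for p
    using that outer_length_le[of "bs ! fst p"]
    by (intro pencil_chain_carrier[OF kronecker_form_chain[OF K E A]]) (auto simp: outer_index_def)
  define V where "V = mat_of_cols (2 * n) (map ?f L)"
  have V: "V \<in> carrier_mat (2 * n) n" using len by (auto simp: V_def)
  have "cols V = map ?f L" unfolding V_def using fc L by (intro cols_mat_of_cols) auto
  then have cols: "set (cols V) = ?f ` ?I" using L by simp
  show thesis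
  proof (rule that[OF V cols])
    fix v assume v: "v \<in> carrier_vec (2 * n)" "hform n v v = 0" "\<And>w. outer_vec w \<Longrightarrow> hform n w v = 0"
    have "\<exists>c. \<forall>k<2 * n + 0. v $ k = (\<Sum>p\<in>?I. c p * ?f p $ k)"
    proof (rule neutral_family_maximal[of ?I n 0 "\<lambda>p. ($) (?f p)"])
      show "card ?I = n + 0" using card_outer_index by simp
      show "hform n (?f p) (?f q) = 0" if "p \<in> ?I" "q \<in> ?I" for p q
        using that by (intro outer_vec_neutral outer_chain_vec) (auto simp: outer_index_def)
      show "\<forall>p\<in>?I. c p = 0" if "\<And>k. k < 2 * n + 0 \<Longrightarrow> (\<Sum>p\<in>?I. c p * ?f p $ k) = 0" for c
        using that unfolding outer_index_def by (intro chain_vec_independent[OF outer_length_le]) simp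
      show "hform n (?f p) v = 0" if "p \<in> ?I" for p
        using that by (intro v(3) outer_chain_vec) (auto simp: outer_index_def)
    qed (use fin v in auto)
    then obtain c where c: "\<And>k. k < 2 * n \<Longrightarrow> v $ k = (\<Sum>p\<in>?I. c p * ?f p $ k)" by auto
    have "V *\<^sub>v vec n (\<lambda>i. c (L ! i)) = v"
    proof (rule eq_vecI)
      fix k assume "k < dim_vec v"
      then have k: "k < 2 * n" using v(1) by simp
      have "(V *\<^sub>v vec n (\<lambda>i. c (L ! i))) $ k = (\<Sum>i<n. V $$ (k, i) * c (L ! i))"
        by (subst mult_mat_vec_index[OF V _ k]) auto
      also have "\<dots> = (\<Sum>i<length L. ?f (L ! i) $ k * c (L ! i))"
        using k len by (intro sum.cong) (auto simp: V_def mat_of_cols_index)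
      also have "\<dots> = (\<Sum>p\<in>set L. ?f p $ k * c p)"
        using L(2) by (intro sum.reindex_bij_betw bij_betw_nth) auto
      also have "\<dots> = v $ k" using c[OF k] L(1) by (simp add: mult.commute)
      finally show "(V *\<^sub>v vec n (\<lambda>i. c (L ! i))) $ k = v $ k" .
    qed (use V v in auto)
    then show "\<exists>c\<in>carrier_vec n. V *\<^sub>v c = v" by (intro bexI[of _ "vec n (\<lambda>i. c (L ! i))"]) auto
  qed
qed

end

end

section \<open>Deflating subspaces\<close>

lemma mult_mat_vec_diff:
  fixes M :: "complex mat"
  assumes "M \<in> carrier_mat r c" "N \<in> carrier_mat r c" "v \<in> carrier_vec c"
  shows "(a \<cdot>\<^sub>m M - N) *\<^sub>v v = a \<cdot>\<^sub>v (M *\<^sub>v v) - N *\<^sub>v v"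
proof -
  have "a \<cdot>\<^sub>m M \<in> carrier_mat r c" using assms by simp
  then show ?thesis using assms by (simp add: minus_mult_distrib_mat_vec[of _ r c] smult_mat_mult_vec[of _ r c])
qed

text \<open>At a point where the large pencil is nonsingular, \<open>(s E - A) V\<close> is
  injective and factors through \<open>s E' - A'\<close>. This forces \<open>k \<le> l\<close>, so
  the small pencil is square and regular, and \<open>W\<close> inherits injectivity.\<close>

lemma deflating_witness_regular:
  assumes reg: "regular_pencil N E A" and wit: "deflating_witness N N E A k S l E' A'"
  obtains V W where "l = k" "E' \<in> carrier_mat k k" "A' \<in> carrier_mat k k" "V \<in> carrier_mat N k" "W \<in> carrier_mat N k"
    "S = {V *\<^sub>v c | c. c \<in> carrier_vec k}"
    "\<And>c. c \<in> carrier_vec k \<Longrightarrow> V *\<^sub>v c = 0\<^sub>v N \<Longrightarrow> c = 0\<^sub>v k"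
    "\<And>c. c \<in> carrier_vec k \<Longrightarrow> W *\<^sub>v c = 0\<^sub>v N \<Longrightarrow> c = 0\<^sub>v k"
    "\<And>c. c \<in> carrier_vec k \<Longrightarrow> E *\<^sub>v (V *\<^sub>v c) = W *\<^sub>v (E' *\<^sub>v c)"
    "\<And>c. c \<in> carrier_vec k \<Longrightarrow> A *\<^sub>v (V *\<^sub>v c) = W *\<^sub>v (A' *\<^sub>v c)"
    "\<And>s. det (s \<cdot>\<^sub>m E - A) \<noteq> 0 \<Longrightarrow> invertible_mat (s \<cdot>\<^sub>m E' - A')"
proof -
  have E: "E \<in> carrier_mat N N" and A: "A \<in> carrier_mat N N"
    using reg by (simp_all add: regular_pencil_def)
  from wit obtain V W where lk: "l \<le> k" and E'l: "E' \<in> carrier_mat l k" and A'l: "A' \<in> carrier_mat l k"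
    and bV: "basis_mat N k S V" and Wl: "W \<in> carrier_mat N l"
    and eq: "\<And>s. (s \<cdot>\<^sub>m E - A) * V = W * (s \<cdot>\<^sub>m E' - A')"
    unfolding deflating_witness_def by blast
  have V: "V \<in> carrier_mat N k" and rV: "vec_space.rank N V = k" and S: "vec_space.col_space N V = S"
    using bV by (simp_all add: basis_mat_def)
  have injV: "c = 0\<^sub>v k" if "c \<in> carrier_vec k" "V *\<^sub>v c = 0\<^sub>v N" for c
    using vec_space.full_rank_imp_injective[OF V rV that] .
  have eqv: "s \<cdot>\<^sub>v (E *\<^sub>v (V *\<^sub>v c)) - A *\<^sub>v (V *\<^sub>v c) = W *\<^sub>v ((s \<cdot>\<^sub>m E' - A') *\<^sub>v c)"
    if c: "c \<in> carrier_vec k" for s c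
  proof -
    have Vc: "V *\<^sub>v c \<in> carrier_vec N" using V c by (rule mult_mat_vec_carrier)
    have 1: "s \<cdot>\<^sub>m E - A \<in> carrier_mat N N" and 2: "s \<cdot>\<^sub>m E' - A' \<in> carrier_mat l k"
      using A A'l by (auto intro: minus_carrier_mat)
    have "(s \<cdot>\<^sub>m E - A) *\<^sub>v (V *\<^sub>v c) = ((s \<cdot>\<^sub>m E - A) * V) *\<^sub>v c"
      using assoc_mult_mat_vec[OF 1 V c] by simp
    also have "\<dots> = W *\<^sub>v ((s \<cdot>\<^sub>m E' - A') *\<^sub>v c)"
      unfolding eq using assoc_mult_mat_vec[OF Wl 2 c] by simp
    finally show ?thesis using mult_mat_vec_diff[OF E A Vc] by simp
  qed
  have key: "c = 0\<^sub>v k" if s: "det (s \<cdot>\<^sub>m E - A) \<noteq> 0" and c: "c \<in> carrier_vec k"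
    and 0: "W *\<^sub>v ((s \<cdot>\<^sub>m E' - A') *\<^sub>v c) = 0\<^sub>v N" for s c
  proof -
    have Vc: "V *\<^sub>v c \<in> carrier_vec N" using V c by (rule mult_mat_vec_carrier)
    have sE: "s \<cdot>\<^sub>m E - A \<in> carrier_mat N N" using A by (rule minus_carrier_mat)
    have "(s \<cdot>\<^sub>m E - A) *\<^sub>v (V *\<^sub>v c) = 0\<^sub>v N"
      using eqv[OF c, of s] 0 mult_mat_vec_diff[OF E A Vc] by simp
    moreover have "invertible_mat (s \<cdot>\<^sub>m E - A)" using s sE by (simp add: invertible_mat_iff_det)
    ultimately have "V *\<^sub>v c = 0\<^sub>v N" using Vc by (simp add: invertible_mat_iff_injective[OF sE])
    then show ?thesis using injV c by simp
  qed
  obtain s0 where s0: "det (s0 \<cdot>\<^sub>m E - A) \<noteq> 0" using reg by (auto simp: regular_pencil_def)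
  have "k \<le> l"
  proof (rule injective_mat_dim[of "s0 \<cdot>\<^sub>m E' - A'"])
    show "s0 \<cdot>\<^sub>m E' - A' \<in> carrier_mat l k" using A'l by (rule minus_carrier_mat)
    show "c = 0\<^sub>v k" if "c \<in> carrier_vec k" "(s0 \<cdot>\<^sub>m E' - A') *\<^sub>v c = 0\<^sub>v l" for c
      using key[OF s0 that(1)] mult_mat_zero_vec[OF Wl] that(2) by simp
  qed
  with lk have l: "l = k" by simp
  note E' = E'l[unfolded l] and A' = A'l[unfolded l] and W = Wl[unfolded l]
  have sq: "s \<cdot>\<^sub>m E' - A' \<in> carrier_mat k k" for s using A' by (rule minus_carrier_mat)
  have inv: "invertible_mat (s \<cdot>\<^sub>m E' - A')" if "det (s \<cdot>\<^sub>m E - A) \<noteq> 0" for s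
    unfolding invertible_mat_iff_injective[OF sq]
    using key[OF that] mult_mat_zero_vec[OF W] by simp
  show thesis
  proof (rule that[OF l E' A' V W])
    show "S = {V *\<^sub>v c | c. c \<in> carrier_vec k}"
      unfolding S[symmetric] vec_space.col_space_eq[OF V] using V mult_mat_vec_carrier[OF V] by auto
    show "c = 0\<^sub>v k" if c: "c \<in> carrier_vec k" "W *\<^sub>v c = 0\<^sub>v N" for c
    proof -
      \<comment> \<open>The small pencil at \<open>s0\<close> is onto, so \<open>key\<close> reaches
        every argument of \<open>W\<close>.\<close>
      obtain d where d: "d \<in> carrier_vec k" "(s0 \<cdot>\<^sub>m E' - A') *\<^sub>v d = c"
        using inv[OF s0] sq c(1) by (rule invertible_mat_surjective)
      then have "d = 0\<^sub>v k" using key[OF s0 d(1)] c(2) by simp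
      then show ?thesis using d(2) mult_mat_zero_vec[OF sq] by simp
    qed
    show AV: "A *\<^sub>v (V *\<^sub>v c) = W *\<^sub>v (A' *\<^sub>v c)" if c: "c \<in> carrier_vec k" for c
    proof -
      have v: "E *\<^sub>v (V *\<^sub>v c) \<in> carrier_vec N" "A *\<^sub>v (V *\<^sub>v c) \<in> carrier_vec N" "A' *\<^sub>v c \<in> carrier_vec k"
        "E' *\<^sub>v c \<in> carrier_vec k"
        using E A V A' E' c by (auto intro!: mult_mat_vec_carrier)
      \<comment> \<open>The pencil identity at \<open>s = 0\<close> isolates \<open>A\<close>; at
        \<open>s = 1\<close>, with this known, it gives \<open>E\<close>.\<close>
      have "- (A *\<^sub>v (V *\<^sub>v c)) = W *\<^sub>v (- (A' *\<^sub>v c))"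
        using eqv[OF c, of 0] v mult_mat_vec_diff[OF E' A' c, of 0] smult_vec_eq_0_iff[OF v(1), of 0]
           smult_vec_eq_0_iff[OF v(4), of 0]
        by (simp add: uminus_zero_vec_eq)
      moreover have "W *\<^sub>v (- (A' *\<^sub>v c)) = - (W *\<^sub>v (A' *\<^sub>v c))"
        using W v(3) by (rule mult_mat_vec_uminus)
      ultimately show ?thesis by simp
    qed
    show "E *\<^sub>v (V *\<^sub>v c) = W *\<^sub>v (E' *\<^sub>v c)" if c: "c \<in> carrier_vec k" for c
    proof -
      have v: "E *\<^sub>v (V *\<^sub>v c) \<in> carrier_vec N" "A *\<^sub>v (V *\<^sub>v c) \<in> carrier_vec N" "A' *\<^sub>v c \<in> carrier_vec k"
        "E' *\<^sub>v c \<in> carrier_vec k"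
        using E A V A' E' c by (auto intro!: mult_mat_vec_carrier)
      have "E *\<^sub>v (V *\<^sub>v c) - A *\<^sub>v (V *\<^sub>v c) = W *\<^sub>v (E' *\<^sub>v c - A' *\<^sub>v c)"
        using eqv[OF c, of 1] mult_mat_vec_diff[OF E' A' c, of 1] by simp
      also have "\<dots> = W *\<^sub>v (E' *\<^sub>v c) - A *\<^sub>v (V *\<^sub>v c)"
        using W v AV[OF c] by (simp add: mult_minus_distrib_mat_vec[of _ N k])
      finally show ?thesis
        using minus_vec_cancel_right[OF v(1) mult_mat_vec_carrier[OF W v(4)] v(2)] by simp
    qed
  qed (use injV inv in auto)
qed

text \<open>The last property is semi-stability for eigenvectors: an eigenvector in \<open>S\<close>
  makes the small pencil drop rank at \<open>z\<close>, so \<open>z\<close> is a contained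
  eigenvalue. The infinite eigenvalue is critical and imposes nothing.\<close>

lemma semi_stable_deflatingE:
  assumes reg: "regular_pencil N E A" and S: "c_semi_stable_deflating N N E A k S"
  obtains V W E' A' where "E' \<in> carrier_mat k k" "A' \<in> carrier_mat k k" "V \<in> carrier_mat N k" "W \<in> carrier_mat N k"
    "S = {V *\<^sub>v c | c. c \<in> carrier_vec k}"
    "\<And>c. c \<in> carrier_vec k \<Longrightarrow> V *\<^sub>v c = 0\<^sub>v N \<Longrightarrow> c = 0\<^sub>v k"
    "\<And>c. c \<in> carrier_vec k \<Longrightarrow> E *\<^sub>v (V *\<^sub>v c) = W *\<^sub>v (E' *\<^sub>v c)"
    "\<And>c. c \<in> carrier_vec k \<Longrightarrow> A *\<^sub>v (V *\<^sub>v c) = W *\<^sub>v (A' *\<^sub>v c)"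
    "\<And>s. det (s \<cdot>\<^sub>m E - A) \<noteq> 0 \<Longrightarrow> invertible_mat (s \<cdot>\<^sub>m E' - A')"
    "\<And>v z. v \<in> S \<Longrightarrow> v \<noteq> 0\<^sub>v N \<Longrightarrow> A *\<^sub>v v = z \<cdot>\<^sub>v (E *\<^sub>v v) \<Longrightarrow> Re z \<le> 0"
proof -
  from S obtain l E' A' where wit: "deflating_witness N N E A k S l E' A'"
    by (auto simp: c_semi_stable_deflating_def deflating_subspace_def)
  obtain V W where l: "l = k" and E': "E' \<in> carrier_mat k k" and A': "A' \<in> carrier_mat k k"
    and V: "V \<in> carrier_mat N k" and W: "W \<in> carrier_mat N k"
    and SV: "S = {V *\<^sub>v c | c. c \<in> carrier_vec k}"
    and injV: "\<And>c. c \<in> carrier_vec k \<Longrightarrow> V *\<^sub>v c = 0\<^sub>v N \<Longrightarrow> c = 0\<^sub>v k"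
    and injW: "\<And>c. c \<in> carrier_vec k \<Longrightarrow> W *\<^sub>v c = 0\<^sub>v N \<Longrightarrow> c = 0\<^sub>v k"
    and EV: "\<And>c. c \<in> carrier_vec k \<Longrightarrow> E *\<^sub>v (V *\<^sub>v c) = W *\<^sub>v (E' *\<^sub>v c)"
    and AV: "\<And>c. c \<in> carrier_vec k \<Longrightarrow> A *\<^sub>v (V *\<^sub>v c) = W *\<^sub>v (A' *\<^sub>v c)"
    and inv: "\<And>s. det (s \<cdot>\<^sub>m E - A) \<noteq> 0 \<Longrightarrow> invertible_mat (s \<cdot>\<^sub>m E' - A')"
    using deflating_witness_regular[OF reg wit] by blast
  have sq: "s \<cdot>\<^sub>m E' - A' \<in> carrier_mat k k" for s using A' by (rule minus_carrier_mat)
  show thesis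
  proof (rule that[OF E' A' V W SV injV EV AV inv])
    fix v z assume v: "v \<in> S" "v \<noteq> 0\<^sub>v N" "A *\<^sub>v v = z \<cdot>\<^sub>v (E *\<^sub>v v)"
    then obtain c where c: "c \<in> carrier_vec k" "v = V *\<^sub>v c" using SV by blast
    have E'c: "E' *\<^sub>v c \<in> carrier_vec k" "A' *\<^sub>v c \<in> carrier_vec k" "W *\<^sub>v (A' *\<^sub>v c) \<in> carrier_vec N"
      using E' A' W c by (auto intro!: mult_mat_vec_carrier)
    have "(z \<cdot>\<^sub>m E' - A') *\<^sub>v c \<in> carrier_vec k" using mult_mat_vec_carrier[OF sq c(1)] .
    moreover have "W *\<^sub>v ((z \<cdot>\<^sub>m E' - A') *\<^sub>v c) = 0\<^sub>v N"
      using v(3) E'c W unfolding c(2) EV[OF c(1)] AV[OF c(1)] mult_mat_vec_diff[OF E' A' c(1)]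
      by (simp add: mult_minus_distrib_mat_vec[of _ N k] mult_mat_vec[of _ N k])
    ultimately have "(z \<cdot>\<^sub>m E' - A') *\<^sub>v c = 0\<^sub>v k" by (rule injW)
    moreover have "c \<noteq> 0\<^sub>v k" using v(2) c(2) mult_mat_zero_vec[OF V] by auto
    ultimately have "\<not> invertible_mat (z \<cdot>\<^sub>m E' - A')"
      using c(1) by (auto simp: invertible_mat_iff_injective[OF sq])
    then have "det (z \<cdot>\<^sub>m E' - A') = 0" using invertible_mat_iff_det[OF sq] by blast
    then have "vec_space.rank k (z \<cdot>\<^sub>m E' - A') < k" by (rule vec_space.det_zero_low_rank[OF sq])
    moreover obtain s0 where "det (s0 \<cdot>\<^sub>m E - A) \<noteq> 0" using reg by (auto simp: regular_pencil_def)
    then have "vec_space.rank k (s0 \<cdot>\<^sub>m E' - A') = k" by (intro invertible_imp_rank sq inv)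
    ultimately have "pencil_eigenvalue k E' A' (Finite z)" by (auto intro!: exI[of _ s0])
    then have "contained_eigenvalue N N E A k S (Finite z)"
      using wit unfolding contained_eigenvalue_def l by blast
    then have "c_stable (Finite z) \<or> c_critical (Finite z)" using S by (auto simp: c_semi_stable_deflating_def)
    then show "Re z \<le> 0" by auto
  qed
qed

section \<open>The reduced pencil\<close>

lemma vec_eq_iff_index: "v \<in> carrier_vec n \<Longrightarrow> w \<in> carrier_vec n \<Longrightarrow> v = w \<longleftrightarrow> (\<forall>i<n. v $ i = w $ i)"
  by (auto intro!: eq_vecI)

context lure_data
begin

lemma dims [simp]:
  "dim_row A = n" "dim_col A = n" "dim_row Q = n" "dim_col Q = n" "dim_row B = n" "dim_col B = m"
  "dim_row C = n" "dim_col C = m" "dim_row R = m" "dim_col R = m"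
  by (simp_all only: carrier_matD[OF A] carrier_matD[OF B] carrier_matD[OF C] carrier_matD[OF Q] carrier_matD[OF R])

abbreviation "\<E> \<equiv> even_E n m"
abbreviation "\<A> \<equiv> even_A n m A B C Q R"

lemma even_E_mult:
  assumes "p \<in> carrier_vec n" "q \<in> carrier_vec n" "r \<in> carrier_vec m"
  shows "\<E> *\<^sub>v ((p @\<^sub>v q) @\<^sub>v r) = ((- q) @\<^sub>v p) @\<^sub>v 0\<^sub>v m"
proof -
  have "(- 1\<^sub>m n) *\<^sub>v q = - q" using assms by simp
  then show ?thesis unfolding even_E_def using assms
    by (subst block3_mat_mult_vec[of _ n n _ n _ m _ n _ _ _ m]) auto
qed

lemma even_A_mult:
  assumes "p \<in> carrier_vec n" "q \<in> carrier_vec n" "r \<in> carrier_vec m"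
  shows "\<A> *\<^sub>v ((p @\<^sub>v q) @\<^sub>v r) = ((- (A *\<^sub>v q + B *\<^sub>v r)) @\<^sub>v (- (mat_adjoint A *\<^sub>v p + Q *\<^sub>v q + C *\<^sub>v r))) @\<^sub>v
    (- (mat_adjoint B *\<^sub>v p + mat_adjoint C *\<^sub>v q + R *\<^sub>v r))"
proof -
  have c: "block3_mat (0\<^sub>m n n) A B (mat_adjoint A) Q C (mat_adjoint B) (mat_adjoint C) R \<in> carrier_mat (n + n + m) (n + n + m)"
    by (rule block3_mat_carrier) auto
  have v: "dim_vec ((p @\<^sub>v q) @\<^sub>v r) = n + n + m" using assms by simp
  show ?thesis unfolding even_A_def using assms
    by (subst uminus_mult_mat_vec, simp only: v carrier_matD[OF c],
        subst block3_mat_mult_vec[of _ n n _ n _ m _ n _ _ _ m]) (auto simp: append_vec_uminus)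
qed

lemma even_carrier: "\<E> \<in> carrier_mat (2 * n + m) (2 * n + m)" "\<A> \<in> carrier_mat (2 * n + m) (2 * n + m)"
  unfolding even_E_def even_A_def mult_2 by (intro uminus_carrier_mat block3_mat_carrier; simp)+

lemma even_E_form:
  assumes "v \<in> carrier_vec (2 * n + m)" "w \<in> carrier_vec (2 * n + m)"
  shows "conjugate v \<bullet> (\<E> *\<^sub>v w) = hform n v w"
proof -
  obtain p q r where v: "v = (p @\<^sub>v q) @\<^sub>v r" and [simp]: "p \<in> carrier_vec n" "q \<in> carrier_vec n" "r \<in> carrier_vec m"
    using assms(1) by (rule split3_vec)
  obtain p' q' r' where w: "w = (p' @\<^sub>v q') @\<^sub>v r'" and [simp]: "p' \<in> carrier_vec n" "q' \<in> carrier_vec n" "r' \<in> carrier_vec m"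
    using assms(2) by (rule split3_vec)
  have "conjugate v \<bullet> (\<E> *\<^sub>v w) = cip ((p @\<^sub>v q) @\<^sub>v r) (((- q') @\<^sub>v p') @\<^sub>v 0\<^sub>v m)"
    by (simp add: v w even_E_mult cip_def)
  also have "\<dots> = cip q p' - cip p q'"
    by (simp add: cip_append[where n = "n + n" and m = m] cip_append[where n = n and m = n]
        cip_uminus_right[where n = n] cip_zero_right[where n = m])
  also have "\<dots> = hform n v w"
    unfolding v w by (subst hform_append_right) (simp_all add: append_vec_carrier_2n skew_form_append)
  finally show ?thesis .
qed

lemma popov_mat_hermitian: "hermitian_mat (four_block_mat Q C (mat_adjoint C) R)" (is "hermitian_mat ?M")
proof -
  have sym: "cnj (M $$ (l, k)) = M $$ (k, l)" if "hermitian_mat M" "k < dim_row M" "l < dim_row M" for M k l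
    using that mat_adjoint_index[of k M l] by (auto simp: hermitian_mat_def)
  have "mat_adjoint ?M = ?M"
    by (rule eq_matI) (auto simp: sym[OF Q_herm] sym[OF R_herm])
  then show ?thesis by (simp add: hermitian_mat_def)
qed

text \<open>Not a value of the even pencil: the first block column is that of
  \<open>s = -\<gamma>\<close> and the second that of \<open>s = \<gamma>\<close>, with the roles
  exchanged in \<open>M_plus\<close>. \<open>M_minus_red\<close> undoes this exchange.\<close>

definition M_minus :: "complex mat" where
  "M_minus = block3_mat (0\<^sub>m n n) (A - g \<cdot>\<^sub>m 1\<^sub>m n) B (mat_adjoint A - g \<cdot>\<^sub>m 1\<^sub>m n) Q C (mat_adjoint B) (mat_adjoint C) R"

definition M_plus :: "complex mat" where
  "M_plus = block3_mat (0\<^sub>m n n) (A + g \<cdot>\<^sub>m 1\<^sub>m n) B (mat_adjoint A + g \<cdot>\<^sub>m 1\<^sub>m n) Q C (mat_adjoint B) (mat_adjoint C) R"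

lemma M_carrier: "M_minus \<in> carrier_mat (n + n + m) (n + n + m)" "M_plus \<in> carrier_mat (n + n + m) (n + n + m)"
  unfolding M_minus_def M_plus_def by (rule block3_mat_carrier; simp add: minus_carrier_mat)+

lemma M_minus_mult:
  assumes "p \<in> carrier_vec n" "q \<in> carrier_vec n" "r \<in> carrier_vec m"
  shows "M_minus *\<^sub>v ((p @\<^sub>v q) @\<^sub>v r) = ((A *\<^sub>v q - g \<cdot>\<^sub>v q + B *\<^sub>v r) @\<^sub>v (mat_adjoint A *\<^sub>v p - g \<cdot>\<^sub>v p + Q *\<^sub>v q + C *\<^sub>v r)) @\<^sub>v
    (mat_adjoint B *\<^sub>v p + mat_adjoint C *\<^sub>v q + R *\<^sub>v r)"
proof -
  have "(A - g \<cdot>\<^sub>m 1\<^sub>m n) *\<^sub>v q = A *\<^sub>v q - g \<cdot>\<^sub>v q" "(mat_adjoint A - g \<cdot>\<^sub>m 1\<^sub>m n) *\<^sub>v p = mat_adjoint A *\<^sub>v p - g \<cdot>\<^sub>v p"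
    using assms by (simp_all add: minus_mult_distrib_mat_vec[of _ n n] smult_mat_mult_vec[of _ n n])
  then show ?thesis unfolding M_minus_def using assms
    by (subst block3_mat_mult_vec[of _ n n _ n _ m _ n _ _ _ m]) (auto simp: minus_carrier_mat)
qed

lemma M_plus_mult:
  assumes "p \<in> carrier_vec n" "q \<in> carrier_vec n" "r \<in> carrier_vec m"
  shows "M_plus *\<^sub>v ((p @\<^sub>v q) @\<^sub>v r) = ((A *\<^sub>v q + g \<cdot>\<^sub>v q + B *\<^sub>v r) @\<^sub>v (mat_adjoint A *\<^sub>v p + g \<cdot>\<^sub>v p + Q *\<^sub>v q + C *\<^sub>v r)) @\<^sub>v
    (mat_adjoint B *\<^sub>v p + mat_adjoint C *\<^sub>v q + R *\<^sub>v r)"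
proof -
  have "(A + g \<cdot>\<^sub>m 1\<^sub>m n) *\<^sub>v q = A *\<^sub>v q + g \<cdot>\<^sub>v q" "(mat_adjoint A + g \<cdot>\<^sub>m 1\<^sub>m n) *\<^sub>v p = mat_adjoint A *\<^sub>v p + g \<cdot>\<^sub>v p"
    using assms by (simp_all add: add_mult_distrib_mat_vec[of _ n n] smult_mat_mult_vec[of _ n n])
  then show ?thesis unfolding M_plus_def using assms
    by (subst block3_mat_mult_vec[of _ n n _ n _ m _ n _ _ _ m]) auto
qed

lemma append3_eq_iff:
  assumes "p \<in> carrier_vec n" "p' \<in> carrier_vec n" "q \<in> carrier_vec n" "q' \<in> carrier_vec n"
  shows "(p @\<^sub>v q) @\<^sub>v r = (p' @\<^sub>v q') @\<^sub>v r' \<longleftrightarrow> p = p' \<and> q = q' \<and> r = r'"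
proof -
  have "(p @\<^sub>v q) @\<^sub>v r = (p' @\<^sub>v q') @\<^sub>v r' \<longleftrightarrow> p @\<^sub>v q = p' @\<^sub>v q' \<and> r = r'"
    by (rule append_vec_eq[of _ "n + n"]) (use assms in auto)
  then show ?thesis using append_vec_eq[OF assms(1,2)] by simp
qed

text \<open>The last \<open>m\<close> coordinates enter both sides through the same columns, so only
  their difference survives; it becomes the input of the step.\<close>

lemma even_pencil_step:
  assumes c: "\<mu> \<in> carrier_vec n" "x \<in> carrier_vec n" "u \<in> carrier_vec m" "\<mu>' \<in> carrier_vec n" "x' \<in> carrier_vec n" "u' \<in> carrier_vec m"
    and eq: "\<A> *\<^sub>v ((\<mu> @\<^sub>v x) @\<^sub>v u) - g \<cdot>\<^sub>v (\<E> *\<^sub>v ((\<mu> @\<^sub>v x) @\<^sub>v u)) =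
      \<A> *\<^sub>v ((\<mu>' @\<^sub>v x') @\<^sub>v u') + g \<cdot>\<^sub>v (\<E> *\<^sub>v ((\<mu>' @\<^sub>v x') @\<^sub>v u'))"
  shows "step \<mu> x \<mu>' x' (u' - u)"
proof -
  note [simp] = c
  have [simp]: "dim_vec \<mu> = n" "dim_vec x = n" "dim_vec u = m" "dim_vec \<mu>' = n" "dim_vec x' = n" "dim_vec u' = m"
    using c by auto
  have "((- (A *\<^sub>v x + B *\<^sub>v u) + g \<cdot>\<^sub>v x) @\<^sub>v (- (mat_adjoint A *\<^sub>v \<mu> + Q *\<^sub>v x + C *\<^sub>v u) - g \<cdot>\<^sub>v \<mu>)) @\<^sub>v
      (- (mat_adjoint B *\<^sub>v \<mu> + mat_adjoint C *\<^sub>v x + R *\<^sub>v u)) =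
    ((- (A *\<^sub>v x' + B *\<^sub>v u') - g \<cdot>\<^sub>v x') @\<^sub>v (- (mat_adjoint A *\<^sub>v \<mu>' + Q *\<^sub>v x' + C *\<^sub>v u') + g \<cdot>\<^sub>v \<mu>')) @\<^sub>v
      (- (mat_adjoint B *\<^sub>v \<mu>' + mat_adjoint C *\<^sub>v x' + R *\<^sub>v u'))" (is "?l = ?r")
  proof -
    have "\<A> *\<^sub>v ((\<mu> @\<^sub>v x) @\<^sub>v u) - g \<cdot>\<^sub>v (\<E> *\<^sub>v ((\<mu> @\<^sub>v x) @\<^sub>v u)) = ?l"
      unfolding even_A_mult[OF c(1-3)] even_E_mult[OF c(1-3)]
      by (intro eq_vecI) (auto simp del: index_mult_mat_vec)
    moreover have "\<A> *\<^sub>v ((\<mu>' @\<^sub>v x') @\<^sub>v u') + g \<cdot>\<^sub>v (\<E> *\<^sub>v ((\<mu>' @\<^sub>v x') @\<^sub>v u')) = ?r"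
      unfolding even_A_mult[OF c(4-6)] even_E_mult[OF c(4-6)]
      by (intro eq_vecI) (auto simp del: index_mult_mat_vec)
    ultimately show ?thesis using eq by simp
  qed
  then have e: "- (A *\<^sub>v x + B *\<^sub>v u) + g \<cdot>\<^sub>v x = - (A *\<^sub>v x' + B *\<^sub>v u') - g \<cdot>\<^sub>v x'"
    "- (mat_adjoint A *\<^sub>v \<mu> + Q *\<^sub>v x + C *\<^sub>v u) - g \<cdot>\<^sub>v \<mu> = - (mat_adjoint A *\<^sub>v \<mu>' + Q *\<^sub>v x' + C *\<^sub>v u') + g \<cdot>\<^sub>v \<mu>'"
    "- (mat_adjoint B *\<^sub>v \<mu> + mat_adjoint C *\<^sub>v x + R *\<^sub>v u) = - (mat_adjoint B *\<^sub>v \<mu>' + mat_adjoint C *\<^sub>v x' + R *\<^sub>v u')"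
    by (subst (asm) append3_eq_iff; simp)+
  have d: "A *\<^sub>v (x - x') = A *\<^sub>v x - A *\<^sub>v x'" "mat_adjoint A *\<^sub>v (\<mu> - \<mu>') = mat_adjoint A *\<^sub>v \<mu> - mat_adjoint A *\<^sub>v \<mu>'"
    "Q *\<^sub>v (x - x') = Q *\<^sub>v x - Q *\<^sub>v x'" "B *\<^sub>v (u' - u) = B *\<^sub>v u' - B *\<^sub>v u" "C *\<^sub>v (u' - u) = C *\<^sub>v u' - C *\<^sub>v u"
    "R *\<^sub>v (u' - u) = R *\<^sub>v u' - R *\<^sub>v u" "mat_adjoint B *\<^sub>v (\<mu> - \<mu>') = mat_adjoint B *\<^sub>v \<mu> - mat_adjoint B *\<^sub>v \<mu>'"
    "mat_adjoint C *\<^sub>v (x - x') = mat_adjoint C *\<^sub>v x - mat_adjoint C *\<^sub>v x'"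
    by (simp_all add: mult_minus_distrib_mat_vec[of _ n n] mult_minus_distrib_mat_vec[of _ n m]
        mult_minus_distrib_mat_vec[of _ m n] mult_minus_distrib_mat_vec[of _ m m])
  show ?thesis unfolding step_def d
    using e
    by (auto simp: vec_eq_iff_index[of _ n] vec_eq_iff_index[of _ m] algebra_simps simp del: index_mult_mat_vec)
qed

end

text \<open>\<open>V\<close> and \<open>W\<close> intertwine the small pencil with the large one,
  and the chain relations are linear.\<close>

lemma pencil_chain_map:
  assumes ch: "pencil_chain k E' A' ev l c" and V: "V \<in> carrier_mat N k"
    and E': "E' \<in> carrier_mat k k" and A': "A' \<in> carrier_mat k k"
    and EV: "\<And>c. c \<in> carrier_vec k \<Longrightarrow> E *\<^sub>v (V *\<^sub>v c) = W *\<^sub>v (E' *\<^sub>v c)"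
    and AV: "\<And>c. c \<in> carrier_vec k \<Longrightarrow> A *\<^sub>v (V *\<^sub>v c) = W *\<^sub>v (A' *\<^sub>v c)"
  shows "pencil_chain N E A ev l (\<lambda>i. V *\<^sub>v c i)"
  unfolding pencil_chain_def
proof (intro allI impI conjI)
  fix i assume i: "i < l"
  have c: "c i \<in> carrier_vec k" "chain_pred k c i \<in> carrier_vec k"
    using ch i by (auto intro: pencil_chain_carrier pencil_chain_pred_carrier)
  show "V *\<^sub>v c i \<in> carrier_vec N" using V c(1) by (rule mult_mat_vec_carrier)
  have p: "chain_pred N (\<lambda>i. V *\<^sub>v c i) i = V *\<^sub>v chain_pred k c i"
    using mult_mat_zero_vec[OF V] by (cases i) auto
  show "case ev of
      Finite z \<Rightarrow> A *\<^sub>v (V *\<^sub>v c i) = E *\<^sub>v (z \<cdot>\<^sub>v (V *\<^sub>v c i) + chain_pred N (\<lambda>i. V *\<^sub>v c i) i)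
    | Infinity \<Rightarrow> E *\<^sub>v (V *\<^sub>v c i) = A *\<^sub>v chain_pred N (\<lambda>i. V *\<^sub>v c i) i"
  proof (cases ev)
    case (Finite z)
    have "z \<cdot>\<^sub>v (V *\<^sub>v c i) + V *\<^sub>v chain_pred k c i = V *\<^sub>v (z \<cdot>\<^sub>v c i + chain_pred k c i)"
      using c by (simp add: mult_add_distrib_mat_vec[OF V] mult_mat_vec[OF V])
    moreover have "A' *\<^sub>v c i = E' *\<^sub>v (z \<cdot>\<^sub>v c i + chain_pred k c i)"
      using ch i Finite by (simp add: pencil_chain_def)
    ultimately show ?thesis using c Finite by (simp add: p EV AV)
  next
    case Infinity
    then have "E' *\<^sub>v c i = A' *\<^sub>v chain_pred k c i" using ch i by (simp add: pencil_chain_def)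
    then show ?thesis using c Infinity by (simp add: p EV AV)
  qed
qed

text \<open>The defining product is stated with the inverse multiplied out; \<open>S1\<close> and
  \<open>S2\<close> are the two unnamed blocks of its last row.\<close>

locale reduced_pencil = lure_data +
  fixes E F G H S1 S2 :: "complex mat"
  assumes E [simp]: "E \<in> carrier_mat n n" and F [simp]: "F \<in> carrier_mat n n"
    and G [simp]: "G \<in> carrier_mat n n" and H [simp]: "H \<in> carrier_mat n n"
    and S1 [simp]: "S1 \<in> carrier_mat m n" and S2 [simp]: "S2 \<in> carrier_mat m n"
    and M_minus_inv: "invertible_mat M_minus"
    and M_plus_eq: "M_minus * block3_mat E (- G) (0\<^sub>m n m) (- H) F (0\<^sub>m n m) S1 S2 (1\<^sub>m m) = M_plus"
begin

definition E_red :: "complex mat" where "E_red = four_block_mat (1\<^sub>m n) (- G) (0\<^sub>m n n) F"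
definition A_red :: "complex mat" where "A_red = four_block_mat E (0\<^sub>m n n) (- H) (1\<^sub>m n)"

lemma red_carrier: "E_red \<in> carrier_mat (2 * n) (2 * n)" "A_red \<in> carrier_mat (2 * n) (2 * n)"
  unfolding E_red_def A_red_def mult_2 by simp_all

lemma red_mult_closed [simp]:
  "v \<in> carrier_vec n \<Longrightarrow> E *\<^sub>v v \<in> carrier_vec n" "v \<in> carrier_vec n \<Longrightarrow> F *\<^sub>v v \<in> carrier_vec n"
  "v \<in> carrier_vec n \<Longrightarrow> G *\<^sub>v v \<in> carrier_vec n" "v \<in> carrier_vec n \<Longrightarrow> H *\<^sub>v v \<in> carrier_vec n"
  "v \<in> carrier_vec n \<Longrightarrow> S1 *\<^sub>v v \<in> carrier_vec m" "v \<in> carrier_vec n \<Longrightarrow> S2 *\<^sub>v v \<in> carrier_vec m"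
  using E F G H S1 S2 by (blast intro: mult_mat_vec_carrier)+

lemma uminus_mult_vec [simp]:
  "v \<in> carrier_vec n \<Longrightarrow> (- G) *\<^sub>v v = - (G *\<^sub>v v)" "v \<in> carrier_vec n \<Longrightarrow> (- H) *\<^sub>v v = - (H *\<^sub>v v)"
  by (simp_all add: carrier_matD[OF G] carrier_matD[OF H] carrier_vecD)

lemma red_mult:
  assumes "p \<in> carrier_vec n" "q \<in> carrier_vec n"
  shows "E_red *\<^sub>v (p @\<^sub>v q) = (p - G *\<^sub>v q) @\<^sub>v (F *\<^sub>v q)" "A_red *\<^sub>v (p @\<^sub>v q) = (E *\<^sub>v p) @\<^sub>v (q - H *\<^sub>v p)"
proof -
  have "E_red *\<^sub>v (p @\<^sub>v q) = (p + - (G *\<^sub>v q)) @\<^sub>v (0\<^sub>v n + F *\<^sub>v q)"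
    unfolding E_red_def using assms by (subst four_block_mat_mult_vec[of _ n n _ n _ n]) auto
  then show "E_red *\<^sub>v (p @\<^sub>v q) = (p - G *\<^sub>v q) @\<^sub>v (F *\<^sub>v q)"
    using assms by (simp add: minus_add_uminus_vec[of _ n])
  have "A_red *\<^sub>v (p @\<^sub>v q) = (E *\<^sub>v p + 0\<^sub>v n) @\<^sub>v (- (H *\<^sub>v p) + q)"
    unfolding A_red_def using assms by (subst four_block_mat_mult_vec[of _ n n _ n _ n]) auto
  moreover have "- (H *\<^sub>v p) + q = q - H *\<^sub>v p"
    using assms by (simp add: minus_add_uminus_vec[of _ n] comm_add_vec[of _ n])
  ultimately show "A_red *\<^sub>v (p @\<^sub>v q) = (E *\<^sub>v p) @\<^sub>v (q - H *\<^sub>v p)"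
    using assms by simp
qed

text \<open>The vector on the left is
  \<open>N (\<mu>, 0, 0) + (0, x, 0) - (\<mu>', 0, 0) - N (0, x', 0)\<close> with \<open>N\<close>
  the block matrix of \<open>E\<close>, \<open>F\<close>, \<open>G\<close>, \<open>H\<close>,
  \<open>S1\<close>, \<open>S2\<close>. As \<open>M_minus * N = M_plus\<close>, its image takes
  columns of both matrices, and they recombine to the even pencil at \<gamma> on
  \<open>(\<mu>, x)\<close> minus the even pencil at \<open>-\<gamma>\<close> on
  \<open>(\<mu>', x')\<close>.\<close>

lemma M_minus_red:
  assumes c [simp]: "\<mu> \<in> carrier_vec n" "x \<in> carrier_vec n" "\<mu>' \<in> carrier_vec n" "x' \<in> carrier_vec n"
  shows "M_minus *\<^sub>v ((A_red *\<^sub>v (\<mu> @\<^sub>v x) - E_red *\<^sub>v (\<mu>' @\<^sub>v x')) @\<^sub>v (S1 *\<^sub>v \<mu> - S2 *\<^sub>v x')) =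
    ((A *\<^sub>v (x - x') - g \<cdot>\<^sub>v (x + x')) @\<^sub>v (mat_adjoint A *\<^sub>v (\<mu> - \<mu>') + g \<cdot>\<^sub>v (\<mu> + \<mu>') + Q *\<^sub>v (x - x'))) @\<^sub>v
    (mat_adjoint B *\<^sub>v (\<mu> - \<mu>') + mat_adjoint C *\<^sub>v (x - x'))"
proof -
  define N where "N = block3_mat E (- G) (0\<^sub>m n m) (- H) F (0\<^sub>m n m) S1 S2 (1\<^sub>m m)"
  have N: "N \<in> carrier_mat (n + n + m) (n + n + m)" unfolding N_def by (rule block3_mat_carrier) auto
  have c3: "(p @\<^sub>v q) @\<^sub>v r \<in> carrier_vec (n + n + m)" if "p \<in> carrier_vec n" "q \<in> carrier_vec n" "r \<in> carrier_vec m" for p q r :: "complex vec"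
    using that by auto
  have MN: "M_plus *\<^sub>v v = M_minus *\<^sub>v (N *\<^sub>v v)" if "v \<in> carrier_vec (n + n + m)" for v
    using assoc_mult_mat_vec[OF M_carrier(1) N that] M_plus_eq by (simp add: N_def)
  have N1: "N *\<^sub>v ((\<mu> @\<^sub>v 0\<^sub>v n) @\<^sub>v 0\<^sub>v m) = ((E *\<^sub>v \<mu>) @\<^sub>v (- (H *\<^sub>v \<mu>))) @\<^sub>v (S1 *\<^sub>v \<mu>)"
    unfolding N_def by (subst block3_mat_mult_vec[of _ n n _ n _ m _ n _ _ _ m])
      (auto simp: mult_mat_zero_vec[OF F] mult_mat_zero_vec[OF G] mult_mat_zero_vec[OF S2])
  have N2: "N *\<^sub>v ((0\<^sub>v n @\<^sub>v x') @\<^sub>v 0\<^sub>v m) = ((- (G *\<^sub>v x')) @\<^sub>v (F *\<^sub>v x')) @\<^sub>v (S2 *\<^sub>v x')"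
    unfolding N_def by (subst block3_mat_mult_vec[of _ n n _ n _ m _ n _ _ _ m])
      (auto simp: mult_mat_zero_vec[OF E] mult_mat_zero_vec[OF H] mult_mat_zero_vec[OF S1])
  let ?a = "N *\<^sub>v ((\<mu> @\<^sub>v 0\<^sub>v n) @\<^sub>v 0\<^sub>v m)" and ?b = "(0\<^sub>v n @\<^sub>v x) @\<^sub>v 0\<^sub>v m"
    and ?c = "(\<mu>' @\<^sub>v 0\<^sub>v n) @\<^sub>v 0\<^sub>v m" and ?d = "N *\<^sub>v ((0\<^sub>v n @\<^sub>v x') @\<^sub>v 0\<^sub>v m)"
  have abcd [simp]: "?a \<in> carrier_vec (n + n + m)" "?b \<in> carrier_vec (n + n + m)"
    "?c \<in> carrier_vec (n + n + m)" "?d \<in> carrier_vec (n + n + m)"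
    by (intro mult_mat_vec_carrier[OF N] c3; simp)+
  have dims [simp]: "dim_vec \<mu> = n" "dim_vec x = n" "dim_vec \<mu>' = n" "dim_vec x' = n" "dim_row E = n" "dim_row H = n" "dim_row G = n" "dim_row F = n" "dim_row S1 = m" "dim_row S2 = m"
    by (simp_all only: carrier_matD[OF E] carrier_matD[OF F] carrier_matD[OF G] carrier_matD[OF H]
        carrier_matD[OF S1] carrier_matD[OF S2] c[THEN carrier_vecD])
  have "(A_red *\<^sub>v (\<mu> @\<^sub>v x) - E_red *\<^sub>v (\<mu>' @\<^sub>v x')) @\<^sub>v (S1 *\<^sub>v \<mu> - S2 *\<^sub>v x') = ?a + ?b - ?c - ?d"
    unfolding N1 N2 by (intro eq_vecI) (auto simp: red_mult simp del: index_mult_mat_vec)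
  then have "M_minus *\<^sub>v ((A_red *\<^sub>v (\<mu> @\<^sub>v x) - E_red *\<^sub>v (\<mu>' @\<^sub>v x')) @\<^sub>v (S1 *\<^sub>v \<mu> - S2 *\<^sub>v x')) =
    M_plus *\<^sub>v ((\<mu> @\<^sub>v 0\<^sub>v n) @\<^sub>v 0\<^sub>v m) + M_minus *\<^sub>v ?b - M_minus *\<^sub>v ?c - M_plus *\<^sub>v ((0\<^sub>v n @\<^sub>v x') @\<^sub>v 0\<^sub>v m)"
    by (simp add: MN c3 mult_add_distrib_mat_vec[OF M_carrier(1)] mult_minus_distrib_mat_vec[OF M_carrier(1)])
  also have "\<dots> = ((A *\<^sub>v (x - x') - g \<cdot>\<^sub>v (x + x')) @\<^sub>v (mat_adjoint A *\<^sub>v (\<mu> - \<mu>') + g \<cdot>\<^sub>v (\<mu> + \<mu>') + Q *\<^sub>v (x - x'))) @\<^sub>v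
    (mat_adjoint B *\<^sub>v (\<mu> - \<mu>') + mat_adjoint C *\<^sub>v (x - x'))"
    using mult_mat_zero_vec[OF A] mult_mat_zero_vec[OF B] mult_mat_zero_vec[OF C] mult_mat_zero_vec[OF Q] mult_mat_zero_vec[OF R]
      mult_mat_zero_vec[OF mat_adjoint_carrier[OF A]] mult_mat_zero_vec[OF mat_adjoint_carrier[OF B]] mult_mat_zero_vec[OF mat_adjoint_carrier[OF C]]
    by (simp add: M_minus_mult M_plus_mult mult_minus_distrib_mat_vec[of _ n n] mult_minus_distrib_mat_vec[of _ m n])
      (intro eq_vecI; auto simp: algebra_simps simp del: index_mult_mat_vec)
  finally show ?thesis .
qed

text \<open>By injectivity of \<open>M_minus\<close>, the reduced relation says that the residuals
  of the three rows are the image of \<open>(0, 0, u)\<close> for some \<open>u\<close>, which is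
  \<open>step\<close>. The input is then \<open>S1 \<mu> - S2 x'\<close>.\<close>

lemma red_eq_iff_step:
  assumes c [simp]: "\<mu> \<in> carrier_vec n" "x \<in> carrier_vec n" "\<mu>' \<in> carrier_vec n" "x' \<in> carrier_vec n"
  shows "A_red *\<^sub>v (\<mu> @\<^sub>v x) = E_red *\<^sub>v (\<mu>' @\<^sub>v x') \<longleftrightarrow> (\<exists>u. step \<mu> x \<mu>' x' u)"
proof -
  let ?d = "A_red *\<^sub>v (\<mu> @\<^sub>v x) - E_red *\<^sub>v (\<mu>' @\<^sub>v x')" and ?s = "S1 *\<^sub>v \<mu> - S2 *\<^sub>v x'"
  have rc: "A_red *\<^sub>v (\<mu> @\<^sub>v x) \<in> carrier_vec (n + n)" "E_red *\<^sub>v (\<mu>' @\<^sub>v x') \<in> carrier_vec (n + n)"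
    using red_carrier append_vec_carrier_2n[OF c(1,2)] append_vec_carrier_2n[OF c(3,4)]
    by (auto simp: mult_2 intro!: mult_mat_vec_carrier[of _ "n + n" "n + n"])
  have mz [simp]: "mat_adjoint A *\<^sub>v 0\<^sub>v n = 0\<^sub>v n" "A *\<^sub>v 0\<^sub>v n = 0\<^sub>v n" "Q *\<^sub>v 0\<^sub>v n = 0\<^sub>v n"
     "mat_adjoint B *\<^sub>v 0\<^sub>v n = 0\<^sub>v m" "mat_adjoint C *\<^sub>v 0\<^sub>v n = 0\<^sub>v m"
    using mult_mat_zero_vec[OF A] mult_mat_zero_vec[OF Q]
      mult_mat_zero_vec[OF mat_adjoint_carrier[OF A]] mult_mat_zero_vec[OF mat_adjoint_carrier[OF B]] mult_mat_zero_vec[OF mat_adjoint_carrier[OF C]]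
    by simp_all
  have Mu: "M_minus *\<^sub>v ((0\<^sub>v n @\<^sub>v 0\<^sub>v n) @\<^sub>v u) = ((B *\<^sub>v u) @\<^sub>v (C *\<^sub>v u)) @\<^sub>v (R *\<^sub>v u)" if "u \<in> carrier_vec m" for u
    using that by (subst M_minus_mult) auto
  have r1: "A *\<^sub>v (x - x') - g \<cdot>\<^sub>v (x + x') = B *\<^sub>v u \<longleftrightarrow> A *\<^sub>v (x - x') = g \<cdot>\<^sub>v (x + x') + B *\<^sub>v u"
    if "u \<in> carrier_vec m" for u
    by (rule vec_minus_eq_iff[of _ n]) (use that in simp_all)
  show ?thesis
  proof
    assume "A_red *\<^sub>v (\<mu> @\<^sub>v x) = E_red *\<^sub>v (\<mu>' @\<^sub>v x')"
    then have "?d = 0\<^sub>v n @\<^sub>v 0\<^sub>v n" using rc(2) by (simp add: mult_2)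
    then have "((B *\<^sub>v ?s) @\<^sub>v (C *\<^sub>v ?s)) @\<^sub>v (R *\<^sub>v ?s) = ((A *\<^sub>v (x - x') - g \<cdot>\<^sub>v (x + x')) @\<^sub>v
        (mat_adjoint A *\<^sub>v (\<mu> - \<mu>') + g \<cdot>\<^sub>v (\<mu> + \<mu>') + Q *\<^sub>v (x - x'))) @\<^sub>v
      (mat_adjoint B *\<^sub>v (\<mu> - \<mu>') + mat_adjoint C *\<^sub>v (x - x'))"
      using M_minus_red[OF c] Mu[of ?s] by simp
    then have "B *\<^sub>v ?s = A *\<^sub>v (x - x') - g \<cdot>\<^sub>v (x + x') \<and>
      C *\<^sub>v ?s = mat_adjoint A *\<^sub>v (\<mu> - \<mu>') + g \<cdot>\<^sub>v (\<mu> + \<mu>') + Q *\<^sub>v (x - x') \<and>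
      R *\<^sub>v ?s = mat_adjoint B *\<^sub>v (\<mu> - \<mu>') + mat_adjoint C *\<^sub>v (x - x')"
      by (rule append3_eq_iff[THEN iffD1, rotated 4]) simp_all
    then have "step \<mu> x \<mu>' x' ?s" unfolding step_def using r1[of ?s] by simp
    then show "\<exists>u. step \<mu> x \<mu>' x' u" ..
  next
    assume "\<exists>u. step \<mu> x \<mu>' x' u"
    then obtain u where st: "step \<mu> x \<mu>' x' u" ..
    then have u: "u \<in> carrier_vec m" by (simp add: step_def)
    have eq: "M_minus *\<^sub>v (?d @\<^sub>v ?s) = M_minus *\<^sub>v ((0\<^sub>v n @\<^sub>v 0\<^sub>v n) @\<^sub>v u)"
      unfolding M_minus_red[OF c] Mu[OF u] using st r1[OF u] by (simp add: step_def)
    have d: "?d \<in> carrier_vec (n + n)" using rc by (rule minus_carrier_vec)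
    have l: "?d @\<^sub>v ?s \<in> carrier_vec (n + n + m)" by (rule append_carrier_vec[OF d]) simp
    have r: "(0\<^sub>v n @\<^sub>v 0\<^sub>v n) @\<^sub>v u \<in> carrier_vec (n + n + m)" using u by simp
    have "?d @\<^sub>v ?s = (0\<^sub>v n @\<^sub>v 0\<^sub>v n) @\<^sub>v u"
      by (rule invertible_mat_injective[OF M_minus_inv M_carrier(1) l r eq])
    with d have "?d = 0\<^sub>v (n + n)" using append_vec_eq[of ?d "n + n" "0\<^sub>v n @\<^sub>v 0\<^sub>v n" ?s u] by simp
    then show "A_red *\<^sub>v (\<mu> @\<^sub>v x) = E_red *\<^sub>v (\<mu>' @\<^sub>v x')" using vec_minus_eq_0_iff[OF rc] by simp
  qed
qed

lemma red_isometric: "isometric_pencil n E_red A_red"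
proof
  fix z z' w w' assume v: "z \<in> carrier_vec (2 * n)" "z' \<in> carrier_vec (2 * n)" "w \<in> carrier_vec (2 * n)" "w' \<in> carrier_vec (2 * n)"
    and eq: "A_red *\<^sub>v z = E_red *\<^sub>v z'" "A_red *\<^sub>v w = E_red *\<^sub>v w'"
  obtain \<mu> x where z: "z = \<mu> @\<^sub>v x" and c: "\<mu> \<in> carrier_vec n" "x \<in> carrier_vec n"
    using v(1) by (rule split_2n_vec)
  obtain \<mu>' x' where z': "z' = \<mu>' @\<^sub>v x'" and c': "\<mu>' \<in> carrier_vec n" "x' \<in> carrier_vec n"
    using v(2) by (rule split_2n_vec)
  obtain \<nu> y where w: "w = \<nu> @\<^sub>v y" and d: "\<nu> \<in> carrier_vec n" "y \<in> carrier_vec n"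
    using v(3) by (rule split_2n_vec)
  obtain \<nu>' y' where w': "w' = \<nu>' @\<^sub>v y'" and d': "\<nu>' \<in> carrier_vec n" "y' \<in> carrier_vec n"
    using v(4) by (rule split_2n_vec)
  obtain u v where "step \<mu> x \<mu>' x' u" "step \<nu> y \<nu>' y' v"
    using eq c c' d d' unfolding z z' w w' by (auto simp: red_eq_iff_step)
  from step_isometry[OF this] show "hform n z' w' = hform n z w"
    unfolding z z' w w' using c c' d d' by (simp add: skew_form_append)
qed (rule red_carrier)+

end

section \<open>The Cayley transform of the deflating subspace\<close>

lemma det_pencil_polynomial:
  fixes E A :: "complex mat"
  assumes "E \<in> carrier_mat N N" "A \<in> carrier_mat N N"
  obtains p where "\<And>s. det (s \<cdot>\<^sub>m E - A) = poly p s"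
proof -
  define M where "M = mat N N (\<lambda>(i, j). [:- A $$ (i, j), E $$ (i, j):])"
  have "det (s \<cdot>\<^sub>m E - A) = poly (det M) s" for s
  proof -
    have hom: "comm_ring_hom (\<lambda>p. poly p s)" by unfold_locales auto
    have "map_mat (\<lambda>p. poly p s) M = s \<cdot>\<^sub>m E - A"
      using assms by (intro eq_matI) (auto simp: M_def)
    then show ?thesis using comm_ring_hom.hom_det[OF hom, of M] by simp
  qed
  with that show thesis by blast
qed

text \<open>The determinant is a nonzero polynomial in \<open>s\<close>, and the imaginary axis is
  infinite.\<close>

lemma regular_pencil_imaginary:
  assumes "regular_pencil N E A"
  obtains \<omega> where "det (Complex 0 \<omega> \<cdot>\<^sub>m E - A) \<noteq> 0"
proof -
  from assms have c: "E \<in> carrier_mat N N" "A \<in> carrier_mat N N" by (simp_all add: regular_pencil_def)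
  obtain p where p: "\<And>s. det (s \<cdot>\<^sub>m E - A) = poly p s" using det_pencil_polynomial[OF c] by metis
  have "p \<noteq> 0" using assms p by (auto simp: regular_pencil_def)
  then have "finite {s. poly p s = 0}" by (rule poly_roots_finite)
  moreover have "infinite (range (Complex 0))"
    using infinite_UNIV_char_0[where 'a = real] by (simp add: finite_image_iff inj_on_def)
  ultimately have "\<not> range (Complex 0) \<subseteq> {s. poly p s = 0}" using finite_subset by blast
  then obtain \<omega> where "poly p (Complex 0 \<omega>) \<noteq> 0" by auto
  with that p show thesis by metis
qed

locale lure_problem = reduced_pencil +
  fixes \<V> :: "complex vec set"
  assumes stab: "stabilizable n A B"
    and reg: "regular_pencil (2 * n + m) \<E> \<A>"
    and semi: "c_semi_stable_deflating (2 * n + m) (2 * n + m) \<E> \<A> (n + m) \<V>"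
    and neutral_V: "neutral \<E> \<V>"
begin

lemma cayley_mult:
  fixes X Y :: "complex mat"
  assumes X: "X \<in> carrier_mat r c" "Y \<in> carrier_mat r c" "v \<in> carrier_vec c"
  shows "(X + a \<cdot>\<^sub>m Y) *\<^sub>v v = X *\<^sub>v v + a \<cdot>\<^sub>v (Y *\<^sub>v v)" "(X - a \<cdot>\<^sub>m Y) *\<^sub>v v = X *\<^sub>v v - a \<cdot>\<^sub>v (Y *\<^sub>v v)"
proof -
  have "a \<cdot>\<^sub>m Y \<in> carrier_mat r c" using X by simp
  then show "(X + a \<cdot>\<^sub>m Y) *\<^sub>v v = X *\<^sub>v v + a \<cdot>\<^sub>v (Y *\<^sub>v v)" "(X - a \<cdot>\<^sub>m Y) *\<^sub>v v = X *\<^sub>v v - a \<cdot>\<^sub>v (Y *\<^sub>v v)"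
    using X by (simp_all add: add_mult_distrib_mat_vec[of _ r c] minus_mult_distrib_mat_vec[of _ r c] smult_mat_mult_vec[of _ r c])
qed

text \<open>For \<open>s \<noteq> 1\<close>, \<open>A_cay v = s * E_cay v\<close> means that the
  even pencil has \<open>v\<close> as eigenvector for \<open>\<gamma> * (1 + s) / (1 - s)\<close>;
  \<open>s = 1\<close> belongs to the infinite eigenvalue.\<close>

definition E_cay :: "complex mat" where "E_cay = \<A> + g \<cdot>\<^sub>m \<E>"
definition A_cay :: "complex mat" where "A_cay = \<A> - g \<cdot>\<^sub>m \<E>"

text \<open>The coordinates \<open>u\<close> and \<open>u'\<close> merge into the input of a step,
  so the Cayley relation descends to the first \<open>2 * n\<close> coordinates.\<close>

lemma cay_imp_red:
  assumes z: "z \<in> carrier_vec (2 * n)" "z' \<in> carrier_vec (2 * n)" "u \<in> carrier_vec m" "u' \<in> carrier_vec m"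
    and eq: "A_cay *\<^sub>v (z @\<^sub>v u) = E_cay *\<^sub>v (z' @\<^sub>v u')"
  shows "A_red *\<^sub>v z = E_red *\<^sub>v z'"
proof -
  obtain \<mu> x where zz: "z = \<mu> @\<^sub>v x" and c: "\<mu> \<in> carrier_vec n" "x \<in> carrier_vec n"
    using z(1) by (rule split_2n_vec)
  obtain \<mu>' x' where zz': "z' = \<mu>' @\<^sub>v x'" and c': "\<mu>' \<in> carrier_vec n" "x' \<in> carrier_vec n"
    using z(2) by (rule split_2n_vec)
  have v: "z @\<^sub>v u \<in> carrier_vec (2 * n + m)" "z' @\<^sub>v u' \<in> carrier_vec (2 * n + m)" using z by simp_all
  have "\<A> *\<^sub>v (z @\<^sub>v u) - g \<cdot>\<^sub>v (\<E> *\<^sub>v (z @\<^sub>v u)) = \<A> *\<^sub>v (z' @\<^sub>v u') + g \<cdot>\<^sub>v (\<E> *\<^sub>v (z' @\<^sub>v u'))"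
    using eq unfolding A_cay_def E_cay_def
      cayley_mult(2)[OF even_carrier(2,1) v(1)] cayley_mult(1)[OF even_carrier(2,1) v(2)] .
  from even_pencil_step[OF c z(3) c' z(4) this[unfolded zz zz']]
  show ?thesis unfolding zz zz' using c c' by (auto simp: red_eq_iff_step)
qed

text \<open>These facts let later arguments work without a basis of \<open>\<V>\<close>; only
  \<open>L_induct\<close> returns to the witness matrices. The resolvent property holds because
  \<open>\<E>\<close> and \<open>s \<E> - \<A>\<close> restrict to the small pencil, which is
  invertible at \<open>s\<close>; maximality holds because the \<open>n + m\<close> basis columns
  form a neutral family of the largest size.\<close>

lemma V_carrier: "\<V> \<subseteq> carrier_vec (2 * n + m)"
  and V_zero: "0\<^sub>v (2 * n + m) \<in> \<V>"
  and V_add: "v \<in> \<V> \<Longrightarrow> w \<in> \<V> \<Longrightarrow> v + w \<in> \<V>"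
  and V_smult: "v \<in> \<V> \<Longrightarrow> a \<cdot>\<^sub>v v \<in> \<V>"
  and V_resolvent: "det (s \<cdot>\<^sub>m \<E> - \<A>) \<noteq> 0 \<Longrightarrow> v \<in> \<V> \<Longrightarrow> \<exists>w\<in>\<V>. s \<cdot>\<^sub>v (\<E> *\<^sub>v w) - \<A> *\<^sub>v w = \<E> *\<^sub>v v"
  and V_eigenvalue: "v \<in> \<V> \<Longrightarrow> v \<noteq> 0\<^sub>v (2 * n + m) \<Longrightarrow> \<A> *\<^sub>v v = z \<cdot>\<^sub>v (\<E> *\<^sub>v v) \<Longrightarrow> Re z \<le> 0"
  and V_maximal: "u \<in> carrier_vec (2 * n + m) \<Longrightarrow> hform n u u = 0 \<Longrightarrow> (\<And>w. w \<in> \<V> \<Longrightarrow> hform n w u = 0) \<Longrightarrow> u \<in> \<V>"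
proof -
  let ?N = "2 * n + m"
  obtain V W E' A' where E': "E' \<in> carrier_mat (n + m) (n + m)" and A': "A' \<in> carrier_mat (n + m) (n + m)"
    and V: "V \<in> carrier_mat ?N (n + m)" and W: "W \<in> carrier_mat ?N (n + m)"
    and SV: "\<V> = {V *\<^sub>v c | c. c \<in> carrier_vec (n + m)}"
    and injV: "\<And>c. c \<in> carrier_vec (n + m) \<Longrightarrow> V *\<^sub>v c = 0\<^sub>v ?N \<Longrightarrow> c = 0\<^sub>v (n + m)"
    and EV: "\<And>c. c \<in> carrier_vec (n + m) \<Longrightarrow> \<E> *\<^sub>v (V *\<^sub>v c) = W *\<^sub>v (E' *\<^sub>v c)"
    and AV: "\<And>c. c \<in> carrier_vec (n + m) \<Longrightarrow> \<A> *\<^sub>v (V *\<^sub>v c) = W *\<^sub>v (A' *\<^sub>v c)"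
    and inv: "\<And>s. det (s \<cdot>\<^sub>m \<E> - \<A>) \<noteq> 0 \<Longrightarrow> invertible_mat (s \<cdot>\<^sub>m E' - A')"
    and ev: "\<And>v z. v \<in> \<V> \<Longrightarrow> v \<noteq> 0\<^sub>v ?N \<Longrightarrow> \<A> *\<^sub>v v = z \<cdot>\<^sub>v (\<E> *\<^sub>v v) \<Longrightarrow> Re z \<le> 0"
    by (rule semi_stable_deflatingE[OF reg semi]) blast
  show Vc: "\<V> \<subseteq> carrier_vec ?N" unfolding SV using mult_mat_vec_carrier[OF V] by auto
  show "0\<^sub>v ?N \<in> \<V>" unfolding SV using mult_mat_zero_vec[OF V] zero_carrier_vec by (intro CollectI exI[of _ "0\<^sub>v (n + m)"]) simp
  show "v + w \<in> \<V>" if "v \<in> \<V>" "w \<in> \<V>" for v w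
    using that unfolding SV by (auto simp: mult_add_distrib_mat_vec[OF V, symmetric])
  show "a \<cdot>\<^sub>v v \<in> \<V>" if "v \<in> \<V>" for a v
    using that unfolding SV by (auto simp: mult_mat_vec[OF V, symmetric])
  show "v \<in> \<V> \<Longrightarrow> v \<noteq> 0\<^sub>v ?N \<Longrightarrow> \<A> *\<^sub>v v = z \<cdot>\<^sub>v (\<E> *\<^sub>v v) \<Longrightarrow> Re z \<le> 0" for v z by (rule ev)
  show "\<exists>w\<in>\<V>. s \<cdot>\<^sub>v (\<E> *\<^sub>v w) - \<A> *\<^sub>v w = \<E> *\<^sub>v v" if s: "det (s \<cdot>\<^sub>m \<E> - \<A>) \<noteq> 0" and v: "v \<in> \<V>" for s v
  proof -
    obtain c where c: "c \<in> carrier_vec (n + m)" "v = V *\<^sub>v c" using v SV by blast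
    have sq: "s \<cdot>\<^sub>m E' - A' \<in> carrier_mat (n + m) (n + m)" using A' by (rule minus_carrier_mat)
    have E'c: "E' *\<^sub>v c \<in> carrier_vec (n + m)" using E' c(1) by (rule mult_mat_vec_carrier)
    obtain d where d: "d \<in> carrier_vec (n + m)" "(s \<cdot>\<^sub>m E' - A') *\<^sub>v d = E' *\<^sub>v c"
      using inv[OF s] sq E'c by (rule invertible_mat_surjective)
    have cd: "E' *\<^sub>v d \<in> carrier_vec (n + m)" "A' *\<^sub>v d \<in> carrier_vec (n + m)"
      using E' A' d(1) by (auto intro: mult_mat_vec_carrier)
    have "s \<cdot>\<^sub>v (\<E> *\<^sub>v (V *\<^sub>v d)) - \<A> *\<^sub>v (V *\<^sub>v d) = W *\<^sub>v (s \<cdot>\<^sub>v (E' *\<^sub>v d) - A' *\<^sub>v d)"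
      using cd by (simp add: EV[OF d(1)] AV[OF d(1)] mult_minus_distrib_mat_vec[OF W] mult_mat_vec[OF W])
    also have "\<dots> = W *\<^sub>v (E' *\<^sub>v c)" using d(2) mult_mat_vec_diff[OF E' A' d(1)] by simp
    also have "\<dots> = \<E> *\<^sub>v v" using EV[OF c(1)] c(2) by simp
    finally show ?thesis using d(1) SV by blast
  qed
  show "u \<in> \<V>" if u: "u \<in> carrier_vec ?N" "hform n u u = 0" "\<And>w. w \<in> \<V> \<Longrightarrow> hform n w u = 0" for u
  proof -
    let ?I = "{..<n + m}"
    have colV: "col V i \<in> \<V>" if "i < n + m" for i
      unfolding SV using mult_mat_unit_vec[OF V that] by (intro CollectI exI[of _ "unit_vec (n + m) i"]) auto
    have "\<exists>c. \<forall>k<?N. u $ k = (\<Sum>i\<in>?I. c i * col V i $ k)"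
    proof (rule neutral_family_maximal[of ?I n m "\<lambda>i. ($) (col V i)"])
      show "hform n (col V i) (col V j) = 0" if "i \<in> ?I" "j \<in> ?I" for i j
        using neutral_V colV[of i] colV[of j] that even_E_form[of "col V i" "col V j"] Vc by (auto simp: neutral_def)
      show "hform n (col V i) u = 0" if "i \<in> ?I" for i using u(3) colV that by simp
      show "\<forall>i\<in>?I. c i = 0" if 0: "\<And>k. k < ?N \<Longrightarrow> (\<Sum>i\<in>?I. c i * col V i $ k) = 0" for c
      proof -
        have "V *\<^sub>v vec (n + m) c = 0\<^sub>v ?N"
        proof (rule eq_vecI)
          fix k assume "k < dim_vec (0\<^sub>v ?N :: complex vec)"
          then have k: "k < ?N" by simp
          have "(V *\<^sub>v vec (n + m) c) $ k = (\<Sum>i<n + m. c i * col V i $ k)"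
            unfolding mult_mat_vec_index[OF V vec_carrier k] using k V by (intro sum.cong) auto
          then show "(V *\<^sub>v vec (n + m) c) $ k = 0\<^sub>v ?N $ k" using 0[OF k] k by simp
        qed (use V in auto)
        then have "vec (n + m) c = 0\<^sub>v (n + m)" by (intro injV) auto
        then show ?thesis by (metis index_vec index_zero_vec(1) lessThan_iff)
      qed
    qed (use u in auto)
    then obtain c where c: "\<And>k. k < ?N \<Longrightarrow> u $ k = (\<Sum>i<n + m. c i * col V i $ k)" by auto
    have "V *\<^sub>v vec (n + m) c = u"
    proof (rule eq_vecI)
      fix k assume "k < dim_vec u"
      then have k: "k < ?N" using u(1) by simp
      have "(V *\<^sub>v vec (n + m) c) $ k = (\<Sum>i<n + m. c i * col V i $ k)"
        unfolding mult_mat_vec_index[OF V vec_carrier k] using k V by (intro sum.cong) auto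
      then show "(V *\<^sub>v vec (n + m) c) $ k = u $ k" using c[OF k] by simp
    qed (use V u in auto)
    then show ?thesis unfolding SV by (intro CollectI exI[of _ "vec (n + m) c"]) auto
  qed
qed

end

lemma vec_first_append [simp]: "v \<in> carrier_vec a \<Longrightarrow> vec_first (v @\<^sub>v w) a = v"
  by (intro eq_vecI) (auto simp: vec_first_def)

lemma vec_first_combination:
  "v \<in> carrier_vec (a + b) \<Longrightarrow> w \<in> carrier_vec (a + b) \<Longrightarrow>
    vec_first (c \<cdot>\<^sub>v v + w) a = c \<cdot>\<^sub>v vec_first v a + vec_first w a"
  "v \<in> carrier_vec (a + b) \<Longrightarrow> w \<in> carrier_vec (a + b) \<Longrightarrow> vec_first (v + w) a = vec_first v a + vec_first w a"
  "v \<in> carrier_vec (a + b) \<Longrightarrow> vec_first (c \<cdot>\<^sub>v v) a = c \<cdot>\<^sub>v vec_first v a"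
  by (auto intro!: eq_vecI simp: vec_first_def)

lemma vec_first_zero: "vec_first (0\<^sub>v (a + b)) a = 0\<^sub>v a"
  by (intro eq_vecI) (auto simp: vec_first_def)

lemma split_vec_first:
  assumes "v \<in> carrier_vec (a + b)"
  obtains u where "u \<in> carrier_vec b" "v = vec_first v a @\<^sub>v u"
  using vec_first_last_append[OF assms] vec_last_carrier by metis

section \<open>The first 2n coordinates of the deflating subspace\<close>

context lure_problem
begin

text \<open>A slice of \<open>\<V>\<close>, which equals the projection onto the first
  \<open>2 * n\<close> coordinates by \<open>V_iff_L\<close>; as a slice it inherits linearity at
  once.\<close>

definition L :: "complex vec set" where
  "L = {z \<in> carrier_vec (2 * n). z @\<^sub>v 0\<^sub>v m \<in> \<V>}"

text \<open>These vectors are orthogonal to everything, so the maximality of \<open>\<V>\<close>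
  absorbs them. They account for the identity block in the final basis.\<close>

lemma V_kernel:
  assumes u: "u \<in> carrier_vec m"
  shows "0\<^sub>v (2 * n) @\<^sub>v u \<in> \<V>"
proof (rule V_maximal)
  have *: "hform n w (0\<^sub>v (2 * n) @\<^sub>v u) = 0" if w: "w \<in> carrier_vec (2 * n + m)" for w
  proof -
    obtain u' where "w = vec_first w (2 * n) @\<^sub>v u'" using w by (rule split_vec_first)
    then have "hform n w (0\<^sub>v (2 * n) @\<^sub>v u) = hform n (vec_first w (2 * n)) (0\<^sub>v (2 * n))"
      using hform_append_right[of "vec_first w (2 * n)" n "0\<^sub>v (2 * n)" u' u] by simp
    then show ?thesis by simp
  qed
  show c: "0\<^sub>v (2 * n) @\<^sub>v u \<in> carrier_vec (2 * n + m)" using u by simp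
  show "hform n (0\<^sub>v (2 * n) @\<^sub>v u) (0\<^sub>v (2 * n) @\<^sub>v u) = 0" by (rule *[OF c])
  show "hform n w (0\<^sub>v (2 * n) @\<^sub>v u) = 0" if "w \<in> \<V>" for w using * V_carrier that by blast
qed

lemma V_iff_L:
  assumes z: "z \<in> carrier_vec (2 * n)" and u: "u \<in> carrier_vec m"
  shows "z @\<^sub>v u \<in> \<V> \<longleftrightarrow> z \<in> L"
proof -
  have 1: "z @\<^sub>v u = (z @\<^sub>v 0\<^sub>v m) + (0\<^sub>v (2 * n) @\<^sub>v u)"
    using z u by (simp add: append_vec_add[of _ "2 * n" _ _ m])
  have 2: "z @\<^sub>v 0\<^sub>v m = (z @\<^sub>v u) + (-1) \<cdot>\<^sub>v (0\<^sub>v (2 * n) @\<^sub>v u)"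
  proof -
    have "u + (-1) \<cdot>\<^sub>v u = 0\<^sub>v m" using u by (intro eq_vecI) auto
    then show ?thesis using z u by (simp add: append_vec_smult append_vec_add[of _ "2 * n" _ _ m])
  qed
  have k: "0\<^sub>v (2 * n) @\<^sub>v u \<in> \<V>" using u by (rule V_kernel)
  show ?thesis
  proof
    assume "z @\<^sub>v u \<in> \<V>"
    then have "z @\<^sub>v 0\<^sub>v m \<in> \<V>" unfolding 2 using V_smult[OF k] by (rule V_add)
    then show "z \<in> L" using z by (simp add: L_def)
  next
    assume "z \<in> L"
    then have "z @\<^sub>v 0\<^sub>v m \<in> \<V>" by (simp add: L_def)
    then show "z @\<^sub>v u \<in> \<V>" unfolding 1 using k by (rule V_add)
  qed
qed

lemma L_carrier: "L \<subseteq> carrier_vec (2 * n)"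
  by (auto simp: L_def)

lemma L_zero: "0\<^sub>v (2 * n) \<in> L"
  using V_zero by (simp add: L_def)

lemma L_add: "z \<in> L \<Longrightarrow> w \<in> L \<Longrightarrow> z + w \<in> L"
  using V_add[of "z @\<^sub>v 0\<^sub>v m" "w @\<^sub>v 0\<^sub>v m"] by (auto simp: L_def append_vec_add[of _ "2 * n" _ _ m])

lemma L_smult: "z \<in> L \<Longrightarrow> a \<cdot>\<^sub>v z \<in> L"
  using V_smult[of "z @\<^sub>v 0\<^sub>v m" a] by (auto simp: L_def append_vec_smult)

lemma L_minus: "z \<in> L \<Longrightarrow> w \<in> L \<Longrightarrow> z - w \<in> L"
proof -
  assume zw: "z \<in> L" "w \<in> L"
  then have c: "z \<in> carrier_vec (2 * n)" "w \<in> carrier_vec (2 * n)" using L_carrier by auto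
  have "z - w = z + (-1) \<cdot>\<^sub>v w" using c by (intro eq_vecI) auto
  then show "z - w \<in> L" using L_add[OF zw(1) L_smult[OF zw(2)]] by simp
qed

lemma L_neutral: "z \<in> L \<Longrightarrow> w \<in> L \<Longrightarrow> hform n z w = 0"
proof -
  assume z: "z \<in> L" and w: "w \<in> L"
  then have c: "z \<in> carrier_vec (2 * n)" "w \<in> carrier_vec (2 * n)" "z @\<^sub>v 0\<^sub>v m \<in> \<V>" "w @\<^sub>v 0\<^sub>v m \<in> \<V>"
    by (auto simp: L_def)
  have "hform n (z @\<^sub>v 0\<^sub>v m) (w @\<^sub>v 0\<^sub>v m) = 0"
    using neutral_V c(3,4) even_E_form[of "z @\<^sub>v 0\<^sub>v m" "w @\<^sub>v 0\<^sub>v m"] c(1,2) by (simp add: neutral_def)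
  then show "hform n z w = 0" using hform_append_right[OF c(1,2)] by simp
qed

lemma L_maximal:
  assumes z: "z \<in> carrier_vec (2 * n)" "hform n z z = 0" "\<And>w. w \<in> L \<Longrightarrow> hform n w z = 0"
  shows "z \<in> L"
proof -
  have "z @\<^sub>v 0\<^sub>v m \<in> \<V>"
  proof (rule V_maximal)
    show "z @\<^sub>v 0\<^sub>v m \<in> carrier_vec (2 * n + m)" using z by simp
    show "hform n (z @\<^sub>v 0\<^sub>v m) (z @\<^sub>v 0\<^sub>v m) = 0" using z by (simp add: hform_append_right)
    show "hform n w (z @\<^sub>v 0\<^sub>v m) = 0" if w: "w \<in> \<V>" for w
    proof -
      have "w \<in> carrier_vec (2 * n + m)" using w V_carrier by auto
      then obtain u where u: "u \<in> carrier_vec m" "w = vec_first w (2 * n) @\<^sub>v u" by (rule split_vec_first)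
      then have "vec_first w (2 * n) \<in> L" using w V_iff_L[OF vec_first_carrier u(1)] by metis
      then have "hform n (vec_first w (2 * n)) z = 0" by (rule z(3))
      then show ?thesis using u(2) hform_append_right[OF vec_first_carrier z(1)] by metis
    qed
  qed
  then show ?thesis using z by (simp add: L_def)
qed

text \<open>With \<open>l = Complex 0 \<omega>\<close> and \<open>a = (l - g) / (l + g)\<close> the
  last equation says that \<open>l\<close> is the inverse Cayley image of \<open>a\<close>; it
  transports nonsingularity at \<open>l\<close> to nonsingularity at \<open>a\<close>. The
  denominators are nonzero since \<open>\<gamma> > 0\<close>.\<close>

lemma cayley_point:
  obtains \<omega> where "det (Complex 0 \<omega> \<cdot>\<^sub>m \<E> - \<A>) \<noteq> 0" "Complex 0 \<omega> + g \<noteq> 0"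
    "1 - (Complex 0 \<omega> - g) / (Complex 0 \<omega> + g) \<noteq> 0"
    "g * (1 + (Complex 0 \<omega> - g) / (Complex 0 \<omega> + g)) = (1 - (Complex 0 \<omega> - g) / (Complex 0 \<omega> + g)) * Complex 0 \<omega>"
proof -
  obtain \<omega> where w: "det (Complex 0 \<omega> \<cdot>\<^sub>m \<E> - \<A>) \<noteq> 0" using regular_pencil_imaginary[OF reg] .
  have nz: "Complex 0 \<omega> + g \<noteq> 0" using \<gamma> by (simp add: complex_eq_iff)
  have g0: "g \<noteq> 0" using \<gamma> by simp
  have 1: "1 - (Complex 0 \<omega> - g) / (Complex 0 \<omega> + g) = 2 * g / (Complex 0 \<omega> + g)"
    using nz by (simp add: field_simps)
  have 2: "1 + (Complex 0 \<omega> - g) / (Complex 0 \<omega> + g) = 2 * Complex 0 \<omega> / (Complex 0 \<omega> + g)"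
    using nz by (simp add: field_simps)
  show thesis using nz g0 by (intro that[OF w nz]) (simp_all add: 1 2)
qed

text \<open>A kernel vector \<open>z\<close> of the reduced pencil at \<open>a\<close> is a step
  from \<open>z\<close> to \<open>a z\<close>. Rescaling its input by \<open>- 1 / (1 - a)\<close>
  completes it to a kernel vector of the even pencil at \<open>l\<close>, which vanishes.\<close>

lemma red_regular: "regular_pencil (2 * n) E_red A_red"
proof -
  obtain \<omega> where w: "det (Complex 0 \<omega> \<cdot>\<^sub>m \<E> - \<A>) \<noteq> 0" "Complex 0 \<omega> + g \<noteq> 0"
    "1 - (Complex 0 \<omega> - g) / (Complex 0 \<omega> + g) \<noteq> 0"
    "g * (1 + (Complex 0 \<omega> - g) / (Complex 0 \<omega> + g)) = (1 - (Complex 0 \<omega> - g) / (Complex 0 \<omega> + g)) * Complex 0 \<omega>"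
    by (rule cayley_point)
  define l where "l = Complex 0 \<omega>"
  define a where "a = (l - g) / (l + g)"
  have a: "1 - a \<noteq> 0" "g * (1 + a) = (1 - a) * l" using w by (simp_all add: a_def l_def)
  have sq: "a \<cdot>\<^sub>m E_red - A_red \<in> carrier_mat (2 * n) (2 * n)" using red_carrier(2) by (rule minus_carrier_mat)
  have lsq: "l \<cdot>\<^sub>m \<E> - \<A> \<in> carrier_mat (2 * n + m) (2 * n + m)" using even_carrier(2) by (rule minus_carrier_mat)
  have linv: "invertible_mat (l \<cdot>\<^sub>m \<E> - \<A>)" using w(1) lsq by (simp add: invertible_mat_iff_det l_def)
  have "v = 0\<^sub>v (2 * n)" if v: "v \<in> carrier_vec (2 * n)" "(a \<cdot>\<^sub>m E_red - A_red) *\<^sub>v v = 0\<^sub>v (2 * n)" for v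
  proof -
    obtain \<mu> x where vv: "v = \<mu> @\<^sub>v x" and c [simp]: "\<mu> \<in> carrier_vec n" "x \<in> carrier_vec n"
      using v(1) by (rule split_2n_vec)
    have [simp]: "dim_vec \<mu> = n" "dim_vec x = n" using c by (simp_all only: carrier_vecD)
    have "E_red *\<^sub>v v \<in> carrier_vec (2 * n)" "A_red *\<^sub>v v \<in> carrier_vec (2 * n)"
      using v(1) red_carrier by (auto intro: mult_mat_vec_carrier)
    then have "A_red *\<^sub>v v = E_red *\<^sub>v (a \<cdot>\<^sub>v v)"
      using v mult_mat_vec_diff[OF red_carrier v(1)] vec_minus_eq_0_iff[of "a \<cdot>\<^sub>v (E_red *\<^sub>v v)" "2 * n" "A_red *\<^sub>v v"]
      by (simp add: mult_mat_vec[OF red_carrier(1)])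
    then obtain u where st: "step \<mu> x (a \<cdot>\<^sub>v \<mu>) (a \<cdot>\<^sub>v x) u"
      unfolding vv append_vec_smult using red_eq_iff_step[of \<mu> x "a \<cdot>\<^sub>v \<mu>" "a \<cdot>\<^sub>v x"] by auto
    then have u [simp]: "u \<in> carrier_vec m" by (simp add: step_def)
    define w where "w = (- 1 / (1 - a)) \<cdot>\<^sub>v u"
    have w [simp]: "w \<in> carrier_vec m" by (simp add: w_def)
    have [simp]: "dim_vec w = m" using w by (simp only: carrier_vecD)
    have "(- (1 - a)) * (- 1 / (1 - a)) = 1" using a(1) by (simp only: mult_minus_left mult_minus_right minus_divide_left[symmetric] times_divide_eq_right) simp
    then have uw: "u = (- (1 - a)) \<cdot>\<^sub>v w" unfolding w_def smult_smult_assoc by simp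
    have d: "x - a \<cdot>\<^sub>v x = (1 - a) \<cdot>\<^sub>v x" "\<mu> - a \<cdot>\<^sub>v \<mu> = (1 - a) \<cdot>\<^sub>v \<mu>" "x + a \<cdot>\<^sub>v x = (1 + a) \<cdot>\<^sub>v x" "\<mu> + a \<cdot>\<^sub>v \<mu> = (1 + a) \<cdot>\<^sub>v \<mu>"
      by (intro eq_vecI; simp add: algebra_simps)+
    have m: "M *\<^sub>v (s \<cdot>\<^sub>v y) = s \<cdot>\<^sub>v (M *\<^sub>v y)" if "M \<in> carrier_mat p q" "y \<in> carrier_vec q" for M :: "complex mat" and s y p q
      using that by (rule mult_mat_vec)
    have f: "(1 - a) \<cdot>\<^sub>v (A *\<^sub>v x) = (g * (1 + a)) \<cdot>\<^sub>v x + (- (1 - a)) \<cdot>\<^sub>v (B *\<^sub>v w)"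
      "(1 - a) \<cdot>\<^sub>v (mat_adjoint A *\<^sub>v \<mu>) + (g * (1 + a)) \<cdot>\<^sub>v \<mu> + (1 - a) \<cdot>\<^sub>v (Q *\<^sub>v x) = (- (1 - a)) \<cdot>\<^sub>v (C *\<^sub>v w)"
      "(1 - a) \<cdot>\<^sub>v (mat_adjoint B *\<^sub>v \<mu>) + (1 - a) \<cdot>\<^sub>v (mat_adjoint C *\<^sub>v x) = (- (1 - a)) \<cdot>\<^sub>v (R *\<^sub>v w)"
      using st unfolding step_def uw d
      by (simp_all add: m[of _ n n] m[of _ n m] m[of _ m n] m[of _ m m] smult_smult_assoc)
    have cancel: "k * p + k * l * q + k * r = - k * s \<Longrightarrow> k \<noteq> 0 \<Longrightarrow> p + l * q + r + s = 0" for k l p q r s :: complex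
    proof -
      assume "k * p + k * l * q + k * r = - k * s" "k \<noteq> 0"
      moreover have "k * (p + l * q + r + s) = (k * p + k * l * q + k * r) + k * s" by (simp add: algebra_simps)
      ultimately show ?thesis by simp
    qed
    have e1: "(A *\<^sub>v x) $ i = l * x $ i - (B *\<^sub>v w) $ i" if i: "i < n" for i
    proof -
      have "(1 - a) * (A *\<^sub>v x) $ i = (1 - a) * (l * x $ i - (B *\<^sub>v w) $ i)"
        using arg_cong[OF f(1)[unfolded a(2)], of "\<lambda>v. v $ i"] i
        by (simp add: right_diff_distrib mult.assoc left_diff_distrib del: index_mult_mat_vec)
      then show ?thesis using a(1) by simp
    qed
    have e2: "(mat_adjoint A *\<^sub>v \<mu>) $ i + l * \<mu> $ i + (Q *\<^sub>v x) $ i + (C *\<^sub>v w) $ i = 0" if i: "i < n" for i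
      by (rule cancel[OF _ a(1)]) (use arg_cong[OF f(2)[unfolded a(2)], of "\<lambda>v. v $ i"] i in \<open>simp del: index_mult_mat_vec\<close>)
    have e3: "(mat_adjoint B *\<^sub>v \<mu>) $ i + (mat_adjoint C *\<^sub>v x) $ i + (R *\<^sub>v w) $ i = 0" if i: "i < m" for i
    proof -
      \<comment> \<open>The third row has no \<open>l\<close>-term; \<open>0 * 0\<close> stands in
        for it to match \<open>cancel\<close>.\<close>
      have "(mat_adjoint B *\<^sub>v \<mu>) $ i + 0 * 0 + (mat_adjoint C *\<^sub>v x) $ i + (R *\<^sub>v w) $ i = 0"
        by (rule cancel[OF _ a(1)]) (use arg_cong[OF f(3), of "\<lambda>v. v $ i"] i in \<open>simp del: index_mult_mat_vec\<close>)
      then show ?thesis by simp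
    qed
    have "(l \<cdot>\<^sub>m \<E> - \<A>) *\<^sub>v ((\<mu> @\<^sub>v x) @\<^sub>v w) = l \<cdot>\<^sub>v (\<E> *\<^sub>v ((\<mu> @\<^sub>v x) @\<^sub>v w)) - \<A> *\<^sub>v ((\<mu> @\<^sub>v x) @\<^sub>v w)"
      by (rule mult_mat_vec_diff[OF even_carrier]) (simp add: mult_2)
    also have "\<dots> = ((l \<cdot>\<^sub>v (- x) + (A *\<^sub>v x + B *\<^sub>v w)) @\<^sub>v
        (l \<cdot>\<^sub>v \<mu> + (mat_adjoint A *\<^sub>v \<mu> + Q *\<^sub>v x + C *\<^sub>v w))) @\<^sub>v (mat_adjoint B *\<^sub>v \<mu> + mat_adjoint C *\<^sub>v x + R *\<^sub>v w)"
      unfolding even_A_mult[OF c w] even_E_mult[OF c w]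
      by (intro eq_vecI) (auto simp del: index_mult_mat_vec)
    also have "l \<cdot>\<^sub>v (- x) + (A *\<^sub>v x + B *\<^sub>v w) = 0\<^sub>v n"
      by (intro eq_vecI) (simp_all add: e1 del: index_mult_mat_vec)
    also have "l \<cdot>\<^sub>v \<mu> + (mat_adjoint A *\<^sub>v \<mu> + Q *\<^sub>v x + C *\<^sub>v w) = 0\<^sub>v n"
      using e2 by (intro eq_vecI) (simp_all add: add.assoc add.left_commute del: index_mult_mat_vec)
    also have "mat_adjoint B *\<^sub>v \<mu> + mat_adjoint C *\<^sub>v x + R *\<^sub>v w = 0\<^sub>v m"
      using e3 by (intro eq_vecI) (simp_all del: index_mult_mat_vec)
    also have "(0\<^sub>v n @\<^sub>v 0\<^sub>v n) @\<^sub>v 0\<^sub>v m = (0\<^sub>v (2 * n + m) :: complex vec)" by (simp add: mult_2)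
    finally have "(\<mu> @\<^sub>v x) @\<^sub>v w = 0\<^sub>v (2 * n + m)"
      using linv[unfolded invertible_mat_iff_injective[OF lsq]] by (simp add: mult_2)
    then show ?thesis
      using append_vec_eq_zero_iff[of v "2 * n" w m] v(1) vv by simp
  qed
  then have "invertible_mat (a \<cdot>\<^sub>m E_red - A_red)" by (simp add: invertible_mat_iff_injective[OF sq])
  then show ?thesis
    unfolding regular_pencil_def using red_carrier invertible_mat_iff_det[OF sq] by blast
qed

section \<open>Chains inside the deflating subspace\<close>

lemma chain_V_imp_L:
  assumes ch: "pencil_chain (2 * n + m) E_cay A_cay ev k v" and V: "\<And>i. i < k \<Longrightarrow> v i \<in> \<V>"
  shows "pencil_chain (2 * n) E_red A_red ev k (\<lambda>i. vec_first (v i) (2 * n))"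
    and "i < k \<Longrightarrow> vec_first (v i) (2 * n) \<in> L"
proof -
  have split: "\<exists>u\<in>carrier_vec m. v i = vec_first (v i) (2 * n) @\<^sub>v u" if "i < k" for i
    using pencil_chain_carrier[OF ch that] split_vec_first by metis
  show "vec_first (v i) (2 * n) \<in> L" if i: "i < k" for i
    using split[OF i] V[OF i] V_iff_L[OF vec_first_carrier] by metis
  have vc: "v i \<in> carrier_vec (2 * n + m)" "chain_pred (2 * n + m) v i \<in> carrier_vec (2 * n + m)" if "i < k" for i
    using ch that by (auto intro: pencil_chain_carrier pencil_chain_pred_carrier)
  have imp: "A_red *\<^sub>v vec_first p (2 * n) = E_red *\<^sub>v vec_first q (2 * n)"
    if p: "p \<in> carrier_vec (2 * n + m)" and q: "q \<in> carrier_vec (2 * n + m)" and eq: "A_cay *\<^sub>v p = E_cay *\<^sub>v q" for p q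
  proof -
    obtain u where "u \<in> carrier_vec m" "p = vec_first p (2 * n) @\<^sub>v u" using p by (rule split_vec_first)
    moreover obtain w where "w \<in> carrier_vec m" "q = vec_first q (2 * n) @\<^sub>v w" using q by (rule split_vec_first)
    ultimately show ?thesis using eq cay_imp_red[OF vec_first_carrier vec_first_carrier] by metis
  qed
  have pred: "chain_pred (2 * n) (\<lambda>i. vec_first (v i) (2 * n)) i = vec_first (chain_pred (2 * n + m) v i) (2 * n)" for i
    by (cases i) (simp_all add: vec_first_zero)
  show "pencil_chain (2 * n) E_red A_red ev k (\<lambda>i. vec_first (v i) (2 * n))"
    unfolding pencil_chain_def
  proof (intro allI impI conjI)
    fix i assume i: "i < k"
    show "case ev of
        Finite z \<Rightarrow> A_red *\<^sub>v vec_first (v i) (2 * n) = E_red *\<^sub>v (z \<cdot>\<^sub>v vec_first (v i) (2 * n) + chain_pred (2 * n) (\<lambda>i. vec_first (v i) (2 * n)) i)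
      | Infinity \<Rightarrow> E_red *\<^sub>v vec_first (v i) (2 * n) = A_red *\<^sub>v chain_pred (2 * n) (\<lambda>i. vec_first (v i) (2 * n)) i"
    proof (cases ev)
      case (Finite z)
      then have "A_cay *\<^sub>v v i = E_cay *\<^sub>v (z \<cdot>\<^sub>v v i + chain_pred (2 * n + m) v i)"
        using ch i by (simp add: pencil_chain_def)
      then show ?thesis
        using imp[of "v i" "z \<cdot>\<^sub>v v i + chain_pred (2 * n + m) v i"] vc[OF i] Finite
        by (simp add: pred vec_first_combination(1)[OF vc[OF i]])
    next
      case Infinity
      then have "A_cay *\<^sub>v chain_pred (2 * n + m) v i = E_cay *\<^sub>v v i"
        using ch i by (simp add: pencil_chain_def)
      then show ?thesis using imp[OF vc(2)[OF i] vc(1)[OF i]] Infinity by (simp add: pred)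
    qed
  qed simp
qed

text \<open>\<open>(1 + s) / (1 - s)\<close> maps the open unit disc to the open right half-plane.\<close>
lemma no_stable_eigenvector:
  assumes v: "v \<in> \<V>" "v \<noteq> 0\<^sub>v (2 * n + m)" and eq: "A_cay *\<^sub>v v = E_cay *\<^sub>v (s \<cdot>\<^sub>v v)"
  shows "cmod s \<ge> 1"
proof (rule ccontr)
  assume "\<not> 1 \<le> cmod s"
  then have s: "cmod s < 1" by simp
  then have s1: "1 - s \<noteq> 0" by auto
  have vc: "v \<in> carrier_vec (2 * n + m)" using v V_carrier by auto
  define a where "a = \<A> *\<^sub>v v"
  define e where "e = \<E> *\<^sub>v v"
  have ac: "a \<in> carrier_vec (2 * n + m)" "e \<in> carrier_vec (2 * n + m)"
    using even_carrier vc by (auto simp: a_def e_def intro: mult_mat_vec_carrier)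
  have d: "dim_vec a = 2 * n + m" "dim_vec e = 2 * n + m" using ac by (simp_all only: carrier_vecD)
  have eq': "a - g \<cdot>\<^sub>v e = s \<cdot>\<^sub>v a + (g * s) \<cdot>\<^sub>v e"
    using eq vc unfolding A_cay_def E_cay_def
    by (simp add: cayley_mult[OF even_carrier(2,1)] mult_mat_vec[OF even_carrier(1)] mult_mat_vec[OF even_carrier(2)]
        a_def e_def smult_smult_assoc)
  define z where "z = g * (1 + s) / (1 - s)"
  have "a = z \<cdot>\<^sub>v e"
  proof (rule eq_vecI)
    fix i assume "i < dim_vec (z \<cdot>\<^sub>v e)"
    then have i: "i < 2 * n + m" using d by simp
    have "(a - g \<cdot>\<^sub>v e) $ i = (s \<cdot>\<^sub>v a + (g * s) \<cdot>\<^sub>v e) $ i" by (simp only: eq')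
    then have "a $ i - g * e $ i = s * a $ i + g * s * e $ i" using i d by simp
    then have "(1 - s) * a $ i = g * (1 + s) * e $ i" by (simp add: algebra_simps)
    then show "a $ i = (z \<cdot>\<^sub>v e) $ i" using s1 i d by (simp add: z_def field_simps)
  qed (use d in simp)
  then have "Re z \<le> 0" using V_eigenvalue[OF v] by (simp add: a_def e_def)
  moreover have "Re z > 0"
  proof -
    have "z = g * ((1 + s) * cnj (1 - s)) / ((1 - s) * cnj (1 - s))"
      using s1 by (simp add: z_def)
    also have "(1 - s) * cnj (1 - s) = complex_of_real ((cmod (1 - s))\<^sup>2)" by (simp only: complex_norm_square)
    finally have "Re z = \<gamma> * Re ((1 + s) * cnj (1 - s)) / (cmod (1 - s))\<^sup>2"
      by (simp add: Re_divide_of_real)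
    moreover have "Re ((1 + s) * cnj (1 - s)) = 1 - (cmod s)\<^sup>2"
      unfolding cmod_power2 by (simp add: algebra_simps power2_eq_square)
    moreover have "(cmod s)\<^sup>2 < 1" using power_strict_mono[OF s norm_ge_zero, of 2] by simp
    ultimately show ?thesis using s1 \<gamma> by simp
  qed
  ultimately show False by simp
qed

text \<open>The Kronecker form of the Cayley transform restricted to \<open>\<V>\<close> supplies
  chains spanning \<open>\<V>\<close>; cutting off the last \<open>m\<close> coordinates turns them
  into chains of the reduced pencil inside \<open>L\<close>. Truncation may produce zero vectors and
  dependent chains, so the outcome is an induction rule and not a basis.\<close>

lemma L_induct:
  assumes P0: "P (0\<^sub>v (2 * n))" and Padd: "\<And>z w. z \<in> L \<Longrightarrow> w \<in> L \<Longrightarrow> P z \<Longrightarrow> P w \<Longrightarrow> P (z + w)"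
    and Psmult: "\<And>z a. z \<in> L \<Longrightarrow> P z \<Longrightarrow> P (a \<cdot>\<^sub>v z)"
    and Pchain: "\<And>ev k z i. pencil_chain (2 * n) E_red A_red ev k z \<Longrightarrow> (\<And>j. j < k \<Longrightarrow> z j \<in> L) \<Longrightarrow>
      \<not> d_stable ev \<Longrightarrow> i < k \<Longrightarrow> P (z i)"
    and v: "v \<in> L"
  shows "P v"
proof -
  let ?N = "2 * n + m"
  obtain V W E' A' where E': "E' \<in> carrier_mat (n + m) (n + m)" and A': "A' \<in> carrier_mat (n + m) (n + m)"
    and V: "V \<in> carrier_mat ?N (n + m)" and W: "W \<in> carrier_mat ?N (n + m)"
    and SV: "\<V> = {V *\<^sub>v c | c. c \<in> carrier_vec (n + m)}"
    and injV: "\<And>c. c \<in> carrier_vec (n + m) \<Longrightarrow> V *\<^sub>v c = 0\<^sub>v ?N \<Longrightarrow> c = 0\<^sub>v (n + m)"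
    and EV: "\<And>c. c \<in> carrier_vec (n + m) \<Longrightarrow> \<E> *\<^sub>v (V *\<^sub>v c) = W *\<^sub>v (E' *\<^sub>v c)"
    and AV: "\<And>c. c \<in> carrier_vec (n + m) \<Longrightarrow> \<A> *\<^sub>v (V *\<^sub>v c) = W *\<^sub>v (A' *\<^sub>v c)"
    and inv: "\<And>s. det (s \<cdot>\<^sub>m \<E> - \<A>) \<noteq> 0 \<Longrightarrow> invertible_mat (s \<cdot>\<^sub>m E' - A')"
    by (rule semi_stable_deflatingE[OF reg semi]) blast
  define E'' where "E'' = A' + g \<cdot>\<^sub>m E'"
  define A'' where "A'' = A' - g \<cdot>\<^sub>m E'"
  have E'': "E'' \<in> carrier_mat (n + m) (n + m)" and A'': "A'' \<in> carrier_mat (n + m) (n + m)"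
    using E' A' by (auto simp: E''_def A''_def intro: minus_carrier_mat)
  have c': "E' *\<^sub>v c \<in> carrier_vec (n + m)" "A' *\<^sub>v c \<in> carrier_vec (n + m)" "V *\<^sub>v c \<in> carrier_vec ?N" if "c \<in> carrier_vec (n + m)" for c
    using E' A' V that by (auto intro: mult_mat_vec_carrier)
  have EV'': "E_cay *\<^sub>v (V *\<^sub>v c) = W *\<^sub>v (E'' *\<^sub>v c)" and AV'': "A_cay *\<^sub>v (V *\<^sub>v c) = W *\<^sub>v (A'' *\<^sub>v c)"
    if c: "c \<in> carrier_vec (n + m)" for c
    using c'[OF c] c unfolding E_cay_def A_cay_def E''_def A''_def
    by (simp_all add: cayley_mult[OF even_carrier(2,1)] cayley_mult[OF A' E'] EV AV
        mult_add_distrib_mat_vec[OF W] mult_minus_distrib_mat_vec[OF W] mult_mat_vec[OF W])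
  have "regular_pencil (n + m) E'' A''"
  proof -
    obtain \<omega> where w: "det (Complex 0 \<omega> \<cdot>\<^sub>m \<E> - \<A>) \<noteq> 0"
      "1 - (Complex 0 \<omega> - g) / (Complex 0 \<omega> + g) \<noteq> 0"
      "g * (1 + (Complex 0 \<omega> - g) / (Complex 0 \<omega> + g)) = (1 - (Complex 0 \<omega> - g) / (Complex 0 \<omega> + g)) * Complex 0 \<omega>"
      by (rule cayley_point)
    define l where "l = Complex 0 \<omega>"
    define a where "a = (l - g) / (l + g)"
    have a: "1 - a \<noteq> 0" "g * (1 + a) = (1 - a) * l" using w by (simp_all add: a_def l_def)
    have sq: "a \<cdot>\<^sub>m E'' - A'' \<in> carrier_mat (n + m) (n + m)" using A'' by (rule minus_carrier_mat)
    have lsq: "l \<cdot>\<^sub>m E' - A' \<in> carrier_mat (n + m) (n + m)" using A' by (rule minus_carrier_mat)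
    \<comment> \<open>The Cayley transform at \<open>a\<close> is a nonzero multiple of the original
      at \<open>l\<close>, so regularity carries over.\<close>
    have "a \<cdot>\<^sub>m E'' - A'' = (1 - a) \<cdot>\<^sub>m (l \<cdot>\<^sub>m E' - A')"
    proof (rule eq_matI)
      fix i j assume "i < dim_row ((1 - a) \<cdot>\<^sub>m (l \<cdot>\<^sub>m E' - A'))" "j < dim_col ((1 - a) \<cdot>\<^sub>m (l \<cdot>\<^sub>m E' - A'))"
      then have ij: "i < n + m" "j < n + m" using A' by auto
      have "(a \<cdot>\<^sub>m E'' - A'') $$ (i, j) = g * (1 + a) * E' $$ (i, j) - (1 - a) * A' $$ (i, j)"
        using ij E' A' by (simp add: E''_def A''_def algebra_simps)
      then show "(a \<cdot>\<^sub>m E'' - A'') $$ (i, j) = ((1 - a) \<cdot>\<^sub>m (l \<cdot>\<^sub>m E' - A')) $$ (i, j)"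
        using ij E' A' unfolding a(2) by (simp add: algebra_simps)
    qed (use A' A'' in auto)
    then have "det (a \<cdot>\<^sub>m E'' - A'') = (1 - a) ^ (n + m) * det (l \<cdot>\<^sub>m E' - A')"
      using carrier_matD[OF lsq] by (simp add: det_smult)
    moreover have "det (l \<cdot>\<^sub>m E' - A') \<noteq> 0" using inv[OF w(1)] lsq by (simp add: invertible_mat_iff_det l_def)
    ultimately have "det (a \<cdot>\<^sub>m E'' - A'') \<noteq> 0" using a(1) by simp
    with E'' A'' show ?thesis unfolding regular_pencil_def by blast
  qed
  then obtain P' T bs where K: "kronecker_form (n + m) E'' A'' P' T bs" using kronecker_form_exists by blast
  have T: "T \<in> carrier_mat (n + m) (n + m)" "invertible_mat T" using K by (simp_all add: kronecker_form_def)
  define f where "f c = vec_first (V *\<^sub>v c) (2 * n)" for c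
  have col: "f (col T r) \<in> L \<and> P (f (col T r))" if r: "r < n + m" for r
  proof -
    have "r < sum_list (map fst bs)" using r kronecker_form_size[OF K E''] by simp
    then obtain i j where ij: "i < length bs" "j < fst (bs ! i)" "r = block_offset bs i + j"
      by (rule block_offset_cases)
    let ?c = "chain_vec T bs i" and ?ev = "snd (bs ! i)" and ?k = "fst (bs ! i)"
    have ch': "pencil_chain (n + m) E'' A'' ?ev ?k ?c" using kronecker_form_chain[OF K E'' A'' ij(1)] .
    have ch: "pencil_chain ?N E_cay A_cay ?ev ?k (\<lambda>j. V *\<^sub>v ?c j)"
      by (rule pencil_chain_map[OF ch' V E'' A'' EV'' AV''])
    have cc: "?c j \<in> carrier_vec (n + m)" if "j < ?k" for j using ch' that by (rule pencil_chain_carrier)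
    have inV: "V *\<^sub>v ?c j \<in> \<V>" if "j < ?k" for j using cc[OF that] SV by blast
    have "\<not> d_stable ?ev"
    proof
      assume st: "d_stable ?ev"
      \<comment> \<open>The first vector of the chain would be an eigenvector in
        \<open>\<V>\<close>; invertibility of \<open>T\<close> and injectivity of \<open>V\<close>
        keep it nonzero.\<close>
      then obtain s where s: "?ev = Finite s" "cmod s < 1" by (cases ?ev) auto
      have k0: "0 < ?k" using ij(2) by simp
      have "chain_vec T bs i 0 = T *\<^sub>v unit_vec (n + m) (block_offset bs i)"
        using ij(3) r by (subst mult_mat_unit_vec[OF T(1)]) (auto simp: chain_vec_def)
      moreover have "unit_vec (n + m) (block_offset bs i) \<noteq> (0\<^sub>v (n + m) :: complex vec)"
        using ij(3) r by (metis add_lessD1 index_unit_vec(1) index_zero_vec(1) zero_neq_one)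
      ultimately have "?c 0 \<noteq> 0\<^sub>v (n + m)" using T by (auto simp: invertible_mat_iff_injective[OF T(1)])
      then have "V *\<^sub>v ?c 0 \<noteq> 0\<^sub>v ?N" using injV cc[OF k0] by blast
      moreover have "A_cay *\<^sub>v (V *\<^sub>v ?c 0) = E_cay *\<^sub>v (s \<cdot>\<^sub>v (V *\<^sub>v ?c 0))"
        using ch k0 s(1) c'(3)[OF cc[OF k0]] by (auto simp: pencil_chain_def dest!: spec[of _ 0])
      ultimately show False using no_stable_eigenvector[OF inV[OF k0]] s(2) by fastforce
    qed
    moreover note chain_V_imp_L[OF ch inV]
    moreover have "f (col T r) = vec_first (V *\<^sub>v ?c j) (2 * n)" using ij(3) by (simp add: f_def chain_vec_def)
    ultimately show ?thesis using ij(2) Pchain[of ?ev ?k "\<lambda>j. vec_first (V *\<^sub>v ?c j) (2 * n)" j] by auto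
  qed
  have vc: "v \<in> carrier_vec (2 * n)" "v @\<^sub>v 0\<^sub>v m \<in> \<V>" using v by (auto simp: L_def)
  then obtain d where d: "d \<in> carrier_vec (n + m)" "v @\<^sub>v 0\<^sub>v m = V *\<^sub>v d" using SV by blast
  obtain e where e: "e \<in> carrier_vec (n + m)" "T *\<^sub>v e = d" using T(2,1) d(1) by (rule invertible_mat_surjective)
  have "f (T *\<^sub>v e) \<in> L \<and> P (f (T *\<^sub>v e))"
    using T(1) e(1)
  proof (induction rule: mult_mat_vec_induct)
    case zero
    show ?case using L_zero P0 by (simp add: f_def mult_mat_zero_vec[OF V] vec_first_zero)
  next
    case (step i w)
    have "col T i \<in> carrier_vec (n + m)" using T(1) step(1) by auto
    then have "f (w + e $ i \<cdot>\<^sub>v col T i) = f w + e $ i \<cdot>\<^sub>v f (col T i)"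
      using step(3) c'(3) by (simp add: f_def mult_add_distrib_mat_vec[OF V] mult_mat_vec[OF V] vec_first_combination(2,3)[where b = m])
    then show ?case using step(4) col[OF step(1)] by (auto intro!: L_add L_smult Padd Psmult)
  qed
  moreover have "f (T *\<^sub>v e) = v" using vc(1) by (simp add: e(2) f_def d(2)[symmetric])
  ultimately show ?thesis by simp
qed

section \<open>The canonical subspace\<close>

definition null_at :: "complex mat \<Rightarrow> complex vec \<Rightarrow> bool" where
  "null_at Y z \<longleftrightarrow> (\<exists>x\<in>carrier_vec n. z = (Y *\<^sub>v x) @\<^sub>v x)"

lemma S_LMI_carrier: "Y \<in> S_LMI n A B C Q R \<Longrightarrow> Y \<in> carrier_mat n n \<and> hermitian_mat Y"
  by (simp add: S_LMI_def)

lemma S_LMI_lure_psd: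
  assumes Y: "Y \<in> S_LMI n A B C Q R"
  shows "lure_psd n m A B (Y * B + C) (mat_adjoint A * Y + Y * A + Q) R \<gamma>"
proof -
  have Yc: "Y \<in> carrier_mat n n" "hermitian_mat Y" using S_LMI_carrier[OF Y] by simp_all
  interpret Y: lure_data n m A B "Y * B + C" "mat_adjoint A * Y + Y * A + Q" R \<gamma>
    using Yc by (rule lure_data_shift)
  show ?thesis
    by unfold_locales (use Y stab in \<open>simp_all add: adjoint_shift[OF Yc] S_LMI_def\<close>)
qed

text \<open>The substance is \<open>null_step\<close>. For \<open>z = (\<mu>, x)\<close> and
  \<open>z'\<close> null over \<open>x0\<close>, shifting by \<open>Y\<close> turns the step into
  one from \<open>\<mu> - Y x\<close> to \<open>s\<close> times it, and orthogonality of
  \<open>z'\<close> to \<open>z\<close> says that \<open>x0\<close> is orthogonal to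
  \<open>\<mu> - Y x\<close>. Then \<open>step_unimodular\<close> gives
  \<open>\<mu> = Y x\<close>.\<close>

lemma red_definite:
  assumes Y: "Y \<in> S_LMI n A B C Q R"
  shows "definite_pencil n E_red A_red (null_at Y)"
proof -
  have Yc: "Y \<in> carrier_mat n n" "hermitian_mat Y" using S_LMI_carrier[OF Y] by simp_all
  have Yv: "Y *\<^sub>v x \<in> carrier_vec n" if "x \<in> carrier_vec n" for x using Yc(1) that by (rule mult_mat_vec_carrier)
  interpret isometric_pencil n E_red A_red by (rule red_isometric)
  interpret Y: lure_psd n m A B "Y * B + C" "mat_adjoint A * Y + Y * A + Q" R \<gamma>
    using Y by (rule S_LMI_lure_psd)
  show ?thesis
  proof
    show "null_at Y (0\<^sub>v (2 * n))" unfolding null_at_def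
      by (intro bexI[of _ "0\<^sub>v n"]) (simp_all add: mult_mat_zero_vec[OF Yc(1)] mult_2)
    show "hform n z w = 0" if "null_at Y z" "null_at Y w" for z w
    proof -
      from that obtain x y where "x \<in> carrier_vec n" "z = (Y *\<^sub>v x) @\<^sub>v x" "y \<in> carrier_vec n" "w = (Y *\<^sub>v y) @\<^sub>v y"
        unfolding null_at_def by blast
      then show ?thesis using hermitian_cip[OF Yc(2,1)] by (simp add: skew_form_append Yv)
    qed
    fix s :: complex and z z'
    assume z: "z \<in> carrier_vec (2 * n)" and "z' \<in> carrier_vec (2 * n)" and s: "cmod s = 1"
      and eq: "A_red *\<^sub>v z = E_red *\<^sub>v (s \<cdot>\<^sub>v z + z')" and "null_at Y z'" and h: "hform n z' z = 0"
    then obtain x0 where x0 [simp]: "x0 \<in> carrier_vec n" and z': "z' = (Y *\<^sub>v x0) @\<^sub>v x0"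
      unfolding null_at_def by blast
    obtain \<mu> x where zz: "z = \<mu> @\<^sub>v x" and c [simp]: "\<mu> \<in> carrier_vec n" "x \<in> carrier_vec n"
      using z by (rule split_2n_vec)
    note [simp] = Yv
    have "s \<cdot>\<^sub>v z + z' = (s \<cdot>\<^sub>v \<mu> + Y *\<^sub>v x0) @\<^sub>v (s \<cdot>\<^sub>v x + x0)"
      unfolding zz z' by (simp add: append_vec_smult append_vec_add[of _ n _ _ n])
    then obtain u where "step \<mu> x (s \<cdot>\<^sub>v \<mu> + Y *\<^sub>v x0) (s \<cdot>\<^sub>v x + x0) u"
      using eq red_eq_iff_step[of \<mu> x "s \<cdot>\<^sub>v \<mu> + Y *\<^sub>v x0" "s \<cdot>\<^sub>v x + x0"] unfolding zz by auto
    from step_shift[OF Yc this]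
    have st: "Y.step (\<mu> - Y *\<^sub>v x) x (s \<cdot>\<^sub>v \<mu> + Y *\<^sub>v x0 - Y *\<^sub>v (s \<cdot>\<^sub>v x + x0)) (s \<cdot>\<^sub>v x + x0) u" .
    have "s \<cdot>\<^sub>v \<mu> + Y *\<^sub>v x0 - Y *\<^sub>v (s \<cdot>\<^sub>v x + x0) = s \<cdot>\<^sub>v (\<mu> - Y *\<^sub>v x)"
    proof -
      have 1: "Y *\<^sub>v (s \<cdot>\<^sub>v x + x0) = s \<cdot>\<^sub>v (Y *\<^sub>v x) + Y *\<^sub>v x0"
        by (simp add: mult_add_distrib_mat_vec[OF Yc(1)] mult_mat_vec[OF Yc(1)])
      have d: "dim_vec \<mu> = n" "dim_vec (Y *\<^sub>v x) = n" "dim_vec (Y *\<^sub>v x0) = n"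
        by (intro carrier_vecD; simp)+
      show ?thesis unfolding 1
        by (intro eq_vecI) (auto simp: d algebra_simps simp del: index_mult_mat_vec dim_mult_mat_vec)
    qed
    note st' = st[unfolded this]
    have "cip x0 (\<mu> - Y *\<^sub>v x) = 0"
      using h hermitian_cip[OF Yc(2,1) x0 c(2)]
      by (simp add: z' zz skew_form_append cip_minus_right[where n = n])
    from Y.step_unimodular[OF st' s x0 this] have "\<mu> = Y *\<^sub>v x"
      using vec_minus_eq_0_iff[of \<mu> n "Y *\<^sub>v x"] by simp
    then show "null_at Y z" unfolding null_at_def zz by auto
  qed
qed

text \<open>Every chain inside \<open>L\<close> that is not stable consists of outer vectors: a
  critical one is null along its whole length because \<open>L\<close> is neutral. So
  \<open>L\<close> is orthogonal to all outer vectors; maximality of \<open>L\<close> puts these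
  into \<open>L\<close>, and maximality of the outer family puts \<open>L\<close> into their
  span.\<close>

lemma L_canonical:
  assumes Y: "Y \<in> S_LMI n A B C Q R"
  obtains V P T bs where "V \<in> carrier_mat (2 * n) n" "L = {V *\<^sub>v c | c. c \<in> carrier_vec n}"
    "kronecker_form (2 * n) E_red A_red P T bs" "split_blocks n bs"
    "set (cols V) = {chain_vec T bs i j | i j. i < length bs \<and> d_unstable (snd (bs ! i)) \<and> j < fst (bs ! i)} \<union>
      {chain_vec T bs i j | i j. i < length bs \<and> d_critical (snd (bs ! i)) \<and> j < fst (bs ! i) div 2}"
proof -
  interpret definite_pencil n E_red A_red "null_at Y" by (rule red_definite[OF Y])
  obtain P T bs where K: "kronecker_form (2 * n) E_red A_red P T bs"
    using kronecker_form_exists[OF red_regular] by blast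
  obtain V where V: "V \<in> carrier_mat (2 * n) n"
    and cols: "set (cols V) = (\<lambda>p. chain_vec T bs (fst p) (snd p)) ` outer_index bs"
    and max: "\<And>v. v \<in> carrier_vec (2 * n) \<Longrightarrow> hform n v v = 0 \<Longrightarrow> (\<And>w. outer_vec w \<Longrightarrow> hform n w v = 0) \<Longrightarrow>
      \<exists>c\<in>carrier_vec n. V *\<^sub>v c = v"
    by (rule canonical_basis[OF K]) blast
  have L_outer: "hform n w v = 0" if w: "outer_vec w" and v: "v \<in> L" for v w
  proof -
    have wc: "w \<in> carrier_vec (2 * n)" using w pencil_chain_carrier by (auto simp: outer_vec_def)
    show ?thesis
    proof (rule L_induct[where P = "\<lambda>v. hform n w v = 0", OF _ _ _ _ v])
      show "hform n w (0\<^sub>v (2 * n)) = 0" by simp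
      show "hform n w (z + z') = 0" if "z \<in> L" "z' \<in> L" "hform n w z = 0" "hform n w z' = 0" for z z'
        using that wc L_carrier by (simp add: subset_iff)
      show "hform n w (a \<cdot>\<^sub>v z) = 0" if "z \<in> L" "hform n w z = 0" for z a
        using that wc L_carrier by (simp add: subset_iff)
      fix ev k z i
      assume ch: "chain ev k z" "\<And>j. j < k \<Longrightarrow> z j \<in> L" "\<not> d_stable ev" "i < k"
      have "outer_vec (z i)"
      proof (cases "d_unstable ev")
        case True
        then show ?thesis using ch unfolding outer_vec_def by blast
      next
        case False
        then have c: "d_critical ev" using ch pencil_ev_trichotomy by blast
        then obtain s where s: "ev = Finite s" "cmod s = 1" by (cases ev) auto
        have "null_at Y (z i)"
          using ch s by (intro critical_chain_null[of s k z k i]) (auto intro: L_neutral)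
        then show ?thesis using ch c unfolding outer_vec_def by blast
      qed
      then show "hform n w (z i) = 0" using w by (intro outer_vec_neutral)
    qed
  qed
  have outer_L: "w \<in> L" if w: "outer_vec w" for w
  proof (rule L_maximal)
    show "w \<in> carrier_vec (2 * n)" using w pencil_chain_carrier by (auto simp: outer_vec_def)
    show "hform n w w = 0" using w by (intro outer_vec_neutral)
    show "hform n v w = 0" if "v \<in> L" for v
      using L_outer[OF w that] skew_form_commute[of n "($) v" "($) w"] by simp
  qed
  have "L = {V *\<^sub>v c | c. c \<in> carrier_vec n}"
  proof (intro equalityI subsetI)
    fix v assume "v \<in> L"
    then have "\<exists>c\<in>carrier_vec n. V *\<^sub>v c = v" using L_carrier L_neutral L_outer by (intro max) auto
    then show "v \<in> {V *\<^sub>v c | c. c \<in> carrier_vec n}" by auto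
  next
    fix v assume "v \<in> {V *\<^sub>v c | c. c \<in> carrier_vec n}"
    then obtain c where c: "c \<in> carrier_vec n" "v = V *\<^sub>v c" by blast
    have colL: "col V i \<in> L" if "i < n" for i
    proof -
      have "col V i \<in> set (cols V)" using V that by (auto simp: cols_def)
      then obtain l j where "l < length bs" "j < outer_length (bs ! l)" "col V i = chain_vec T bs l j"
        unfolding cols outer_index_def by auto
      then show ?thesis using outer_L outer_chain_vec[OF K] by auto
    qed
    have "V *\<^sub>v c \<in> L" using V c(1)
      by (induction rule: mult_mat_vec_induct) (auto intro: L_zero L_add L_smult colL)
    then show "v \<in> L" using c by simp
  qed
  then show thesis
    using that[OF V _ K split_blocks_kronecker[OF K]] cols outer_index_chain_vecs[OF K] by simp
qed

end

section \<open>Positive semidefinite matrices\<close>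

lemma hermitian_matI:
  assumes M: "M \<in> carrier_mat k k" and sym: "\<And>x y. x \<in> carrier_vec k \<Longrightarrow> y \<in> carrier_vec k \<Longrightarrow> cip x (M *\<^sub>v y) = cip (M *\<^sub>v x) y"
  shows "hermitian_mat M"
proof -
  have u: "cip (unit_vec k i) v = v $ i" if "i < k" "v \<in> carrier_vec k" for i v
  proof -
    have "cip (unit_vec k i) v = (\<Sum>l<k. if l = i then v $ l else 0)"
      unfolding cip_sum[OF unit_vec_carrier that(2)] by (intro sum.cong) (auto simp: unit_vec_def)
    then show ?thesis using that(1) by (simp add: sum.delta)
  qed
  have "mat_adjoint M = M"
  proof (rule eq_matI)
    fix i j assume "i < dim_row M" "j < dim_col M"
    then have ij: "i < k" "j < k" using M by auto
    have "M $$ (i, j) = cip (unit_vec k i) (M *\<^sub>v unit_vec k j)"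
      using M ij by (simp add: mult_mat_unit_vec u)
    also have "\<dots> = cip (M *\<^sub>v unit_vec k i) (unit_vec k j)" by (rule sym) auto
    also have "\<dots> = cnj (cip (unit_vec k j) (M *\<^sub>v unit_vec k i))"
      using M by (intro cip_cnj[of _ k, symmetric]) auto
    also have "\<dots> = cnj (M $$ (j, i))"
      using M ij by (simp add: mult_mat_unit_vec u)
    finally show "mat_adjoint M $$ (i, j) = M $$ (i, j)" using M ij by simp
  qed (use M in auto)
  then show ?thesis using M by (simp add: hermitian_mat_def)
qed

lemma psd_matI:
  assumes M: "M \<in> carrier_mat k k" "hermitian_mat M" and pos: "\<And>v. v \<in> carrier_vec k \<Longrightarrow> 0 \<le> Re (cip v (M *\<^sub>v v))"
  shows "psd_mat M"
  unfolding psd_mat_def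
proof (intro conjI ballI)
  fix v :: "complex vec" assume "v \<in> carrier_vec (dim_row M)"
  then have v: "v \<in> carrier_vec k" using M by simp
  have Mv: "M *\<^sub>v v \<in> carrier_vec k" using M(1) v by (rule mult_mat_vec_carrier)
  have "cnj (cip v (M *\<^sub>v v)) = cip v (M *\<^sub>v v)"
    using cip_cnj[OF v Mv] hermitian_cip[OF M(2,1) v v] by simp
  then have "Im (cip v (M *\<^sub>v v)) = 0" by (simp add: complex_eq_iff)
  then show "0 \<le> conjugate v \<bullet> (M *\<^sub>v v)" using pos[OF v] by (simp add: less_eq_complex_def cip_def)
qed (rule M)

lemma psd_matD:
  assumes "psd_mat M" "M \<in> carrier_mat k k" "v \<in> carrier_vec k"
  shows "0 \<le> Re (cip v (M *\<^sub>v v))"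
  using assms by (auto simp: psd_mat_def cip_def less_eq_complex_def)

text \<open>A Cholesky factorization that skips zero pivots; surjectivity of the factor says that its
  number of rows is the rank.\<close>
lemma psd_factorization:
  assumes "psd_mat M" "M \<in> carrier_mat k k"
  shows "\<exists>p. \<exists>F\<in>carrier_mat p k. M = mat_adjoint F * F \<and> (\<forall>b\<in>carrier_vec p. \<exists>v\<in>carrier_vec k. F *\<^sub>v v = b)"
  using assms
proof (induction k arbitrary: M)
  case 0
  then show ?case
    by (intro exI[of _ 0] bexI[of _ "0\<^sub>m 0 0"]) (auto intro!: eq_matI bexI[of _ "0\<^sub>v 0"] eq_vecI)
next
  case (Suc k)
  have M: "M \<in> carrier_mat (Suc k) (Suc k)" by fact
  have herm: "hermitian_mat M" using Suc.prems by (simp add: psd_mat_def)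
  have Mcnj: "M $$ (i, j) = cnj (M $$ (j, i))" if "i < Suc k" "j < Suc k" for i j
  proof -
    have "mat_adjoint M $$ (i, j) = cnj (M $$ (j, i))" using that M by (intro mat_adjoint_index) auto
    then show ?thesis using herm by (simp add: hermitian_mat_def)
  qed
  define a where "a = Re (M $$ (0, 0))"
  have a: "M $$ (0, 0) = complex_of_real a"
    using Mcnj[of 0 0] by (simp add: a_def complex_eq_iff)
  define b where "b = vec k (\<lambda>i. M $$ (Suc i, 0))"
  define N where "N = mat k k (\<lambda>(i, j). M $$ (Suc i, Suc j))"
  have b: "b \<in> carrier_vec k" and N: "N \<in> carrier_mat k k" by (simp_all add: b_def N_def)
  have b_index: "b $ i = M $$ (Suc i, 0)" if "i < k" for i using that by (simp add: b_def)
  \<comment> \<open>The Schur complement of the pivot \<open>a\<close> when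
    \<open>c = 1 / a\<close>; a zero pivot takes \<open>c = 0\<close> and leaves the block
    \<open>N\<close> itself.\<close>
  define S where "S c = mat k k (\<lambda>(i, j). N $$ (i, j) - complex_of_real c * (b $ i * cnj (b $ j)))" for c
  have S: "S c \<in> carrier_mat k k" for c by (simp add: S_def)
  have S_index: "S c $$ (i, j) = N $$ (i, j) - complex_of_real c * (b $ i * cnj (b $ j))" if "i < k" "j < k" for c i j
    using that by (simp add: S_def)
  have quad: "cip (vCons t y) (M *\<^sub>v vCons t y) =
      cnj t * t * a + cnj t * cip b y + t * cip y b + cip y (N *\<^sub>v y)" if y: "y \<in> carrier_vec k" for t y
  proof -
    have v: "vCons t y \<in> carrier_vec (Suc k)" using y by simp
    have Ny: "N *\<^sub>v y \<in> carrier_vec k" using N y by (rule mult_mat_vec_carrier)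
    have 0: "(M *\<^sub>v vCons t y) $ 0 = a * t + cip b y"
      using mult_mat_vec_index[OF M v, of 0] y
      by (simp add: sum.lessThan_Suc_shift cip_sum[OF b y] a b_index Mcnj[of 0 "Suc _"]
          del: index_mult_mat_vec sum.lessThan_Suc)
    have i: "(M *\<^sub>v vCons t y) $ Suc i = b $ i * t + (N *\<^sub>v y) $ i" if "i < k" for i
      using mult_mat_vec_index[OF M v, of "Suc i"] y that
      by (simp add: sum.lessThan_Suc_shift mult_mat_vec_index[OF N y that] b_index
          del: index_mult_mat_vec sum.lessThan_Suc) (simp add: N_def)
    have "cip (vCons t y) (M *\<^sub>v vCons t y) = cnj t * (a * t + cip b y) + (\<Sum>i<k. cnj (y $ i) * (b $ i * t + (N *\<^sub>v y) $ i))"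
      using mult_mat_vec_carrier[OF M v]
      by (subst cip_sum[OF v]) (simp_all add: sum.lessThan_Suc_shift 0 i del: index_mult_mat_vec sum.lessThan_Suc)
    also have "(\<Sum>i<k. cnj (y $ i) * (b $ i * t + (N *\<^sub>v y) $ i)) = t * cip y b + cip y (N *\<^sub>v y)"
      by (simp add: cip_sum[OF y b] cip_sum[OF y Ny] sum.distrib sum_distrib_left algebra_simps del: index_mult_mat_vec)
    finally show ?thesis by (simp add: algebra_simps)
  qed
  have Squad: "cip y (S c *\<^sub>v y) = cip y (N *\<^sub>v y) - c * (cip y b * cip b y)" if y: "y \<in> carrier_vec k" for c y
  proof -
    have Ny: "N *\<^sub>v y \<in> carrier_vec k" using N y by (rule mult_mat_vec_carrier)
    have Sy: "(S c *\<^sub>v y) $ i = (N *\<^sub>v y) $ i - c * (b $ i * cip b y)" if "i < k" for i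
      using that by (simp add: mult_mat_vec_index[OF S y that] mult_mat_vec_index[OF N y that] cip_sum[OF b y]
          S_index sum_subtractf[symmetric] sum_distrib_left algebra_simps del: index_mult_mat_vec)
    have "cip y (S c *\<^sub>v y) = (\<Sum>i<k. cnj (y $ i) * ((N *\<^sub>v y) $ i - c * (b $ i * cip b y)))"
      unfolding cip_sum[OF y mult_mat_vec_carrier[OF S y]] by (intro sum.cong) (simp_all add: Sy del: index_mult_mat_vec)
    also have "\<dots> = (\<Sum>i<k. cnj (y $ i) * (N *\<^sub>v y) $ i - cnj (y $ i) * b $ i * (c * cip b y))"
      by (intro sum.cong) (simp_all add: algebra_simps del: index_mult_mat_vec)
    also have "\<dots> = cip y (N *\<^sub>v y) - cip y b * (c * cip b y)"
      unfolding cip_sum[OF y Ny] cip_sum[OF y b] sum_subtractf sum_distrib_right ..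
    finally show ?thesis by simp
  qed
  have Sherm: "hermitian_mat (S c)" for c
  proof -
    have "mat_adjoint (S c) = S c"
    proof (rule eq_matI)
      fix i j assume "i < dim_row (S c)" "j < dim_col (S c)"
      then have ij: "i < k" "j < k" by (simp_all add: S_def)
      have "N $$ (i, j) = cnj (N $$ (j, i))" using Mcnj[of "Suc i" "Suc j"] ij by (simp add: N_def)
      then show "mat_adjoint (S c) $$ (i, j) = S c $$ (i, j)"
        using ij carrier_matD[OF S, of c] by (simp add: S_index)
    qed (use carrier_matD[OF S, of c] in simp_all)
    then show ?thesis using carrier_matD[OF S] by (simp add: hermitian_mat_def)
  qed
  have pos: "0 \<le> Re (cip (vCons t y) (M *\<^sub>v vCons t y))" if "y \<in> carrier_vec k" for t y
    using that by (intro psd_matD[OF Suc.prems]) auto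
  have a0: "a \<ge> 0" using pos[of "0\<^sub>v k" 1] N by (simp add: quad cip_zero_left[OF b] cip_zero_right[OF b] mult_mat_zero_vec[OF N] cip_zero_right[of _ k])
  \<comment> \<open>A zero pivot puts the first unit vector into the kernel, so the whole first
    column vanishes.\<close>
  have b0: "b = 0\<^sub>v k" if "a = 0"
  proof -
    have e: "vCons 1 (0\<^sub>v k) \<in> carrier_vec (Suc k)" by simp
    have "Re (cip (vCons 1 (0\<^sub>v k)) (M *\<^sub>v vCons 1 (0\<^sub>v k))) = 0"
      using that N by (simp add: quad cip_zero_left[OF b] cip_zero_right[OF b] mult_mat_zero_vec[OF N] cip_zero_right[of _ k])
    from psd_mat_kernel[OF Suc.prems e this] have z: "M *\<^sub>v vCons 1 (0\<^sub>v k) = 0\<^sub>v (Suc k)" .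
    show ?thesis
    proof (rule eq_vecI)
      fix i assume "i < dim_vec (0\<^sub>v k :: complex vec)"
      then have i: "i < k" by simp
      have "(M *\<^sub>v vCons 1 (0\<^sub>v k)) $ Suc i = M $$ (Suc i, 0)"
        using mult_mat_vec_index[OF M e, of "Suc i"] i
        by (simp add: sum.lessThan_Suc_shift del: index_mult_mat_vec sum.lessThan_Suc)
      then show "b $ i = 0\<^sub>v k $ i" using i z by (simp add: b_def)
    qed (use b in simp)
  qed
  define c where "c = (if a = 0 then 0 else 1 / a)"
  have "psd_mat (S c)"
  proof (rule psd_matI[OF S Sherm])
    fix y :: "complex vec" assume y: "y \<in> carrier_vec k"
    have by_: "cip y b = cnj (cip b y)" using cip_cnj[OF b y] by simp
    \<comment> \<open>The choice that completes the square: the form of \<open>M\<close> at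
      \<open>vCons t y\<close> becomes the form of the Schur complement at \<open>y\<close>.\<close>
    define t where "t = - complex_of_real c * cip b y"
    have "cip (vCons t y) (M *\<^sub>v vCons t y) = cip y (S c *\<^sub>v y)"
    proof (cases "a = 0")
      case True
      then show ?thesis using y by (simp add: quad Squad t_def c_def)
    next
      case False
      then show ?thesis using y by (simp add: quad Squad t_def c_def by_ field_simps)
    qed
    then show "0 \<le> Re (cip y (S c *\<^sub>v y))" using pos[OF y, of t] by simp
  qed
  from Suc.IH[OF this S] obtain p F where F: "F \<in> carrier_mat p k" "S c = mat_adjoint F * F"
    and surj: "\<And>d. d \<in> carrier_vec p \<Longrightarrow> \<exists>v\<in>carrier_vec k. F *\<^sub>v v = d" by blast
  have SF: "S c $$ (i, j) = (\<Sum>l<p. cnj (F $$ (l, i)) * F $$ (l, j))" if "i < k" "j < k" for i j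
    using that F by (auto simp: scalar_prod_def atLeast0LessThan intro!: sum.cong)
  show ?case
  proof (cases "a = 0")
    case True
    \<comment> \<open>No row is added for a zero pivot, which keeps the factor surjective.\<close>
    define F' where "F' = mat p (Suc k) (\<lambda>(l, j). if j = 0 then 0 else F $$ (l, j - 1))"
    have F': "F' \<in> carrier_mat p (Suc k)" by (simp add: F'_def)
    have "M = mat_adjoint F' * F'"
    proof (rule eq_matI)
      fix i j assume "i < dim_row (mat_adjoint F' * F')" "j < dim_col (mat_adjoint F' * F')"
      then have ij: "i < Suc k" "j < Suc k" by (simp_all add: F'_def)
      have e: "(mat_adjoint F' * F') $$ (i, j) = (\<Sum>l<p. cnj (F' $$ (l, i)) * F' $$ (l, j))"
        using ij F' by (auto simp: scalar_prod_def atLeast0LessThan intro!: sum.cong)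
      show "M $$ (i, j) = (mat_adjoint F' * F') $$ (i, j)"
      proof (cases "i = 0 \<or> j = 0")
        case T: True
        have "M $$ (Suc i', 0) = 0" if "i' < k" for i' using b0[OF True] that by (metis b_def index_vec index_zero_vec(1))
        then have "M $$ (i, j) = 0" using T ij a True Mcnj[of 0 j]
          by (cases i; cases j) auto
        moreover have "(\<Sum>l<p. cnj (F' $$ (l, i)) * F' $$ (l, j)) = 0"
          using T ij by (intro sum.neutral) (auto simp: F'_def)
        ultimately show ?thesis unfolding e by simp
      next
        case False
        then obtain i' j' where "i = Suc i'" "j = Suc j'" by (metis not0_implies_Suc)
        then show ?thesis unfolding e using ij SF[of i' j'] True b0[OF True] by (simp add: F'_def S_def c_def N_def)
      qed
    qed (use M in \<open>auto simp: F'_def\<close>)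
    moreover have "\<exists>v\<in>carrier_vec (Suc k). F' *\<^sub>v v = d" if d: "d \<in> carrier_vec p" for d
    proof -
      obtain v where v: "v \<in> carrier_vec k" "F *\<^sub>v v = d" using surj[OF d] by auto
      have v': "vCons 0 v \<in> carrier_vec (Suc k)" using v by simp
      have "F' *\<^sub>v vCons 0 v = F *\<^sub>v v"
      proof (rule eq_vecI)
        fix l assume "l < dim_vec (F *\<^sub>v v)"
        then have l: "l < p" using F by simp
        show "(F' *\<^sub>v vCons 0 v) $ l = (F *\<^sub>v v) $ l"
          unfolding mult_mat_vec_index[OF F' v' l] mult_mat_vec_index[OF F(1) v(1) l] sum.lessThan_Suc_shift
          using l by (simp add: F'_def)
      qed (use F F' in simp)
      then show ?thesis using v v' by blast
    qed
    ultimately show ?thesis using F' by blast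
  next
    case False
    with a0 have apos: "a > 0" by simp
    define r where "r = complex_of_real (sqrt a)"
    have rr: "r * r = a" "cnj r = r" "r \<noteq> 0" using apos by (simp_all add: r_def of_real_mult[symmetric] del: of_real_mult)
    \<comment> \<open>The new first row is the root of the pivot followed by the adjoint of
      \<open>b\<close> divided by that root, as in Cholesky's method.\<close>
    define F' where "F' = mat (Suc p) (Suc k) (\<lambda>(l, j). if l = 0 then (if j = 0 then r else cnj (b $ (j - 1)) / r)
        else (if j = 0 then 0 else F $$ (l - 1, j - 1)))"
    have F': "F' \<in> carrier_mat (Suc p) (Suc k)" by (simp add: F'_def)
    have "M = mat_adjoint F' * F'"
    proof (rule eq_matI)
      fix i j assume "i < dim_row (mat_adjoint F' * F')" "j < dim_col (mat_adjoint F' * F')"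
      then have ij: "i < Suc k" "j < Suc k" by (simp_all add: F'_def)
      have "(mat_adjoint F' * F') $$ (i, j) = (\<Sum>l<Suc p. cnj (F' $$ (l, i)) * F' $$ (l, j))"
        using ij F' by (auto simp: scalar_prod_def atLeast0LessThan intro!: sum.cong)
      then have e: "(mat_adjoint F' * F') $$ (i, j) = cnj (F' $$ (0, i)) * F' $$ (0, j) + (\<Sum>l<p. cnj (F' $$ (Suc l, i)) * F' $$ (Suc l, j))"
        by (simp add: sum.lessThan_Suc_shift del: sum.lessThan_Suc)
      show "M $$ (i, j) = (mat_adjoint F' * F') $$ (i, j)"
      proof (cases i)
        case 0
        show ?thesis
        proof (cases j)
          case 0
          then show ?thesis unfolding e using \<open>i = 0\<close> rr by (simp add: F'_def a)
        next
          case (Suc j')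
          then show ?thesis unfolding e using \<open>i = 0\<close> rr ij Mcnj[of 0 "Suc j'"] by (simp add: F'_def b_def)
        qed
      next
        case (Suc i')
        show ?thesis
        proof (cases j)
          case 0
          then show ?thesis unfolding e using Suc rr ij by (simp add: F'_def b_def)
        next
          case (Suc j')
          have ij': "i' < k" "j' < k" using ij \<open>i = Suc i'\<close> Suc by auto
          have "(mat_adjoint F' * F') $$ (i, j) = b $ i' * cnj (b $ j') / (r * r) + S c $$ (i', j')"
            unfolding e using ij ij' \<open>i = Suc i'\<close> Suc rr SF[OF ij'] by (simp add: F'_def)
          also have "\<dots> = M $$ (i, j)"
            using ij' False \<open>i = Suc i'\<close> Suc by (simp add: rr(1) S_def c_def N_def)
          finally show ?thesis by simp
        qed
      qed
    qed (use M in \<open>auto simp: F'_def\<close>)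
    moreover have "\<exists>v\<in>carrier_vec (Suc k). F' *\<^sub>v v = d" if d: "d \<in> carrier_vec (Suc p)" for d
    proof -
      define d' where "d' = vec p (\<lambda>l. d $ Suc l)"
      obtain v where v: "v \<in> carrier_vec k" "F *\<^sub>v v = d'" using surj[of d'] by (auto simp: d'_def)
      \<comment> \<open>The first row has the nonzero pivot \<open>r\<close>, so it is solved for
        the first coordinate after \<open>v\<close> has met the other rows.\<close>
      define t where "t = (d $ 0 - cip b v / r) / r"
      have v': "vCons t v \<in> carrier_vec (Suc k)" using v by simp
      have "F' *\<^sub>v vCons t v = d"
      proof (rule eq_vecI)
        fix l assume "l < dim_vec d"
        then have l: "l < Suc p" using d by simp
        show "(F' *\<^sub>v vCons t v) $ l = d $ l"
        proof (cases l)
          case 0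
          have "(F' *\<^sub>v vCons t v) $ 0 = r * t + (\<Sum>j<k. cnj (b $ j) / r * v $ j)"
            unfolding mult_mat_vec_index[OF F' v' zero_less_Suc] sum.lessThan_Suc_shift by (simp add: F'_def)
          also have "(\<Sum>j<k. cnj (b $ j) / r * v $ j) = cip b v / r"
            by (simp add: cip_sum[OF b v(1)] sum_divide_distrib)
          finally show ?thesis using 0 rr by (simp add: t_def)
        next
          case (Suc l')
          then have l': "l' < p" using l by simp
          have "(F' *\<^sub>v vCons t v) $ l = (F *\<^sub>v v) $ l'"
            unfolding mult_mat_vec_index[OF F' v' l] mult_mat_vec_index[OF F(1) v(1) l'] sum.lessThan_Suc_shift
            using l Suc by (simp add: F'_def)
          then show ?thesis using v(2) l' Suc by (simp add: d'_def)
        qed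
      qed (use d F' in simp)
      then show ?thesis using v' by blast
    qed
    ultimately show ?thesis using F' by blast
  qed
qed

section \<open>The Lur'e equations\<close>

context lure_problem
begin

abbreviation "lmi_mat X \<equiv> four_block_mat (mat_adjoint A * X + X * A + Q) (X * B + C) (mat_adjoint B * X + mat_adjoint C) R"

lemma lmi_mat_carrier: "lmi_mat X \<in> carrier_mat (n + m) (n + m)" if "X \<in> carrier_mat n n"
  using that by auto

lemma lmi_mat_mult:
  assumes X: "X \<in> carrier_mat n n" and y: "y \<in> carrier_vec n" "u \<in> carrier_vec m"
  shows "lmi_mat X *\<^sub>v (y @\<^sub>v u) =
    (mat_adjoint A *\<^sub>v (X *\<^sub>v y) + X *\<^sub>v (A *\<^sub>v y + B *\<^sub>v u) + Q *\<^sub>v y + C *\<^sub>v u) @\<^sub>v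
    (mat_adjoint B *\<^sub>v (X *\<^sub>v y) + mat_adjoint C *\<^sub>v y + R *\<^sub>v u)"
proof -
  note [simp] = y X
  have Xv [simp]: "X *\<^sub>v v \<in> carrier_vec n" if "v \<in> carrier_vec n" for v
    using X that by (rule mult_mat_vec_carrier)
  have AX: "mat_adjoint A * X \<in> carrier_mat n n" "X * A \<in> carrier_mat n n" "X * B \<in> carrier_mat n m" "mat_adjoint B * X \<in> carrier_mat m n"
    using mult_carrier_mat[OF mat_adjoint_carrier[OF A] X] mult_carrier_mat[OF X A] mult_carrier_mat[OF X B]
      mult_carrier_mat[OF mat_adjoint_carrier[OF B] X] by simp_all
  have 1: "(mat_adjoint A * X + X * A + Q) *\<^sub>v y = mat_adjoint A *\<^sub>v (X *\<^sub>v y) + X *\<^sub>v (A *\<^sub>v y) + Q *\<^sub>v y"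
    using AX by (simp add: add_mult_distrib_mat_vec[of _ n n] assoc_add_vec[of _ n] assoc_mult_mat_vec[OF mat_adjoint_carrier[OF A] X] assoc_mult_mat_vec[OF X A])
  have 2: "(X * B + C) *\<^sub>v u = X *\<^sub>v (B *\<^sub>v u) + C *\<^sub>v u"
    using AX by (simp add: add_mult_distrib_mat_vec[of _ n m] assoc_mult_mat_vec[OF X B])
  have 3: "(mat_adjoint B * X + mat_adjoint C) *\<^sub>v y = mat_adjoint B *\<^sub>v (X *\<^sub>v y) + mat_adjoint C *\<^sub>v y"
    using AX by (simp add: add_mult_distrib_mat_vec[of _ m n] assoc_mult_mat_vec[OF mat_adjoint_carrier[OF B] X])
  have "lmi_mat X *\<^sub>v (y @\<^sub>v u) = ((mat_adjoint A * X + X * A + Q) *\<^sub>v y + (X * B + C) *\<^sub>v u) @\<^sub>v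
      ((mat_adjoint B * X + mat_adjoint C) *\<^sub>v y + R *\<^sub>v u)"
    using AX by (intro four_block_mat_mult_vec[of _ n n _ m _ m]) auto
  also have "(mat_adjoint A * X + X * A + Q) *\<^sub>v y + (X * B + C) *\<^sub>v u =
      mat_adjoint A *\<^sub>v (X *\<^sub>v y) + X *\<^sub>v (A *\<^sub>v y + B *\<^sub>v u) + Q *\<^sub>v y + C *\<^sub>v u"
  proof -
    have d: "dim_vec (X *\<^sub>v (A *\<^sub>v y)) = n" "dim_vec (X *\<^sub>v (B *\<^sub>v u)) = n" "dim_vec (mat_adjoint A *\<^sub>v (X *\<^sub>v y)) = n"
      "dim_vec (Q *\<^sub>v y) = n" "dim_vec (C *\<^sub>v u) = n"
      by (intro carrier_vecD; simp)+
    show ?thesis unfolding 1 2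
      by (simp add: mult_add_distrib_mat_vec[OF X])
        (intro eq_vecI; simp add: d algebra_simps del: index_mult_mat_vec dim_mult_mat_vec)
  qed
  finally show ?thesis unfolding 3 .
qed

lemma lmi_mat_hermitian:
  assumes X: "X \<in> carrier_mat n n" "hermitian_mat X"
  shows "hermitian_mat (lmi_mat X)"
proof -
  interpret X: lure_data n m A B "X * B + C" "mat_adjoint A * X + X * A + Q" R \<gamma>
    using X by (rule lure_data_shift)
  show ?thesis using X.popov_mat_hermitian unfolding adjoint_shift[OF X] .
qed

text \<open>The terms with \<open>X\<close> add up to \<open>cnj l + l\<close> times the form of
  \<open>X\<close> at \<open>y\<close>, and this factor is zero on the imaginary axis.\<close>

lemma lmi_mat_form:
  assumes X: "X \<in> carrier_mat n n" "hermitian_mat X" and y [simp]: "y \<in> carrier_vec n" "u \<in> carrier_vec m"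
    and l: "A *\<^sub>v y + B *\<^sub>v u = l \<cdot>\<^sub>v y" "Re l = 0"
  shows "cip (y @\<^sub>v u) (lmi_mat X *\<^sub>v (y @\<^sub>v u)) =
    cip y (Q *\<^sub>v y) + cip y (C *\<^sub>v u) + cip u (mat_adjoint C *\<^sub>v y) + cip u (R *\<^sub>v u)"
proof -
  have Xv [simp]: "X *\<^sub>v v \<in> carrier_vec n" if "v \<in> carrier_vec n" for v
    using X(1) that by (rule mult_mat_vec_carrier)
  have "cip (y @\<^sub>v u) (lmi_mat X *\<^sub>v (y @\<^sub>v u)) =
    cip y (mat_adjoint A *\<^sub>v (X *\<^sub>v y)) + cip y (X *\<^sub>v (A *\<^sub>v y + B *\<^sub>v u)) + cip y (Q *\<^sub>v y) + cip y (C *\<^sub>v u) +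
    (cip u (mat_adjoint B *\<^sub>v (X *\<^sub>v y)) + cip u (mat_adjoint C *\<^sub>v y) + cip u (R *\<^sub>v u))"
    unfolding lmi_mat_mult[OF X(1) y]
    by (simp add: cip_append[where n = n and m = m] cip_add_right[where n = n] cip_add_right[where n = m])
  also have "cip y (mat_adjoint A *\<^sub>v (X *\<^sub>v y)) = cip (A *\<^sub>v y) (X *\<^sub>v y)" by (simp add: cip_mult_left[OF A])
  also have "cip u (mat_adjoint B *\<^sub>v (X *\<^sub>v y)) = cip (B *\<^sub>v u) (X *\<^sub>v y)" by (simp add: cip_mult_left[OF B])
  finally have "cip (y @\<^sub>v u) (lmi_mat X *\<^sub>v (y @\<^sub>v u)) =
    cip (A *\<^sub>v y + B *\<^sub>v u) (X *\<^sub>v y) + cip y (X *\<^sub>v (A *\<^sub>v y + B *\<^sub>v u)) +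
    (cip y (Q *\<^sub>v y) + cip y (C *\<^sub>v u) + cip u (mat_adjoint C *\<^sub>v y) + cip u (R *\<^sub>v u))"
    by (simp add: cip_add_left[where n = n])
  also have "cip (A *\<^sub>v y + B *\<^sub>v u) (X *\<^sub>v y) + cip y (X *\<^sub>v (A *\<^sub>v y + B *\<^sub>v u)) = (cnj l + l) * cip y (X *\<^sub>v y)"
    unfolding l(1) by (simp add: mult_mat_vec[OF X(1)] cip_smult_left[where n = n] cip_smult_right[where n = n] algebra_simps)
  also have "cnj l + l = 0" using l(2) by (simp add: complex_eq_iff)
  finally show ?thesis by simp
qed

text \<open>The right-hand side contributes \<open>- x\<close> to the first row and
  \<open>X x\<close> to the second; substituting the first row into \<open>X (A y + B u)\<close>
  cancels both \<open>l X y\<close> and \<open>X x\<close>.\<close>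

lemma even_pencil_solution:
  assumes X: "X \<in> carrier_mat n n" and y [simp]: "y \<in> carrier_vec n" "u \<in> carrier_vec m" "x \<in> carrier_vec n"
    and eq: "l \<cdot>\<^sub>v (\<E> *\<^sub>v (((X *\<^sub>v y) @\<^sub>v y) @\<^sub>v u)) - \<A> *\<^sub>v (((X *\<^sub>v y) @\<^sub>v y) @\<^sub>v u) = \<E> *\<^sub>v (((X *\<^sub>v x) @\<^sub>v x) @\<^sub>v 0\<^sub>v m)"
  shows "A *\<^sub>v y + B *\<^sub>v u = l \<cdot>\<^sub>v y - x" "lmi_mat X *\<^sub>v (y @\<^sub>v u) = 0\<^sub>v (n + m)"
proof -
  have Xv [simp]: "X *\<^sub>v v \<in> carrier_vec n" if "v \<in> carrier_vec n" for v
    using X that by (rule mult_mat_vec_carrier)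
  have d: "dim_vec (X *\<^sub>v y) = n" "dim_vec (X *\<^sub>v x) = n" "dim_vec y = n" "dim_vec x = n" "dim_vec u = m"
    "dim_vec (A *\<^sub>v y) = n" "dim_vec (B *\<^sub>v u) = n" "dim_vec (mat_adjoint A *\<^sub>v (X *\<^sub>v y)) = n"
    "dim_vec (Q *\<^sub>v y) = n" "dim_vec (C *\<^sub>v u) = n" "dim_vec (R *\<^sub>v u) = m"
    by (intro carrier_vecD; simp)+
  have "((l \<cdot>\<^sub>v (- y) + (A *\<^sub>v y + B *\<^sub>v u)) @\<^sub>v (l \<cdot>\<^sub>v (X *\<^sub>v y) + (mat_adjoint A *\<^sub>v (X *\<^sub>v y) + Q *\<^sub>v y + C *\<^sub>v u))) @\<^sub>v
      (mat_adjoint B *\<^sub>v (X *\<^sub>v y) + mat_adjoint C *\<^sub>v y + R *\<^sub>v u) = ((- x) @\<^sub>v (X *\<^sub>v x)) @\<^sub>v 0\<^sub>v m"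
  proof -
    have "l \<cdot>\<^sub>v (\<E> *\<^sub>v (((X *\<^sub>v y) @\<^sub>v y) @\<^sub>v u)) - \<A> *\<^sub>v (((X *\<^sub>v y) @\<^sub>v y) @\<^sub>v u) =
      ((l \<cdot>\<^sub>v (- y) + (A *\<^sub>v y + B *\<^sub>v u)) @\<^sub>v (l \<cdot>\<^sub>v (X *\<^sub>v y) + (mat_adjoint A *\<^sub>v (X *\<^sub>v y) + Q *\<^sub>v y + C *\<^sub>v u))) @\<^sub>v
      (mat_adjoint B *\<^sub>v (X *\<^sub>v y) + mat_adjoint C *\<^sub>v y + R *\<^sub>v u)"
      unfolding even_A_mult[OF Xv[OF y(1)] y(1,2)] even_E_mult[OF Xv[OF y(1)] y(1,2)]
      by (intro eq_vecI) (auto simp: d simp del: index_mult_mat_vec dim_mult_mat_vec)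
    moreover have "\<E> *\<^sub>v (((X *\<^sub>v x) @\<^sub>v x) @\<^sub>v 0\<^sub>v m) = ((- x) @\<^sub>v (X *\<^sub>v x)) @\<^sub>v 0\<^sub>v m"
      by (rule even_E_mult) auto
    ultimately show ?thesis using eq by simp
  qed
  then have "l \<cdot>\<^sub>v (- y) + (A *\<^sub>v y + B *\<^sub>v u) = - x \<and> l \<cdot>\<^sub>v (X *\<^sub>v y) + (mat_adjoint A *\<^sub>v (X *\<^sub>v y) + Q *\<^sub>v y + C *\<^sub>v u) = X *\<^sub>v x \<and>
      mat_adjoint B *\<^sub>v (X *\<^sub>v y) + mat_adjoint C *\<^sub>v y + R *\<^sub>v u = 0\<^sub>v m"
    by (rule append3_eq_iff[THEN iffD1, rotated 4]) simp_all
  then have e: "l \<cdot>\<^sub>v (- y) + (A *\<^sub>v y + B *\<^sub>v u) = - x" "l \<cdot>\<^sub>v (X *\<^sub>v y) + (mat_adjoint A *\<^sub>v (X *\<^sub>v y) + Q *\<^sub>v y + C *\<^sub>v u) = X *\<^sub>v x"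
     "mat_adjoint B *\<^sub>v (X *\<^sub>v y) + mat_adjoint C *\<^sub>v y + R *\<^sub>v u = 0\<^sub>v m" by simp_all
  show 1: "A *\<^sub>v y + B *\<^sub>v u = l \<cdot>\<^sub>v y - x"
  proof (rule eq_vecI)
    fix i assume "i < dim_vec (l \<cdot>\<^sub>v y - x)"
    then have i: "i < n" by (simp add: d)
    have "- (l * y $ i) + ((A *\<^sub>v y) $ i + (B *\<^sub>v u) $ i) = - x $ i"
      using arg_cong[OF e(1), of "\<lambda>v. v $ i"] i by (simp add: d del: index_mult_mat_vec dim_mult_mat_vec)
    then have "(A *\<^sub>v y) $ i + (B *\<^sub>v u) $ i = l * y $ i - x $ i" by (simp add: algebra_simps)
    then show "(A *\<^sub>v y + B *\<^sub>v u) $ i = (l \<cdot>\<^sub>v y - x) $ i"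
      using i by (simp add: d del: index_mult_mat_vec dim_mult_mat_vec)
  qed (simp add: d)
  have "mat_adjoint A *\<^sub>v (X *\<^sub>v y) + X *\<^sub>v (A *\<^sub>v y + B *\<^sub>v u) + Q *\<^sub>v y + C *\<^sub>v u = 0\<^sub>v n"
  proof (rule eq_vecI)
    fix i assume "i < dim_vec (0\<^sub>v n :: complex vec)"
    then have i: "i < n" by simp
    have X1: "X *\<^sub>v (A *\<^sub>v y + B *\<^sub>v u) = l \<cdot>\<^sub>v (X *\<^sub>v y) - X *\<^sub>v x"
      unfolding 1 by (simp add: mult_minus_distrib_mat_vec[OF X] mult_mat_vec[OF X])
    have "l * (X *\<^sub>v y) $ i + ((mat_adjoint A *\<^sub>v (X *\<^sub>v y)) $ i + (Q *\<^sub>v y) $ i + (C *\<^sub>v u) $ i) = (X *\<^sub>v x) $ i"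
      using arg_cong[OF e(2), of "\<lambda>v. v $ i"] i by (simp add: d del: index_mult_mat_vec dim_mult_mat_vec)
    then show "(mat_adjoint A *\<^sub>v (X *\<^sub>v y) + X *\<^sub>v (A *\<^sub>v y + B *\<^sub>v u) + Q *\<^sub>v y + C *\<^sub>v u) $ i = 0\<^sub>v n $ i"
      unfolding X1 using i by (simp add: d algebra_simps del: index_mult_mat_vec dim_mult_mat_vec)
  qed (simp add: d del: dim_mult_mat_vec)
  then show "lmi_mat X *\<^sub>v (y @\<^sub>v u) = 0\<^sub>v (n + m)"
    unfolding lmi_mat_mult[OF X y(1,2)] e(3) by simp
qed

text \<open>With fewer than \<open>m\<close> rows the matrix with block rows
  \<open>[A - l I, B]\<close> and \<open>[K, L']\<close> is wide and has a nonzero kernel vector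
  \<open>(y, u)\<close>. The matrix of the inequality annihilates it, and then
  \<open>(X y, y, u)\<close> is a kernel vector of the even pencil at \<open>l\<close>, where that
  pencil is nonsingular.\<close>

lemma lure_equations_rank:
  assumes eq: "lure_equations n m A B C Q R p X K L'"
  shows "m \<le> p"
proof (rule ccontr)
  assume "\<not> m \<le> p"
  have X: "X \<in> carrier_mat n n" and K: "K \<in> carrier_mat p n" and L': "L' \<in> carrier_mat p m" and Xh: "hermitian_mat X"
    and e: "mat_adjoint A * X + X * A + Q = mat_adjoint K * K" "X * B + C = mat_adjoint K * L'" "R = mat_adjoint L' * L'"
    using eq by (simp_all add: lure_equations_def)
  obtain \<omega> where w: "det (Complex 0 \<omega> \<cdot>\<^sub>m \<E> - \<A>) \<noteq> 0" using regular_pencil_imaginary[OF reg] .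
  define l where "l = Complex 0 \<omega>"
  have Al: "A - l \<cdot>\<^sub>m 1\<^sub>m n \<in> carrier_mat n n" by (rule minus_carrier_mat) simp
  have O: "(A - l \<cdot>\<^sub>m 1\<^sub>m n) @\<^sub>c B \<in> carrier_mat n (n + m)" and KL: "K @\<^sub>c L' \<in> carrier_mat p (n + m)"
    using append_cols_carrier[OF Al B] append_cols_carrier[OF K L'] .
  obtain v where v: "v \<in> carrier_vec (n + m)" "v \<noteq> 0\<^sub>v (n + m)"
    "(((A - l \<cdot>\<^sub>m 1\<^sub>m n) @\<^sub>c B) @\<^sub>r (K @\<^sub>c L')) *\<^sub>v v = 0\<^sub>v (n + p)"
    using wide_mat_kernel[OF carrier_append_rows[OF O KL]] \<open>\<not> m \<le> p\<close> by auto
  obtain y u where vv: "v = y @\<^sub>v u" and y [simp]: "y \<in> carrier_vec n" "u \<in> carrier_vec m"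
    using v(1) by (rule split2_vec)
  have Xy [simp]: "X *\<^sub>v y \<in> carrier_vec n" using X y(1) by (rule mult_mat_vec_carrier)
  have KLc: "K *\<^sub>v y \<in> carrier_vec p" "L' *\<^sub>v u \<in> carrier_vec p"
    using mult_mat_vec_carrier[OF K y(1)] mult_mat_vec_carrier[OF L' y(2)] .
  have "((A - l \<cdot>\<^sub>m 1\<^sub>m n) *\<^sub>v y + B *\<^sub>v u) @\<^sub>v (K *\<^sub>v y + L' *\<^sub>v u) = 0\<^sub>v (n + p)"
    using v(3) unfolding mat_mult_append[OF O KL v(1)] unfolding vv append_cols_mult_vec[OF Al B y] append_cols_mult_vec[OF K L' y] .
  then have z: "(A - l \<cdot>\<^sub>m 1\<^sub>m n) *\<^sub>v y + B *\<^sub>v u = 0\<^sub>v n" "K *\<^sub>v y + L' *\<^sub>v u = 0\<^sub>v p"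
    using append_vec_eq_zero_iff[of "(A - l \<cdot>\<^sub>m 1\<^sub>m n) *\<^sub>v y + B *\<^sub>v u" n "K *\<^sub>v y + L' *\<^sub>v u" p] KLc
      mult_mat_vec_carrier[OF Al y(1)] by simp_all
  have Aly: "(A - l \<cdot>\<^sub>m 1\<^sub>m n) *\<^sub>v y = A *\<^sub>v y - l \<cdot>\<^sub>v y"
    by (subst cayley_mult(2)[of _ n n]) auto
  have d: "dim_vec (X *\<^sub>v y) = n" "dim_vec y = n" "dim_vec u = m"
    "dim_vec (A *\<^sub>v y) = n" "dim_vec (B *\<^sub>v u) = n" "dim_vec (mat_adjoint A *\<^sub>v (X *\<^sub>v y)) = n"
    "dim_vec (Q *\<^sub>v y) = n" "dim_vec (C *\<^sub>v u) = n" "dim_vec (mat_adjoint B *\<^sub>v (X *\<^sub>v y)) = m" "dim_vec (mat_adjoint C *\<^sub>v y) = m"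
    "dim_vec (R *\<^sub>v u) = m"
    by (intro carrier_vecD; simp)+
  have AB: "(A *\<^sub>v y) $ i + (B *\<^sub>v u) $ i = l * y $ i" if "i < n" for i
    using arg_cong[OF z(1)[unfolded Aly], of "\<lambda>v. v $ i"] that
    by (simp add: d algebra_simps del: index_mult_mat_vec dim_mult_mat_vec)
  have ABv: "A *\<^sub>v y + B *\<^sub>v u = l \<cdot>\<^sub>v y"
    by (rule eq_vecI) (simp_all add: AB d del: index_mult_mat_vec dim_mult_mat_vec)
  have "lmi_mat X *\<^sub>v (y @\<^sub>v u) = 0\<^sub>v (n + m)"
  proof -
    have adj: "mat_adjoint B * X + mat_adjoint C = mat_adjoint L' * K"
      unfolding adjoint_shift[OF X Xh, symmetric] e(2) by (simp add: mat_adjoint_mult[OF mat_adjoint_carrier[OF K] L'])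
    have aK: "mat_adjoint K \<in> carrier_mat n p" and aL: "mat_adjoint L' \<in> carrier_mat m p" using K L' by simp_all
    have "lmi_mat X *\<^sub>v (y @\<^sub>v u) = ((mat_adjoint K * K) *\<^sub>v y + (mat_adjoint K * L') *\<^sub>v u) @\<^sub>v ((mat_adjoint L' * K) *\<^sub>v y + (mat_adjoint L' * L') *\<^sub>v u)"
      unfolding adj e(1,2) unfolding e(3)
      by (rule four_block_mat_mult_vec[OF mult_carrier_mat[OF aK K] mult_carrier_mat[OF aK L'] mult_carrier_mat[OF aL K] mult_carrier_mat[OF aL L'] y])
    also have "(mat_adjoint K * K) *\<^sub>v y + (mat_adjoint K * L') *\<^sub>v u = mat_adjoint K *\<^sub>v (K *\<^sub>v y + L' *\<^sub>v u)"
      by (simp add: mult_add_distrib_mat_vec[OF aK KLc] assoc_mult_mat_vec[OF aK K] assoc_mult_mat_vec[OF aK L'])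
    also have "(mat_adjoint L' * K) *\<^sub>v y + (mat_adjoint L' * L') *\<^sub>v u = mat_adjoint L' *\<^sub>v (K *\<^sub>v y + L' *\<^sub>v u)"
      by (simp add: mult_add_distrib_mat_vec[OF aL KLc] assoc_mult_mat_vec[OF aL K] assoc_mult_mat_vec[OF aL L'])
    finally show ?thesis by (simp add: z(2) mult_mat_zero_vec[OF aK] mult_mat_zero_vec[OF aL])
  qed
  then have "(mat_adjoint A *\<^sub>v (X *\<^sub>v y) + X *\<^sub>v (A *\<^sub>v y + B *\<^sub>v u) + Q *\<^sub>v y + C *\<^sub>v u) @\<^sub>v
    (mat_adjoint B *\<^sub>v (X *\<^sub>v y) + mat_adjoint C *\<^sub>v y + R *\<^sub>v u) = 0\<^sub>v (n + m)"
    unfolding lmi_mat_mult[OF X y] .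
  then have "mat_adjoint A *\<^sub>v (X *\<^sub>v y) + X *\<^sub>v (A *\<^sub>v y + B *\<^sub>v u) + Q *\<^sub>v y + C *\<^sub>v u = 0\<^sub>v n \<and>
    mat_adjoint B *\<^sub>v (X *\<^sub>v y) + mat_adjoint C *\<^sub>v y + R *\<^sub>v u = 0\<^sub>v m"
    by (rule append_vec_eq_zero_iff[THEN iffD1, rotated 2]) (simp_all add: mult_mat_vec_carrier[OF X])
  then have f: "mat_adjoint A *\<^sub>v (X *\<^sub>v y) + l \<cdot>\<^sub>v (X *\<^sub>v y) + Q *\<^sub>v y + C *\<^sub>v u = 0\<^sub>v n"
    "mat_adjoint B *\<^sub>v (X *\<^sub>v y) + mat_adjoint C *\<^sub>v y + R *\<^sub>v u = 0\<^sub>v m"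
    by (simp_all add: ABv mult_mat_vec[OF X])
  have lsq: "l \<cdot>\<^sub>m \<E> - \<A> \<in> carrier_mat (2 * n + m) (2 * n + m)" using even_carrier(2) by (rule minus_carrier_mat)
  let ?w = "((X *\<^sub>v y) @\<^sub>v y) @\<^sub>v u"
  have wc: "?w \<in> carrier_vec (2 * n + m)" by (simp add: mult_2)
  have "(l \<cdot>\<^sub>m \<E> - \<A>) *\<^sub>v ?w = l \<cdot>\<^sub>v (\<E> *\<^sub>v ?w) - \<A> *\<^sub>v ?w"
    by (rule mult_mat_vec_diff[OF even_carrier wc])
  also have "\<dots> = ((l \<cdot>\<^sub>v (- y) + (A *\<^sub>v y + B *\<^sub>v u)) @\<^sub>v (mat_adjoint A *\<^sub>v (X *\<^sub>v y) + l \<cdot>\<^sub>v (X *\<^sub>v y) + Q *\<^sub>v y + C *\<^sub>v u)) @\<^sub>v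
      (mat_adjoint B *\<^sub>v (X *\<^sub>v y) + mat_adjoint C *\<^sub>v y + R *\<^sub>v u)"
    unfolding even_A_mult[OF Xy y] even_E_mult[OF Xy y]
    by (intro eq_vecI) (auto simp: d simp del: index_mult_mat_vec dim_mult_mat_vec)
  also have "l \<cdot>\<^sub>v (- y) + (A *\<^sub>v y + B *\<^sub>v u) = 0\<^sub>v n" unfolding ABv by (intro eq_vecI) (auto simp: d)
  also have "(0\<^sub>v n @\<^sub>v (mat_adjoint A *\<^sub>v (X *\<^sub>v y) + l \<cdot>\<^sub>v (X *\<^sub>v y) + Q *\<^sub>v y + C *\<^sub>v u)) @\<^sub>v
      (mat_adjoint B *\<^sub>v (X *\<^sub>v y) + mat_adjoint C *\<^sub>v y + R *\<^sub>v u) = 0\<^sub>v (2 * n + m)"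
    unfolding f by (simp add: mult_2)
  finally have "(l \<cdot>\<^sub>m \<E> - \<A>) *\<^sub>v ?w = 0\<^sub>v (2 * n + m)" .
  moreover have "invertible_mat (l \<cdot>\<^sub>m \<E> - \<A>)" using w lsq by (simp add: invertible_mat_iff_det l_def)
  ultimately have "?w = 0\<^sub>v (2 * n + m)" using wc by (simp add: invertible_mat_iff_injective[OF lsq])
  then have "y = 0\<^sub>v n \<and> u = 0\<^sub>v m"
    using append_vec_eq_zero_iff[of "(X *\<^sub>v y) @\<^sub>v y" "n + n" u m] append_vec_eq_zero_iff[of "X *\<^sub>v y" n y n]
    by (simp add: mult_2)
  then show False using v(2) vv by simp
qed

section \<open>Maximality\<close>

context
  fixes X :: "complex mat"
  assumes X: "X \<in> carrier_mat n n" and LX: "L = {(X *\<^sub>v x) @\<^sub>v x | x. x \<in> carrier_vec n}"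
begin

lemma X_closed [simp]: "v \<in> carrier_vec n \<Longrightarrow> X *\<^sub>v v \<in> carrier_vec n"
  using X by (rule mult_mat_vec_carrier)

lemma X_in_L: "x \<in> carrier_vec n \<Longrightarrow> (X *\<^sub>v x) @\<^sub>v x \<in> L"
  unfolding LX by blast

text \<open>For a graph, neutrality is symmetry of the matrix.\<close>

lemma X_hermitian: "hermitian_mat X"
proof (rule hermitian_matI[OF X])
  fix x y :: "complex vec" assume xy: "x \<in> carrier_vec n" "y \<in> carrier_vec n"
  have "hform n ((X *\<^sub>v x) @\<^sub>v x) ((X *\<^sub>v y) @\<^sub>v y) = 0" using xy by (intro L_neutral X_in_L)
  then show "cip x (X *\<^sub>v y) = cip (X *\<^sub>v x) y" using xy by (simp add: skew_form_append)
qed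

text \<open>\<open>\<V>\<close> is invariant under the resolvent, so the solution for the right-hand
  side built from \<open>(X x, x, 0)\<close> has again the shape \<open>(X y, y, u)\<close>. Thus
  \<open>[l I - A, -B]\<close> maps the kernel of \<open>lmi_mat X\<close> onto the whole
  space.\<close>

lemma X_kernel_lift:
  assumes x: "x \<in> carrier_vec n" and w: "det (l \<cdot>\<^sub>m \<E> - \<A>) \<noteq> 0"
  obtains y u where "y \<in> carrier_vec n" "u \<in> carrier_vec m" "A *\<^sub>v y + B *\<^sub>v u = l \<cdot>\<^sub>v y - x"
    "lmi_mat X *\<^sub>v (y @\<^sub>v u) = 0\<^sub>v (n + m)"
proof -
  have v: "((X *\<^sub>v x) @\<^sub>v x) @\<^sub>v 0\<^sub>v m \<in> \<V>" using X_in_L[OF x] by (simp add: L_def)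
  obtain w where w: "w \<in> \<V>" "l \<cdot>\<^sub>v (\<E> *\<^sub>v w) - \<A> *\<^sub>v w = \<E> *\<^sub>v (((X *\<^sub>v x) @\<^sub>v x) @\<^sub>v 0\<^sub>v m)"
    using V_resolvent[OF w v] by blast
  have "w \<in> carrier_vec (2 * n + m)" using w(1) V_carrier by blast
  then obtain u where u: "u \<in> carrier_vec m" "w = vec_first w (2 * n) @\<^sub>v u" by (rule split_vec_first)
  then have "vec_first w (2 * n) \<in> L" using w(1) V_iff_L[OF vec_first_carrier u(1)] by metis
  then obtain y where y: "y \<in> carrier_vec n" "vec_first w (2 * n) = (X *\<^sub>v y) @\<^sub>v y" using LX by blast
  have "w = ((X *\<^sub>v y) @\<^sub>v y) @\<^sub>v u" using u(2) y(2) by simp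
  with w(2) have "l \<cdot>\<^sub>v (\<E> *\<^sub>v (((X *\<^sub>v y) @\<^sub>v y) @\<^sub>v u)) - \<A> *\<^sub>v (((X *\<^sub>v y) @\<^sub>v y) @\<^sub>v u) = \<E> *\<^sub>v (((X *\<^sub>v x) @\<^sub>v x) @\<^sub>v 0\<^sub>v m)"
    by simp
  from even_pencil_solution[OF X y(1) u(1) x this] y(1) u(1) show thesis using that by blast
qed

lemma X_decomposition:
  assumes v: "v \<in> carrier_vec (n + m)" and w: "det (l \<cdot>\<^sub>m \<E> - \<A>) \<noteq> 0"
  obtains y u k where "y \<in> carrier_vec n" "u \<in> carrier_vec m" "A *\<^sub>v y + B *\<^sub>v u = l \<cdot>\<^sub>v y"
    "k \<in> carrier_vec (n + m)" "lmi_mat X *\<^sub>v k = 0\<^sub>v (n + m)" "v = (y @\<^sub>v u) + k"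
proof -
  obtain p q where pq: "v = p @\<^sub>v q" and p [simp]: "p \<in> carrier_vec n" "q \<in> carrier_vec m" using v by (rule split2_vec)
  \<comment> \<open>The defect of \<open>v\<close> with respect to the kernel of
    \<open>[A - l I, B]\<close>; subtracting a lift of it moves \<open>v\<close> into that
    kernel.\<close>
  define x where "x = l \<cdot>\<^sub>v p - (A *\<^sub>v p + B *\<^sub>v q)"
  have x: "x \<in> carrier_vec n" by (simp add: x_def)
  obtain y u where y [simp]: "y \<in> carrier_vec n" "u \<in> carrier_vec m" and eq: "A *\<^sub>v y + B *\<^sub>v u = l \<cdot>\<^sub>v y - x"
    and ker: "lmi_mat X *\<^sub>v (y @\<^sub>v u) = 0\<^sub>v (n + m)" using x w by (rule X_kernel_lift)
  have d: "dim_vec y = n" "dim_vec p = n" "dim_vec q = m" "dim_vec u = m" "dim_vec (A *\<^sub>v y) = n" "dim_vec (B *\<^sub>v u) = n"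
    "dim_vec (A *\<^sub>v p) = n" "dim_vec (B *\<^sub>v q) = n" "dim_vec x = n"
    using x by (intro carrier_vecD; simp)+
  have "A *\<^sub>v (p - y) + B *\<^sub>v (q - u) = l \<cdot>\<^sub>v (p - y)"
  proof (rule eq_vecI)
    fix i assume "i < dim_vec (l \<cdot>\<^sub>v (p - y))"
    then have i: "i < n" by (simp add: d)
    have "(A *\<^sub>v y) $ i + (B *\<^sub>v u) $ i = l * y $ i - (l * p $ i - ((A *\<^sub>v p) $ i + (B *\<^sub>v q) $ i))"
      using arg_cong[OF eq, of "\<lambda>v. v $ i"] i by (simp add: x_def d del: index_mult_mat_vec dim_mult_mat_vec)
    then show "(A *\<^sub>v (p - y) + B *\<^sub>v (q - u)) $ i = (l \<cdot>\<^sub>v (p - y)) $ i"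
      using i by (simp add: mult_minus_distrib_mat_vec[OF A] mult_minus_distrib_mat_vec[OF B] d algebra_simps
          del: index_mult_mat_vec dim_mult_mat_vec)
  qed (simp add: d)
  moreover have "v = ((p - y) @\<^sub>v (q - u)) + (y @\<^sub>v u)"
    unfolding pq by (intro eq_vecI) (auto simp: d)
  ultimately show thesis using that[of "p - y" "q - u" "y @\<^sub>v u"] ker by simp
qed

lemma lmi_form_decomposition:
  assumes y: "s \<in> carrier_vec (n + m)" and k: "k \<in> carrier_vec (n + m)" "lmi_mat X *\<^sub>v k = 0\<^sub>v (n + m)"
  shows "cip (s + k) (lmi_mat X *\<^sub>v (s + k)) = cip s (lmi_mat X *\<^sub>v s)"
proof -
  note P = lmi_mat_carrier[OF X]
  have Ps: "lmi_mat X *\<^sub>v s \<in> carrier_vec (n + m)" using P y by (rule mult_mat_vec_carrier)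
  have "lmi_mat X *\<^sub>v (s + k) = lmi_mat X *\<^sub>v s"
    using mult_add_distrib_mat_vec[OF P y k(1)] Ps k(2) by simp
  moreover have "cip k (lmi_mat X *\<^sub>v s) = 0"
    using hermitian_cip[OF lmi_mat_hermitian[OF X X_hermitian] P k(1) y] k(2) cip_zero_left[OF y] by simp
  ultimately show ?thesis using cip_add_left[OF y k(1) Ps] by simp
qed

lemma lmi_X_psd:
  assumes Y: "Y \<in> S_LMI n A B C Q R"
  shows "psd_mat (lmi_mat X)"
proof (rule psd_matI[OF lmi_mat_carrier[OF X] lmi_mat_hermitian[OF X X_hermitian]])
  fix v :: "complex vec" assume v: "v \<in> carrier_vec (n + m)"
  have Yc: "Y \<in> carrier_mat n n" "hermitian_mat Y" and Yp: "psd_mat (lmi_mat Y)"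
    using Y by (simp_all add: S_LMI_def)
  obtain \<omega> where w: "det (Complex 0 \<omega> \<cdot>\<^sub>m \<E> - \<A>) \<noteq> 0" using regular_pencil_imaginary[OF reg] .
  obtain y u k where y: "y \<in> carrier_vec n" "u \<in> carrier_vec m" "A *\<^sub>v y + B *\<^sub>v u = Complex 0 \<omega> \<cdot>\<^sub>v y"
    and k: "k \<in> carrier_vec (n + m)" "lmi_mat X *\<^sub>v k = 0\<^sub>v (n + m)" "v = (y @\<^sub>v u) + k"
    using v w by (rule X_decomposition)
  have s: "y @\<^sub>v u \<in> carrier_vec (n + m)" using y by simp
  have "cip v (lmi_mat X *\<^sub>v v) = cip (y @\<^sub>v u) (lmi_mat X *\<^sub>v (y @\<^sub>v u))"
    unfolding k(3) by (rule lmi_form_decomposition[OF s k(1,2)])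
  also have "\<dots> = cip (y @\<^sub>v u) (lmi_mat Y *\<^sub>v (y @\<^sub>v u))"
    using lmi_mat_form[OF X X_hermitian y] lmi_mat_form[OF Yc y] by simp
  finally show "0 \<le> Re (cip v (lmi_mat X *\<^sub>v v))"
    using psd_matD[OF Yp lmi_mat_carrier[OF Yc(1)] s] by simp
qed

text \<open>The surjective factor \<open>W\<close> has \<open>p\<close> rows. Stacked below
  \<open>[A - l I, B]\<close> it gives a surjective matrix, so \<open>n + p \<le> n + m\<close>,
  while \<open>lure_equations_rank\<close> bounds the number of rows in every solution from below by
  \<open>m\<close>.\<close>

lemma X_lure_solution:
  assumes Y: "Y \<in> S_LMI n A B C Q R"
  shows "lure_solution n m A B C Q R X"
proof -
  note P = lmi_mat_carrier[OF X]
  obtain p W where W: "W \<in> carrier_mat p (n + m)" "lmi_mat X = mat_adjoint W * W"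
    and surj: "\<And>b. b \<in> carrier_vec p \<Longrightarrow> \<exists>v\<in>carrier_vec (n + m). W *\<^sub>v v = b"
    using psd_factorization[OF lmi_X_psd[OF Y] P] by blast
  have Wker: "W *\<^sub>v k = 0\<^sub>v p" if k: "k \<in> carrier_vec (n + m)" "lmi_mat X *\<^sub>v k = 0\<^sub>v (n + m)" for k
  proof -
    have Wk: "W *\<^sub>v k \<in> carrier_vec p" using W(1) k(1) by (rule mult_mat_vec_carrier)
    have "cip (W *\<^sub>v k) (W *\<^sub>v k) = cip k (lmi_mat X *\<^sub>v k)"
      unfolding W(2) using cip_mult_left[OF W(1) k(1) Wk] assoc_mult_mat_vec[OF mat_adjoint_carrier[OF W(1)] W(1) k(1)] by simp
    then show ?thesis using k cip_self_eq_0[OF Wk] by simp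
  qed
  obtain \<omega> where w: "det (Complex 0 \<omega> \<cdot>\<^sub>m \<E> - \<A>) \<noteq> 0" using regular_pencil_imaginary[OF reg] .
  define l where "l = Complex 0 \<omega>"
  have w: "det (l \<cdot>\<^sub>m \<E> - \<A>) \<noteq> 0" using w by (simp add: l_def)
  have Al: "A - l \<cdot>\<^sub>m 1\<^sub>m n \<in> carrier_mat n n" by (rule minus_carrier_mat) simp
  have O: "(A - l \<cdot>\<^sub>m 1\<^sub>m n) @\<^sub>c B \<in> carrier_mat n (n + m)" using append_cols_carrier[OF Al B] .
  let ?O = "(A - l \<cdot>\<^sub>m 1\<^sub>m n) @\<^sub>c B"
  have Omult: "?O *\<^sub>v (y @\<^sub>v u) = A *\<^sub>v y + B *\<^sub>v u - l \<cdot>\<^sub>v y" if yu [simp]: "y \<in> carrier_vec n" "u \<in> carrier_vec m" for y u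
  proof -
    have "(A - l \<cdot>\<^sub>m 1\<^sub>m n) *\<^sub>v y = A *\<^sub>v y - l \<cdot>\<^sub>v y" by (subst cayley_mult(2)[of _ n n]) auto
    moreover have d: "dim_vec (A *\<^sub>v y) = n" "dim_vec (B *\<^sub>v u) = n" "dim_vec y = n" by (intro carrier_vecD; simp)+
    ultimately show ?thesis unfolding append_cols_mult_vec[OF Al B yu]
      by (intro eq_vecI) (auto simp: d simp del: index_mult_mat_vec dim_mult_mat_vec)
  qed
  have "n + p \<le> n + m"
  proof (rule surjective_mat_dim[OF carrier_append_rows[OF O W(1)]])
    fix c :: "complex vec" assume "c \<in> carrier_vec (n + p)"
    then obtain a b where c: "c = a @\<^sub>v b" and a: "a \<in> carrier_vec n" and b: "b \<in> carrier_vec p" by (rule split2_vec)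
    \<comment> \<open>Hit \<open>(a, 0)\<close> by a kernel vector of \<open>lmi_mat X\<close>, on
      which \<open>W\<close> vanishes, and \<open>(0, b)\<close> by the part of a
      \<open>W\<close>-preimage of \<open>b\<close> that lies in the kernel of
      \<open>[A - l I, B]\<close>.\<close>
    have "- a \<in> carrier_vec n" using a by simp
    then obtain y u where y: "y \<in> carrier_vec n" "u \<in> carrier_vec m" "A *\<^sub>v y + B *\<^sub>v u = l \<cdot>\<^sub>v y - (- a)"
      "lmi_mat X *\<^sub>v (y @\<^sub>v u) = 0\<^sub>v (n + m)" using w by (rule X_kernel_lift)
    have yu: "y @\<^sub>v u \<in> carrier_vec (n + m)" using y by simp
    have Oy: "?O *\<^sub>v (y @\<^sub>v u) = a"
      unfolding Omult[OF y(1,2)] y(3) using y(1) a by (intro eq_vecI) auto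
    have Wy: "W *\<^sub>v (y @\<^sub>v u) = 0\<^sub>v p" using Wker[OF yu y(4)] .
    obtain f where f: "f \<in> carrier_vec (n + m)" "W *\<^sub>v f = b" using surj[OF b] by blast
    obtain y' u' k where y': "y' \<in> carrier_vec n" "u' \<in> carrier_vec m" "A *\<^sub>v y' + B *\<^sub>v u' = l \<cdot>\<^sub>v y'"
      and k: "k \<in> carrier_vec (n + m)" "lmi_mat X *\<^sub>v k = 0\<^sub>v (n + m)" "f = (y' @\<^sub>v u') + k"
      using f(1) w by (rule X_decomposition)
    have yu': "y' @\<^sub>v u' \<in> carrier_vec (n + m)" using y' by simp
    have Oy': "?O *\<^sub>v (y' @\<^sub>v u') = 0\<^sub>v n" unfolding Omult[OF y'(1,2)] y'(3) using y'(1) by simp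
    have "W *\<^sub>v f = W *\<^sub>v (y' @\<^sub>v u') + 0\<^sub>v p"
      unfolding k(3) mult_add_distrib_mat_vec[OF W(1) yu' k(1)] Wker[OF k(1,2)] ..
    then have Wy': "W *\<^sub>v (y' @\<^sub>v u') = b" using f(2) mult_mat_vec_carrier[OF W(1) yu'] by simp
    let ?v = "(y' @\<^sub>v u') + (y @\<^sub>v u)"
    have vc: "?v \<in> carrier_vec (n + m)" using yu yu' by simp
    have "?O *\<^sub>v ?v = a" unfolding mult_add_distrib_mat_vec[OF O yu' yu] Oy Oy' using a by simp
    moreover have "W *\<^sub>v ?v = b" unfolding mult_add_distrib_mat_vec[OF W(1) yu' yu] Wy Wy' using b by simp
    ultimately have "(?O @\<^sub>r W) *\<^sub>v ?v = c" unfolding mat_mult_append[OF O W(1) vc] c by simp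
    with vc show "\<exists>v\<in>carrier_vec (n + m). (?O @\<^sub>r W) *\<^sub>v v = c" by blast
  qed
  then have pm: "p \<le> m" by simp
  define K where "K = mat p n (\<lambda>(i, j). W $$ (i, j))"
  define L' where "L' = mat p m (\<lambda>(i, j). W $$ (i, n + j))"
  have Wsum: "(mat_adjoint W * W) $$ (i, j) = (\<Sum>r<p. cnj (W $$ (r, i)) * W $$ (r, j))" if "i < n + m" "j < n + m" for i j
    using that W(1) by (auto simp: scalar_prod_def atLeast0LessThan intro!: sum.cong)
  have prod: "(mat_adjoint M * N) $$ (i, j) = (\<Sum>r<p. cnj (M $$ (r, i)) * N $$ (r, j))"
    if "M \<in> carrier_mat p c" "N \<in> carrier_mat p d" "i < c" "j < d" for M N :: "complex mat" and c d i j
    using that by (auto simp: scalar_prod_def atLeast0LessThan intro!: sum.cong)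
  have Kc: "K \<in> carrier_mat p n" and Lc: "L' \<in> carrier_mat p m" by (simp_all add: K_def L'_def)
  define M11 where "M11 = mat_adjoint A * X + X * A + Q"
  define M12 where "M12 = X * B + C"
  define M21 where "M21 = mat_adjoint B * X + mat_adjoint C"
  have Mc: "M11 \<in> carrier_mat n n" "M12 \<in> carrier_mat n m" "M21 \<in> carrier_mat m n"
    using X by (auto simp: M11_def M12_def M21_def)
  have blocks: "four_block_mat M11 M12 M21 R = mat_adjoint W * W"
    using W(2) by (simp only: M11_def M12_def M21_def)
  have ix: "four_block_mat M11 M12 M21 R $$ (i, j) = (\<Sum>r<p. cnj (W $$ (r, i)) * W $$ (r, j))" if "i < n + m" "j < n + m" for i j
    unfolding blocks using that by (rule Wsum)
  have "lure_equations n m A B C Q R p X K L'"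
    unfolding lure_equations_def
  proof (intro conjI X Kc Lc X_hermitian)
    show "mat_adjoint A * X + X * A + Q = mat_adjoint K * K"
      unfolding M11_def[symmetric]
    proof (rule eq_matI)
      fix i j assume "i < dim_row (mat_adjoint K * K)" "j < dim_col (mat_adjoint K * K)"
      then have ij: "i < n" "j < n" by (simp_all add: K_def)
      then have "M11 $$ (i, j) = (\<Sum>r<p. cnj (W $$ (r, i)) * W $$ (r, j))"
        using ix[of i j] carrier_matD[OF Mc(1)] by simp
      also have "\<dots> = (mat_adjoint K * K) $$ (i, j)"
        unfolding prod[OF Kc Kc ij] using ij by (intro sum.cong) (auto simp: K_def)
      finally show "M11 $$ (i, j) = (mat_adjoint K * K) $$ (i, j)" .
    qed (use carrier_matD[OF Mc(1)] in \<open>simp_all add: K_def\<close>)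
    show "X * B + C = mat_adjoint K * L'"
      unfolding M12_def[symmetric]
    proof (rule eq_matI)
      fix i j assume "i < dim_row (mat_adjoint K * L')" "j < dim_col (mat_adjoint K * L')"
      then have ij: "i < n" "j < m" by (simp_all add: K_def L'_def)
      then have "M12 $$ (i, j) = (\<Sum>r<p. cnj (W $$ (r, i)) * W $$ (r, n + j))"
        using ix[of i "n + j"] carrier_matD[OF Mc(1)] by simp
      also have "\<dots> = (mat_adjoint K * L') $$ (i, j)"
        unfolding prod[OF Kc Lc ij] using ij by (intro sum.cong) (auto simp: K_def L'_def)
      finally show "M12 $$ (i, j) = (mat_adjoint K * L') $$ (i, j)" .
    qed (use carrier_matD[OF Mc(2)] in \<open>simp_all add: K_def L'_def\<close>)
    show "R = mat_adjoint L' * L'"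
    proof (rule eq_matI)
      fix i j assume "i < dim_row (mat_adjoint L' * L')" "j < dim_col (mat_adjoint L' * L')"
      then have ij: "i < m" "j < m" by (simp_all add: L'_def)
      then have "R $$ (i, j) = (\<Sum>r<p. cnj (W $$ (r, n + i)) * W $$ (r, n + j))"
        using ix[of "n + i" "n + j"] carrier_matD[OF Mc(1)] by simp
      also have "\<dots> = (mat_adjoint L' * L') $$ (i, j)"
        unfolding prod[OF Lc Lc ij] using ij by (intro sum.cong) (auto simp: L'_def)
      finally show "R $$ (i, j) = (mat_adjoint L' * L') $$ (i, j)" .
    qed (simp_all add: L'_def)
  qed
  then show ?thesis
    unfolding lure_solution_def using pm lure_equations_rank order.trans by blast
qed

text \<open>The unstable part of \<open>L\<close> yields backward orbits and its critical part
  yields vectors on which \<open>X\<close> and \<open>Y\<close> agree. So the form of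
  \<open>X - Y\<close> at \<open>x\<close> equals its value at the start of an orbit, along which it
  does not increase and tends to zero.\<close>

lemma X_maximal:
  assumes Y: "Y \<in> S_LMI n A B C Q R"
  shows "psd_mat (X - Y)"
proof -
  have Yc: "Y \<in> carrier_mat n n" "hermitian_mat Y" using S_LMI_carrier[OF Y] by simp_all
  interpret definite_pencil n E_red A_red "null_at Y" by (rule red_definite[OF Y])
  interpret Y: lure_psd n m A B "Y * B + C" "mat_adjoint A * Y + Y * A + Q" R \<gamma>
    using Y by (rule S_LMI_lure_psd)
  have Yv [simp]: "Y *\<^sub>v x \<in> carrier_vec n" if "x \<in> carrier_vec n" for x using Yc(1) that by (rule mult_mat_vec_carrier)
  define D where "D = X - Y"
  have D: "D \<in> carrier_mat n n" unfolding D_def using Yc(1) by (rule minus_carrier_mat)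
  have Dv: "D *\<^sub>v x = X *\<^sub>v x - Y *\<^sub>v x" if "x \<in> carrier_vec n" for x
    unfolding D_def using X Yc(1) that by (rule minus_mult_distrib_mat_vec)
  have Dc [simp]: "D *\<^sub>v x \<in> carrier_vec n" if "x \<in> carrier_vec n" for x using D that by (rule mult_mat_vec_carrier)
  have Dh: "hermitian_mat D"
  proof (rule hermitian_matI[OF D])
    fix x y :: "complex vec" assume xy: "x \<in> carrier_vec n" "y \<in> carrier_vec n"
    then show "cip x (D *\<^sub>v y) = cip (D *\<^sub>v x) y"
      using hermitian_cip[OF X_hermitian X xy] hermitian_cip[OF Yc(2,1) xy]
      by (simp add: Dv cip_minus_left[where n = n] cip_minus_right[where n = n])
  qed
  have mono: "Re (cip x (D *\<^sub>v x)) \<le> Re (cip x' (D *\<^sub>v x'))"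
    if c: "x \<in> carrier_vec n" "x' \<in> carrier_vec n" and eq: "A_red *\<^sub>v ((X *\<^sub>v x) @\<^sub>v x) = E_red *\<^sub>v ((X *\<^sub>v x') @\<^sub>v x')" for x x'
  proof -
    obtain u where "step (X *\<^sub>v x) x (X *\<^sub>v x') x' u"
      using eq c red_eq_iff_step[of "X *\<^sub>v x" x "X *\<^sub>v x'" x'] by auto
    from Y.step_mono[OF step_shift[OF Yc this]] show ?thesis using c by (simp add: Dv)
  qed
  \<comment> \<open>Closed under sums and multiples, so \<open>L_induct\<close> reduces the
    decomposition to single chains.\<close>
  define good where "good v \<longleftrightarrow> (\<exists>p w. backward_orbit L p \<and> null_at Y w \<and> w \<in> L \<and> v = p 0 + w)" for v
  have orbit_c: "p t \<in> L" "p t \<in> carrier_vec (2 * n)" if "backward_orbit L p" for p t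
    using that L_carrier by (auto simp: backward_orbit_def)
  have good: "good v" if v: "v \<in> L" for v
  proof (rule L_induct[where P = good, OF _ _ _ _ v])
    have o0: "backward_orbit L (\<lambda>_. 0\<^sub>v (2 * n))"
      using L_zero mult_mat_zero_vec[OF red_carrier(1)] mult_mat_zero_vec[OF red_carrier(2)] by (simp add: backward_orbit_def)
    show "good (0\<^sub>v (2 * n))" unfolding good_def
      using o0 null_zero L_zero by (intro exI[of _ "\<lambda>_. 0\<^sub>v (2 * n)"] exI[of _ "0\<^sub>v (2 * n)"]) simp
    show "good (z + z')" if zz: "good z" "good z'" for z z'
    proof -
      obtain p w where p: "backward_orbit L p" "null_at Y w" "w \<in> L" "z = p 0 + w" using zz(1) good_def by blast
      obtain p' w' where p': "backward_orbit L p'" "null_at Y w'" "w' \<in> L" "z' = p' 0 + w'" using zz(2) good_def by blast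
      have c: "w \<in> carrier_vec (2 * n)" "w' \<in> carrier_vec (2 * n)" using p(3) p'(3) L_carrier by auto
      have "backward_orbit L (\<lambda>t. p t + p' t)"
        unfolding backward_orbit_def
      proof (intro conjI allI impI)
        fix t
        show "p t + p' t \<in> L" using orbit_c[OF p(1)] orbit_c[OF p'(1)] by (intro L_add)
        have "A_red *\<^sub>v p (Suc t) = E_red *\<^sub>v p t" "A_red *\<^sub>v p' (Suc t) = E_red *\<^sub>v p' t"
          using p(1) p'(1) by (simp_all add: backward_orbit_def)
        then show "A_red *\<^sub>v (p (Suc t) + p' (Suc t)) = E_red *\<^sub>v (p t + p' t)"
          using orbit_c[OF p(1)] orbit_c[OF p'(1)]
          by (simp add: mult_add_distrib_mat_vec[OF red_carrier(1)] mult_add_distrib_mat_vec[OF red_carrier(2)])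
        fix c assume c: "c < 2 * n"
        have "(\<lambda>t. p t $ c + p' t $ c) \<longlonglongrightarrow> 0 + 0"
          using p(1) p'(1) c by (intro tendsto_add) (auto simp: backward_orbit_def)
        then show "(\<lambda>t. (p t + p' t) $ c) \<longlonglongrightarrow> 0"
          using c by (simp add: carrier_vecD[OF orbit_c(2)[OF p'(1)]])
      qed
      moreover have "null_at Y (w + w')"
      proof -
        obtain x x' where x: "x \<in> carrier_vec n" "w = (Y *\<^sub>v x) @\<^sub>v x" "x' \<in> carrier_vec n" "w' = (Y *\<^sub>v x') @\<^sub>v x'"
          using p(2) p'(2) unfolding null_at_def by blast
        then have "w + w' = (Y *\<^sub>v (x + x')) @\<^sub>v (x + x')"
          by (simp add: append_vec_add[of _ n _ _ n] mult_add_distrib_mat_vec[OF Yc(1)])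
        moreover have "x + x' \<in> carrier_vec n" using x by simp
        ultimately show ?thesis unfolding null_at_def by blast
      qed
      moreover have "z + z' = (p 0 + p' 0) + (w + w')"
        unfolding p(4) p'(4) using orbit_c(2)[OF p(1), of 0] orbit_c(2)[OF p'(1), of 0] c
        by (intro eq_vecI) auto
      ultimately show ?thesis unfolding good_def using L_add[OF p(3) p'(3)]
        by (intro exI[of _ "\<lambda>t. p t + p' t"] exI[of _ "w + w'"]) simp
    qed
    show "good (a \<cdot>\<^sub>v z)" if zz: "good z" for z a
    proof -
      obtain p w where p: "backward_orbit L p" "null_at Y w" "w \<in> L" "z = p 0 + w" using zz good_def by blast
      have c: "w \<in> carrier_vec (2 * n)" using p(3) L_carrier by auto
      have "backward_orbit L (\<lambda>t. a \<cdot>\<^sub>v p t)"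
        unfolding backward_orbit_def
      proof (intro conjI allI impI)
        fix t
        show "a \<cdot>\<^sub>v p t \<in> L" using orbit_c[OF p(1)] by (intro L_smult)
        have "A_red *\<^sub>v p (Suc t) = E_red *\<^sub>v p t" using p(1) by (simp add: backward_orbit_def)
        then show "A_red *\<^sub>v (a \<cdot>\<^sub>v p (Suc t)) = E_red *\<^sub>v (a \<cdot>\<^sub>v p t)"
          using orbit_c[OF p(1)] by (simp add: mult_mat_vec[OF red_carrier(1)] mult_mat_vec[OF red_carrier(2)])
        fix c assume c: "c < 2 * n"
        have "(\<lambda>t. a * p t $ c) \<longlonglongrightarrow> a * 0"
          using p(1) c by (intro tendsto_mult_left) (auto simp: backward_orbit_def)
        then show "(\<lambda>t. (a \<cdot>\<^sub>v p t) $ c) \<longlonglongrightarrow> 0"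
          using c by (simp add: carrier_vecD[OF orbit_c(2)[OF p(1)]])
      qed
      moreover have "null_at Y (a \<cdot>\<^sub>v w)"
      proof -
        obtain x where x: "x \<in> carrier_vec n" "w = (Y *\<^sub>v x) @\<^sub>v x" using p(2) unfolding null_at_def by blast
        then have "a \<cdot>\<^sub>v w = (Y *\<^sub>v (a \<cdot>\<^sub>v x)) @\<^sub>v (a \<cdot>\<^sub>v x)" by (simp add: append_vec_smult mult_mat_vec[OF Yc(1)])
        moreover have "a \<cdot>\<^sub>v x \<in> carrier_vec n" using x by simp
        ultimately show ?thesis unfolding null_at_def by blast
      qed
      moreover have "a \<cdot>\<^sub>v z = a \<cdot>\<^sub>v p 0 + a \<cdot>\<^sub>v w"
        unfolding p(4) using orbit_c(2)[OF p(1), of 0] c by (rule smult_add_distrib_vec)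
      ultimately show ?thesis unfolding good_def using L_smult[OF p(3)]
        by (intro exI[of _ "\<lambda>t. a \<cdot>\<^sub>v p t"] exI[of _ "a \<cdot>\<^sub>v w"]) simp
    qed
    fix ev k z i assume ch: "chain ev k z" "\<And>j. j < k \<Longrightarrow> z j \<in> L" "\<not> d_stable ev" "i < k"
    have zc: "z i \<in> carrier_vec (2 * n)" using ch L_carrier by blast
    show "good (z i)"
    proof (cases "d_unstable ev")
      case True
      obtain p where "p 0 = z i" "backward_orbit L p"
        using unstable_chain_decay[OF L_zero L_minus L_smult L_carrier ch(1) True ch(2) ch(4)] by blast
      then show ?thesis unfolding good_def using null_zero L_zero zc
        by (intro exI[of _ p] exI[of _ "0\<^sub>v (2 * n)"]) simp
    next
      case False
      then have "d_critical ev" using ch(3) pencil_ev_trichotomy by blast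
      then obtain s where s: "ev = Finite s" "cmod s = 1" by (cases ev) auto
      \<comment> \<open>The chain lies in the neutral subspace \<open>L\<close>, so all its
        neighbours are orthogonal and the whole chain is null.\<close>
      have "null_at Y (z i)"
        using ch s by (intro critical_chain_null[of s k z k i]) (auto intro: L_neutral)
      then show ?thesis unfolding good_def using o0 ch(2)[OF ch(4)] zc
        by (intro exI[of _ "\<lambda>_. 0\<^sub>v (2 * n)"] exI[of _ "z i"]) simp
    qed
  qed
  show ?thesis
  proof (rule psd_matI[OF D[unfolded D_def] Dh[unfolded D_def]], unfold D_def[symmetric])
    fix x :: "complex vec" assume x: "x \<in> carrier_vec n"
    obtain p w where p: "backward_orbit L p" and w: "null_at Y w" "w \<in> L" and eq: "(X *\<^sub>v x) @\<^sub>v x = p 0 + w"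
      using good[OF X_in_L[OF x]] unfolding good_def by blast
    define y where "y t = vec n (\<lambda>k. p t $ (n + k))" for t
    have y [simp]: "y t \<in> carrier_vec n" for t by (simp add: y_def)
    have py: "p t = (X *\<^sub>v y t) @\<^sub>v y t" for t
    proof -
      obtain v where v: "v \<in> carrier_vec n" "p t = (X *\<^sub>v v) @\<^sub>v v" using orbit_c(1)[OF p, of t] LX by blast
      have "dim_vec (X *\<^sub>v v) = n" "dim_vec v = n" using v(1) by (intro carrier_vecD; simp)+
      then have "y t = v" unfolding y_def v(2) by (intro eq_vecI) (simp_all del: dim_mult_mat_vec)
      then show ?thesis using v by simp
    qed
    obtain xc where xc: "xc \<in> carrier_vec n" "w = (Y *\<^sub>v xc) @\<^sub>v xc" using w(1) unfolding null_at_def by blast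
    obtain v where v: "v \<in> carrier_vec n" "w = (X *\<^sub>v v) @\<^sub>v v" using w(2) LX by blast
    have "(Y *\<^sub>v xc) @\<^sub>v xc = (X *\<^sub>v v) @\<^sub>v v" using xc(2) v(2) by simp
    \<comment> \<open>\<open>w\<close> lies on the graphs of both \<open>X\<close> and
      \<open>Y\<close>, so \<open>X - Y\<close> vanishes at \<open>xc\<close>.\<close>
    then have "Y *\<^sub>v xc = X *\<^sub>v v \<and> xc = v"
      by (rule append_vec_eq[of _ n, THEN iffD1, rotated 2]) (simp_all add: xc(1) v(1))
    then have "Y *\<^sub>v xc = X *\<^sub>v xc" by metis
    then have "D *\<^sub>v xc = 0\<^sub>v n" using Dv[OF xc(1)] X_closed[OF xc(1)] by simp
    have "(X *\<^sub>v x) @\<^sub>v x = (X *\<^sub>v y 0 + Y *\<^sub>v xc) @\<^sub>v (y 0 + xc)"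
      unfolding eq py xc(2) using xc(1) by (intro append_vec_add[of _ n _ _ n]) auto
    then have xs: "x = y 0 + xc"
      using append_vec_eq[of "X *\<^sub>v x" n "X *\<^sub>v y 0 + Y *\<^sub>v xc" x "y 0 + xc"] x xc(1) by simp
    have Dx: "D *\<^sub>v x = D *\<^sub>v y 0"
      unfolding xs mult_add_distrib_mat_vec[OF D y xc(1)] \<open>D *\<^sub>v xc = 0\<^sub>v n\<close> by simp
    have "cip xc (D *\<^sub>v y 0) = cip (D *\<^sub>v xc) (y 0)" using hermitian_cip[OF Dh D xc(1) y] by simp
    then have "cip xc (D *\<^sub>v y 0) = 0" unfolding \<open>D *\<^sub>v xc = 0\<^sub>v n\<close> using cip_zero_left[OF y] by simp
    then have q: "cip x (D *\<^sub>v x) = cip (y 0) (D *\<^sub>v y 0)"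
      unfolding Dx unfolding xs using xc(1) by (simp add: cip_add_left[where n = n])
    define f where "f t = Re (cip (y t) (D *\<^sub>v y t))" for t
    \<comment> \<open>The relation runs from \<open>p (Suc t)\<close> to \<open>p t\<close>, so the
      dissipation inequality makes \<open>f\<close> nonincreasing in \<open>t\<close>.\<close>
    have "f (Suc t) \<le> f t" for t
    proof -
      have "A_red *\<^sub>v p (Suc t) = E_red *\<^sub>v p t" using p by (simp add: backward_orbit_def)
      from mono[OF y y this[unfolded py]] show ?thesis by (simp add: f_def)
    qed
    then have "decseq f" by (rule decseq_SucI)
    then have "f t \<le> f 0" for t by (simp add: decseqD)
    moreover have "f \<longlonglongrightarrow> 0"
    proof -
      have yt: "(\<lambda>t. y t $ k) \<longlonglongrightarrow> 0" if "k < n" for k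
        using p that by (simp add: y_def backward_orbit_def)
      have "(\<lambda>t. cip (y t) (D *\<^sub>v y t)) = (\<lambda>t. \<Sum>k<n. cnj (y t $ k) * (\<Sum>j<n. D $$ (k, j) * y t $ j))"
        by (rule ext, subst cip_sum[of _ n])
          (auto simp: mult_mat_vec_index[OF D y] simp del: index_mult_mat_vec)
      moreover have "(\<lambda>t. \<Sum>k<n. cnj (y t $ k) * (\<Sum>j<n. D $$ (k, j) * y t $ j)) \<longlonglongrightarrow>
          (\<Sum>k<n. cnj 0 * (\<Sum>j<n. D $$ (k, j) * 0))"
        by (intro tendsto_sum tendsto_mult tendsto_cnj tendsto_const yt) auto
      ultimately have "(\<lambda>t. cip (y t) (D *\<^sub>v y t)) \<longlonglongrightarrow> 0" by simp
      from tendsto_Re[OF this] show ?thesis by (simp add: f_def[abs_def])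
    qed
    ultimately have "0 \<le> f 0" by (intro LIMSEQ_le_const2[of f 0 "f 0"]) auto
    then show "0 \<le> Re (cip x (D *\<^sub>v x))" by (simp add: q f_def)
  qed
qed

end

end

section \<open>The Schur complement and the block form of the basis\<close>

lemma col_space_image:
  fixes M :: "complex mat"
  assumes "M \<in> carrier_mat N k"
  shows "vec_space.col_space N M = {M *\<^sub>v c | c. c \<in> carrier_vec k}"
  using assms mult_mat_vec_carrier[OF assms] by (auto simp: vec_space.col_space_eq[OF assms])

text \<open>Block elimination: the first row determines \<open>z\<close> from \<open>r\<close>, and
  the second becomes the Schur complement applied to \<open>r\<close>. It turns the two
  nonsingularity hypotheses into invertibility of \<open>M_minus\<close>.\<close>

lemma schur_complement_invertible:
  fixes M11 :: "complex mat"
  assumes c: "M11 \<in> carrier_mat k k" "M12 \<in> carrier_mat k l" "M21 \<in> carrier_mat l k" "M22 \<in> carrier_mat l l"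
    and inv: "invertible_mat M11" "invertible_mat (M22 - M21 * mat_inv M11 * M12)"
  shows "invertible_mat (four_block_mat M11 M12 M21 M22)"
proof -
  note i = mat_inv_props[OF inv(1) c(1)]
  have M: "four_block_mat M11 M12 M21 M22 \<in> carrier_mat (k + l) (k + l)" using c by simp
  have MM: "M21 * mat_inv M11 \<in> carrier_mat l k" "M21 * mat_inv M11 * M12 \<in> carrier_mat l l"
    using mult_carrier_mat[OF c(3) i(1)] mult_carrier_mat[OF mult_carrier_mat[OF c(3) i(1)] c(2)] .
  have S: "M22 - M21 * mat_inv M11 * M12 \<in> carrier_mat l l" using MM(2) by (rule minus_carrier_mat)
  have "v = 0\<^sub>v (k + l)" if v: "v \<in> carrier_vec (k + l)" "four_block_mat M11 M12 M21 M22 *\<^sub>v v = 0\<^sub>v (k + l)" for v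
  proof -
    obtain z r where zr: "v = z @\<^sub>v r" and z: "z \<in> carrier_vec k" and r: "r \<in> carrier_vec l" using v(1) by (rule split2_vec)
    have mv: "M11 *\<^sub>v z \<in> carrier_vec k" "M12 *\<^sub>v r \<in> carrier_vec k" "M21 *\<^sub>v z \<in> carrier_vec l" "M22 *\<^sub>v r \<in> carrier_vec l"
      using c z r by (auto intro: mult_mat_vec_carrier)
    have "(M11 *\<^sub>v z + M12 *\<^sub>v r) @\<^sub>v (M21 *\<^sub>v z + M22 *\<^sub>v r) = 0\<^sub>v (k + l)"
      using v(2) four_block_mat_mult_vec[OF c z r] by (simp add: zr)
    then have e: "M11 *\<^sub>v z + M12 *\<^sub>v r = 0\<^sub>v k" "M21 *\<^sub>v z + M22 *\<^sub>v r = 0\<^sub>v l"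
      using append_vec_eq_zero_iff[OF add_carrier_vec[OF mv(1,2)] add_carrier_vec[OF mv(3,4)]] by simp_all
    have "z + mat_inv M11 *\<^sub>v (M12 *\<^sub>v r) = mat_inv M11 *\<^sub>v (M11 *\<^sub>v z + M12 *\<^sub>v r)"
      using mult_add_distrib_mat_vec[OF i(1) mv(1,2)] assoc_mult_mat_vec[OF i(1) c(1) z] z by (simp add: i(3))
    then have z0: "z + mat_inv M11 *\<^sub>v (M12 *\<^sub>v r) = 0\<^sub>v k" by (simp add: e(1) mult_mat_zero_vec[OF i(1)])
    have w: "mat_inv M11 *\<^sub>v (M12 *\<^sub>v r) \<in> carrier_vec k" using i(1) mv(2) by (rule mult_mat_vec_carrier)
    have "M21 *\<^sub>v z + M21 *\<^sub>v (mat_inv M11 *\<^sub>v (M12 *\<^sub>v r)) = 0\<^sub>v l"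
      using mult_add_distrib_mat_vec[OF c(3) z w] z0 mult_mat_zero_vec[OF c(3)] by simp
    moreover have "(M21 * mat_inv M11 * M12) *\<^sub>v r = M21 *\<^sub>v (mat_inv M11 *\<^sub>v (M12 *\<^sub>v r))"
      using assoc_mult_mat_vec[OF MM(1) c(2) r] assoc_mult_mat_vec[OF c(3) i(1) mv(2)] by simp
    ultimately have "M21 *\<^sub>v z + (M21 * mat_inv M11 * M12) *\<^sub>v r = M21 *\<^sub>v z + M22 *\<^sub>v r" using e(2) by simp
    then have "M22 *\<^sub>v r = (M21 * mat_inv M11 * M12) *\<^sub>v r"
      using add_vec_cancel_left[OF mv(3) mult_mat_vec_carrier[OF MM(2) r] mv(4)] by simp
    then have "(M22 - M21 * mat_inv M11 * M12) *\<^sub>v r = 0\<^sub>v l"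
      using minus_mult_distrib_mat_vec[OF c(4) MM(2) r] mult_mat_vec_carrier[OF MM(2) r] by simp
    then have r0: "r = 0\<^sub>v l" using inv(2) r by (simp add: invertible_mat_iff_injective[OF S])
    then have "M11 *\<^sub>v z = 0\<^sub>v k" using e(1) mv mult_mat_zero_vec[OF c(2)] by simp
    then have "z = 0\<^sub>v k" using inv(1) z by (simp add: invertible_mat_iff_injective[OF c(1)])
    then show ?thesis using r0 by (simp add: zr)
  qed
  then show ?thesis by (simp add: invertible_mat_iff_injective[OF M])
qed

theorem theorem6p1:
  fixes n m :: nat
    and A B C Q R :: "complex mat"
    and \<gamma> :: real
    and E F G H S1 S2 :: "complex mat"
    and \<V> :: "complex vec set"
  defines "\<gamma>I \<equiv> complex_of_real \<gamma> \<cdot>\<^sub>m 1\<^sub>m n"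
  assumes "A \<in> carrier_mat n n" and "Q \<in> carrier_mat n n" and "hermitian_mat Q"
    and "B \<in> carrier_mat n m" and "C \<in> carrier_mat n m"
    and "R \<in> carrier_mat m m" and "hermitian_mat R"
    and "stabilizable n A B"
    and "S_LMI n A B C Q R \<noteq> {}"
    and "regular_pencil (2 * n + m) (even_E n m) (even_A n m A B C Q R)"
    and "\<gamma> > 0"
    and "invertible_mat (four_block_mat (0\<^sub>m n n) (A - \<gamma>I) (mat_adjoint A - \<gamma>I) Q)"
    and "invertible_mat (R - (mat_adjoint B @\<^sub>c mat_adjoint C) *
           mat_inv (four_block_mat (0\<^sub>m n n) (A - \<gamma>I) (mat_adjoint A - \<gamma>I) Q) * (B @\<^sub>r C))"
    and "E \<in> carrier_mat n n" and "F \<in> carrier_mat n n"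
    and "G \<in> carrier_mat n n" and "H \<in> carrier_mat n n"
    and "S1 \<in> carrier_mat m n" and "S2 \<in> carrier_mat m n"
    and "mat_inv (block3_mat (0\<^sub>m n n)               (A - \<gamma>I)      B
                             (mat_adjoint A - \<gamma>I)  Q                 C
                             (mat_adjoint B)         (mat_adjoint C)   R) *
         block3_mat (0\<^sub>m n n)               (A + \<gamma>I)      B
                    (mat_adjoint A + \<gamma>I)  Q                 C
                    (mat_adjoint B)         (mat_adjoint C)   R
         = block3_mat E (- G) (0\<^sub>m n m) (- H) F (0\<^sub>m n m) S1 S2 (1\<^sub>m m)"
    and "c_semi_stable_deflating (2 * n + m) (2 * n + m)
           (even_E n m) (even_A n m A B C Q R) (n + m) \<V>"
    and "neutral (even_E n m) \<V>"
  defines "E_red \<equiv> four_block_mat (1\<^sub>m n) (- G) (0\<^sub>m n n) F"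
    and "A_red \<equiv> four_block_mat E (0\<^sub>m n n) (- H) (1\<^sub>m n)"
  shows "weakly_d_split n E_red A_red \<and>
    (\<exists>V\<^sub>1 V\<^sub>2. V\<^sub>1 \<in> carrier_mat (2 * n) n \<and> V\<^sub>2 \<in> carrier_mat m n \<and>
       \<V> = vec_space.col_space (2 * n + m) (four_block_mat V\<^sub>1 (0\<^sub>m (2 * n) m) V\<^sub>2 (1\<^sub>m m)) \<and>
       canonical_d_semi_unstable n E_red A_red (vec_space.col_space (2 * n) V\<^sub>1) \<and>
       (\<forall>X \<in> carrier_mat n n.
          basis_mat (2 * n) n (vec_space.col_space (2 * n) V\<^sub>1) (X @\<^sub>r 1\<^sub>m n) \<longrightarrow>
          maximal_lure_solution n m A B C Q R X))"
proof -
  interpret lure_data n m A B C Q R \<gamma>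
    by unfold_locales (use assms in simp_all)
  have gI: "\<gamma>I = g \<cdot>\<^sub>m 1\<^sub>m n" by (simp add: \<gamma>I_def)
  have Mm: "block3_mat (0\<^sub>m n n) (A - \<gamma>I) B (mat_adjoint A - \<gamma>I) Q C (mat_adjoint B) (mat_adjoint C) R = M_minus"
    by (simp add: M_minus_def gI)
  have Mp: "block3_mat (0\<^sub>m n n) (A + \<gamma>I) B (mat_adjoint A + \<gamma>I) Q C (mat_adjoint B) (mat_adjoint C) R = M_plus"
    by (simp add: M_plus_def gI)
  have Mblock: "M_minus = four_block_mat (four_block_mat (0\<^sub>m n n) (A - \<gamma>I) (mat_adjoint A - \<gamma>I) Q) (B @\<^sub>r C)
      (mat_adjoint B @\<^sub>c mat_adjoint C) R"
    unfolding Mm[symmetric] block3_mat_def ..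
  have inv: "invertible_mat M_minus"
    unfolding Mblock
    by (rule schur_complement_invertible[of _ "n + n" _ m])
      (use assms in \<open>auto intro: append_cols_carrier[of _ m n _ n]\<close>)
  note Mi = mat_inv_props[OF inv M_carrier(1)]
  have prod: "mat_inv M_minus * M_plus = block3_mat E (- G) (0\<^sub>m n m) (- H) F (0\<^sub>m n m) S1 S2 (1\<^sub>m m)"
    using assms(21) unfolding Mm Mp .
  \<comment> \<open>Multiplying the inverse out gives the identity that
    \<open>reduced_pencil\<close> assumes.\<close>
  have "M_minus * (mat_inv M_minus * M_plus) = M_plus"
    using assoc_mult_mat[OF M_carrier(1) Mi(1) M_carrier(2)] left_mult_one_mat[OF M_carrier(2)] Mi(2) by simp
  then interpret reduced_pencil n m A B C Q R \<gamma> E F G H S1 S2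
    unfolding prod by unfold_locales (use assms inv in simp_all)
  interpret lure_problem n m A B C Q R \<gamma> E F G H S1 S2 \<V>
    by unfold_locales (use assms in simp_all)
  have red: "local.E_red = E_red" "local.A_red = A_red"
    unfolding E_red_def A_red_def by (simp_all add: assms)
  obtain Y where Y: "Y \<in> S_LMI n A B C Q R" using assms(10) by blast
  obtain V\<^sub>1 P T bs where V1: "V\<^sub>1 \<in> carrier_mat (2 * n) n" and L: "L = {V\<^sub>1 *\<^sub>v c | c. c \<in> carrier_vec n}"
    and K: "kronecker_form (2 * n) E_red A_red P T bs" and bs: "split_blocks n bs"
    and cols: "set (cols V\<^sub>1) = {chain_vec T bs i j | i j. i < length bs \<and> d_unstable (snd (bs ! i)) \<and> j < fst (bs ! i)} \<union>
      {chain_vec T bs i j | i j. i < length bs \<and> d_critical (snd (bs ! i)) \<and> j < fst (bs ! i) div 2}"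
    by (rule L_canonical[OF Y, unfolded red]) blast
  note reg' = red_regular[unfolded red]
  \<comment> \<open>Zero is possible because \<open>\<V>\<close> contains every vector supported in
    the last \<open>m\<close> coordinates, so the lower left block can be cleared.\<close>
  define V\<^sub>2 where "V\<^sub>2 = (0\<^sub>m m n :: complex mat)"
  let ?V = "four_block_mat V\<^sub>1 (0\<^sub>m (2 * n) m) V\<^sub>2 (1\<^sub>m m)"
  have V2: "V\<^sub>2 \<in> carrier_mat m n" by (simp add: V\<^sub>2_def)
  have V: "?V \<in> carrier_mat (2 * n + m) (n + m)" using V1 by simp
  have mult: "?V *\<^sub>v (c @\<^sub>v u) = (V\<^sub>1 *\<^sub>v c) @\<^sub>v u" if "c \<in> carrier_vec n" "u \<in> carrier_vec m" for c u
    using that mult_mat_vec_carrier[OF V1 that(1)]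
    by (subst four_block_mat_mult_vec[OF V1 _ V2]) (auto simp: V\<^sub>2_def)
  have "\<V> = vec_space.col_space (2 * n + m) ?V"
  proof (intro equalityI subsetI)
    fix v assume v: "v \<in> \<V>"
    then have "v \<in> carrier_vec (2 * n + m)" using V_carrier by blast
    then obtain u where u: "u \<in> carrier_vec m" "v = vec_first v (2 * n) @\<^sub>v u" by (rule split_vec_first)
    then have "vec_first v (2 * n) \<in> L" using v V_iff_L[OF vec_first_carrier u(1)] by metis
    then obtain c where c: "c \<in> carrier_vec n" "vec_first v (2 * n) = V\<^sub>1 *\<^sub>v c" using L by blast
    have "?V *\<^sub>v (c @\<^sub>v u) = v" using mult[OF c(1) u(1)] c(2) u(2) by simp
    moreover have "c @\<^sub>v u \<in> carrier_vec (n + m)" using c(1) u(1) by simp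
    ultimately show "v \<in> vec_space.col_space (2 * n + m) ?V"
      unfolding col_space_image[OF V] by blast
  next
    fix v assume "v \<in> vec_space.col_space (2 * n + m) ?V"
    then obtain d where d: "d \<in> carrier_vec (n + m)" "v = ?V *\<^sub>v d" unfolding col_space_image[OF V] by blast
    obtain c u where cu: "c \<in> carrier_vec n" "u \<in> carrier_vec m" "d = c @\<^sub>v u" using d(1) by (rule split2_vec)
    have "V\<^sub>1 *\<^sub>v c \<in> L" using cu(1) L by blast
    then show "v \<in> \<V>" unfolding d(2) cu(3) mult[OF cu(1,2)]
      using V_iff_L[OF mult_mat_vec_carrier[OF V1 cu(1)] cu(2)] by simp
  qed
  moreover have "weakly_d_split n E_red A_red"
    unfolding weakly_d_split_def using reg' K bs by blast
  moreover have "canonical_d_semi_unstable n E_red A_red (vec_space.col_space (2 * n) V\<^sub>1)"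
    unfolding canonical_d_semi_unstable_def vec_space.col_space_def cols using reg' K bs by blast
  moreover have "maximal_lure_solution n m A B C Q R X"
    if X: "X \<in> carrier_mat n n" and basis: "basis_mat (2 * n) n (vec_space.col_space (2 * n) V\<^sub>1) (X @\<^sub>r 1\<^sub>m n)" for X
  proof -
    have X1: "X @\<^sub>r 1\<^sub>m n \<in> carrier_mat (2 * n) n" using basis by (simp add: basis_mat_def)
    \<comment> \<open>A basis consisting of \<open>X\<close> above the identity makes
      \<open>L\<close> the graph of \<open>X\<close>.\<close>
    have "L = vec_space.col_space (2 * n) (X @\<^sub>r 1\<^sub>m n)"
      using basis L col_space_image[OF V1] by (simp add: basis_mat_def)
    also have "\<dots> = {(X @\<^sub>r 1\<^sub>m n) *\<^sub>v c | c. c \<in> carrier_vec n}" by (rule col_space_image[OF X1])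
    also have "\<dots> = {(X *\<^sub>v x) @\<^sub>v x | x. x \<in> carrier_vec n}"
      using mat_mult_append[OF X one_carrier_mat] by (metis (no_types, opaque_lifting) one_mult_mat_vec)
    finally have LX: "L = {(X *\<^sub>v x) @\<^sub>v x | x. x \<in> carrier_vec n}" .
    show ?thesis unfolding maximal_lure_solution_def
      using X_lure_solution[OF X LX Y] X_maximal[OF X LX] by blast
  qed
  ultimately show ?thesis using V1 V2 by blast
qed

end
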